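(* Let the plant, the exosystem, the digraph $\bar{\mathcal G}$, the matrices $M,Q,\Gamma,T,\Omega,A_o(h),B_o(h)$ and the constants $\lambda_1,\bar\lambda_2,\bar\lambda_M,\lambda_M,\lambda_m,\lambda_0$ be as defined in the context. Suppose Assumptions A1--A3 of the context hold. Then for any compact sets $\mathbb V\subset\mathbb R^{n_v}$ and $\mathbb W\subset\mathbb R^{n_w}$ with $0\in\mathbb V$ and $0\in\mathbb W$, there exist positive real numbers $K^*$ and $h^*$ such that, for any $K>K^*$ and $h>h^*$, the following holds. For any $\epsilon>0$, and for constants $\sigma\in(0,1)$, $\beta>0$, $\alpha\in(0,\lambda)$ with $\lambda=\frac{1-\sigma}{\lambda_M}$, the distributed output feedback control law $$u_i(t)=\Gamma T^{-1}\eta_i(t_k^i)-K\Omega\zeta_i(t_k^i),$$ $$\dot\eta_i(t)=M\eta_i(t)+Q\big(\Gamma T^{-1}\eta_i(t_k^i)-K\Omega\zeta_i(t_k^i)\big),$$ $$\dot\zeta_i(t)=A_o(h)\zeta_i(t)+B_o(h)e_{vi}(t_k^i),\qquad t\in[t_k^i,t_{k+1}^i),\ k\in\mathbb Z^+,\ i=1,\dots,N,$$ together with the distributed output-based event-triggered mechanism $t_0^i=0$, $$t_{k+1}^i=\inf\{t>t_k^i:\ \|\tilde v_{ci}(t)\|^2\ge\bar\sigma(\|\zeta_i(t)\|^2+e_{vi}^2(t))+\beta\mathbf e^{-\alpha t}+\delta\},\qquad \bar\sigma=\frac{\sigma}{\lambda_1\bar\lambda_M\bar\lambda_2},\quad \delta=\frac{\lambda\lambda_m}{\lambda_0}\epsilon^2,$$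 solves the cooperative robust practical output regulation problem. That is, for every $w\in\mathbb W$, every solution $v$ of the exosystem with $v(t)\in\mathbb V$ for all $t\ge0$, and any initial conditions $z_i(0),\xi_i(0),\eta_i(0),\zeta_i(0)$, $i=1,\dots,N$: (a) the trajectory of the closed-loop system exists and is bounded for all $t\ge0$; (b) $\limsup_{t\to+\infty}\|e(t)\|\le\epsilon$, where $e=\mathrm{col}(e_1,\dots,e_N)$.
   Context: Notation: $\mathbb Z^+$ is the set of nonnegative integers; $\mathrm{col}(a_1,\dots,a_s)=[a_1^T,\dots,a_s^T]^T$; $\|\cdot\|$ is the Euclidean norm or the induced matrix norm; $\mathbf e$ is the base of the natural logarithm; $\otimes$ is the Kronecker product; $\lambda_{\max},\lambda_{\min}$ are the maximum and minimum eigenvalues of a symmetric real matrix. Plant ($N$ agents, $i=1,\dots,N$): $\dot z_i=A_{1i}(w)z_i+A_{2i}(w)\xi_{1i}+E_{0i}(w)v$; $\dot\xi_{si}=\xi_{(s+1)i}$ for $s=1,\dots,r-1$; $\dot\xi_{ri}=A_{3i}(w)z_i+\sum_{s=1}^r c_{si}(w)\xi_{si}+E_{ri}(w)v+b_i(w)u_i$; $y_i=\xi_{1i}$. Here $z_i\in\mathbb R^{n_i-r}$ and $\xi_i=\mathrm{col}(\xi_{1i},\dots,\xi_{ri})\in\mathbb R^r$ are the states, $u_i\in\mathbb R$ is the input, $y_i\in\mathbb R$ is the output. $w\in\mathbb R^{n_w}$ is a constant unknown parameter vector collecting all entries of the perturbations in $A_{1i}(w)=A_1+w_{A_{1i}}$,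 $A_{2i}(w)=A_2+w_{A_{2i}}$, $A_{3i}(w)=A_3+w_{A_{3i}}$, $E_{0i}(w)=E_0+w_{E_{0i}}$, $E_{ri}(w)=E_r+w_{E_{ri}}$, $F(w)=F+w_F$, $c_{si}(w)=c_s+w_{c_{si}}$, $b_i(w)=b+w_{b_i}$, where $A_1,A_2,A_3,E_0,E_r,F,c_s,b$ are nominal values (of compatible dimensions). It is assumed that $b_i(w)>0$ for all $w\in\mathbb R^{n_w}$. Exosystem: $\dot v=Sv$, $v\in\mathbb R^{n_v}$, $S$ a known constant matrix, with output $y_0=F(w)v\in\mathbb R$. Regulated errors: $e_i=y_i-y_0$. Digraph: $\bar{\mathcal G}$ has node set $\{0,1,\dots,N\}$ (node $0$ is the exosystem/leader) and adjacency matrix $[\bar a_{ij}]$, with $\bar a_{ii}=0$, $\bar a_{ij}=1$ if $(j,i)$ is an edge, and $\bar a_{ij}=0$ otherwise. $e_{vi}=\sum_{j=0}^N\bar a_{ij}(y_i-y_j)$. $H=[h_{ij}]_{i,j=1}^N$ with $h_{ii}=\sum_{j=0}^N\bar a_{ij}$ and $h_{ij}=-\bar a_{ij}$ for $i\ne j$; thus $\mathrm{col}(e_{v1},\dots,e_{vN})=He$. Assumptions. A1: all eigenvalues of $S$ are semi-simple with zero real parts. A2: $A_{1i}(w)$ is Hurwitz for all $w\in\mathbb W$ and $i=1,\dots,N$. A3: $\bar{\mathcal G}$ is connected, i.e. contains a directed spanning tree with node $0$ as root. Controller data: $m(\mathbf s)=\mathbf s^l+\alpha_{l-1}\mathbf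 s^{l-1}+\dots+\alpha_0$ is the minimal polynomial of $S$; $\Phi\in\mathbb R^{l\times l}$ is the companion matrix with ones on the superdiagonal and last row $(-\alpha_0,\dots,-\alpha_{l-1})$; $\Gamma=[1,0,\dots,0]\in\mathbb R^{1\times l}$; $(M,Q)$ is any controllable pair with $M\in\mathbb R^{l\times l}$ Hurwitz and $Q\in\mathbb R^{l\times1}$; $T$ is the unique solution of $T\Phi-MT=Q\Gamma$. $\eta_i\in\mathbb R^l$, $\zeta_i\in\mathbb R^r$. $\Omega=[\gamma_0,\dots,\gamma_{r-2},1]$, where $\gamma_j$ and $\delta_j$ are real numbers such that $\mathbf s^{r-1}+\gamma_{r-2}\mathbf s^{r-2}+\dots+\gamma_0$ and $\mathbf s^r+\delta_{r-1}\mathbf s^{r-1}+\dots+\delta_0$ are stable polynomials (all roots have negative real part). $B_o(h)=\mathrm{col}(h\delta_{r-1},h^2\delta_{r-2},\dots,h^r\delta_0)$; $A_o(h)$ is the $r\times r$ matrix whose first column is $-B_o(h)$, with additional ones on the superdiagonal and zeros elsewhere. $K,h>0$ are real gains. Sampling errors: for $t\in[t_k^i,t_{k+1}^i)$, $\tilde e_{vi}(t)=e_{vi}(t_k^i)-e_{vi}(t)$, $\tilde\eta_i(t)=\eta_i(t_k^i)-\eta_i(t)$, $\tilde\zeta_i(t)=\zeta_i(t_k^i)-\zeta_i(t)$, and $\tilde v_{ci}=\mathrm{col}(\tilde\eta_i,\tilde\zeta_i,\tilde e_{vi})$. In the infimum defining $t_{k+1}^i$, these errors are computed relative to time $t_k^i$.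 Closed-loop matrix: $$A_c(w)=\begin{bmatrix}\bar A_1(w)&\bar A_2(w)&0&0\\ \bar A_4(w)&\bar A_5(w)&\bar A_6(w)&\bar A_7(w)\\0&0&\bar A_8&\bar A_9\\0&\bar A_{11}&0&\bar A_{12}\end{bmatrix},$$ where $\bar A_1,\bar A_2,\bar A_4,\bar A_5,\bar A_6,\bar A_7$ are block diagonal with $i$-th diagonal blocks ($i=1,\dots,N$), respectively: $A_{1i}(w)$; $A_{2i}(w)[1\ 0\cdots0]_{1\times r}$; $A_{4i}(w)=\begin{bmatrix}0_{(r-1)\times(n_i-r)}\\ A_{3i}(w)\end{bmatrix}$; $A_{5i}(w)$, the $r\times r$ companion-type matrix with ones on the superdiagonal and last row $(c_{1i}(w),\dots,c_{ri}(w))$; $B_{0i}(w)\Gamma T^{-1}$; $-B_{0i}(w)K\Omega$, with $B_{0i}(w)=[0\cdots0\ b_i(w)]^T\in\mathbb R^r$. Moreover $\bar A_8=I_N\otimes(M+Q\Gamma T^{-1})$, $\bar A_9=-I_N\otimes(QK\Omega)$, $\bar A_{10}=I_N\otimes(Q\Gamma T^{-1})$, $\bar A_{11}=(H\otimes I_r)(I_N\otimes[B_o(h)\ 0_{r\times(r-1)}])$, $\bar A_{12}=I_N\otimes A_o(h)$. Constants (depending on $K,h$): the positive numbers $K^*,h^*$ are such that, for any $K>K^*$ and $h>h^*$, $A_c(w)$ is Hurwitz for all $w\in\mathbb W$; for such $K,h$, $P(w)$ is the symmetric positive definite solution of $A_c(w)^TP(w)+P(w)A_c(w)=-2I$. $\lambda_M=\sup_{w\in\mathbb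 W}\lambda_{\max}(P(w))$, $\lambda_m=\inf_{w\in\mathbb W}\lambda_{\min}(P(w))$, $\lambda_1=\sup_{w\in\mathbb W}\|P(w)\|^2$; $\lambda_2=\max_{i=1,\dots,\rho}\|H_i\|^2$, where $\rho$ is the total number of connected digraphs (in the sense of A3) on the $N+1$ nodes and $H_1,\dots,H_\rho$ are the corresponding matrices $H$; $\lambda_3=\|B_o(h)\|^2$; $\lambda_4=\sup_{w\in\mathbb W}\{\|\bar A_6(w)\|^2+\|\bar A_{10}\|^2\}$; $\lambda_5=\sup_{w\in\mathbb W}\{\|\bar A_7(w)\|^2+\|\bar A_9\|^2\}$; $\bar\lambda_2=\max\{1,\lambda_2\}$; $\bar\lambda_M=\max\{\lambda_3,\lambda_4,\lambda_5\}$; $\lambda_0=\lambda_1\bar\lambda_MN$.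
   Formalization: The threshold h* may depend on K (no single h* serves all K > K*: A_c(w) can fail to be Hurwitz for fixed h and large K, e.g. r = 2, N = 1, S = 0), and b_i(w) > 0 is assumed only for w in W, since positivity on the whole parameter space is unsatisfiable. *)

theory Defs
  imports
    "Jordan_Normal_Form.Char_Poly"
    "Jordan_Normal_Form.DL_Rank"
    "Jordan_Normal_Form.Matrix_Kernel"
    "Jordan_Normal_Form.Gauss_Jordan_Elimination"
    "HOL-Library.Extended_Real"
    "HOL-Analysis.Function_Topology"
begin

text \<open>
  Vectors and matrices are those of Jordan_Normal_Form, whose dimensions are terms. Their indices
  start at 0, so the \<open>s\<close>-th component of \<open>\<xi>\<^sub>i\<close> is \<open>\<xi>\<^sub>i $ (s - 1)\<close>. Agents keep the numbers
  \<open>1, \<dots>, N\<close> and the leader the number \<open>0\<close>.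
\<close>

section \<open>Vectors and matrices\<close>

definition vnorm :: "real vec \<Rightarrow> real" where
  "vnorm x = sqrt (x \<bullet> x)"

definition mnorm :: "real mat \<Rightarrow> real" where
  "mnorm A = (SUP x \<in> {x \<in> carrier_vec (dim_col A). vnorm x \<le> 1}. vnorm (A *\<^sub>v x))"

text \<open>The type \<^typ>\<open>'a vec\<close> carries no topology; \<open>\<real>\<^sup>n\<close> is embedded in \<open>nat \<Rightarrow> real\<close> (product
  topology) by padding with zeros.\<close>
definition compact_vecs :: "nat \<Rightarrow> real vec set \<Rightarrow> bool" where
  "compact_vecs n X \<longleftrightarrow> X \<subseteq> carrier_vec n \<and>
     compact ((\<lambda>x i. if i < n then x $ i else 0) ` X)"

definition continuous_vec_on :: "nat \<Rightarrow> real set \<Rightarrow> (real \<Rightarrow> real vec) \<Rightarrow> bool" where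
  "continuous_vec_on n I x \<longleftrightarrow> (\<forall>t\<in>I. x t \<in> carrier_vec n) \<and>
     (\<forall>j<n. continuous_on I (\<lambda>t. x t $ j))"

definition has_vec_deriv :: "nat \<Rightarrow> (real \<Rightarrow> real vec) \<Rightarrow> real vec \<Rightarrow> real \<Rightarrow> real set \<Rightarrow> bool" where
  "has_vec_deriv n x x' t I \<longleftrightarrow> x' \<in> carrier_vec n \<and>
     (\<forall>j<n. ((\<lambda>s. x s $ j) has_real_derivative (x' $ j)) (at t within I))"

definition scal :: "real \<Rightarrow> real vec" where
  "scal a = vec 1 (\<lambda>_. a)"

definition kron :: "real mat \<Rightarrow> real mat \<Rightarrow> real mat" where
  "kron A B = mat (dim_row A * dim_row B) (dim_col A * dim_col B)
     (\<lambda>(i, j). A $$ (i div dim_row B, j div dim_col B) * B $$ (i mod dim_row B, j mod dim_col B))"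

definition e1row :: "nat \<Rightarrow> real mat" where
  "e1row n = mat 1 n (\<lambda>(_, j). if j = 0 then 1 else 0)"

definition companion :: "nat \<Rightarrow> (nat \<Rightarrow> real) \<Rightarrow> real mat" where
  "companion n a = mat n n (\<lambda>(i, j). if i = n - 1 then a j else if j = i + 1 then 1 else 0)"

abbreviation cmat :: "real mat \<Rightarrow> complex mat" where
  "cmat A \<equiv> map_mat complex_of_real A"

definition hurwitz :: "real mat \<Rightarrow> bool" where
  "hurwitz A \<longleftrightarrow> (\<forall>\<mu>. eigenvalue (cmat A) \<mu> \<longrightarrow> Re \<mu> < 0)"

text \<open>Algebraic multiplicity equals geometric multiplicity.\<close>
definition semisimple_eigenvalue :: "complex mat \<Rightarrow> complex \<Rightarrow> bool" where
  "semisimple_eigenvalue A \<mu> \<longleftrightarrow> eigenvalue A \<mu> \<and>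
     Polynomial.order \<mu> (char_poly A) = kernel_dim (char_matrix A \<mu>)"

definition stable_poly :: "real poly \<Rightarrow> bool" where
  "stable_poly q \<longleftrightarrow> (\<forall>s::complex. poly (map_poly complex_of_real q) s = 0 \<longrightarrow> Re s < 0)"

definition poly_mat :: "real poly \<Rightarrow> real mat \<Rightarrow> real mat" where
  "poly_mat q A = mat (dim_row A) (dim_row A) (\<lambda>(i, j). \<Sum>k\<le>degree q. coeff q k * (A ^\<^sub>m k) $$ (i, j))"

definition min_poly :: "real mat \<Rightarrow> real poly" where
  "min_poly A = (THE q. lead_coeff q = 1 \<and> poly_mat q A = 0\<^sub>m (dim_row A) (dim_row A) \<and>
     (\<forall>q'. q' \<noteq> 0 \<and> poly_mat q' A = 0\<^sub>m (dim_row A) (dim_row A) \<longrightarrow> degree q \<le> degree q'))"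

text \<open>Kalman's rank condition on \<open>[Q, MQ, \<dots>, M\<^sup>l\<^sup>-\<^sup>1Q]\<close>.\<close>
definition controllable :: "nat \<Rightarrow> real mat \<Rightarrow> real mat \<Rightarrow> bool" where
  "controllable l M Q \<longleftrightarrow>
     vec_space.rank l (mat l l (\<lambda>(i, j). ((M ^\<^sub>m j) * Q) $$ (i, 0))) = l"

definition pos_def :: "real mat \<Rightarrow> bool" where
  "pos_def P \<longleftrightarrow> (\<forall>x \<in> carrier_vec (dim_row P). x \<noteq> 0\<^sub>v (dim_row P) \<longrightarrow> 0 < x \<bullet> (P *\<^sub>v x))"

definition lyap :: "real mat \<Rightarrow> real mat" where
  "lyap A = (THE P. P \<in> carrier_mat (dim_row A) (dim_row A) \<and> transpose_mat P = P \<and> pos_def P \<and>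
     transpose_mat A * P + P * A = (-2) \<cdot>\<^sub>m 1\<^sub>m (dim_row A))"

definition eig_max :: "real mat \<Rightarrow> real" where
  "eig_max P = Max {x. eigenvalue P x}"

definition eig_min :: "real mat \<Rightarrow> real" where
  "eig_min P = Min {x. eigenvalue P x}"

section \<open>Communication digraph\<close>

text \<open>\<open>(j, i) \<in> E\<close> is the edge from \<open>j\<close> to \<open>i\<close>.\<close>

definition digraph :: "nat \<Rightarrow> (nat \<times> nat) set \<Rightarrow> bool" where
  "digraph N E \<longleftrightarrow> E \<subseteq> {0..N} \<times> {0..N} \<and> (\<forall>i. (i, i) \<notin> E)"

definition adj :: "(nat \<times> nat) set \<Rightarrow> nat \<Rightarrow> nat \<Rightarrow> real" where
  "adj E i j = (if (j, i) \<in> E then 1 else 0)"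

definition spanning_tree :: "nat \<Rightarrow> (nat \<times> nat) set \<Rightarrow> bool" where
  "spanning_tree N R \<longleftrightarrow> (\<forall>j. (j, 0) \<notin> R) \<and>
     (\<forall>i\<in>{1..N}. (\<exists>!j. (j, i) \<in> R) \<and> (0, i) \<in> R\<^sup>+)"

definition connected_digraph :: "nat \<Rightarrow> (nat \<times> nat) set \<Rightarrow> bool" where
  "connected_digraph N E \<longleftrightarrow> (\<exists>R \<subseteq> E. spanning_tree N R)"

definition Hmat :: "nat \<Rightarrow> (nat \<times> nat) set \<Rightarrow> real mat" where
  "Hmat N E = mat N N (\<lambda>(i, j). if i = j then (\<Sum>k\<in>{0..N}. adj E (i + 1) k) else - adj E (i + 1) (j + 1))"

section \<open>Plant and exosystem\<close>

text \<open>One slot for every entry of the perturbations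
  \<open>w\<^sub>A\<^sub>1\<^sub>i, w\<^sub>A\<^sub>2\<^sub>i, w\<^sub>A\<^sub>3\<^sub>i, w\<^sub>E\<^sub>0\<^sub>i, w\<^sub>E\<^sub>r\<^sub>i, w\<^sub>F, w\<^sub>c\<^sub>s\<^sub>i, w\<^sub>b\<^sub>i\<close>. The first argument is the agent \<open>i\<close>
  (there is none for \<open>w\<^sub>F\<close>), the others are matrix indices; \<open>Slot_c i s\<close> has \<open>1 \<le> s \<le> r\<close>.\<close>
datatype slot =
    Slot_A1 nat nat nat
  | Slot_A2 nat nat
  | Slot_A3 nat nat
  | Slot_E0 nat nat nat
  | Slot_Er nat nat
  | Slot_F nat
  | Slot_c nat nat
  | Slot_b nat

text \<open>\<open>slot_index\<close> is the position in \<open>w\<close> at which each perturbation entry is stored.\<close>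
record plant =
  agents :: nat
  reldeg :: nat
  order_of :: "nat \<Rightarrow> nat"
  exodim :: nat
  A1_nom :: "real mat"
  A2_nom :: "real mat"
  A3_nom :: "real mat"
  E0_nom :: "real mat"
  Er_nom :: "real mat"
  F_nom :: "real mat"
  c_nom :: "nat \<Rightarrow> real"
  b_nom :: real
  exo_S :: "real mat"
  slot_index :: "slot \<Rightarrow> nat"

definition zdim :: "plant \<Rightarrow> nat \<Rightarrow> nat" where
  "zdim p i = order_of p i - reldeg p"

definition slots :: "plant \<Rightarrow> slot set" where
  "slots p =
     {Slot_A1 i j k | i j k. i \<in> {1..agents p} \<and> j < zdim p i \<and> k < zdim p i} \<union>
     {Slot_A2 i j | i j. i \<in> {1..agents p} \<and> j < zdim p i} \<union>
     {Slot_A3 i k | i k. i \<in> {1..agents p} \<and> k < zdim p i} \<union>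
     {Slot_E0 i j k | i j k. i \<in> {1..agents p} \<and> j < zdim p i \<and> k < exodim p} \<union>
     {Slot_Er i k | i k. i \<in> {1..agents p} \<and> k < exodim p} \<union>
     {Slot_F k | k. k < exodim p} \<union>
     {Slot_c i s | i s. i \<in> {1..agents p} \<and> s \<in> {1..reldeg p}} \<union>
     {Slot_b i | i. i \<in> {1..agents p}}"

definition wdim :: "plant \<Rightarrow> nat" where
  "wdim p = card (slots p)"

text \<open>The nominal matrices are common to all agents, so the dimension requirements below force all
  \<open>n\<^sub>i\<close> to be equal.\<close>
definition plant_wf :: "plant \<Rightarrow> bool" where
  "plant_wf p \<longleftrightarrow> 1 \<le> agents p \<and> 1 \<le> reldeg p \<and> 1 \<le> exodim p \<and>
     (\<forall>i\<in>{1..agents p}.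
        reldeg p \<le> order_of p i \<and>
        A1_nom p \<in> carrier_mat (zdim p i) (zdim p i) \<and>
        A2_nom p \<in> carrier_mat (zdim p i) 1 \<and>
        A3_nom p \<in> carrier_mat 1 (zdim p i) \<and>
        E0_nom p \<in> carrier_mat (zdim p i) (exodim p)) \<and>
     Er_nom p \<in> carrier_mat 1 (exodim p) \<and>
     F_nom p \<in> carrier_mat 1 (exodim p) \<and>
     exo_S p \<in> carrier_mat (exodim p) (exodim p) \<and>
     bij_betw (slot_index p) (slots p) {..<wdim p}"

definition pert :: "plant \<Rightarrow> real vec \<Rightarrow> slot \<Rightarrow> real" where
  "pert p w s = w $ slot_index p s"

definition A1 :: "plant \<Rightarrow> real vec \<Rightarrow> nat \<Rightarrow> real mat" where
  "A1 p w i = A1_nom p + mat (zdim p i) (zdim p i) (\<lambda>(j, k). pert p w (Slot_A1 i j k))"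

definition A2 :: "plant \<Rightarrow> real vec \<Rightarrow> nat \<Rightarrow> real mat" where
  "A2 p w i = A2_nom p + mat (zdim p i) 1 (\<lambda>(j, _). pert p w (Slot_A2 i j))"

definition A3 :: "plant \<Rightarrow> real vec \<Rightarrow> nat \<Rightarrow> real mat" where
  "A3 p w i = A3_nom p + mat 1 (zdim p i) (\<lambda>(_, k). pert p w (Slot_A3 i k))"

definition E0 :: "plant \<Rightarrow> real vec \<Rightarrow> nat \<Rightarrow> real mat" where
  "E0 p w i = E0_nom p + mat (zdim p i) (exodim p) (\<lambda>(j, k). pert p w (Slot_E0 i j k))"

definition Er :: "plant \<Rightarrow> real vec \<Rightarrow> nat \<Rightarrow> real mat" where
  "Er p w i = Er_nom p + mat 1 (exodim p) (\<lambda>(_, k). pert p w (Slot_Er i k))"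

definition Fw :: "plant \<Rightarrow> real vec \<Rightarrow> real mat" where
  "Fw p w = F_nom p + mat 1 (exodim p) (\<lambda>(_, k). pert p w (Slot_F k))"

definition cc :: "plant \<Rightarrow> real vec \<Rightarrow> nat \<Rightarrow> nat \<Rightarrow> real" where
  "cc p w s i = c_nom p s + pert p w (Slot_c i s)"

definition bb :: "plant \<Rightarrow> real vec \<Rightarrow> nat \<Rightarrow> real" where
  "bb p w i = b_nom p + pert p w (Slot_b i)"

definition exo_solution :: "plant \<Rightarrow> (real \<Rightarrow> real vec) \<Rightarrow> bool" where
  "exo_solution p v \<longleftrightarrow> (\<forall>t\<ge>0. v t \<in> carrier_vec (exodim p) \<and>
     has_vec_deriv (exodim p) v (exo_S p *\<^sub>v v t) t {0..})"

section \<open>Controller data\<close>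

record design =
  ctrl_M :: "real mat"
  ctrl_Q :: "real mat"
  ctrl_gamma :: "nat \<Rightarrow> real"
  ctrl_delta :: "nat \<Rightarrow> real"

definition ldim :: "plant \<Rightarrow> nat" where
  "ldim p = degree (min_poly (exo_S p))"

definition Phi :: "plant \<Rightarrow> real mat" where
  "Phi p = companion (ldim p) (\<lambda>j. - coeff (min_poly (exo_S p)) j)"

definition Gam :: "plant \<Rightarrow> real mat" where
  "Gam p = e1row (ldim p)"

definition design_wf :: "plant \<Rightarrow> design \<Rightarrow> bool" where
  "design_wf p d \<longleftrightarrow>
     ctrl_M d \<in> carrier_mat (ldim p) (ldim p) \<and> ctrl_Q d \<in> carrier_mat (ldim p) 1 \<and>
     hurwitz (ctrl_M d) \<and> controllable (ldim p) (ctrl_M d) (ctrl_Q d) \<and>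
     stable_poly (monom 1 (reldeg p - 1) + (\<Sum>j<reldeg p - 1. monom (ctrl_gamma d j) j)) \<and>
     stable_poly (monom 1 (reldeg p) + (\<Sum>j<reldeg p. monom (ctrl_delta d j) j))"

definition Tmat :: "plant \<Rightarrow> design \<Rightarrow> real mat" where
  "Tmat p d = (THE T. T \<in> carrier_mat (ldim p) (ldim p) \<and>
     T * Phi p - ctrl_M d * T = ctrl_Q d * Gam p)"

definition GamTinv :: "plant \<Rightarrow> design \<Rightarrow> real mat" where
  "GamTinv p d = Gam p * the (mat_inverse (Tmat p d))"

definition Omega :: "plant \<Rightarrow> design \<Rightarrow> real mat" where
  "Omega p d = mat 1 (reldeg p) (\<lambda>(_, j). if j = reldeg p - 1 then 1 else ctrl_gamma d j)"

definition Bo :: "plant \<Rightarrow> design \<Rightarrow> real \<Rightarrow> real mat" where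
  "Bo p d h = mat (reldeg p) 1 (\<lambda>(i, _). h ^ (i + 1) * ctrl_delta d (reldeg p - 1 - i))"

definition Ao :: "plant \<Rightarrow> design \<Rightarrow> real \<Rightarrow> real mat" where
  "Ao p d h = mat (reldeg p) (reldeg p)
     (\<lambda>(i, j). if j = 0 then - (Bo p d h $$ (i, 0)) else if j = i + 1 then 1 else 0)"

section \<open>Closed-loop matrix and constants\<close>

definition agent_diag :: "plant \<Rightarrow> (nat \<Rightarrow> real mat) \<Rightarrow> real mat" where
  "agent_diag p X = diag_block_mat (map X [1..<Suc (agents p)])"

definition B0 :: "plant \<Rightarrow> real vec \<Rightarrow> nat \<Rightarrow> real mat" where
  "B0 p w i = mat (reldeg p) 1 (\<lambda>(j, _). if j = reldeg p - 1 then bb p w i else 0)"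

definition A4 :: "plant \<Rightarrow> real vec \<Rightarrow> nat \<Rightarrow> real mat" where
  "A4 p w i = mat (reldeg p) (zdim p i) (\<lambda>(j, k). if j = reldeg p - 1 then A3 p w i $$ (0, k) else 0)"

definition A5 :: "plant \<Rightarrow> real vec \<Rightarrow> nat \<Rightarrow> real mat" where
  "A5 p w i = companion (reldeg p) (\<lambda>s. cc p w (s + 1) i)"

definition Abar1 :: "plant \<Rightarrow> real vec \<Rightarrow> real mat" where
  "Abar1 p w = agent_diag p (A1 p w)"

definition Abar2 :: "plant \<Rightarrow> real vec \<Rightarrow> real mat" where
  "Abar2 p w = agent_diag p (\<lambda>i. A2 p w i * e1row (reldeg p))"

definition Abar4 :: "plant \<Rightarrow> real vec \<Rightarrow> real mat" where
  "Abar4 p w = agent_diag p (A4 p w)"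

definition Abar5 :: "plant \<Rightarrow> real vec \<Rightarrow> real mat" where
  "Abar5 p w = agent_diag p (A5 p w)"

definition Abar6 :: "plant \<Rightarrow> design \<Rightarrow> real vec \<Rightarrow> real mat" where
  "Abar6 p d w = agent_diag p (\<lambda>i. B0 p w i * GamTinv p d)"

definition Abar7 :: "plant \<Rightarrow> design \<Rightarrow> real \<Rightarrow> real vec \<Rightarrow> real mat" where
  "Abar7 p d K w = agent_diag p (\<lambda>i. - (B0 p w i * (K \<cdot>\<^sub>m Omega p d)))"

definition Abar8 :: "plant \<Rightarrow> design \<Rightarrow> real mat" where
  "Abar8 p d = kron (1\<^sub>m (agents p)) (ctrl_M d + ctrl_Q d * GamTinv p d)"

definition Abar9 :: "plant \<Rightarrow> design \<Rightarrow> real \<Rightarrow> real mat" where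
  "Abar9 p d K = - kron (1\<^sub>m (agents p)) (ctrl_Q d * (K \<cdot>\<^sub>m Omega p d))"

definition Abar10 :: "plant \<Rightarrow> design \<Rightarrow> real mat" where
  "Abar10 p d = kron (1\<^sub>m (agents p)) (ctrl_Q d * GamTinv p d)"

definition Abar11 :: "plant \<Rightarrow> design \<Rightarrow> (nat \<times> nat) set \<Rightarrow> real \<Rightarrow> real mat" where
  "Abar11 p d E h = kron (Hmat (agents p) E) (1\<^sub>m (reldeg p)) *
     kron (1\<^sub>m (agents p))
       (mat (reldeg p) (reldeg p) (\<lambda>(i, j). if j = 0 then Bo p d h $$ (i, 0) else 0))"

definition Abar12 :: "plant \<Rightarrow> design \<Rightarrow> real \<Rightarrow> real mat" where
  "Abar12 p d h = kron (1\<^sub>m (agents p)) (Ao p d h)"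

definition Ac :: "plant \<Rightarrow> design \<Rightarrow> (nat \<times> nat) set \<Rightarrow> real \<Rightarrow> real \<Rightarrow> real vec \<Rightarrow> real mat" where
  "Ac p d E K h w =
     (let nz = (\<Sum>i\<in>{1..agents p}. zdim p i); nx = agents p * reldeg p; nl = agents p * ldim p in
      four_block_mat
        (four_block_mat (Abar1 p w) (Abar2 p w)
                        (Abar4 p w) (Abar5 p w))
        (four_block_mat (0\<^sub>m nz nl)    (0\<^sub>m nz nx)
                        (Abar6 p d w) (Abar7 p d K w))
        (four_block_mat (0\<^sub>m nl nz) (0\<^sub>m nl nx)
                        (0\<^sub>m nx nz) (Abar11 p d E h))
        (four_block_mat (Abar8 p d)  (Abar9 p d K)
                        (0\<^sub>m nx nl) (Abar12 p d h)))"

definition PP :: "plant \<Rightarrow> design \<Rightarrow> (nat \<times> nat) set \<Rightarrow> real \<Rightarrow> real \<Rightarrow> real vec \<Rightarrow> real mat" where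
  "PP p d E K h w = lyap (Ac p d E K h w)"

definition lam_M :: "plant \<Rightarrow> design \<Rightarrow> (nat \<times> nat) set \<Rightarrow> real vec set \<Rightarrow> real \<Rightarrow> real \<Rightarrow> real" where
  "lam_M p d E W K h = (SUP w\<in>W. eig_max (PP p d E K h w))"

definition lam_m :: "plant \<Rightarrow> design \<Rightarrow> (nat \<times> nat) set \<Rightarrow> real vec set \<Rightarrow> real \<Rightarrow> real \<Rightarrow> real" where
  "lam_m p d E W K h = (INF w\<in>W. eig_min (PP p d E K h w))"

definition lam1 :: "plant \<Rightarrow> design \<Rightarrow> (nat \<times> nat) set \<Rightarrow> real vec set \<Rightarrow> real \<Rightarrow> real \<Rightarrow> real" where
  "lam1 p d E W K h = (SUP w\<in>W. (mnorm (PP p d E K h w))\<^sup>2)"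

definition lam2 :: "nat \<Rightarrow> real" where
  "lam2 N = Max {(mnorm (Hmat N E))\<^sup>2 | E. digraph N E \<and> connected_digraph N E}"

definition lam3 :: "plant \<Rightarrow> design \<Rightarrow> real \<Rightarrow> real" where
  "lam3 p d h = (mnorm (Bo p d h))\<^sup>2"

definition lam4 :: "plant \<Rightarrow> design \<Rightarrow> real vec set \<Rightarrow> real" where
  "lam4 p d W = (SUP w\<in>W. (mnorm (Abar6 p d w))\<^sup>2 + (mnorm (Abar10 p d))\<^sup>2)"

definition lam5 :: "plant \<Rightarrow> design \<Rightarrow> real vec set \<Rightarrow> real \<Rightarrow> real" where
  "lam5 p d W K = (SUP w\<in>W. (mnorm (Abar7 p d K w))\<^sup>2 + (mnorm (Abar9 p d K))\<^sup>2)"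

definition lam2_bar :: "nat \<Rightarrow> real" where
  "lam2_bar N = max 1 (lam2 N)"

definition lamM_bar :: "plant \<Rightarrow> design \<Rightarrow> real vec set \<Rightarrow> real \<Rightarrow> real \<Rightarrow> real" where
  "lamM_bar p d W K h = Max {lam3 p d h, lam4 p d W, lam5 p d W K}"

definition lam0 :: "plant \<Rightarrow> design \<Rightarrow> (nat \<times> nat) set \<Rightarrow> real vec set \<Rightarrow> real \<Rightarrow> real \<Rightarrow> real" where
  "lam0 p d E W K h = lam1 p d E W K h * lamM_bar p d W K h * real (agents p)"

section \<open>Closed-loop trajectories\<close>

text \<open>\<open>tm x i k\<close> is the event time \<open>t\<^sub>k\<^sup>i\<close>. It is extended real: the infimum of the empty set is
  \<open>\<infinity>\<close>, that is, no further event occurs.\<close>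
record trajectory =
  zz :: "nat \<Rightarrow> real \<Rightarrow> real vec"
  xi :: "nat \<Rightarrow> real \<Rightarrow> real vec"
  eta :: "nat \<Rightarrow> real \<Rightarrow> real vec"
  zeta :: "nat \<Rightarrow> real \<Rightarrow> real vec"
  tm :: "nat \<Rightarrow> nat \<Rightarrow> ereal"

definition yout :: "plant \<Rightarrow> real vec \<Rightarrow> (real \<Rightarrow> real vec) \<Rightarrow> trajectory \<Rightarrow> nat \<Rightarrow> real \<Rightarrow> real" where
  "yout p w v x i t = (if i = 0 then (Fw p w *\<^sub>v v t) $ 0 else xi x i t $ 0)"

definition err :: "plant \<Rightarrow> real vec \<Rightarrow> (real \<Rightarrow> real vec) \<Rightarrow> trajectory \<Rightarrow> real \<Rightarrow> real vec" where
  "err p w v x t = vec (agents p) (\<lambda>i. yout p w v x (i + 1) t - yout p w v x 0 t)"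

definition ev :: "plant \<Rightarrow> (nat \<times> nat) set \<Rightarrow> real vec \<Rightarrow> (real \<Rightarrow> real vec) \<Rightarrow> trajectory \<Rightarrow> nat \<Rightarrow> real \<Rightarrow> real" where
  "ev p E w v x i t = (\<Sum>j\<in>{0..agents p}. adj E i j * (yout p w v x i t - yout p w v x j t))"

definition sampling_error ::
  "plant \<Rightarrow> (nat \<times> nat) set \<Rightarrow> real vec \<Rightarrow> (real \<Rightarrow> real vec) \<Rightarrow> trajectory \<Rightarrow> nat \<Rightarrow> real \<Rightarrow> real \<Rightarrow> real vec" where
  "sampling_error p E w v x i tk t =
     (eta x i tk - eta x i t) @\<^sub>v (zeta x i tk - zeta x i t) @\<^sub>v scal (ev p E w v x i tk - ev p E w v x i t)"

definition control_input :: "plant \<Rightarrow> design \<Rightarrow> real \<Rightarrow> trajectory \<Rightarrow> nat \<Rightarrow> real \<Rightarrow> real" where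
  "control_input p d K x i tk =
     (GamTinv p d *\<^sub>v eta x i tk) $ 0 - K * (Omega p d *\<^sub>v zeta x i tk) $ 0"

definition states_continuous :: "plant \<Rightarrow> trajectory \<Rightarrow> bool" where
  "states_continuous p x \<longleftrightarrow> (\<forall>i\<in>{1..agents p}.
     continuous_vec_on (zdim p i) {0..} (zz x i) \<and> continuous_vec_on (reldeg p) {0..} (xi x i) \<and>
     continuous_vec_on (ldim p) {0..} (eta x i) \<and> continuous_vec_on (reldeg p) {0..} (zeta x i))"

definition event_times ::
  "plant \<Rightarrow> (nat \<times> nat) set \<Rightarrow> real \<Rightarrow> real \<Rightarrow> real \<Rightarrow> real \<Rightarrow> real vec \<Rightarrow> (real \<Rightarrow> real vec) \<Rightarrow> trajectory \<Rightarrow> bool" where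
  "event_times p E sigma_bar \<beta> \<alpha> \<delta> w v x \<longleftrightarrow> (\<forall>i\<in>{1..agents p}.
     tm x i 0 = 0 \<and>
     (\<forall>k. tm x i (Suc k) = Inf (ereal ` {t. tm x i k < ereal t \<and>
        (vnorm (sampling_error p E w v x i (real_of_ereal (tm x i k)) t))\<^sup>2
          \<ge> sigma_bar * ((vnorm (zeta x i t))\<^sup>2 + (ev p E w v x i t)\<^sup>2) + \<beta> * exp (- \<alpha> * t) + \<delta>})))"

text \<open>The differential equations of agent \<open>i\<close> on one of its sampling intervals \<open>I = [t\<^sub>k\<^sup>i, t\<^sub>k\<^sub>+\<^sub>1\<^sup>i)\<close>,
  with \<open>tk = t\<^sub>k\<^sup>i\<close>; at the left end point the derivative is one-sided.\<close>
definition agent_dynamics ::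
  "plant \<Rightarrow> design \<Rightarrow> (nat \<times> nat) set \<Rightarrow> real \<Rightarrow> real \<Rightarrow> real vec \<Rightarrow> (real \<Rightarrow> real vec) \<Rightarrow> trajectory \<Rightarrow>
   nat \<Rightarrow> real \<Rightarrow> real set \<Rightarrow> bool" where
  "agent_dynamics p d E K h w v x i tk I \<longleftrightarrow> (let u = control_input p d K x i tk; r = reldeg p in
     \<forall>t\<in>I.
       has_vec_deriv (zdim p i) (zz x i)
         (A1 p w i *\<^sub>v zz x i t + A2 p w i *\<^sub>v scal (xi x i t $ 0) + E0 p w i *\<^sub>v v t) t I \<and>
       has_vec_deriv r (xi x i)
         (vec r (\<lambda>s. if s + 1 < r then xi x i t $ (s + 1)
            else (A3 p w i *\<^sub>v zz x i t) $ 0 + (\<Sum>q\<in>{1..r}. cc p w q i * xi x i t $ (q - 1))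
                 + (Er p w i *\<^sub>v v t) $ 0 + bb p w i * u)) t I \<and>
       has_vec_deriv (ldim p) (eta x i) (ctrl_M d *\<^sub>v eta x i t + ctrl_Q d *\<^sub>v scal u) t I \<and>
       has_vec_deriv r (zeta x i)
         (Ao p d h *\<^sub>v zeta x i t + Bo p d h *\<^sub>v scal (ev p E w v x i tk)) t I)"

text \<open>A trajectory that exists for all \<open>t \<ge> 0\<close>: for every agent the sampling intervals cover
  \<open>[0, \<infinity>)\<close>, so event times do not accumulate.\<close>
definition closed_loop ::
  "plant \<Rightarrow> design \<Rightarrow> (nat \<times> nat) set \<Rightarrow> real \<Rightarrow> real \<Rightarrow> real \<Rightarrow> real \<Rightarrow> real \<Rightarrow> real \<Rightarrow>
   real vec \<Rightarrow> (real \<Rightarrow> real vec) \<Rightarrow> trajectory \<Rightarrow> bool" where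
  "closed_loop p d E K h sigma_bar \<beta> \<alpha> \<delta> w v x \<longleftrightarrow>
     states_continuous p x \<and>
     event_times p E sigma_bar \<beta> \<alpha> \<delta> w v x \<and>
     (\<forall>i\<in>{1..agents p}.
        (\<forall>t\<ge>0. \<exists>k. tm x i k \<le> ereal t \<and> ereal t < tm x i (Suc k)) \<and>
        (\<forall>k. agent_dynamics p d E K h w v x i (real_of_ereal (tm x i k))
               {t. tm x i k \<le> ereal t \<and> ereal t < tm x i (Suc k)}))"

definition initial_dims ::
  "plant \<Rightarrow> (nat \<Rightarrow> real vec) \<Rightarrow> (nat \<Rightarrow> real vec) \<Rightarrow> (nat \<Rightarrow> real vec) \<Rightarrow> (nat \<Rightarrow> real vec) \<Rightarrow> bool" where
  "initial_dims p z0 xi0 eta0 zeta0 \<longleftrightarrow> (\<forall>i\<in>{1..agents p}.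
     z0 i \<in> carrier_vec (zdim p i) \<and> xi0 i \<in> carrier_vec (reldeg p) \<and>
     eta0 i \<in> carrier_vec (ldim p) \<and> zeta0 i \<in> carrier_vec (reldeg p))"

definition starts_at ::
  "plant \<Rightarrow> trajectory \<Rightarrow> (nat \<Rightarrow> real vec) \<Rightarrow> (nat \<Rightarrow> real vec) \<Rightarrow> (nat \<Rightarrow> real vec) \<Rightarrow> (nat \<Rightarrow> real vec) \<Rightarrow> bool" where
  "starts_at p x z0 xi0 eta0 zeta0 \<longleftrightarrow> (\<forall>i\<in>{1..agents p}.
     zz x i 0 = z0 i \<and> xi x i 0 = xi0 i \<and> eta x i 0 = eta0 i \<and> zeta x i 0 = zeta0 i)"

definition bounded_trajectory :: "plant \<Rightarrow> (real \<Rightarrow> real vec) \<Rightarrow> trajectory \<Rightarrow> bool" where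
  "bounded_trajectory p v x \<longleftrightarrow> (\<exists>C. \<forall>t\<ge>0. vnorm (v t) \<le> C \<and> (\<forall>i\<in>{1..agents p}.
     vnorm (zz x i t) \<le> C \<and> vnorm (xi x i t) \<le> C \<and>
     vnorm (eta x i t) \<le> C \<and> vnorm (zeta x i t) \<le> C))"

end

theory Submission
  imports
    Defs
    "Jordan_Normal_Form.Schur_Decomposition"
    "HOL-Analysis.Elementary_Metric_Spaces"
    "HOL-Analysis.L2_Norm"
begin

text \<open>
  Let \<open>x\<close> be the deviation of the closed loop from its steady state, given by the solution of the
  regulator equations together with \<open>\<eta>\<^sub>i = T col(u, uS, \<dots>)v\<close>. Then \<open>x' = A\<^sub>c x\<close> plus terms linear in
  the sampling errors.

  An eigenvector of \<open>A\<^sub>c\<close> with \<open>Re \<mu> \<ge> 0\<close> vanishes: resolvent estimates, uniform in \<open>w\<close> by compactness,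
  bound \<open>z\<close>, \<open>\<xi>\<close>, \<open>\<eta>\<close> by \<open>\<theta> = \<Omega>\<xi>\<close>; large \<open>K\<close> and a diagonally weighted dissipativity of \<open>H\<close> bound \<open>\<theta>\<close>
  by the observer error \<open>\<kappa> = \<zeta> - (H \<otimes> I)\<xi>\<close>, and large \<open>h\<close> makes \<open>\<kappa>\<close> smaller than itself.

  While no threshold is crossed, \<open>V = x\<^sup>TPx\<close> satisfies \<open>V' \<le> -\<lambda>V + \<lambda>\<^sub>0(\<beta> e\<^sup>-\<^sup>\<alpha>\<^sup>t + \<delta>)\<close>, so \<open>V\<close> is bounded and
  \<open>limsup V \<le> \<lambda>\<^sub>m \<epsilon>\<^sup>2\<close>. This a priori bound makes the sampled signals Lipschitz, and since \<open>\<delta> > 0\<close> every agent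
  waits a uniform positive time between events. Trajectories pieced together from linear equations
  between events therefore exist for all times.
\<close>

section \<open>Linear systems and Sylvester equations\<close>

text \<open>Vectors and matrices are coefficient functions read below a dimension that is a term;
  R^n then sits inside \<open>nat => real\<close> with its product topology, where the compactness
  arguments take place. Stability is used through \<open>lyap_cert\<close>, an inequality instead of
  the Lyapunov equation: it survives small perturbations with the same form \<open>p\<close>, so
  finitely many forms serve a whole compact \<open>W\<close>, and it yields resolvent bounds on the
  closed right half-plane.

  Two obstacles shape the choice of gains. The observer error is forced by an input proportional to
  K, so the threshold for h depends on K. And the maximum of \<lambda>_4 and \<lambda>_5 does not
  bound the joint effect of the sampling errors of \<eta> and \<zeta>, so h is also taken so large
  that \<lambda>_3 does.

  The a priori bound is stated for any family that satisfies flow and threshold inequalities on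
  [0, b] with right derivatives (\<open>adm\<close>). It thus applies to a partially built
  trajectory, where it excludes accumulation of events, and to an arbitrary closed-loop trajectory,
  where it gives boundedness and the limit superior.\<close>

definition mv :: "nat => (nat => nat => 'a) => (nat => 'a) => nat => 'a::comm_semiring_0" where
 "mv n a x i = (SUM j<n. a i j*x j)"

definition bil :: "nat => (nat => nat => real) => (nat => real) => (nat => real) => real" where
 "bil n p x y = (SUM i<n. SUM j<n. p i j*x i*y j)"

lemma index_mult_mat_vec_sum:
 "A : carrier_mat n m ==> v : carrier_vec m ==> i < n ==>
  (A *\<^sub>v v) $ i = (SUM j<m. A $$ (i, j)*v $ j)"
 by (auto simp: scalar_prod_def atLeast0LessThan intro!: sum.cong)

lemma index_mult_mat_sum:
 "A : carrier_mat n m ==> B : carrier_mat m k ==> i < n ==> j < k ==>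
  (A*B) $$ (i, j) = (SUM l<m. A $$ (i, l)*B $$ (l, j))"
 by (auto simp: scalar_prod_def atLeast0LessThan intro!: sum.cong)

lemma eigenvalue_iff_fun:
 assumes A: "(A :: 'a::field mat) : carrier_mat n n"
 shows "eigenvalue A \<mu> \<longleftrightarrow>
  (EX x. (EX i<n. x i ~= 0) & (ALL i<n. (SUM j<n. A $$ (i, j)*x j) = \<mu>*x i))"
proof
 assume "eigenvalue A \<mu>"
 then obtain v where v: "v : carrier_vec n" "v ~= 0\<^sub>v n" "A *\<^sub>v v = \<mu> \<cdot>\<^sub>v v"
  using A unfolding eigenvalue_def eigenvector_def by auto
 have 1: "EX i<n. v $ i ~= 0"
 proof (rule ccontr)
  assume "~ (EX i<n. v $ i ~= 0)"
  then have "v = 0\<^sub>v n" using v(1) by (intro eq_vecI) auto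
  then show False using v(2) by simp
 qed
 have "(SUM j<n. A $$ (i, j)*v $ j) = \<mu>*v $ i" if "i < n" for i
  using index_mult_mat_vec_sum[OF A v(1) that] v that by simp
 with 1 show "EX x. (EX i<n. x i ~= 0) & (ALL i<n. (SUM j<n. A $$ (i, j)*x j) = \<mu>*x i)"
  by (intro exI[of _ "%i. v $ i"]) auto
next
 assume "EX x. (EX i<n. x i ~= 0) & (ALL i<n. (SUM j<n. A $$ (i, j)*x j) = \<mu>*x i)"
 then obtain x where x: "EX i<n. x i ~= 0" "ALL i<n. (SUM j<n. A $$ (i, j)*x j) = \<mu>*x i" by blast
 have "vec n x ~= 0\<^sub>v n" using x(1) by (auto simp: vec_eq_iff)
 moreover have "A *\<^sub>v vec n x = \<mu> \<cdot>\<^sub>v vec n x"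
  using x(2) A index_mult_mat_vec_sum[OF A, of "vec n x"] by (intro eq_vecI) auto
 ultimately show "eigenvalue A \<mu>" using A unfolding eigenvalue_def eigenvector_def
  by (intro exI[of _ "vec n x"]) auto
qed

text \<open>Injectivity of a square matrix excludes determinant zero, so the inverse matrix supplies
  the solution. The coefficient form lets it serve shifted matrices, padded systems and the inverse
  of \<open>H\<close> alike.\<close>

lemma linear_system_solvable:
 fixes a :: "nat => nat => 'a::field"
 assumes inj: "!!x. (ALL i<n. mv n a x i = 0) ==> (ALL i<n. x i = 0)"
 shows "EX x. ALL i<n. mv n a x i = y i"
proof -
 define A where "A = mat n n (%(i, j). a i j)"
 have A: "A : carrier_mat n n" by (simp add: A_def)
 have mv: "(A *\<^sub>v v) $ i = mv n a (%i. v $ i) i" if "v : carrier_vec n" "i < n" for v i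
  using index_mult_mat_vec_sum[OF A that] that by (simp add: A_def mv_def)
 have "det A ~= 0"
 proof
  assume "det A = 0"
  then obtain v where v: "v : carrier_vec n" "v ~= 0\<^sub>v n" "A *\<^sub>v v = 0\<^sub>v n"
   using det_0_iff_vec_prod_zero_field[OF A] by auto
  have "ALL i<n. mv n a (%i. v $ i) i = 0" using mv[OF v(1)] v(3) by simp
  with inj have "ALL i<n. v $ i = 0" by blast
  with v show False by auto
 qed
 from det_non_zero_imp_unit[OF A this, of "()"]
 obtain B where B: "B : carrier_mat n n" "A*B = 1\<^sub>m n" unfolding Units_def ring_mat_def by auto
 have "A *\<^sub>v (B *\<^sub>v vec n y) = vec n y"
  using assoc_mult_mat_vec[OF A B(1), of "vec n y"] B(2) by simp
 then have "ALL i<n. mv n a (%i. (B *\<^sub>v vec n y) $ i) i = y i"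
  using mv[of "B *\<^sub>v vec n y"] B(1) by (metis index_vec mult_mat_vec_carrier vec_carrier)
 then show ?thesis by blast
qed

text \<open>Schur decomposition A = P U Q with Q inverse to P, recorded in both intertwining forms
  AP = PU and QA = UQ, so that equations can be carried to triangular coordinates and back. The
  diagonal of U consists of eigenvalues because similar matrices share the characteristic
  polynomial.\<close>

lemma schur_fun:
 assumes A: "(A :: complex mat) : carrier_mat n n"
 obtains P Q U :: "nat => nat => complex" where
  "ALL i<n. ALL k<n. (SUM j<n. P i j*Q j k) = (if i = k then 1 else 0)"
  "ALL i<n. ALL k<n. (SUM j<n. Q i j*P j k) = (if i = k then 1 else 0)"
  "ALL i<n. ALL k<n. (SUM j<n. A $$ (i, j)*P j k) = (SUM j<n. P i j*U j k)"
  "ALL i<n. ALL k<n. (SUM j<n. Q i j*A $$ (j, k)) = (SUM j<n. U i j*Q j k)"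
  "ALL i<n. ALL j<i. U i j = 0"
  "ALL i<n. eigenvalue A (U i i)"
proof -
 obtain es where "char_poly A = (\<Prod>a\<leftarrow>es. [:- a, 1:])" using char_poly_factorized[OF A] by blast
 from schur_decomposition_exists[OF A this] obtain B P Q where
  B: "B : carrier_mat n n" "upper_triangular B" and sim: "similar_mat_wit A B P Q"
  unfolding similar_mat_def by blast
 note w = similar_mat_witD2[OF A sim]
 have AP: "A*P = P*B"
 proof -
  have "A*P = (P*B)*(Q*P)"
   unfolding w(3) by (rule assoc_mult_mat[of _ n n _ n _ n]) (use w in auto)
  then show ?thesis using w by simp
 qed
 have QA: "Q*A = B*Q"
 proof -
  have "Q*A = Q*(P*(B*Q))"
   unfolding w(3) using w by (simp add: assoc_mult_mat[of _ n n _ n _ n])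
  also have "... = (Q*P)*(B*Q)"
   by (rule assoc_mult_mat[of _ n n _ n _ n, symmetric]) (use w in auto)
  finally show ?thesis using w by simp
 qed
 have ev: "eigenvalue A (B $$ (i, i))" if "i < n" for i
 proof -
  have "char_poly A = char_poly B" by (rule char_poly_similar) (use sim in \<open>auto simp: similar_mat_def\<close>)
  also have "... = (\<Prod>a\<leftarrow>diag_mat B. [:- a, 1:])" by (rule char_poly_upper_triangular[OF B])
  finally have "poly (char_poly A) (B $$ (i, i)) = 0"
   using that B by (auto simp: poly_prod_list prod_list_zero_iff diag_mat_def image_image)
  then show ?thesis using eigenvalue_root_char_poly[OF A] by simp
 qed
 show ?thesis
 proof (rule that[of "%i j. P $$ (i, j)" "%i j. Q $$ (i, j)" "%i j. B $$ (i, j)"])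
  show "ALL i<n. ALL k<n. (SUM j<n. P $$ (i, j)*Q $$ (j, k)) = (if i = k then 1 else 0)"
   using index_mult_mat_sum[OF w(6,7)] w(1) by simp
  show "ALL i<n. ALL k<n. (SUM j<n. Q $$ (i, j)*P $$ (j, k)) = (if i = k then 1 else 0)"
   using index_mult_mat_sum[OF w(7,6)] w(2) by simp
  show "ALL i<n. ALL k<n. (SUM j<n. A $$ (i, j)*P $$ (j, k)) = (SUM j<n. P $$ (i, j)*B $$ (j, k))"
   using index_mult_mat_sum[OF A w(6)] index_mult_mat_sum[OF w(6) B(1)] AP by simp
  show "ALL i<n. ALL k<n. (SUM j<n. Q $$ (i, j)*A $$ (j, k)) = (SUM j<n. B $$ (i, j)*Q $$ (j, k))"
   using index_mult_mat_sum[OF w(7) A] index_mult_mat_sum[OF B(1) w(7)] QA by simp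
 qed (use B ev in auto)
qed

text \<open>With B triangularised and Y = X P the equation becomes A Y - Y U = C P. Column j
  involves only columns up to j, and solving for it inverts A - U_jj, which is possible since U_jj
  is an eigenvalue of B and so not of A.\<close>

lemma sylvester_exists_complex:
 assumes A: "(A :: complex mat) : carrier_mat n n" and B: "B : carrier_mat m m"
  and disj: "ALL \<mu>. eigenvalue A \<mu> --> ~ eigenvalue B \<mu>"
 shows "EX X. ALL i<n. ALL j<m. (SUM k<n. A $$ (i, k)*X k j) - (SUM k<m. X i k*B $$ (k, j)) = C i j"
proof -
 obtain P Q U where PQ: "ALL i<m. ALL k<m. (SUM j<m. P i j*Q j k) = (if i = k then 1 else 0)"
  and QP: "ALL i<m. ALL k<m. (SUM j<m. Q i j*P j k) = (if i = k then 1 else 0)"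
  and BP: "ALL i<m. ALL k<m. (SUM j<m. B $$ (i, j)*P j k) = (SUM j<m. P i j*U j k)"
  and QB: "ALL i<m. ALL k<m. (SUM j<m. Q i j*B $$ (j, k)) = (SUM j<m. U i j*Q j k)"
  and U0: "ALL i<m. ALL j<i. U i j = 0"
  and ev: "ALL i<m. eigenvalue B (U i i)"
  by (rule schur_fun[OF B])
 have col: "EX x. ALL i<n. (SUM k<n. A $$ (i, k)*x k) - U j j*x i = c i" if "j < m" for j c
 proof -
  define a where "a i k = A $$ (i, k) - (if i = k then U j j else 0)" for i k
  have a: "mv n a x i = (SUM k<n. A $$ (i, k)*x k) - U j j*x i" if "i < n" for x i
   using that by (simp add: mv_def a_def left_diff_distrib sum_subtractf if_distrib[of "%t. t*_"] cong: if_cong)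
  have "EX x. ALL i<n. mv n a x i = c i"
  proof (rule linear_system_solvable, rule ccontr)
   fix x assume "ALL i<n. mv n a x i = 0" "~ (ALL i<n. x i = 0)"
   then have "(EX i<n. x i ~= 0) & (ALL i<n. (SUM k<n. A $$ (i, k)*x k) = U j j*x i)"
    using a by simp
   then have "eigenvalue A (U j j)" unfolding eigenvalue_iff_fun[OF A] by blast
   with disj ev that show False by blast
  qed
  then show ?thesis using a by auto
 qed
 define D where "D i j = (SUM k<m. C i k*P k j)" for i j
 \<comment> \<open>\<open>Y\<close> is indexed by column first; the earlier columns have moved to
   the right-hand side, so the first q columns can be extended one by one.\<close>
 have "EX Y. ALL j<q. ALL i<n. (SUM k<n. A $$ (i, k)*Y j k) - U j j*Y j i = D i j + (SUM k<j. Y k i*U k j)"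
  if "q <= m" for q
  using that
 proof (induction q)
  case 0 then show ?case by simp
 next
  case (Suc q)
  then obtain Y where Y: "ALL j<q. ALL i<n. (SUM k<n. A $$ (i, k)*Y j k) - U j j*Y j i
   = D i j + (SUM k<j. Y k i*U k j)" by auto
  from col[of q "%i. D i q + (SUM k<q. Y k i*U k q)"] Suc.prems obtain x where
   x: "ALL i<n. (SUM k<n. A $$ (i, k)*x k) - U q q*x i = D i q + (SUM k<q. Y k i*U k q)" by auto
  have "(SUM k<j. (Y(q := x)) k i*U k j) = (SUM k<j. Y k i*U k j)" if "j <= q" for i j
   using that by (intro sum.cong) auto
  then show ?case
   by (intro exI[of _ "Y(q := x)"]) (use x Y in \<open>simp add: less_Suc_eq\<close>)
 qed
 from this[of m] obtain Y where Y: "!!j i. j < m ==> i < n ==>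
  (SUM k<n. A $$ (i, k)*Y j k) - U j j*Y j i = D i j + (SUM k<j. Y k i*U k j)" by auto
 have Y': "(SUM k<n. A $$ (i, k)*Y j k) = D i j + (SUM k<m. Y k i*U k j)" if "j < m" "i < n" for i j
 proof -
  have "(SUM k<m. Y k i*U k j) = (SUM k:{..<Suc j}. Y k i*U k j)"
   by (rule sum.mono_neutral_right) (use that U0 in auto)
  then show ?thesis using Y[OF that] by (simp add: algebra_simps)
 qed
 define X where "X i j = (SUM k<m. Y k i*Q k j)" for i j
 have "(SUM k<n. A $$ (i, k)*X k j) - (SUM k<m. X i k*B $$ (k, j)) = C i j" if ij: "i < n" "j < m" for i j
 proof -
  have "(SUM k<n. A $$ (i, k)*X k j) = (SUM q<m. (SUM k<n. A $$ (i, k)*Y q k)*Q q j)"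
   unfolding X_def sum_distrib_left sum_distrib_right
   by (subst sum.swap) (simp add: mult_ac)
  also have "... = (SUM q<m. D i q*Q q j) + (SUM q<m. (SUM k<m. Y k i*U k q)*Q q j)"
   using ij by (simp add: Y' sum.distrib ring_distribs)
  also have "(SUM q<m. D i q*Q q j) = (SUM k<m. C i k*(SUM q<m. P k q*Q q j))"
   unfolding D_def sum_distrib_left sum_distrib_right
   by (subst sum.swap) (simp add: mult_ac)
  also have "... = C i j" using ij by (simp add: PQ if_distrib[of "%t. _*t"] cong: if_cong)
  also have "(SUM q<m. (SUM k<m. Y k i*U k q)*Q q j) = (SUM k<m. Y k i*(SUM q<m. U k q*Q q j))"
   unfolding sum_distrib_left sum_distrib_right
   by (subst sum.swap) (simp add: mult_ac)
  also have "... = (SUM k<m. Y k i*(SUM q<m. Q k q*B $$ (q, j)))"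
   using ij by (simp add: QB)
  also have "... = (SUM k<m. X i k*B $$ (k, j))"
   unfolding X_def sum_distrib_left sum_distrib_right
   by (subst sum.swap) (simp add: mult_ac)
  finally show ?thesis by simp
 qed
 then show ?thesis by blast
qed

text \<open>In the coordinates Y = X P the first nonzero column would be an eigenvector of A for the
  eigenvalue U_jj of B.\<close>

lemma sylvester_unique_complex:
 assumes A: "(A :: complex mat) : carrier_mat n n" and B: "B : carrier_mat m m"
  and disj: "ALL \<mu>. eigenvalue A \<mu> --> ~ eigenvalue B \<mu>"
  and X: "ALL i<n. ALL j<m. (SUM k<n. A $$ (i, k)*X k j) = (SUM k<m. X i k*B $$ (k, j))"
  and ij: "i < n" "j < m"
 shows "X i j = 0"
proof -
 obtain P Q U where PQ: "ALL i<m. ALL k<m. (SUM j<m. P i j*Q j k) = (if i = k then 1 else 0)"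
  and QP: "ALL i<m. ALL k<m. (SUM j<m. Q i j*P j k) = (if i = k then 1 else 0)"
  and BP: "ALL i<m. ALL k<m. (SUM j<m. B $$ (i, j)*P j k) = (SUM j<m. P i j*U j k)"
  and QB: "ALL i<m. ALL k<m. (SUM j<m. Q i j*B $$ (j, k)) = (SUM j<m. U i j*Q j k)"
  and U0: "ALL i<m. ALL j<i. U i j = 0"
  and ev: "ALL i<m. eigenvalue B (U i i)"
  by (rule schur_fun[OF B])
 define Y where "Y i j = (SUM k<m. X i k*P k j)" for i j
 have AY: "(SUM k<n. A $$ (i, k)*Y k j) = (SUM k<m. Y i k*U k j)" if "i < n" "j < m" for i j
 proof -
  have "(SUM k<n. A $$ (i, k)*Y k j) = (SUM q<m. (SUM k<n. A $$ (i, k)*X k q)*P q j)"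
   unfolding Y_def sum_distrib_left sum_distrib_right
   by (subst sum.swap) (simp add: mult_ac)
  also have "... = (SUM q<m. (SUM k<m. X i k*B $$ (k, q))*P q j)" using that X by simp
  also have "... = (SUM k<m. X i k*(SUM q<m. B $$ (k, q)*P q j))"
   unfolding sum_distrib_left sum_distrib_right
   by (subst sum.swap) (simp add: mult_ac)
  also have "... = (SUM k<m. X i k*(SUM q<m. P k q*U q j))" using that by (simp add: BP)
  also have "... = (SUM k<m. Y i k*U k j)"
   unfolding Y_def sum_distrib_left sum_distrib_right
   by (subst sum.swap) (simp add: mult_ac)
  finally show ?thesis .
 qed
 have Y0: "ALL i<n. Y i j = 0" if "j < m" for j
  using that
 proof (induction j rule: less_induct)
  case (less j)
  have "(SUM k<n. A $$ (i, k)*Y k j) = U j j*Y i j" if "i < n" for i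
  proof -
   \<comment> \<open>Terms with k < j vanish by induction, those with k > j because U is upper
     triangular.\<close>
   have "(SUM k<m. Y i k*U k j) = (SUM k:{j}. Y i k*U k j)"
    by (rule sum.mono_neutral_right) (use less U0 that in \<open>auto, metis linorder_neqE_nat\<close>)
   then show ?thesis using AY[OF that less.prems] by simp
  qed
  moreover have "~ eigenvalue A (U j j)" using disj ev less.prems by blast
  ultimately show ?case
   unfolding eigenvalue_iff_fun[OF A] not_ex de_Morgan_conj by (elim allE[of _ "%i. Y i j"]) simp
 qed
 have "X i j = (SUM k<m. X i k*(SUM q<m. P k q*Q q j))"
  using ij by (simp add: PQ if_distrib[of "%t. _*t"] cong: if_cong)
 also have "... = (SUM q<m. Y i q*Q q j)"
  unfolding Y_def sum_distrib_left sum_distrib_right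
  by (subst sum.swap) (simp add: mult_ac)
 also have "... = 0" using Y0 ij by simp
 finally show ?thesis .
qed

section \<open>Lyapunov certificates\<close>

lemma bil_add_left: "bil n p (%i. x i + y i) z = bil n p x z + bil n p y z"
 by (simp add: bil_def algebra_simps sum.distrib)

lemma bil_add_right: "bil n p z (%i. x i + y i) = bil n p z x + bil n p z y"
 by (simp add: bil_def algebra_simps sum.distrib)

lemma bil_scale_left: "bil n p (%i. c*x i) y = c*bil n p x y"
 by (simp add: bil_def sum_distrib_left mult_ac)

lemma bil_scale_right: "bil n p x (%i. c*y i) = c*bil n p x y"
 by (simp add: bil_def sum_distrib_left mult_ac)

lemma bil_diff_right: "bil n p z (%i. x i - y i) = bil n p z x - bil n p z y"
 by (simp add: bil_def algebra_simps sum_subtractf)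

lemma bil_sym: "ALL i<n. ALL j<n. p i j = p j i ==> bil n p x y = bil n p y x"
 unfolding bil_def by (subst sum.swap) (auto intro!: sum.cong simp: mult_ac)

lemma bil_matrix_diff: "bil n (%i j. s*p i j - t*q i j) x y = s*bil n p x y - t*bil n q x y"
 by (simp add: bil_def sum_distrib_left algebra_simps sum_subtractf)

lemma bil_cong: "(!!i. i < n ==> x i = x' i) ==> (!!i. i < n ==> y i = y' i) ==> bil n p x y = bil n p x' y'"
 by (simp add: bil_def)

lemma bil_bound:
 assumes "ALL i<n. ALL j<n. \<bar>p i j\<bar> <= B"
 shows "\<bar>bil n p x y\<bar> <= B*(SUM i<n. \<bar>x i\<bar>)*(SUM i<n. \<bar>y i\<bar>)"
proof -
 have "\<bar>bil n p x y\<bar> <= (SUM i<n. SUM j<n. \<bar>p i j*x i*y j\<bar>)"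
  unfolding bil_def by (rule order_trans[OF sum_abs]) (intro sum_mono sum_abs)
 also have "... <= (SUM i<n. SUM j<n. B*\<bar>x i\<bar>*\<bar>y j\<bar>)"
  using assms by (intro sum_mono) (auto simp: abs_mult intro!: mult_right_mono)
 also have "... = B*(SUM i<n. \<bar>x i\<bar>)*(SUM i<n. \<bar>y i\<bar>)"
  by (simp add: sum_distrib_left sum_distrib_right mult_ac)
 finally show ?thesis .
qed

lemma Cauchy_Schwarz_sum:
 fixes a b :: "nat => real"
 shows "(SUM k<n. a k*b k)^2 <= (SUM k<n. (a k)^2)*(SUM k<n. (b k)^2)"
proof -
 have "\<bar>SUM k<n. a k*b k\<bar> <= (SUM k<n. \<bar>a k\<bar>*\<bar>b k\<bar>)" using sum_abs[of "%k. a k*b k" "{..<n}"] by (simp add: abs_mult)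
 also have "... <= L2_set a {..<n} * L2_set b {..<n}" by (rule L2_set_mult_ineq)
 finally have "\<bar>SUM k<n. a k*b k\<bar>^2 <= (L2_set a {..<n} * L2_set b {..<n})^2" by (rule power_mono) simp
 then show ?thesis by (simp add: power_mult_distrib L2_set_def sum_nonneg)
qed

lemma sum_squared_le_card_mult: "(SUM i<n. f i)^2 <= real n*(SUM i<n. (f i)^2)" for f :: "nat => real"
 using Cauchy_Schwarz_sum[where a = "%_. 1" and b = f and n = n] by simp

lemma finite_upper_bound:
 fixes f :: "'i => real"
 assumes "finite I"
 obtains B where "B >= 0" "!!i. i : I ==> f i <= B"
proof (rule that[of "SUM i:I. \<bar>f i\<bar>"])
 fix i assume "i : I"
 have "f i <= \<bar>f i\<bar>" by simp
 also have "... <= (SUM i:I. \<bar>f i\<bar>)" by (rule member_le_sum) (use \<open>i : I\<close> assms in auto)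
 finally show "f i <= (SUM i:I. \<bar>f i\<bar>)" .
qed (simp add: sum_nonneg)

lemma finite_pos_lower_bound:
 fixes f :: "'i => real"
 assumes "finite I" "!!i. i : I ==> f i > 0"
 obtains b where "b > 0" "!!i. i : I ==> b <= f i"
proof (cases "I = {}")
 case True then show ?thesis using that[of 1] by simp
next
 case False
 show ?thesis
  by (rule that[of "Min (f ` I)"]) (use assms False in auto)
qed

text \<open>A zero of a nonnegative form is a minimum, so the form has no first-order term along any
  line through x.\<close>

lemma psd_kernel:
 assumes sym: "ALL i<n. ALL j<n. g i j = g j i" and psd: "!!x. bil n g x x >= 0" and z: "bil n g x x = 0"
 shows "bil n g x y = 0"
proof (rule ccontr)
 assume nz: "bil n g x y ~= 0"
 define b c where "b = bil n g x y" and "c = bil n g y y"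
 have ge: "0 <= 2*t*b + t^2*c" for t
 proof -
  have "0 <= bil n g (%i. x i + t*y i) (%i. x i + t*y i)" by (rule psd)
  also have "... = 2*t*b + t^2*c"
   using z bil_sym[OF sym, of y x]
   by (simp add: bil_add_left bil_add_right bil_scale_left bil_scale_right b_def c_def power2_eq_square)
  finally show ?thesis .
 qed
 have c: "c >= 0" unfolding c_def by (rule psd)
 \<comment> \<open>The denominator is c + 1 because c may be 0; this t makes the quadratic
   polynomial strictly negative.\<close>
 define t where "t = - b / (c + 1)"
 have b: "b = - t*(c + 1)" using c by (simp add: t_def)
 have "t ~= 0" using nz c by (simp add: t_def b_def)
 then have "t^2*(c + 2) > 0" using c by simp
 moreover have "2*t*b + t^2*c = - (t^2*(c + 2))" unfolding b by (simp add: power2_eq_square algebra_simps)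
 ultimately show False using ge[of t] by linarith
qed

section \<open>Compactness and minimisation of Rayleigh quotients\<close>

lemma continuous_on_coord: "continuous_on S (%f::nat => real. f i)"
 by (rule continuous_on_subset[OF continuous_on_product_coordinates]) simp

lemma compact_coordinate_box:
 fixes S :: "nat => real set"
 assumes "!!i. compact (S i)"
 shows "compact {f. ALL i. f i : S i}"
proof -
 have "compactin (product_topology (%i. euclidean) UNIV) (PiE UNIV S)"
  using assms unfolding compactin_PiE by (auto simp: compactin_euclidean_iff)
 then show ?thesis by (simp add: euclidean_product_topology compactin_euclidean_iff PiE_UNIV_domain Pi_def)
qed

text \<open>Sequences that vanish from n on form a copy of R^n; there the sphere is a closed subset
  of a product of compact intervals.\<close>

lemma compact_unit_sphere_fun:
 "compact {f::nat => real. (ALL i>=n. f i = 0) & (SUM i<n. (f i)^2) = 1}" (is "compact ?S")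
proof -
 have "closed {f::nat => real. (SUM i<n. (f i)^2) = 1}"
  by (intro closed_Collect_eq continuous_intros continuous_on_coord)
 moreover have "compact {f::nat => real. ALL i. f i : (if i < n then {-1..1} else {0})}"
  by (rule compact_coordinate_box) auto
 ultimately have "compact ({f::nat => real. ALL i. f i : (if i < n then {-1..1} else {0})} \<inter> {f::nat => real. (SUM i<n. (f i)^2) = 1})"
  by (rule compact_Int_closed[rotated])
 moreover have "{f::nat => real. ALL i. f i : (if i < n then {-1..1} else {0})} \<inter> {f::nat => real. (SUM i<n. (f i)^2) = 1} = ?S"
 proof (rule Set.set_eqI, rule iffI)
  fix f :: "nat => real" assume f: "f : ?S"
  have "f i : {-1..1}" if "i < n" for i
  proof -
   have "(f i)^2 <= (SUM i<n. (f i)^2)" by (rule member_le_sum) (use that in auto)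
   then have "\<bar>f i\<bar> <= 1" using f by (simp add: abs_square_le_1)
   then show ?thesis by auto
  qed
  then show "f : {f. ALL i. f i : (if i < n then {-1..1} else {0})} \<inter> {f. (SUM i<n. (f i)^2) = 1}"
   using f by auto
 next
  fix f :: "nat => real"
  assume f: "f : {f. ALL i. f i : (if i < n then {-1..1} else {0})} \<inter> {f. (SUM i<n. (f i)^2) = 1}"
  then have "f i = 0" if "i >= n" for i using that by (auto dest!: spec[of _ i])
  with f show "f : ?S" by auto
 qed
 ultimately show ?thesis by simp
qed

text \<open>A minimiser x0 of g/b on the sphere with minimum \<mu> makes g - \<mu> b nonnegative and
  zero at x0, so \<open>psd_kernel\<close> turns minimality into a generalised eigenvalue equation,
  tested against all y.\<close>

lemma rayleigh_min:
 assumes n: "0 < n" and gsym: "ALL i<n. ALL j<n. g i j = g j i" and bsym: "ALL i<n. ALL j<n. b i j = b j i"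
  and bpos: "!!x. EX i<n. x i ~= 0 ==> 0 < bil n b x x"
 shows "EX \<mu> x0. (EX i<n. x0 i ~= 0) & (ALL x. \<mu>*bil n b x x <= bil n g x x) &
  (ALL y. bil n g x0 y = \<mu>*bil n b x0 y)"
proof -
 let ?S = "{f::nat => real. (ALL i>=n. f i = 0) & (SUM i<n. (f i)^2) = 1}"
 have nz: "EX i<n. f i ~= 0" if "f : ?S" for f
 proof (rule ccontr)
  assume "~ (EX i<n. f i ~= 0)"
  then have "(SUM i<n. (f i)^2) = 0" by simp
  then show False using that by simp
 qed
 have bnz: "bil n b f f ~= 0" if "f : ?S" for f using bpos[OF nz[OF that]] by simp
 have c1: "continuous_on ?S (%f. bil n q f f)" for q
  unfolding bil_def by (intro continuous_intros continuous_on_coord)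
 have cont: "continuous_on ?S (%f. bil n g f f / bil n b f f)"
  by (intro continuous_on_divide c1) (use bnz in blast)
 have "(%i. if i = 0 then 1 else 0) : ?S"
  using n by (auto simp: if_distrib[of "%t. t^2"] cong: if_cong)
 then have "?S ~= {}" by (metis empty_iff)
 from continuous_attains_inf[OF compact_unit_sphere_fun this cont] obtain x0 where
  x0: "x0 : ?S" and min: "ALL y:?S. bil n g x0 x0 / bil n b x0 x0 <= bil n g y y / bil n b y y" by (rule bexE)
 define \<mu> where "\<mu> = bil n g x0 x0 / bil n b x0 x0"
 have le: "\<mu>*bil n b x x <= bil n g x x" for x
 proof (cases "EX i<n. x i ~= 0")
  case False
  then have "bil n q x x = 0" for q by (simp add: bil_def)
  then show ?thesis by simp
 next
  case True
  define s where "s = (SUM i<n. (x i)^2)"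
  from True obtain i where "i < n" "x i ~= 0" by blast
  then have "0 < s" unfolding s_def by (intro sum_pos2[of _ i]) auto
  define y where "y i = (if i < n then (1 / sqrt s)*x i else 0)" for i
  have "(SUM i<n. (y i)^2) = (SUM i<n. (x i)^2 / s)"
   using \<open>0 < s\<close> by (intro sum.cong) (auto simp: y_def power_divide)
  then have "y : ?S" using \<open>0 < s\<close> by (simp add: y_def flip: sum_divide_distrib s_def)
  have y: "bil n q y y = bil n q x x / s" for q
  proof -
   have "bil n q y y = bil n q (%i. (1 / sqrt s)*x i) (%i. (1 / sqrt s)*x i)"
    by (rule bil_cong) (auto simp: y_def)
   then show ?thesis using \<open>0 < s\<close> unfolding bil_scale_left bil_scale_right by simp
  qed
  from bspec[OF min \<open>y : ?S\<close>] have "\<mu> <= bil n g x x / bil n b x x"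
   using \<open>0 < s\<close> by (simp add: \<mu>_def y)
  then show ?thesis using bpos[OF True] by (simp add: field_simps)
 qed
 have d: "bil n (%i j. g i j - \<mu>*b i j) x y = bil n g x y - \<mu>*bil n b x y" for x y
  using bil_matrix_diff[of n 1 g \<mu> b] by simp
 have "bil n (%i j. g i j - \<mu>*b i j) x0 y = 0" for y
 proof (rule psd_kernel)
  show "bil n (%i j. g i j - \<mu>*b i j) x0 x0 = 0"
   unfolding d using bpos[OF nz[OF x0]] by (simp add: \<mu>_def)
  show "0 <= bil n (%i j. g i j - \<mu>*b i j) x x" for x
   unfolding d using le[of x] by simp
  show "ALL i<n. ALL j<n. g i j - \<mu>*b i j = g j i - \<mu>*b j i"
   using gsym bsym by (metis (no_types))
 qed
 then have "ALL y. bil n g x0 y = \<mu>*bil n b x0 y" using d by simp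
 with nz[OF x0] le show ?thesis by blast
qed

text \<open>A relaxed Lyapunov equation. The inequality, unlike the equation, persists for nearby
  \<open>a\<close> with the same \<open>p\<close>. Only semidefiniteness is demanded: for c > 0 the
  decrease forces definiteness.\<close>

definition lyap_cert :: "nat => (nat => nat => real) => (nat => nat => real) => real => bool" where
 "lyap_cert n a p c \<longleftrightarrow> (ALL i<n. ALL j<n. p i j = p j i) & (ALL x. 0 <= bil n p x x) &
  (ALL x. bil n p x (mv n a x) <= - c*(SUM i<n. (x i)^2))"

lemma lyap_certD:
 assumes "lyap_cert n a p c"
 shows lyap_cert_sym: "ALL i<n. ALL j<n. p i j = p j i"
  and lyap_cert_psd: "0 <= bil n p x x"
  and lyap_cert_decrease: "bil n p x (mv n a x) <= - c*(SUM i<n. (x i)^2)"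
proof -
 note c = assms[unfolded lyap_cert_def]
 show "ALL i<n. ALL j<n. p i j = p j i" by (rule conjunct1[OF c])
 show "0 <= bil n p x x" by (rule spec[OF conjunct1[OF conjunct2[OF c]]])
 show "bil n p x (mv n a x) <= - c*(SUM i<n. (x i)^2)" by (rule spec[OF conjunct2[OF conjunct2[OF c]]])
qed

text \<open>If p(x, x) = 0 then x lies in the kernel of p, so p(x, a x) = 0, against the strict
  decrease.\<close>

lemma lyap_cert_pos:
 assumes "lyap_cert n a p c" "c > 0" and x: "EX i<n. x i ~= 0"
 shows "0 < bil n p x x"
proof (rule ccontr)
 assume "~ 0 < bil n p x x"
 with lyap_cert_psd[OF assms(1), of x] have "bil n p x x = 0" by linarith
 with psd_kernel[OF lyap_cert_sym[OF assms(1)] lyap_cert_psd[OF assms(1)]]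
 have "bil n p x (mv n a x) = 0" .
 moreover note lyap_cert_decrease[OF assms(1), of x]
 moreover have "(SUM i<n. (x i)^2) > 0"
 proof -
  from x obtain i where "i < n" "x i ~= 0" by blast
  then show ?thesis by (intro sum_pos2[of _ i]) auto
 qed
 ultimately show False using \<open>c > 0\<close> by (simp add: mult_le_0_iff)
qed

text \<open>At a minimiser of the Rayleigh quotient of \<open>g\<close> relative to \<open>p\<close> with negative minimum,
 \<open>g\<close> would increase along the flow.\<close>
lemma lyap_cert_nonneg:
 assumes cert: "lyap_cert n a p c" "c > 0"
  and sym: "ALL i<n. ALL j<n. g i j = g j i" and dec: "!!x. bil n g x (mv n a x) <= 0"
 shows "0 <= bil n g x x"
proof (cases "n = 0")
 case True then show ?thesis by (simp add: bil_def)
next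
 case False
 have psym: "ALL i<n. ALL j<n. p i j = p j i" by (rule lyap_cert_sym[OF cert(1)])
 obtain \<mu> x0 where x0: "EX i<n. x0 i ~= 0" and le: "!!x. \<mu>*bil n p x x <= bil n g x x"
  and eq: "!!y. bil n g x0 y = \<mu>*bil n p x0 y"
  using rayleigh_min[OF _ sym psym lyap_cert_pos[OF cert]] False by blast
 have neg: "bil n p x0 (mv n a x0) < 0"
 proof -
  have "bil n p x0 (mv n a x0) <= - c*(SUM i<n. (x0 i)^2)" by (rule lyap_cert_decrease[OF cert(1)])
  also have "... < 0"
  proof -
   from x0 obtain i where "i < n" "x0 i ~= 0" by blast
   then have "(SUM i<n. (x0 i)^2) > 0" by (intro sum_pos2[of _ i]) auto
   then show ?thesis using cert(2) by simp
  qed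
  finally show ?thesis .
 qed
 \<comment> \<open>At the minimiser g(x0, .) is \<mu> p(x0, .), so the decrease of g and the strict
   decrease of p force \<mu> to be nonnegative.\<close>
 have "\<mu>*bil n p x0 (mv n a x0) <= 0" using dec[of x0] eq by metis
 with neg have "\<mu> >= 0" by (meson mult_neg_neg not_le)
 moreover have "bil n p x x >= 0" by (rule lyap_cert_psd[OF cert(1)])
 ultimately have "0 <= \<mu>*bil n p x x" by simp
 also have "... <= bil n g x x" by (rule le)
 finally show ?thesis .
qed

lemma hurwitz_iff_fun:
 assumes "A : carrier_mat n n"
 shows "hurwitz A \<longleftrightarrow> (ALL \<mu> x. (EX i<n. x i ~= 0) &
  (ALL i<n. (SUM j<n. complex_of_real (A $$ (i, j))*x j) = \<mu>*x i) --> Re \<mu> < 0)"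
proof -
 have c: "cmat A : carrier_mat n n" using assms by simp
 have "(SUM j<n. cmat A $$ (i, j)*x j) = (SUM j<n. complex_of_real (A $$ (i, j))*x j)" if "i < n" for i x
  using that assms by (intro sum.cong) auto
 then show ?thesis unfolding hurwitz_def eigenvalue_iff_fun[OF c] by (simp cong: conj_cong)
qed

text \<open>In Schur coordinates the weights \<open>L\<^sup>2\<^sup>i\<close> make the strictly upper triangular part negligible
 against the diagonal.\<close>
lemma triangular_dissipative:
 fixes U :: "nat => nat => complex"
 assumes diag: "ALL i<n. Re (U i i) < 0" and tri: "ALL i<n. ALL j<i. U i j = 0"
 obtains L c :: real where "L >= 1" "c > 0"
  "ALL z. (SUM i<n. L ^ (2*i)*Re (cnj (z i)*(SUM k<n. U i k*z k))) <= - c*(SUM i<n. (cmod (z i))^2)"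
proof -
 obtain \<rho> where \<rho>: "\<rho> > 0" "!!i. i : {..<n} ==> \<rho> <= - Re (U i i)"
  using diag by (rule_tac finite_pos_lower_bound[of "{..<n}" "%i. - Re (U i i)"]) auto
 obtain u where u: "u >= 0" "!!q. q : {..<n} \<times> {..<n} ==> cmod (U (fst q) (snd q)) <= u"
  by (rule finite_upper_bound[of "{..<n} \<times> {..<n}" "%q. cmod (U (fst q) (snd q))"]) auto
 \<comment> \<open>Large enough that all entries above the diagonal together cost at most half of
   the decay \<rho> of the diagonal.\<close>
 define L where "L = max 1 (2*u*real n / \<rho>)"
 have L: "L >= 1" "u*real n / L <= \<rho> / 2"
 proof -
  show "L >= 1" by (simp add: L_def)
  have "2*u*real n / \<rho> <= L" by (simp add: L_def)
  then have "2*u*real n <= L*\<rho>" using \<rho>(1) by (simp add: field_simps)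
  then show "u*real n / L <= \<rho> / 2" using \<open>L >= 1\<close> by (simp add: field_simps)
 qed
 have main: "(SUM i<n. L ^ (2*i)*Re (cnj (z i)*(SUM k<n. U i k*z k))) <= - (\<rho> / 2)*(SUM i<n. (cmod (z i))^2)" for z
 proof -
  define Z where "Z i = L ^ i*cmod (z i)" for i
  have Z0: "Z i >= 0" for i using L by (simp add: Z_def)
  have bd: "L ^ (2*i)*Re (cnj (z i)*(U i k*z k)) <=
    (if i = k then - \<rho>*(Z i)^2 else 0) + u / L*(((Z i)^2 + (Z k)^2) / 2)" if ik: "i < n" "k < n" for i k
  proof (cases "i = k")
   case True
   have "cnj (z i)*(U i i*z i) = complex_of_real ((cmod (z i))^2)*U i i"
    unfolding complex_norm_square by (simp only: mult_ac)
   then have r: "Re (cnj (z i)*(U i i*z i)) = (cmod (z i))^2*Re (U i i)"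
    by (simp only: Re_complex_of_real Im_complex_of_real times_complex.sel mult_zero_left diff_zero)
   have "L ^ (2*i)*Re (cnj (z i)*(U i k*z k)) = Re (U i i)*(Z i)^2"
    unfolding True[symmetric] r Z_def power_mult_distrib
    by (simp only: mult_ac power_mult[symmetric])
   also have "... <= - \<rho>*(Z i)^2" using \<rho>(2)[of i] ik by (intro mult_right_mono) auto
   also have "... <= - \<rho>*(Z i)^2 + u / L*(((Z i)^2 + (Z k)^2) / 2)" using u(1) L(1) by simp
   finally show ?thesis using True by simp
  next
   case False
   show ?thesis
   proof (cases "k < i")
    case True
    then have "U i k = 0" using tri ik by blast
    moreover have "0 <= u / L*(((Z i)^2 + (Z k)^2) / 2)" using u(1) L(1) by simp
    ultimately show ?thesis using False by simp
   next
    case F: False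
    with False have "i < k" by simp
    have "L ^ (2*i)*Re (cnj (z i)*(U i k*z k)) <= L ^ (2*i)*(cmod (z i)*(cmod (U i k)*cmod (z k)))"
    proof (rule mult_left_mono)
     show "Re (cnj (z i)*(U i k*z k)) <= cmod (z i)*(cmod (U i k)*cmod (z k))"
      using complex_Re_le_cmod[of "cnj (z i)*(U i k*z k)"] unfolding norm_mult complex_mod_cnj .
    qed (use L in simp)
    also have "... <= L ^ (2*i)*(cmod (z i)*(u*cmod (z k)))"
     using L u(2)[of "(i, k)"] ik by (intro mult_left_mono mult_right_mono) auto
    \<comment> \<open>Since i < k, the weight L^(2i) is at most L^(i+k) / L: each entry above the
      diagonal gains a factor 1/L in the weighted coordinates \<open>Z\<close>.\<close>
    also have "... = u / L*(L ^ (2*i + 1)*(cmod (z i)*cmod (z k)))"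
     using L by (simp add: field_simps)
    also have "... <= u / L*(L ^ (i + k)*(cmod (z i)*cmod (z k)))"
     using L u(1) \<open>i < k\<close> by (intro mult_left_mono mult_right_mono power_increasing) auto
    also have "L ^ (i + k)*(cmod (z i)*cmod (z k)) = Z i*Z k" by (simp add: Z_def power_add mult_ac)
    also have "u / L*(Z i*Z k) <= u / L*(((Z i)^2 + (Z k)^2) / 2)"
     using sum_squares_bound[of "Z i" "Z k"] u(1) L(1) by (intro mult_left_mono) auto
    finally show ?thesis using False by simp
   qed
  qed
  have "(SUM i<n. L ^ (2*i)*Re (cnj (z i)*(SUM k<n. U i k*z k)))
    = (SUM i<n. SUM k<n. L ^ (2*i)*Re (cnj (z i)*(U i k*z k)))"
   by (simp only: sum_distrib_left Re_sum)
  also have "... <= (SUM i<n. SUM k<n. (if i = k then - \<rho>*(Z i)^2 else 0) + u / L*(((Z i)^2 + (Z k)^2) / 2))"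
   by (intro sum_mono bd) auto
  also have "... = - \<rho>*(SUM i<n. (Z i)^2) + u / L*(SUM i<n. SUM k<n. ((Z i)^2 + (Z k)^2) / 2)"
   by (simp add: sum.distrib sum_distrib_left sum_negf sum_subtractf)
  also have "(SUM i<n. SUM k<n. ((Z i)^2 + (Z k)^2) / 2) = real n*(SUM i<n. (Z i)^2)"
   by (simp add: sum.distrib add_divide_distrib flip: sum_divide_distrib sum_distrib_left)
  also have "- \<rho>*(SUM i<n. (Z i)^2) + u / L*(real n*(SUM i<n. (Z i)^2))
    = (u*real n / L - \<rho>)*(SUM i<n. (Z i)^2)" by (simp add: algebra_simps)
  also have "... <= - (\<rho> / 2)*(SUM i<n. (Z i)^2)"
  proof (rule mult_right_mono)
   show "u*real n / L - \<rho> <= - (\<rho> / 2)" using L(2) by linarith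
  qed (simp add: sum_nonneg)
  also have "... <= - (\<rho> / 2)*(SUM i<n. (cmod (z i))^2)"
  proof -
   have "(cmod (z i))^2 <= (Z i)^2" for i
    unfolding Z_def using L by (intro power_mono) (simp_all add: mult_le_cancel_right1)
   then have "(SUM i<n. (cmod (z i))^2) <= (SUM i<n. (Z i)^2)" by (intro sum_mono)
   then show ?thesis using \<rho>(1) by simp
  qed
  finally show ?thesis .
 qed
 show ?thesis by (rule that[of L "\<rho> / 2"]) (use L \<rho>(1) main in auto)
qed

text \<open>The form is the real part of the weighted Hermitian product of the triangular
  coordinates z = Q x, in which \<open>triangular_dissipative\<close> gives the decrease; x = P z
  carries it back to the Euclidean norm of x.\<close>

lemma hurwitz_imp_lyap_cert:
 assumes hw: "hurwitz (mat n n (%(i, j). a i j))"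
 shows "EX p c. c > 0 & lyap_cert n a p c"
proof -
 define A where "A = cmat (mat n n (%(i, j). a i j))"
 have A: "A : carrier_mat n n" by (simp add: A_def)
 obtain P Q U where PQ: "ALL i<n. ALL k<n. (SUM j<n. P i j*Q j k) = (if i = k then 1 else 0)"
  and QP: "ALL i<n. ALL k<n. (SUM j<n. Q i j*P j k) = (if i = k then 1 else 0)"
  and AP: "ALL i<n. ALL k<n. (SUM j<n. A $$ (i, j)*P j k) = (SUM j<n. P i j*U j k)"
  and QA: "ALL i<n. ALL k<n. (SUM j<n. Q i j*A $$ (j, k)) = (SUM j<n. U i j*Q j k)"
  and U0: "ALL i<n. ALL j<i. U i j = 0"
  and ev: "ALL i<n. eigenvalue A (U i i)"
  by (rule schur_fun[OF A])
 have "ALL i<n. Re (U i i) < 0" using ev hw unfolding hurwitz_def A_def by blast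
 then obtain L c where L: "L >= 1" and c: "c > 0" and diss:
  "ALL z. (SUM i<n. L ^ (2*i)*Re (cnj (z i)*(SUM k<n. U i k*z k))) <= - c*(SUM i<n. (cmod (z i))^2)"
  using U0 by (rule triangular_dissipative)
 define z where "z x i = (SUM j<n. Q i j*complex_of_real (x j))" for x i
 define p where "p j k = (SUM i<n. L ^ (2*i)*Re (cnj (Q i j)*Q i k))" for j k
 have bil: "bil n p x y = (SUM i<n. L ^ (2*i)*Re (cnj (z x i)*z y i))" for x y
 proof -
  have "Re (cnj (z x i)*z y i) = (SUM j<n. SUM k<n. Re (cnj (Q i j)*Q i k)*x j*y k)" for i
  proof -
   have "cnj (z x i)*z y i = (SUM j<n. SUM k<n. (cnj (Q i j)*complex_of_real (x j))*(Q i k*complex_of_real (y k)))"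
    unfolding z_def cnj_sum sum_product complex_cnj_mult complex_cnj_complex_of_real ..
   also have "... = (SUM j<n. SUM k<n. (cnj (Q i j)*Q i k)*complex_of_real (x j*y k))"
    by (simp add: mult_ac)
   also have "Re ... = (SUM j<n. SUM k<n. Re (cnj (Q i j)*Q i k)*x j*y k)"
    unfolding Re_sum by (intro sum.cong refl) simp
   finally show ?thesis .
  qed
  then have "(SUM i<n. L ^ (2*i)*Re (cnj (z x i)*z y i))
   = (SUM i<n. SUM j<n. SUM k<n. L ^ (2*i)*(Re (cnj (Q i j)*Q i k)*x j*y k))"
   by (simp only: sum_distrib_left)
  also have "... = (SUM j<n. SUM i<n. SUM k<n. L ^ (2*i)*(Re (cnj (Q i j)*Q i k)*x j*y k))"
   by (rule sum.swap)
  also have "... = (SUM j<n. SUM k<n. SUM i<n. L ^ (2*i)*(Re (cnj (Q i j)*Q i k)*x j*y k))"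
   by (rule sum.cong[OF refl], rule sum.swap)
  also have "... = bil n p x y"
   unfolding bil_def p_def sum_distrib_right by (intro sum.cong refl) (simp only: mult.assoc)
  finally show ?thesis by simp
 qed
 have zA: "z (mv n a x) i = (SUM k<n. U i k*z x k)" if "i < n" for x i
 proof -
  have "z (mv n a x) i = (SUM j<n. Q i j*(SUM k<n. A $$ (j, k)*complex_of_real (x k)))"
   by (simp add: z_def mv_def A_def)
  also have "... = (SUM j<n. SUM k<n. Q i j*A $$ (j, k)*complex_of_real (x k))"
   by (simp only: sum_distrib_left mult.assoc)
  also have "... = (SUM k<n. SUM j<n. Q i j*A $$ (j, k)*complex_of_real (x k))" by (rule sum.swap)
  also have "... = (SUM k<n. (SUM j<n. Q i j*A $$ (j, k))*complex_of_real (x k))"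
   by (simp only: sum_distrib_right)
  also have "... = (SUM k<n. (SUM j<n. U i j*Q j k)*complex_of_real (x k))"
   using QA that by (intro sum.cong refl) simp
  also have "... = (SUM k<n. SUM j<n. U i j*Q j k*complex_of_real (x k))" by (simp only: sum_distrib_right)
  also have "... = (SUM j<n. SUM k<n. U i j*Q j k*complex_of_real (x k))" by (rule sum.swap)
  also have "... = (SUM k<n. U i k*z x k)" unfolding z_def by (simp only: sum_distrib_left mult.assoc)
  finally show ?thesis .
 qed
 obtain q where q: "q >= 0" "!!s. s : {..<n} \<times> {..<n} ==> cmod (P (fst s) (snd s)) <= q"
  by (rule finite_upper_bound[of "{..<n} \<times> {..<n}" "%s. cmod (P (fst s) (snd s))"]) auto
 have xz: "(SUM i<n. (x i)^2) <= real n*q^2*real n*(SUM i<n. (cmod (z x i))^2)" for x :: "nat => real"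
 proof -
  have "(x i)^2 <= q^2*real n*(SUM i<n. (cmod (z x i))^2)" if i: "i < n" for i
  proof -
   have "(SUM k<n. P i k*z x k) = (SUM k<n. SUM j<n. P i k*Q k j*complex_of_real (x j))"
    unfolding z_def by (simp only: sum_distrib_left mult.assoc)
   also have "... = (SUM j<n. SUM k<n. P i k*Q k j*complex_of_real (x j))" by (rule sum.swap)
   also have "... = (SUM j<n. (SUM k<n. P i k*Q k j)*complex_of_real (x j))" by (simp only: sum_distrib_right)
   also have "... = (SUM j<n. (if i = j then 1 else 0)*complex_of_real (x j))"
    using PQ i by (intro sum.cong refl) simp
   also have "... = complex_of_real (x i)" using i by (simp add: if_distrib[of "%t. t*_"] cong: if_cong)
   finally have "\<bar>x i\<bar> = cmod (SUM k<n. P i k*z x k)" by simp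
   also have "... <= (SUM k<n. cmod (P i k)*cmod (z x k))" by (rule order_trans[OF norm_sum]) (simp add: norm_mult)
   also have "... <= (SUM k<n. q*cmod (z x k))" using q(2)[of "(i, _)"] i by (intro sum_mono mult_right_mono) auto
   also have "... = q*(SUM k<n. cmod (z x k))" by (simp add: sum_distrib_left)
   finally have "\<bar>x i\<bar>^2 <= (q*(SUM k<n. cmod (z x k)))^2" by (intro power_mono) auto
   also have "... = q^2*(SUM k<n. cmod (z x k))^2" by (simp add: power_mult_distrib)
   also have "... <= q^2*(real n*(SUM k<n. (cmod (z x k))^2))"
    by (intro mult_left_mono sum_squared_le_card_mult) auto
   finally show ?thesis by (simp add: mult_ac)
  qed
  then have "(SUM i<n. (x i)^2) <= (SUM i<n. q^2*real n*(SUM i<n. (cmod (z x i))^2))"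
   by (intro sum_mono) auto
  then show ?thesis by (simp add: mult_ac)
 qed
 \<comment> \<open>The summand 1 keeps C positive also for n = 0 or q = 0.\<close>
 define C where "C = real n*q^2*real n + 1"
 have C: "C > 0" unfolding C_def by (simp add: add_nonneg_pos)
 have "lyap_cert n a p (c / C)"
  unfolding lyap_cert_def
 proof (intro conjI allI impI)
  fix i j
  show "p i j = p j i" unfolding p_def by (intro sum.cong refl) simp
 next
  fix x
  show "0 <= bil n p x x"
   unfolding bil using L by (intro sum_nonneg mult_nonneg_nonneg) (auto simp: complex_mult_cnj mult.commute[of "cnj _"])
 next
  fix x
  have "bil n p x (mv n a x) = (SUM i<n. L ^ (2*i)*Re (cnj (z x i)*(SUM k<n. U i k*z x k)))"
   unfolding bil by (intro sum.cong refl) (simp add: zA)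
  also have "... <= - c*(SUM i<n. (cmod (z x i))^2)" by (rule spec[OF diss])
  also have "... <= - (c / C)*(SUM i<n. (x i)^2)"
  proof -
   have "(SUM i<n. (x i)^2) <= C*(SUM i<n. (cmod (z x i))^2)"
    using xz[of x] sum_nonneg[of "{..<n}" "%i. (cmod (z x i))^2"] unfolding C_def by (simp add: distrib_right)
   then have "(c / C)*(SUM i<n. (x i)^2) <= (c / C)*(C*(SUM i<n. (cmod (z x i))^2))"
    using c C by (intro mult_left_mono) auto
   then show ?thesis using C by simp
  qed
  finally show "bil n p x (mv n a x) <= - (c / C)*(SUM i<n. (x i)^2)" .
 qed
 then show ?thesis using c C by (intro exI[of _ p] exI[of _ "c / C"]) simp
qed

text \<open>A perturbation of size \<eta> changes p(x, a x) by at most B n^2 \<eta> times the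
  squared norm, where B bounds the entries of \<open>p\<close>; half of c pays for it.\<close>

lemma lyap_cert_perturb:
 assumes "lyap_cert n a p c" "c > 0"
 shows "EX \<eta>>0. ALL a'. (ALL i<n. ALL j<n. \<bar>a' i j - a i j\<bar> <= \<eta>) --> lyap_cert n a' p (c / 2)"
proof -
 obtain B where B: "B >= 0" "!!s. s : {..<n} \<times> {..<n} ==> \<bar>p (fst s) (snd s)\<bar> <= B"
  by (rule finite_upper_bound[of "{..<n} \<times> {..<n}" "%s. \<bar>p (fst s) (snd s)\<bar>"]) auto
 define \<eta> where "\<eta> = c / (2*(B*real n*real n + 1))"
 have d: "B*real n*real n + 1 > 0" using B(1) by (simp add: add_nonneg_pos)
 have \<eta>: "\<eta> > 0" "B*\<eta>*real n*real n <= c / 2"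
  using d assms(2) by (auto simp: \<eta>_def field_simps)
 have "lyap_cert n a' p (c / 2)" if a': "ALL i<n. ALL j<n. \<bar>a' i j - a i j\<bar> <= \<eta>" for a'
  unfolding lyap_cert_def
 proof (intro conjI lyap_cert_sym[OF assms(1)] allI)
  show "0 <= bil n p x x" for x by (rule lyap_cert_psd[OF assms(1)])
  fix x :: "nat => real"
  let ?s = "SUM i<n. \<bar>x i\<bar>"
  have "bil n p x (mv n a' x) - bil n p x (mv n a x) = bil n p x (%i. mv n a' x i - mv n a x i)"
   by (simp add: bil_diff_right)
  also have "... <= B * ?s*(SUM i<n. \<bar>mv n a' x i - mv n a x i\<bar>)"
   using bil_bound[of n p B x "%i. mv n a' x i - mv n a x i"] B(2) by fastforce
  also have "... <= B * ?s*(SUM i<n. \<eta> * ?s)"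
  proof (intro mult_left_mono sum_mono)
   fix i assume "i : {..<n}"
   have "\<bar>mv n a' x i - mv n a x i\<bar> = \<bar>SUM j<n. (a' i j - a i j)*x j\<bar>"
    by (simp add: mv_def sum_subtractf left_diff_distrib)
   also have "... <= (SUM j<n. \<bar>(a' i j - a i j)*x j\<bar>)" by (rule sum_abs)
   also have "... <= (SUM j<n. \<eta>*\<bar>x j\<bar>)"
    using a' \<open>i : {..<n}\<close> by (intro sum_mono) (simp add: abs_mult mult_right_mono)
   finally show "\<bar>mv n a' x i - mv n a x i\<bar> <= \<eta> * ?s" by (simp add: sum_distrib_left)
  qed (use B in \<open>simp add: sum_nonneg\<close>)
  also have "... = B*\<eta>*real n * ?s^2" by (simp add: power2_eq_square mult_ac)
  also have "... <= B*\<eta>*real n*(real n*(SUM i<n. (x i)^2))"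
   using sum_squared_le_card_mult[of "%i. \<bar>x i\<bar>" n] B(1) \<eta>(1) by (intro mult_left_mono) simp_all
  also have "... = (B*\<eta>*real n*real n)*(SUM i<n. (x i)^2)" by (simp only: mult_ac)
  also have "... <= c / 2*(SUM i<n. (x i)^2)" by (intro mult_right_mono \<eta>(2) sum_nonneg) simp
  finally show "bil n p x (mv n a' x) <= - (c / 2)*(SUM i<n. (x i)^2)"
   using lyap_cert_decrease[OF assms(1), of x] by simp
 qed
 then show ?thesis using \<eta>(1) by blast
qed

lemma lyap_cert_mono:
 assumes "lyap_cert n a p c" "c' <= c"
 shows "lyap_cert n a p c'"
 unfolding lyap_cert_def
proof (intro conjI lyap_cert_sym[OF assms(1)] allI lyap_cert_psd[OF assms(1)])
 fix x :: "nat => real"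
 have "c'*(SUM i<n. (x i)^2) <= c*(SUM i<n. (x i)^2)" by (intro mult_right_mono assms sum_nonneg) simp
 then show "bil n p x (mv n a x) <= - c'*(SUM i<n. (x i)^2)"
  using lyap_cert_decrease[OF assms(1), of x] by simp
qed

lemma compact_vecs_pad_image:
 "compact_vecs m W ==> compact ((%x i. if i < m then x $ i else 0) ` W)"
 by (simp add: compact_vecs_def)

text \<open>Around each w a certificate of \<open>a w\<close> remains valid on an open set of
  parameters; compactness leaves finitely many certificates, hence a common rate c and a common
  entry bound B.\<close>

lemma lyap_cert_uniform:
 assumes W: "compact_vecs m W"
  and lip: "ALL w:W. ALL w':W. ALL \<eta>>=0. (ALL k<m. \<bar>w $ k - w' $ k\<bar> <= \<eta>) -->
   (ALL i<n. ALL j<n. \<bar>a w i j - a w' i j\<bar> <= L*\<eta>)"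
  and L: "L >= 0"
  and hw: "ALL w:W. hurwitz (mat n n (%(i, j). a w i j))"
 shows "EX c>0. EX B>=0. ALL w:W. EX p. lyap_cert n (a w) p c & (ALL i<n. ALL j<n. \<bar>p i j\<bar> <= B)"
proof -
 define pad where "pad x i = (if i < m then x $ i else 0)" for x :: "real Matrix.vec" and i
 have "EX p c \<eta>. w : W --> c > 0 & \<eta> > 0 &
  (ALL a'. (ALL i<n. ALL j<n. \<bar>a' i j - a w i j\<bar> <= \<eta>) --> lyap_cert n a' p (c / 2))" for w
 proof (cases "w : W")
  case True
  obtain p c where pc: "c > 0" "lyap_cert n (a w) p c" using hurwitz_imp_lyap_cert[OF bspec[OF hw True]] by blast
  show ?thesis using lyap_cert_perturb[OF pc(2,1)] pc(1) by blast
 qed simp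
 then have "ALL w. EX p c \<eta>. w : W --> c > 0 & \<eta> > 0 &
  (ALL a'. (ALL i<n. ALL j<n. \<bar>a' i j - a w i j\<bar> <= \<eta>) --> lyap_cert n a' p (c / 2))" ..
 from choice[OF this] obtain p where "ALL w. EX c \<eta>. w : W --> c > 0 & \<eta> > 0 &
  (ALL a'. (ALL i<n. ALL j<n. \<bar>a' i j - a w i j\<bar> <= \<eta>) --> lyap_cert n a' (p w) (c / 2))" ..
 from choice[OF this] obtain c where "ALL w. EX \<eta>. w : W --> c w > 0 & \<eta> > 0 &
  (ALL a'. (ALL i<n. ALL j<n. \<bar>a' i j - a w i j\<bar> <= \<eta>) --> lyap_cert n a' (p w) (c w / 2))" ..
 from choice[OF this] obtain \<eta> where pc': "ALL w. w : W --> c w > 0 & \<eta> w > 0 &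
  (ALL a'. (ALL i<n. ALL j<n. \<bar>a' i j - a w i j\<bar> <= \<eta> w) --> lyap_cert n a' (p w) (c w / 2))" ..
 have pc: "c w > 0" "\<eta> w > 0" "(ALL i<n. ALL j<n. \<bar>a' i j - a w i j\<bar> <= \<eta> w) ==> lyap_cert n a' (p w) (c w / 2)"
  if "w : W" for w a'
  using spec[OF pc', of w] that by blast+
 \<comment> \<open>Dividing by L + 1 instead of L covers L = 0.\<close>
 define \<theta> where "\<theta> w = \<eta> w / (L + 1)" for w
 have \<theta>: "\<theta> w > 0" "L*\<theta> w <= \<eta> w" if "w : W" for w
  using pc(2)[OF that] L by (auto simp: \<theta>_def field_simps)
 \<comment> \<open>Only the finitely many coordinates below m are constrained, so these sets are
   open in the product topology.\<close>
 define U where "U w = (\<Inter>k\<in>{..<m}. {f::nat => real. \<bar>f k - w $ k\<bar> < \<theta> w})" for w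
 have op: "open (U w)" for w
  unfolding U_def
  by (intro open_INT ballI open_Collect_less continuous_intros continuous_on_coord) simp_all
 have cov: "pad ` W \<subseteq> (\<Union>w\<in>W. U w)"
  using \<theta>(1) by (auto simp: U_def pad_def intro!: bexI)
 have cp: "compact (pad ` W)"
  using compact_vecs_pad_image[OF W] unfolding pad_def[abs_def] .
 obtain D where D: "D \<subseteq> W" "finite D" "pad ` W \<subseteq> (\<Union>w\<in>D. U w)"
  by (rule compactE_image[OF cp _ cov]) (use op in auto)
 obtain c0 where c0: "c0 > 0" "!!w. w : D ==> c0 <= c w / 2"
  by (rule finite_pos_lower_bound[OF D(2), of "%w. c w / 2"]) (use pc(1) D(1) in auto)
 have "finite (D \<times> {..<n} \<times> {..<n})" using D(2) by simp
 then obtain B where B: "B >= 0" "!!s. s : D \<times> {..<n} \<times> {..<n} ==> \<bar>p (fst s) (fst (snd s)) (snd (snd s))\<bar> <= B"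
  by (rule finite_upper_bound[of _ "%s. \<bar>p (fst s) (fst (snd s)) (snd (snd s))\<bar>"]) auto
 have "EX p. lyap_cert n (a w) p c0 & (ALL i<n. ALL j<n. \<bar>p i j\<bar> <= B)" if w: "w : W" for w
 proof -
  from D(3) w obtain w' where w': "w' : D" "pad w : U w'" by blast
  have "ALL k<m. \<bar>w $ k - w' $ k\<bar> <= \<theta> w'" using w'(2) by (force simp: U_def pad_def)
  then have "ALL i<n. ALL j<n. \<bar>a w i j - a w' i j\<bar> <= L*\<theta> w'"
   using lip w w'(1) D(1) \<theta>(1)[of w'] by (meson less_imp_le subsetD)
  then have "ALL i<n. ALL j<n. \<bar>a w i j - a w' i j\<bar> <= \<eta> w'"
   using \<theta>(2)[of w'] w'(1) D(1) by (meson order_trans subsetD)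
  then have "lyap_cert n (a w) (p w') (c w' / 2)" using pc(3) w'(1) D(1) by blast
  then have "lyap_cert n (a w) (p w') c0" using lyap_cert_mono c0(2)[OF w'(1)] by blast
  moreover have "ALL i<n. ALL j<n. \<bar>p w' i j\<bar> <= B"
   using B(2)[of "(w', _, _)"] w'(1) by simp
  ultimately show ?thesis by blast
 qed
 then show ?thesis using c0(1) B(1) by blast
qed

text \<open>Pair the real part u and the imaginary part v of the equation with p u and p v. The
  terms with Im \<mu> cancel by symmetry of p, those with Re \<mu> have the right sign, and the
  decrease bounds the squared norm of x by the product of the norms of x and f, uniformly in
  \<mu>.\<close>

lemma lyap_cert_resolvent:
 fixes x f :: "nat => complex"
 assumes cert: "lyap_cert n a p c" "c > 0" and B: "ALL i<n. ALL j<n. \<bar>p i j\<bar> <= B"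
  and \<mu>: "Re \<mu> >= 0" and eq: "ALL i<n. \<mu>*x i = (SUM j<n. complex_of_real (a i j)*x j) + f i"
 shows "(SUM i<n. cmod (x i)) <= (2*real n*B / c)*(SUM i<n. cmod (f i))"
proof (cases "n = 0")
 case True then show ?thesis by simp
next
 case False
 have B0: "B >= 0" using B False by (metis abs_ge_zero gr0I order_trans)
 define u v where "u i = Re (x i)" and "v i = Im (x i)" for i
 define X F where "X = (SUM i<n. cmod (x i))" and "F = (SUM i<n. cmod (f i))"
 have reu: "mv n a u i + Re (f i) = Re \<mu>*u i + (- Im \<mu>)*v i" if "i < n" for i
  using arg_cong[OF spec[OF eq, of i, rule_format, OF that], of Re] by (simp add: mv_def u_def v_def)
 have rev: "mv n a v i + Im (f i) = Re \<mu>*v i + Im \<mu>*u i" if "i < n" for i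
  using arg_cong[OF spec[OF eq, of i, rule_format, OF that], of Im] by (simp add: mv_def u_def v_def)
 have "bil n p u (mv n a u) + bil n p u (%i. Re (f i)) = bil n p u (%i. Re \<mu>*u i + (- Im \<mu>)*v i)"
  unfolding bil_add_right[symmetric] by (rule bil_cong) (use reu in auto)
 also have "... = Re \<mu>*bil n p u u - Im \<mu>*bil n p u v"
  unfolding bil_add_right bil_scale_right by simp
 finally have 1: "bil n p u (mv n a u) + bil n p u (%i. Re (f i)) = Re \<mu>*bil n p u u - Im \<mu>*bil n p u v" .
 have "bil n p v (mv n a v) + bil n p v (%i. Im (f i)) = bil n p v (%i. Re \<mu>*v i + Im \<mu>*u i)"
  unfolding bil_add_right[symmetric] by (rule bil_cong) (use rev in auto)
 also have "... = Re \<mu>*bil n p v v + Im \<mu>*bil n p u v"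
  unfolding bil_add_right bil_scale_right using bil_sym[OF lyap_cert_sym[OF cert(1)], of u v] by simp
 finally have 2: "bil n p v (mv n a v) + bil n p v (%i. Im (f i)) = Re \<mu>*bil n p v v + Im \<mu>*bil n p u v" .
 have 3: "0 <= Re \<mu>*bil n p u u + Re \<mu>*bil n p v v"
  using \<mu> lyap_cert_psd[OF cert(1)] by simp
 have le: "(SUM i<n. \<bar>g (x i)\<bar>) <= X" "(SUM i<n. \<bar>g (f i)\<bar>) <= F" if "g = Re | g = Im" for g
  using that unfolding X_def F_def by (auto intro!: sum_mono abs_Re_le_cmod abs_Im_le_cmod)
 have b: "bil n p (%i. g (x i)) (%i. g (f i)) <= B*X*F" if "g = Re | g = Im" for g
 proof -
  have "bil n p (%i. g (x i)) (%i. g (f i)) <= B*(SUM i<n. \<bar>g (x i)\<bar>)*(SUM i<n. \<bar>g (f i)\<bar>)"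
   using bil_bound[OF B, of "%i. g (x i)" "%i. g (f i)"] by linarith
  also have "... <= B*X*F"
   using le[OF that] B0 by (intro mult_mono mult_nonneg_nonneg) (auto simp: sum_nonneg X_def)
  finally show ?thesis .
 qed
 have bb: "bil n p u (%i. Re (f i)) <= B*X*F" "bil n p v (%i. Im (f i)) <= B*X*F"
  using b[of Re] b[of Im] unfolding u_def v_def by auto
 have "c*(SUM i<n. (cmod (x i))^2) = c*(SUM i<n. (u i)^2) + c*(SUM i<n. (v i)^2)"
  unfolding cmod_power2 u_def v_def by (simp add: sum.distrib distrib_left)
 also have "... <= 2*(B*X*F)"
  using 1 2 3 bb lyap_cert_decrease[OF cert(1), of u] lyap_cert_decrease[OF cert(1), of v] by linarith
 finally have 4: "c*(SUM i<n. (cmod (x i))^2) <= 2*(B*X*F)" .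
 have "c*X^2 <= c*(real n*(SUM i<n. (cmod (x i))^2))"
  unfolding X_def using cert(2) by (intro mult_left_mono sum_squared_le_card_mult) auto
 also have "... = real n*(c*(SUM i<n. (cmod (x i))^2))" by (simp only: mult_ac)
 also have "... <= real n*(2*(B*X*F))" by (intro mult_left_mono 4) simp
 finally have 5: "c*X^2 <= real n*(2*(B*X*F))" .
 have "X >= 0" by (simp add: X_def sum_nonneg)
 show ?thesis
 proof (cases "X = 0")
  case True
  then show ?thesis using B0 cert(2) unfolding X_def[symmetric] F_def[symmetric] by (simp add: F_def sum_nonneg)
 next
  case False
  with \<open>X >= 0\<close> have "X > 0" by simp
  from 5 have "X*(c*X) <= X*(real n*2*B*F)" by (simp add: power2_eq_square mult_ac)
  with \<open>X > 0\<close> have "c*X <= real n*2*B*F" by simp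
  then show ?thesis unfolding X_def[symmetric] F_def[symmetric] using cert(2) by (simp add: field_simps)
 qed
qed

section \<open>The Lyapunov equation\<close>

text \<open>The real part of a complex solution is a solution because the data are real.\<close>

lemma sylvester_real_exists:
 assumes A: "A : carrier_mat n n" and B: "B : carrier_mat m m"
  and disj: "ALL \<mu>. eigenvalue (cmat A) \<mu> --> ~ eigenvalue (cmat B) \<mu>"
 shows "EX X::nat => nat => real. ALL i<n. ALL j<m. (SUM k<n. A $$ (i, k)*X k j) - (SUM k<m. X i k*B $$ (k, j)) = C i j"
proof -
 have cA: "cmat A : carrier_mat n n" and cB: "cmat B : carrier_mat m m" using A B by auto
 obtain X where X: "ALL i<n. ALL j<m. (SUM k<n. cmat A $$ (i, k)*X k j) - (SUM k<m. X i k*cmat B $$ (k, j)) = complex_of_real (C i j)"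
  using sylvester_exists_complex[OF cA cB disj, of "%i j. complex_of_real (C i j)"] by (elim exE)
 have "(SUM k<n. A $$ (i, k)*Re (X k j)) - (SUM k<m. Re (X i k)*B $$ (k, j)) = C i j" if ij: "i < n" "j < m" for i j
 proof -
  have "(SUM k<n. cmat A $$ (i, k)*X k j) = (SUM k<n. complex_of_real (A $$ (i, k))*X k j)"
   by (intro sum.cong refl) (use A ij in auto)
  moreover have "(SUM k<m. X i k*cmat B $$ (k, j)) = (SUM k<m. X i k*complex_of_real (B $$ (k, j)))"
   by (intro sum.cong refl) (use B ij in auto)
  moreover have "(SUM k<n. cmat A $$ (i, k)*X k j) - (SUM k<m. X i k*cmat B $$ (k, j)) = complex_of_real (C i j)"
   by (rule X[rule_format, OF ij])
  ultimately have "(SUM k<n. complex_of_real (A $$ (i, k))*X k j) - (SUM k<m. X i k*complex_of_real (B $$ (k, j))) = complex_of_real (C i j)"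
   by (simp only:)
  from arg_cong[OF this, of Re] show ?thesis by simp
 qed
 then show ?thesis by (intro exI[of _ "%i j. Re (X i j)"]) simp
qed

lemma sylvester_real_unique:
 fixes X :: "nat => nat => real"
 assumes A: "A : carrier_mat n n" and B: "B : carrier_mat m m"
  and disj: "ALL \<mu>. eigenvalue (cmat A) \<mu> --> ~ eigenvalue (cmat B) \<mu>"
  and X: "ALL i<n. ALL j<m. (SUM k<n. A $$ (i, k)*X k j) = (SUM k<m. X i k*B $$ (k, j))"
  and ij: "i < n" "j < m"
 shows "X i j = 0"
proof -
 have cA: "cmat A : carrier_mat n n" and cB: "cmat B : carrier_mat m m" using A B by auto
 have "ALL i<n. ALL j<m. (SUM k<n. cmat A $$ (i, k)*complex_of_real (X k j)) = (SUM k<m. complex_of_real (X i k)*cmat B $$ (k, j))"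
 proof (intro allI impI)
  fix i j assume ij: "i < n" "j < m"
  have "(SUM k<n. cmat A $$ (i, k)*complex_of_real (X k j)) = complex_of_real (SUM k<n. A $$ (i, k)*X k j)"
   unfolding of_real_sum by (intro sum.cong refl) (use A ij in auto)
  also have "... = complex_of_real (SUM k<m. X i k*B $$ (k, j))" using X ij by simp
  also have "... = (SUM k<m. complex_of_real (X i k)*cmat B $$ (k, j))"
   unfolding of_real_sum by (intro sum.cong refl) (use B ij in auto)
  finally show "(SUM k<n. cmat A $$ (i, k)*complex_of_real (X k j)) = (SUM k<m. complex_of_real (X i k)*cmat B $$ (k, j))" .
 qed
 from sylvester_unique_complex[OF cA cB disj this ij] show ?thesis by simp
qed

section \<open>Spectrum of the Lyapunov operator and its solution\<close>

lemma eigenvalue_transpose: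
 assumes "(A :: complex mat) : carrier_mat n n"
 shows "eigenvalue (transpose_mat A) \<mu> \<longleftrightarrow> eigenvalue A \<mu>"
 using assms eigenvalue_root_char_poly[OF assms] eigenvalue_root_char_poly[of "transpose_mat A" n]
  char_poly_transpose_mat[OF assms] by simp

lemma eigenvalue_uminus:
 assumes A: "(A :: complex mat) : carrier_mat n n" and ev: "eigenvalue (- A) \<mu>"
 shows "eigenvalue A (- \<mu>)"
proof -
 have mA: "- A : carrier_mat n n" using A by simp
 obtain x where x: "EX i<n. x i ~= 0" "ALL i<n. (SUM j<n. (- A) $$ (i, j)*x j) = \<mu>*x i"
  using ev unfolding eigenvalue_iff_fun[OF mA] by blast
 have "(SUM j<n. A $$ (i, j)*x j) = - \<mu>*x i" if "i < n" for i
 proof -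
  have "(SUM j<n. (- A) $$ (i, j)*x j) = - (SUM j<n. A $$ (i, j)*x j)"
   unfolding sum_negf[symmetric] by (intro sum.cong refl) (use A that in auto)
  then show ?thesis using x(2) that by (metis minus_equation_iff mult_minus_left)
 qed
 then show ?thesis unfolding eigenvalue_iff_fun[OF A] using x(1) by blast
qed

text \<open>The Lyapunov operator is the Sylvester operator of the transpose of A and of -A;
  stability puts the two spectra in opposite open half-planes.\<close>

lemma hurwitz_disjoint_reflection:
 assumes A: "A : carrier_mat n n" and hw: "hurwitz A"
 shows "ALL \<mu>. eigenvalue (cmat (transpose_mat A)) \<mu> --> ~ eigenvalue (cmat (- A)) \<mu>"
proof (intro allI impI notI)
 fix \<mu>
 assume ev: "eigenvalue (cmat (transpose_mat A)) \<mu>" and "eigenvalue (cmat (- A)) \<mu>"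
 then have "eigenvalue (cmat (- A)) \<mu>" by simp
 moreover have "cmat (- A) = - cmat A" by (rule eq_matI) auto
 ultimately have "eigenvalue (cmat A) (- \<mu>)" using eigenvalue_uminus[of "cmat A" n] A by simp
 then have "Re (- \<mu>) < 0" using hw unfolding hurwitz_def by blast
 moreover have "cmat (transpose_mat A) = transpose_mat (cmat A)" by (rule eq_matI) auto
 then have "eigenvalue (cmat A) \<mu>" using ev eigenvalue_transpose[of "cmat A" n] A by simp
 then have "Re \<mu> < 0" using hw unfolding hurwitz_def by blast
 ultimately show False by simp
qed

definition entries :: "real mat => nat => nat => real" where
 "entries A i j = A $$ (i, j)"

lemma scalar_prod_sum: "dim_vec y = n ==> x \<bullet> y = (SUM i<n. x $ i*y $ i)" for x y :: "real Matrix.vec"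
 by (simp add: scalar_prod_def atLeast0LessThan)

lemma quadratic_form_bil:
 assumes "P : carrier_mat n n" "x : carrier_vec n" "y : carrier_vec n"
 shows "x \<bullet> (P *\<^sub>v y) = bil n (entries P) (%i. x $ i) (%i. y $ i)"
proof -
 have "x \<bullet> (P *\<^sub>v y) = (SUM i<n. x $ i*(SUM j<n. P $$ (i, j)*y $ j))"
  using assms by (simp add: scalar_prod_sum[of _ n] index_mult_mat_vec_sum[of P n n])
 then show ?thesis by (simp add: bil_def entries_def sum_distrib_left mult_ac)
qed

text \<open>The transposed term contributes the same quadratic form, so the coefficient -2 of the
  Lyapunov equation leaves exactly minus the squared norm.\<close>

lemma lyap_equation_bil:
 assumes "ALL i<n. ALL j<n. (SUM k<n. a k i*p k j) + (SUM k<n. p i k*a k j) = (if i = j then -2 else 0)"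
  and sym: "ALL i<n. ALL j<n. p i j = p j i"
 shows "bil n p x (mv n a x) = - (SUM i<n. (x i)^2)"
proof -
 have 1: "bil n p x (mv n a x) = (SUM i<n. SUM j<n. (SUM k<n. p i k*a k j)*x i*x j)"
 proof -
  have "bil n p x (mv n a x) = (SUM i<n. SUM k<n. SUM j<n. p i k*a k j*x i*x j)"
   by (simp add: bil_def mv_def sum_distrib_left mult_ac)
  also have "... = (SUM i<n. SUM j<n. SUM k<n. p i k*a k j*x i*x j)"
   by (rule sum.cong[OF refl], rule sum.swap)
  finally show ?thesis by (simp only: sum_distrib_right)
 qed
 have 2: "bil n p (mv n a x) x = (SUM i<n. SUM j<n. (SUM k<n. a k i*p k j)*x i*x j)"
 proof -
  have "bil n p (mv n a x) x = (SUM k<n. SUM j<n. SUM i<n. a k i*p k j*x i*x j)"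
   by (simp add: bil_def mv_def sum_distrib_left sum_distrib_right mult_ac)
  also have "... = (SUM k<n. SUM i<n. SUM j<n. a k i*p k j*x i*x j)"
   by (rule sum.cong[OF refl], rule sum.swap)
  also have "... = (SUM i<n. SUM k<n. SUM j<n. a k i*p k j*x i*x j)" by (rule sum.swap)
  also have "... = (SUM i<n. SUM j<n. SUM k<n. a k i*p k j*x i*x j)"
   by (rule sum.cong[OF refl], rule sum.swap)
  finally show ?thesis by (simp only: sum_distrib_right)
 qed
 have "bil n p (mv n a x) x + bil n p x (mv n a x)
   = (SUM i<n. SUM j<n. ((SUM k<n. a k i*p k j) + (SUM k<n. p i k*a k j))*x i*x j)"
  unfolding 1 2 by (simp add: distrib_right sum.distrib)
 also have "... = (SUM i<n. SUM j<n. (if i = j then -2 else 0)*x i*x j)"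
  by (intro sum.cong refl) (use assms(1) in simp)
 also have "... = (SUM i<n. SUM j<n. if i = j then - 2*(x i)^2 else 0)"
  by (intro sum.cong refl) (simp add: power2_eq_square)
 also have "... = - 2*(SUM i<n. (x i)^2)"
  by (simp add: sum_negf sum_distrib_left)
 finally show ?thesis using bil_sym[OF sym, of x "mv n a x"] by simp
qed

text \<open>Discharges the definite description in \<open>lyap\<close>. Disjoint spectra give
  existence and uniqueness; the transpose of the solution solves the same equation, hence symmetry;
  comparison with any certificate of A gives positivity.\<close>

lemma lyap_props:
 assumes A: "A : carrier_mat n n" and hw: "hurwitz A"
 shows lyap_carrier: "lyap A : carrier_mat n n"
  and lyap_symmetric: "ALL i<n. ALL j<n. entries (lyap A) i j = entries (lyap A) j i"
  and lyap_bil: "bil n (entries (lyap A)) x (mv n (entries A) x) = - (SUM i<n. (x i)^2)"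
  and lyap_psd: "0 <= bil n (entries (lyap A)) x x"
proof -
 have tA: "transpose_mat A : carrier_mat n n" and nA: "- A : carrier_mat n n" using A by auto
 note disj = hurwitz_disjoint_reflection[OF A hw]
 define F where "F X i j = (SUM k<n. A $$ (k, i)*X k j) + (SUM k<n. X i k*A $$ (k, j))" for X :: "nat => nat => real" and i j
 have F: "(SUM k<n. transpose_mat A $$ (i, k)*X k j) - (SUM k<n. X i k*(- A) $$ (k, j)) = F X i j"
  if "i < n" "j < n" for X i j
 proof -
  have "(SUM k<n. X i k*(- A) $$ (k, j)) = - (SUM k<n. X i k*A $$ (k, j))"
   unfolding sum_negf[symmetric] by (intro sum.cong refl) (use A that in auto)
  moreover have "(SUM k<n. transpose_mat A $$ (i, k)*X k j) = (SUM k<n. A $$ (k, i)*X k j)"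
   by (intro sum.cong refl) (use A that in auto)
  ultimately show ?thesis by (simp add: F_def)
 qed
 obtain X where X: "ALL i<n. ALL j<n. F X i j = (if i = j then -2 else 0)"
 proof -
  obtain X where X: "ALL i<n. ALL j<n. (SUM k<n. transpose_mat A $$ (i, k)*X k j) - (SUM k<n. X i k*(- A) $$ (k, j)) = (if i = j then -2 else 0)"
   using sylvester_real_exists[OF tA nA disj, of "%i j. if i = j then -2 else 0"] by (elim exE)
  have "F X i j = (if i = j then -2 else 0)" if "i < n" "j < n" for i j
   unfolding F[OF that, symmetric] by (rule X[rule_format, OF that])
  then show ?thesis using that by blast
 qed
 have uniq: "X i j = Y i j" if Y: "ALL i<n. ALL j<n. F Y i j = (if i = j then -2 else 0)" and ij: "i < n" "j < n" for Y i j
 proof -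
  have "F (%i j. X i j - Y i j) i j = F X i j - F Y i j" for i j
   by (simp add: F_def algebra_simps sum_subtractf)
  then have "F (%i j. X i j - Y i j) i j = 0" if "i < n" "j < n" for i j
   using X Y that by simp
  then have "ALL i<n. ALL j<n. (SUM k<n. transpose_mat A $$ (i, k)*(X k j - Y k j)) = (SUM k<n. (X i k - Y i k)*(- A) $$ (k, j))"
   using F[of _ _ "%i j. X i j - Y i j"] by simp
  from sylvester_real_unique[OF tA nA disj this ij] show ?thesis by simp
 qed
 have sym: "ALL i<n. ALL j<n. X i j = X j i"
 proof (intro allI impI)
  fix i j assume ij: "i < n" "j < n"
  have "ALL i<n. ALL j<n. F (%i j. X j i) i j = (if i = j then -2 else 0)"
  proof (intro allI impI)
   fix i j assume "i < n" "j < n"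
   have "F (%i j. X j i) i j = F X j i" by (simp add: F_def mult.commute)
   then show "F (%i j. X j i) i j = (if i = j then -2 else 0)" using X \<open>i < n\<close> \<open>j < n\<close> by auto
  qed
  from uniq[OF this ij] show "X i j = X j i" .
 qed
 have bilX: "bil n X x (mv n (entries A) x) = - (SUM i<n. (x i)^2)" for x
  by (rule lyap_equation_bil[OF _ sym]) (use X in \<open>simp add: F_def entries_def\<close>)
 have "mat n n (%(i, j). entries A i j) = A" using A by (intro eq_matI) (auto simp: entries_def)
 then have "hurwitz (mat n n (%(i, j). entries A i j))" using hw by simp
 then obtain p c where pc: "c > 0" "lyap_cert n (entries A) p c" using hurwitz_imp_lyap_cert by blast
 \<comment> \<open>The solution decreases along the flow, and a symmetric form that does so is
   nonnegative by \<open>lyap_cert_nonneg\<close>; this takes the place of the integral formula for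
   X.\<close>
 have psd: "0 <= bil n X x x" for x
  by (rule lyap_cert_nonneg[OF pc(2,1) sym]) (simp add: bilX sum_nonneg)
 have cert: "lyap_cert n (entries A) X 1"
  unfolding lyap_cert_def using psd bilX by (intro conjI sym allI) auto
 have pos: "0 < bil n X x x" if "EX i<n. x i ~= 0" for x
  by (rule lyap_cert_pos[OF cert _ that]) simp
 define P where "P = mat n n (%(i, j). X i j)"
 have P: "P : carrier_mat n n" by (simp add: P_def)
 have eP: "bil n (entries P) x y = bil n X x y" for x y
  by (simp add: bil_def entries_def P_def)
 define lyp where "lyp R \<longleftrightarrow> R : carrier_mat n n & transpose_mat R = R & pos_def R &
  transpose_mat A*R + R*A = (-2) \<cdot>\<^sub>m 1\<^sub>m n" for R
 have FR: "(transpose_mat A*R + R*A) $$ (i, j) = F (entries R) i j" if "R : carrier_mat n n" "i < n" "j < n" for R i j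
 proof -
  have "(SUM k<n. transpose_mat A $$ (i, k)*R $$ (k, j)) = (SUM k<n. A $$ (k, i)*R $$ (k, j))"
   by (intro sum.cong refl) (use A that in auto)
  then show ?thesis using that A index_mult_mat_sum[OF tA that(1) that(2,3)] index_mult_mat_sum[OF that(1) A that(2,3)]
   by (simp add: F_def entries_def)
 qed
 have lypP: "lyp P"
  unfolding lyp_def
 proof (intro conjI P)
  show "transpose_mat P = P" unfolding P_def by (rule eq_matI) (use sym in auto)
  show "pos_def P"
   unfolding pos_def_def
  proof (intro ballI impI)
   fix x :: "real Matrix.vec" assume x: "x : carrier_vec (dim_row P)" "x ~= 0\<^sub>v (dim_row P)"
   then have xn: "x : carrier_vec n" using P by simp
   have "EX i<n. x $ i ~= 0"
   proof (rule ccontr)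
    assume "~ (EX i<n. x $ i ~= 0)"
    then have "x = 0\<^sub>v n" using xn by (intro eq_vecI) auto
    then show False using x P by simp
   qed
   then show "0 < x \<bullet> (P *\<^sub>v x)" unfolding quadratic_form_bil[OF P xn xn] eP by (rule pos)
  qed
  show "transpose_mat A*P + P*A = (-2) \<cdot>\<^sub>m 1\<^sub>m n"
  proof (rule eq_matI)
   fix i j assume "i < dim_row ((-2) \<cdot>\<^sub>m 1\<^sub>m n :: real mat)" "j < dim_col ((-2) \<cdot>\<^sub>m 1\<^sub>m n :: real mat)"
   then have ij: "i < n" "j < n" by auto
   have "F (entries P) i j = F X i j" using ij by (simp add: F_def entries_def P_def)
   then show "(transpose_mat A*P + P*A) $$ (i, j) = ((-2) \<cdot>\<^sub>m 1\<^sub>m n :: real mat) $$ (i, j)"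
    unfolding FR[OF P ij] using X ij by simp
  qed (use A P in auto)
 qed
 have uniqP: "R = P" if "lyp R" for R
 proof -
  have R: "R : carrier_mat n n" using that by (simp add: lyp_def)
  have "ALL i<n. ALL j<n. F (entries R) i j = (if i = j then -2 else 0)"
  proof (intro allI impI)
   fix i j assume ij: "i < n" "j < n"
   have "F (entries R) i j = ((-2) \<cdot>\<^sub>m 1\<^sub>m n :: real mat) $$ (i, j)"
    using that FR[OF R ij] by (simp only: lyp_def)
   then show "F (entries R) i j = (if i = j then -2 else 0)" using ij by simp
  qed
  then show ?thesis using uniq[of "entries R"] R P by (intro eq_matI) (auto simp: entries_def P_def)
 qed
 have L: "lyap A = P"
  unfolding lyap_def carrier_matD(1)[OF A] lyp_def[symmetric]
  by (rule the_equality[of lyp, OF lypP uniqP])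
 show "lyap A : carrier_mat n n" unfolding L by (rule P)
 show "ALL i<n. ALL j<n. entries (lyap A) i j = entries (lyap A) j i" unfolding L using sym by (simp add: entries_def P_def)
 show "bil n (entries (lyap A)) x (mv n (entries A) x) = - (SUM i<n. (x i)^2)" unfolding L eP by (rule bilX)
 show "0 <= bil n (entries (lyap A)) x x" unfolding L eP by (rule psd)
qed

text \<open>Along x' = A x the form p/c drops at least as fast as \<open>lyap A\<close>, whose rate
  is known exactly, so their difference decreases and is therefore nonnegative.\<close>

lemma lyap_le_cert:
 assumes A: "A : carrier_mat n n" and hw: "hurwitz A" and cert: "lyap_cert n (entries A) p c" "c > 0"
  and B: "ALL i<n. ALL j<n. \<bar>p i j\<bar> <= B" "B >= 0"
 shows "bil n (entries (lyap A)) x x <= (real n*B / c)*(SUM i<n. (x i)^2)"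
proof -
 let ?P = "entries (lyap A)"
 have eq: "bil n (%i j. (1 / c)*p i j - 1 * ?P i j) x y = (1 / c)*bil n p x y - bil n ?P x y" for x y
  by (subst bil_matrix_diff) simp
 have "0 <= bil n (%i j. (1 / c)*p i j - 1 * ?P i j) x x"
 proof (rule lyap_cert_nonneg[OF cert])
  show "ALL i<n. ALL j<n. (1 / c)*p i j - 1 * ?P i j = (1 / c)*p j i - 1 * ?P j i"
   using lyap_cert_sym[OF cert(1)] lyap_symmetric[OF A hw] by (metis (no_types))
  fix x
  have "(1 / c)*bil n p x (mv n (entries A) x) <= (1 / c)*(- c*(SUM i<n. (x i)^2))"
   using cert(2) by (intro mult_left_mono lyap_cert_decrease[OF cert(1)]) simp
  then show "bil n (%i j. (1 / c)*p i j - 1 * ?P i j) x (mv n (entries A) x) <= 0"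
   unfolding eq lyap_bil[OF A hw] using cert(2) by simp
 qed
 then have "bil n ?P x x <= (1 / c)*bil n p x x" unfolding eq by simp
 also have "bil n p x x <= B*(SUM i<n. \<bar>x i\<bar>)^2"
  using bil_bound[OF B(1), of x x] by (simp add: power2_eq_square mult_ac)
 also have "... <= B*(real n*(SUM i<n. (x i)^2))"
  using sum_squared_le_card_mult[of "%i. \<bar>x i\<bar>" n] B(2) by (intro mult_left_mono) simp_all
 finally show ?thesis using cert(2) by (simp add: field_simps)
qed

section \<open>Euclidean norm and induced matrix norm\<close>

lemma vnorm_sq: "dim_vec x = n ==> (vnorm x)^2 = (SUM i<n. (x $ i)^2)"
 by (simp add: vnorm_def scalar_prod_sum[of x n] sum_nonneg power2_eq_square)

lemma vnorm_nonneg: "0 <= vnorm x"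
 by (simp add: vnorm_def scalar_prod_sum[OF refl] sum_nonneg)

text \<open>A crude constant suffices: it shows that the supremum in \<open>mnorm\<close> is taken
  over a bounded set, and it turns uniform entry bounds into uniform norm bounds.\<close>

lemma vnorm_mult_le_entries:
 assumes A: "A : carrier_mat n m" and x: "x : carrier_vec m"
  and B: "ALL i<n. ALL j<m. \<bar>A $$ (i, j)\<bar> <= B" "B >= 0"
 shows "vnorm (A *\<^sub>v x) <= real n*real m*B*vnorm x"
proof (cases "n = 0 | m = 0")
 case True
 then have "(vnorm (A *\<^sub>v x))^2 = 0"
  using A x index_mult_mat_vec_sum[OF A x] by (auto simp: vnorm_sq[of _ n] simp del: index_mult_mat_vec)
 then show ?thesis using True by auto
next
 case False
 have "((A *\<^sub>v x) $ i)^2 <= B^2*(real m*(vnorm x)^2)" if i: "i < n" for i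
 proof -
  have "\<bar>(A *\<^sub>v x) $ i\<bar> <= (SUM j<m. \<bar>A $$ (i, j)*x $ j\<bar>)"
   unfolding index_mult_mat_vec_sum[OF A x i] by (rule sum_abs)
  also have "... <= (SUM j<m. B*\<bar>x $ j\<bar>)"
   using B i by (intro sum_mono) (auto simp: abs_mult intro: mult_right_mono)
  also have "... = B*(SUM j<m. \<bar>x $ j\<bar>)" by (simp add: sum_distrib_left)
  finally have "\<bar>(A *\<^sub>v x) $ i\<bar>^2 <= (B*(SUM j<m. \<bar>x $ j\<bar>))^2" by (intro power_mono) auto
  also have "... = B^2*(SUM j<m. \<bar>x $ j\<bar>)^2" by (simp add: power_mult_distrib)
  also have "... <= B^2*(real m*(SUM j<m. \<bar>x $ j\<bar>^2))"
   by (intro mult_left_mono sum_squared_le_card_mult) auto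
  finally show ?thesis using x by (simp add: vnorm_sq[of x m])
 qed
 then have "(vnorm (A *\<^sub>v x))^2 <= (SUM i<n. B^2*(real m*(vnorm x)^2))"
  using A x by (subst vnorm_sq[of _ n]) (auto intro!: sum_mono simp del: sum_constant index_mult_mat_vec)
 also have "... = real n*real m*(B^2*(vnorm x)^2)" by simp
 also have "... <= (real n*real m)^2*(B^2*(vnorm x)^2)"
 proof (rule mult_right_mono)
  have "1 <= real n*real m" using False by (metis One_nat_def Suc_leI mult_eq_0_iff neq0_conv of_nat_1 of_nat_le_iff of_nat_mult)
  then show "real n*real m <= (real n*real m)^2" using self_le_power[of "real n*real m" 2] by simp
 qed simp
 also have "... = (real n*real m*B*vnorm x)^2" by (simp add: power_mult_distrib mult_ac)
 finally show ?thesis by (rule power2_le_imp_le) (use B(2) in \<open>simp add: vnorm_nonneg\<close>)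
qed

lemma mnorm_le_entries:
 assumes A: "A : carrier_mat n m" and B: "ALL i<n. ALL j<m. \<bar>A $$ (i, j)\<bar> <= B" "B >= 0"
 shows "mnorm A <= real n*real m*B"
  and "bdd_above ((%x. vnorm (A *\<^sub>v x)) ` {x : carrier_vec m. vnorm x <= 1})"
proof -
 have le: "vnorm (A *\<^sub>v x) <= real n*real m*B" if "x : carrier_vec m" "vnorm x <= 1" for x
 proof -
  have "vnorm (A *\<^sub>v x) <= real n*real m*B*vnorm x" by (rule vnorm_mult_le_entries[OF A that(1) B])
  also have "... <= real n*real m*B*1" using that B(2) by (intro mult_left_mono) auto
  finally show ?thesis by simp
 qed
 have "0\<^sub>v m : {x : carrier_vec m. vnorm x <= 1}" by (simp add: vnorm_def scalar_prod_def)
 then show "mnorm A <= real n*real m*B"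
  unfolding mnorm_def carrier_matD(2)[OF A] by (intro cSUP_least) (use le \<open>0\<^sub>v m : _\<close> in blast)+
 show "bdd_above ((%x. vnorm (A *\<^sub>v x)) ` {x : carrier_vec m. vnorm x <= 1})"
  by (rule bdd_aboveI2[of _ _ "real n*real m*B"]) (use le in auto)
qed

lemma matrix_entries_bounded:
 obtains B where "B >= 0" "ALL i<n. ALL j<m. \<bar>(A :: real mat) $$ (i, j)\<bar> <= B"
proof -
 obtain B where "B >= 0" "!!s. s : {..<n} \<times> {..<m} ==> \<bar>A $$ (fst s, snd s)\<bar> <= B"
  by (rule finite_upper_bound[of "{..<n} \<times> {..<m}" "%s. \<bar>A $$ (fst s, snd s)\<bar>"]) auto
 then show ?thesis using that[of B] by force
qed

lemma vnorm_smult: "vnorm (c \<cdot>\<^sub>v x) = \<bar>c\<bar>*vnorm x"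
proof -
 have "(c \<cdot>\<^sub>v x) \<bullet> (c \<cdot>\<^sub>v x) = c^2*(x \<bullet> x)"
  by (simp add: scalar_prod_def sum_distrib_left power2_eq_square mult_ac)
 then show ?thesis by (simp add: vnorm_def real_sqrt_mult)
qed

lemma vnorm_mult_le:
 assumes A: "A : carrier_mat n m" and x: "x : carrier_vec m"
 shows "vnorm (A *\<^sub>v x) <= mnorm A*vnorm x"
proof -
 obtain B where B: "B >= 0" "ALL i<n. ALL j<m. \<bar>A $$ (i, j)\<bar> <= B" by (rule matrix_entries_bounded)
 show ?thesis
 proof (cases "vnorm x = 0")
  case True
  then show ?thesis using vnorm_mult_le_entries[OF A x B(2,1)] by simp
 next
  case False
  then have pos: "vnorm x > 0" using vnorm_nonneg[of x] by simp
  let ?y = "(1 / vnorm x) \<cdot>\<^sub>v x"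
  have "?y : {x : carrier_vec m. vnorm x <= 1}" using x pos by (simp add: vnorm_smult)
  then have "vnorm (A *\<^sub>v ?y) <= mnorm A"
   unfolding mnorm_def carrier_matD(2)[OF A] by (rule cSUP_upper[OF _ mnorm_le_entries(2)[OF A B(2,1)]])
  moreover have "A *\<^sub>v ?y = (1 / vnorm x) \<cdot>\<^sub>v (A *\<^sub>v x)" by (rule mult_mat_vec[OF A x])
  ultimately show ?thesis using pos by (simp add: vnorm_smult field_simps)
 qed
qed

lemma mnorm_nonneg: "A : carrier_mat n m ==> 0 <= mnorm A"
proof -
 assume A: "A : carrier_mat n m"
 obtain B where B: "B >= 0" "ALL i<n. ALL j<m. \<bar>A $$ (i, j)\<bar> <= B" by (rule matrix_entries_bounded)
 have z: "0\<^sub>v m : {x : carrier_vec m. vnorm x <= 1}" by (simp add: vnorm_def scalar_prod_def)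
 have "0 <= vnorm (A *\<^sub>v 0\<^sub>v m)" by (rule vnorm_nonneg)
 also have "... <= mnorm A"
  unfolding mnorm_def carrier_matD(2)[OF A] by (rule cSUP_upper[OF z mnorm_le_entries(2)[OF A B(2,1)]])
 finally show ?thesis .
qed

section \<open>Extreme eigenvalues of symmetric matrices\<close>

lemma finite_eigenvalues:
 assumes "P : carrier_mat n n"
 shows "finite {x::real. eigenvalue P x}"
proof -
 have "char_poly P ~= 0" using degree_monic_char_poly[OF assms] by auto
 then show ?thesis unfolding eigenvalue_root_char_poly[OF assms] by (rule poly_roots_finite)
qed

text \<open>The sign s treats the least and the greatest eigenvalue together. Stationarity of the
  Rayleigh quotient, tested against unit vectors, is the eigenvalue equation.\<close>

lemma rayleigh_eigenvalue:
 assumes P: "P : carrier_mat n n" and n: "0 < n" and s: "s = 1 | s = (-1::real)"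
  and sym: "ALL i<n. ALL j<n. entries P i j = entries P j i"
 shows "EX \<mu>. eigenvalue P \<mu> & (ALL x. s*\<mu>*(SUM i<n. (x i)^2) <= s*bil n (entries P) x x)"
proof -
 have one: "bil n (%i j. if i = j then 1 else 0) x y = (SUM i<n. x i*y i)" for x y
  by (simp add: bil_def if_distrib[of "%t. t*_"] cong: if_cong)
 have sc: "bil n (%i j. s*entries P i j) x y = s*bil n (entries P) x y" for x y
  using bil_matrix_diff[of n s "entries P" 0 "entries P" x y] by simp
 have pos: "0 < bil n (%i j. if i = j then 1 else 0) x x" if "EX i<n. x i ~= 0" for x
 proof -
  from that obtain i where "i < n" "x i ~= 0" by blast
  then have "0 < (SUM i<n. (x i)^2)" by (intro sum_pos2[of _ i]) auto
  then show ?thesis unfolding one by (simp add: power2_eq_square)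
 qed
 have "EX \<mu> x0. (EX i<n. x0 i ~= 0) & (ALL x. \<mu>*bil n (%i j. if i = j then 1 else 0) x x <= bil n (%i j. s*entries P i j) x x) &
  (ALL y. bil n (%i j. s*entries P i j) x0 y = \<mu>*bil n (%i j. if i = j then 1 else 0) x0 y)"
 proof (rule rayleigh_min[OF n _ _ pos])
  show "ALL i<n. ALL j<n. s*entries P i j = s*entries P j i" using sym by (metis (no_types))
 qed auto
 then obtain \<mu> x0 where x0: "EX i<n. x0 i ~= 0" and le: "ALL x. \<mu>*(SUM i<n. x i*x i) <= s*bil n (entries P) x x"
  and eq: "ALL y. s*bil n (entries P) x0 y = \<mu>*(SUM i<n. x0 i*y i)"
  unfolding one sc by blast
 have ss: "s*s = 1" using s by auto
 have "(SUM j<n. P $$ (i, j)*x0 j) = (s*\<mu>)*x0 i" if i: "i < n" for i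
 proof -
  have "bil n (entries P) x0 (%j. if j = i then 1 else 0) = (SUM j<n. entries P j i*x0 j)"
   using i by (simp add: bil_def if_distrib[of "%t. _*t"] cong: if_cong)
  also have "... = (SUM j<n. P $$ (i, j)*x0 j)"
   by (intro sum.cong refl) (use sym i in \<open>simp add: entries_def\<close>)
  finally have "s*(SUM j<n. P $$ (i, j)*x0 j) = \<mu>*x0 i"
   using spec[OF eq, of "%j. if j = i then 1 else 0"] i by (simp add: if_distrib[of "%t. _*t"] cong: if_cong)
  then have "s*(s*(SUM j<n. P $$ (i, j)*x0 j)) = s*\<mu>*x0 i" by simp
  then show ?thesis using ss by (simp flip: mult.assoc)
 qed
 then have "eigenvalue P (s*\<mu>)" unfolding eigenvalue_iff_fun[OF P] using x0 by blast
 moreover have "s*(s*\<mu>)*(SUM i<n. (x i)^2) <= s*bil n (entries P) x x" for x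
  using spec[OF le, of x] ss by (simp add: power2_eq_square flip: mult.assoc)
 ultimately show ?thesis by (intro exI[of _ "s*\<mu>"]) blast
qed

lemma eig_max_upper:
 assumes P: "P : carrier_mat n n" and n: "0 < n"
  and sym: "ALL i<n. ALL j<n. entries P i j = entries P j i"
 shows "bil n (entries P) x x <= eig_max P*(SUM i<n. (x i)^2)" and "eigenvalue P (eig_max P)"
proof -
 obtain \<mu> where \<mu>: "eigenvalue P \<mu>" and le: "ALL x. - 1*\<mu>*(SUM i<n. (x i)^2) <= - 1*bil n (entries P) x x"
  using rayleigh_eigenvalue[OF P n disjI2[OF refl] sym] by (elim exE conjE)
 have "\<mu> <= eig_max P" unfolding eig_max_def by (rule Max_ge) (use \<mu> finite_eigenvalues[OF P] in auto)
 then have "\<mu>*(SUM i<n. (x i)^2) <= eig_max P*(SUM i<n. (x i)^2)" by (intro mult_right_mono sum_nonneg) auto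
 then show "bil n (entries P) x x <= eig_max P*(SUM i<n. (x i)^2)" using spec[OF le, of x] by simp
 have "eig_max P : {x. eigenvalue P x}"
  unfolding eig_max_def by (rule Max_in) (use \<mu> finite_eigenvalues[OF P] in auto)
 then show "eigenvalue P (eig_max P)" by simp
qed

lemma eig_min_lower:
 assumes P: "P : carrier_mat n n" and n: "0 < n"
  and sym: "ALL i<n. ALL j<n. entries P i j = entries P j i"
 shows "eig_min P*(SUM i<n. (x i)^2) <= bil n (entries P) x x" and "eigenvalue P (eig_min P)"
proof -
 obtain \<mu> where \<mu>: "eigenvalue P \<mu>" and le: "ALL x. 1*\<mu>*(SUM i<n. (x i)^2) <= 1*bil n (entries P) x x"
  using rayleigh_eigenvalue[OF P n disjI1[OF refl] sym] by (elim exE conjE)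
 have "eig_min P <= \<mu>" unfolding eig_min_def by (rule Min_le) (use \<mu> finite_eigenvalues[OF P] in auto)
 then have "eig_min P*(SUM i<n. (x i)^2) <= \<mu>*(SUM i<n. (x i)^2)" by (intro mult_right_mono sum_nonneg) auto
 then show "eig_min P*(SUM i<n. (x i)^2) <= bil n (entries P) x x" using spec[OF le, of x] by simp
 have "eig_min P : {x. eigenvalue P x}"
  unfolding eig_min_def by (rule Min_in) (use \<mu> finite_eigenvalues[OF P] in auto)
 then show "eigenvalue P (eig_min P)" by simp
qed

lemma eigenvalue_bil:
 assumes P: "P : carrier_mat n n" and ev: "eigenvalue P \<mu>"
  and sym: "ALL i<n. ALL j<n. entries P i j = entries P j i"
 shows "EX x. (SUM i<n. (x i)^2) > 0 & (ALL y. bil n (entries P) x y = \<mu>*(SUM i<n. x i*y i))"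
proof -
 obtain x where x: "EX i<n. x i ~= 0" "ALL i<n. (SUM j<n. P $$ (i, j)*x j) = \<mu>*x i"
  using ev unfolding eigenvalue_iff_fun[OF P] by blast
 from x(1) obtain i where "i < n" "x i ~= 0" by blast
 then have "(SUM i<n. (x i)^2) > 0" by (intro sum_pos2[of _ i]) auto
 moreover have "bil n (entries P) x y = \<mu>*(SUM i<n. x i*y i)" for y
 proof -
  have "bil n (entries P) x y = bil n (entries P) y x" by (rule bil_sym[OF sym])
  also have "... = (SUM i<n. y i*(SUM j<n. P $$ (i, j)*x j))"
   by (simp add: bil_def entries_def sum_distrib_left mult_ac)
  also have "... = (SUM i<n. y i*(\<mu>*x i))" by (intro sum.cong refl) (use x(2) in simp)
  finally show ?thesis by (simp add: sum_distrib_left mult_ac)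
 qed
 ultimately show ?thesis by (intro exI[of _ x]) blast
qed

text \<open>Upper bound: compare with the uniform certificates. Lower bound: for an eigenvector x of
  P with eigenvalue \<mu> the Lyapunov equation reads \<mu> x.Ax = -|x|^2, so \<mu> is at least the
  inverse of a bound on A. The entries of P, and with them \<open>mnorm\<close>, follow from the
  quadratic form by polarisation.\<close>

lemma lyap_bounds_uniform:
 assumes W: "compact_vecs m W" and n: "0 < n"
  and A': "ALL w:W. A w : carrier_mat n n"
  and lip: "ALL w:W. ALL w':W. ALL \<eta>>=0. (ALL k<m. \<bar>w $ k - w' $ k\<bar> <= \<eta>) -->
   (ALL i<n. ALL j<n. \<bar>entries (A w) i j - entries (A w') i j\<bar> <= L*\<eta>)"
  and L: "L >= 0"
  and bd': "ALL w:W. (ALL i<n. ALL j<n. \<bar>entries (A w) i j\<bar> <= \<alpha>)"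
  and hw': "ALL w:W. hurwitz (A w)"
 shows "EX lo>0. EX hi. ALL w:W. lo <= eig_min (lyap (A w)) & lo <= eig_max (lyap (A w)) &
  eig_max (lyap (A w)) <= hi & mnorm (lyap (A w)) <= hi"
proof -
 note A = bspec[OF A'] and hw = bspec[OF hw'] and bd = bspec[OF bd']
 show ?thesis
proof (cases "W = {}")
 case True then show ?thesis by (intro exI[of _ 1]) simp
next
 case False
 have "mat n n (%(i, j). entries (A w) i j) = A w" if "w : W" for w
  using A[OF that] by (intro eq_matI) (auto simp: entries_def)
 then have hw2: "ALL w:W. hurwitz (mat n n (%(i, j). entries (A w) i j))"
  using hw by simp
 have "EX c>0. EX B>=0. ALL w:W. EX p. lyap_cert n (entries (A w)) p c & (ALL i<n. ALL j<n. \<bar>p i j\<bar> <= B)"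
  by (rule lyap_cert_uniform[OF W lip L hw2])
 then obtain c B where c: "c > 0" and B: "B >= 0"
  and cert: "ALL w:W. EX p. lyap_cert n (entries (A w)) p c & (ALL i<n. ALL j<n. \<bar>p i j\<bar> <= B)"
  by (elim exE conjE)
 define \<Lambda> where "\<Lambda> = real n*B / c"
 have up: "bil n (entries (lyap (A w))) x x <= \<Lambda>*(SUM i<n. (x i)^2)" if w: "w : W" for w x
 proof -
  obtain p where "lyap_cert n (entries (A w)) p c" "ALL i<n. ALL j<n. \<bar>p i j\<bar> <= B"
   using bspec[OF cert w] by blast
  then show ?thesis unfolding \<Lambda>_def by (intro lyap_le_cert[OF A[OF w] hw[OF w]] c B)
 qed
 have \<Lambda>: "\<Lambda> >= 0" using B c by (simp add: \<Lambda>_def)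
 \<comment> \<open>The maximum with 1 makes the divisor in \<open>lo\<close> positive.\<close>
 define \<beta> where "\<beta> = max \<alpha> 1"
 have bd2: "ALL i<n. ALL j<n. \<bar>entries (A w) i j\<bar> <= \<beta>" if "w : W" for w
  using bd[OF that] unfolding \<beta>_def by (meson max.coboundedI1)
 define lo where "lo = 1 / (\<beta>*real n)"
 have \<beta>: "\<beta>*real n > 0" using n by (simp add: \<beta>_def)
 have ev_lo: "lo <= \<mu>" if w: "w : W" and ev: "eigenvalue (lyap (A w)) \<mu>" for w \<mu>
 proof -
  obtain x where s: "(SUM i<n. (x i)^2) > 0" and x': "ALL y. bil n (entries (lyap (A w))) x y = \<mu>*(SUM i<n. x i*y i)"
   using eigenvalue_bil[OF lyap_carrier[OF A[OF w] hw[OF w]] ev lyap_symmetric[OF A[OF w] hw[OF w]]] by (elim exE conjE)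
  note x = spec[OF x']
  let ?t = "SUM i<n. x i*mv n (entries (A w)) x i"
  have t: "?t = bil n (entries (A w)) x x" by (simp add: bil_def mv_def sum_distrib_left mult_ac)
  have "\<bar>?t\<bar> <= \<beta>*(SUM i<n. \<bar>x i\<bar>)^2"
   unfolding t using bil_bound[OF bd2[OF w], of x x] by (simp add: power2_eq_square mult_ac)
  also have "... <= \<beta>*(real n*(SUM i<n. (x i)^2))"
   using sum_squared_le_card_mult[of "%i. \<bar>x i\<bar>" n] by (intro mult_left_mono) (simp_all add: \<beta>_def)
  finally have t2: "\<bar>?t\<bar> <= \<beta>*real n*(SUM i<n. (x i)^2)" by (simp add: mult_ac)
  have e: "\<mu> * ?t = - (SUM i<n. (x i)^2)" using x[of "mv n (entries (A w)) x"] lyap_bil[OF A[OF w] hw[OF w]] by simp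
  have "0 <= bil n (entries (lyap (A w))) x x" by (rule lyap_psd[OF A[OF w] hw[OF w]])
  then have "0 <= \<mu>*(SUM i<n. (x i)^2)" using x[of x] by (simp add: power2_eq_square)
  then have \<mu>: "\<mu> >= 0" using s by (simp add: zero_le_mult_iff)
  have "(SUM i<n. (x i)^2) = \<mu>*(- ?t)" using e by simp
  also have "... <= \<mu>*(\<beta>*real n*(SUM i<n. (x i)^2))" using t2 \<mu> by (intro mult_left_mono) auto
  finally have "1*(SUM i<n. (x i)^2) <= (\<mu>*(\<beta>*real n))*(SUM i<n. (x i)^2)" by (simp add: mult_ac)
  then have "1 <= \<mu>*(\<beta>*real n)" using s by (simp only: mult_le_cancel_right_pos)
  then show ?thesis using \<beta> unfolding lo_def by (simp only: divide_le_eq) simp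
 qed
 have ev_hi: "\<mu> <= \<Lambda>" if w: "w : W" and ev: "eigenvalue (lyap (A w)) \<mu>" for w \<mu>
 proof -
  obtain x where s: "(SUM i<n. (x i)^2) > 0" and x': "ALL y. bil n (entries (lyap (A w))) x y = \<mu>*(SUM i<n. x i*y i)"
   using eigenvalue_bil[OF lyap_carrier[OF A[OF w] hw[OF w]] ev lyap_symmetric[OF A[OF w] hw[OF w]]] by (elim exE conjE)
  note x = spec[OF x']
  have "\<mu>*(SUM i<n. (x i)^2) <= \<Lambda>*(SUM i<n. (x i)^2)" using up[OF w, of x] x[of x] by (simp add: power2_eq_square)
  then show ?thesis using s by (simp only: mult_le_cancel_right_pos)
 qed
 have ent: "\<bar>lyap (A w) $$ (i, j)\<bar> <= 2*\<Lambda>" if w: "w : W" and ij: "i < n" "j < n" for w i j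
 proof -
  let ?p = "entries (lyap (A w))"
  have e: "bil n ?p (%k. if k = a then 1 else 0) (%k. if k = b then 1 else 0) = ?p a b" if "a < n" "b < n" for a b
   using that by (simp add: bil_def if_distrib[of "%t. _*t"] if_distrib[of "%t. t*_"] cong: if_cong)
  have ii: "?p a a <= \<Lambda>" if "a < n" for a
   using up[OF w, of "%k. if k = a then 1 else 0"] e[OF that that] that
   by (simp add: if_distrib[of "%t. t^2"] cong: if_cong)
  \<comment> \<open>Nonnegativity on e_i + s e_j for s = 1 and s = -1 bounds the entry (i, j) by the
    diagonal entries.\<close>
  have "0 <= bil n ?p (%k. (if k = i then 1 else 0) + s*(if k = j then 1 else 0)) (%k. (if k = i then 1 else 0) + s*(if k = j then 1 else 0))" for s
   by (rule lyap_psd[OF A[OF w] hw[OF w]])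
  then have g: "0 <= ?p i i + s * ?p i j + s * ?p j i + s*s * ?p j j" for s
   unfolding bil_add_left bil_add_right bil_scale_left bil_scale_right using e ij by (simp add: mult_ac add_ac)
  have sy: "?p j i = ?p i j" using lyap_symmetric[OF A[OF w] hw[OF w]] ij by simp
  show ?thesis using g[of 1] g[of "-1"] sy ii[OF ij(1)] ii[OF ij(2)] \<Lambda> unfolding entries_def by auto
 qed
 define hi where "hi = max \<Lambda> (real n*real n*(2*\<Lambda>))"
 have "lo <= eig_min (lyap (A w)) & lo <= eig_max (lyap (A w)) & eig_max (lyap (A w)) <= hi & mnorm (lyap (A w)) <= hi"
  if w: "w : W" for w
 proof -
  note P = lyap_carrier[OF A[OF w] hw[OF w]] and sym = lyap_symmetric[OF A[OF w] hw[OF w]]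
  have "mnorm (lyap (A w)) <= real n*real n*(2*\<Lambda>)"
   by (rule mnorm_le_entries(1)[OF P]) (use ent[OF w] \<Lambda> in auto)
  then show ?thesis
   using ev_lo[OF w eig_min_lower(2)[OF P n sym]] ev_lo[OF w eig_max_upper(2)[OF P n sym]]
    ev_hi[OF w eig_max_upper(2)[OF P n sym]] unfolding hi_def by linarith
 qed
 moreover have "lo > 0" using \<beta> by (simp add: lo_def)
 ultimately show ?thesis by blast
qed
qed

section \<open>Minimal polynomials and companion matrices\<close>

lemma pow_mat_Suc_left:
 assumes "A : carrier_mat n n"
 shows "A ^\<^sub>m Suc k = A*A ^\<^sub>m k"
proof (induction k)
 case (Suc k)
 have "A ^\<^sub>m Suc (Suc k) = (A*A ^\<^sub>m k)*A" using Suc by simp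
 also have "... = A*(A ^\<^sub>m k*A)"
  by (rule assoc_mult_mat[of _ n n _ n _ n]) (use assms in auto)
 finally show ?case by simp
qed (use assms in simp)

lemma sum_coeff_upto:
 fixes q :: "'a::comm_semiring_0 poly"
 assumes "degree q <= N"
 shows "(SUM k<=N. coeff q k*f k) = (SUM k<=degree q. coeff q k*f k)"
 by (rule sum.mono_neutral_right) (use assms in \<open>auto simp: coeff_eq_0\<close>)

definition annihilates :: "real poly => real mat => bool" where
 "annihilates q A \<longleftrightarrow> (ALL i<dim_row A. ALL j<dim_row A. (SUM k<=degree q. coeff q k*(A ^\<^sub>m k) $$ (i, j)) = 0)"

lemma poly_mat_zero_iff: "poly_mat q A = 0\<^sub>m (dim_row A) (dim_row A) \<longleftrightarrow> annihilates q A"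
 unfolding poly_mat_def annihilates_def mat_eq_iff by auto

text \<open>The n^2 + 1 powers A^0, ..., A^(n^2) are linearly dependent in the space of n by n
  matrices.\<close>

lemma annihilating_poly_exists:
 assumes A: "A : carrier_mat n n"
 shows "EX q. q ~= 0 & annihilates q A"
proof -
 define N where "N = Suc (n*n)"
 \<comment> \<open>Rows are matrix positions, columns are powers. The extra last row is zero, so the
   square system is not surjective and therefore has a nontrivial kernel.\<close>
 define a where "a r k = (if r < n*n then (A ^\<^sub>m k) $$ (r div n, r mod n) else 0)" for r k
 have "EX x. (ALL i<N. mv N a x i = 0) & ~ (ALL i<N. x i = 0)"
 proof (rule ccontr)
  assume "~ ?thesis"
  then have "!!x. (ALL i<N. mv N a x i = 0) ==> (ALL i<N. x i = 0)" by blast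
  from linear_system_solvable[of N a "%i. 1", OF this] obtain x where "ALL i<N. mv N a x i = 1" by blast
  then have "mv N a x (n*n) = 1" by (simp add: N_def)
  moreover have "mv N a x (n*n) = 0" by (simp add: mv_def a_def)
  ultimately show False by simp
 qed
 then obtain x i where x: "ALL i<N. mv N a x i = 0" and i: "i < N" "x i ~= 0" by blast
 define q where "q = (SUM k<N. monom (x k) k)"
 have cq: "coeff q k = (if k < N then x k else 0)" for k
  by (simp add: q_def coeff_sum)
 have "q ~= 0" using i cq[of i] by auto
 moreover have "degree q <= n*n"
  by (rule degree_le) (use cq in \<open>auto simp: N_def\<close>)
 have "annihilates q A"
  unfolding annihilates_def
 proof (intro allI impI)
  fix i j assume "i < dim_row A" "j < dim_row A"
  then have ij: "i < n" "j < n" using A by auto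
  define r where "r = i*n + j"
  have "r div n = i" "r mod n = j" using ij by (auto simp: r_def)
  moreover have "r < n*n"
  proof -
   have "r < i*n + n" using ij by (simp add: r_def)
   also have "... = Suc i*n" by simp
   also have "... <= n*n" using ij by (intro mult_right_mono) auto
   finally show ?thesis .
  qed
  ultimately have "(SUM k<=n*n. coeff q k*(A ^\<^sub>m k) $$ (i, j)) = mv N a x r"
   unfolding mv_def by (intro sum.cong) (auto simp: cq a_def N_def)
  also have "... = 0" using x \<open>r < n*n\<close> by (simp add: N_def)
  finally show "(SUM k<=degree q. coeff q k*(A ^\<^sub>m k) $$ (i, j)) = 0"
   using sum_coeff_upto[OF \<open>degree q <= n*n\<close>] by metis
 qed
 ultimately show ?thesis by blast
qed

lemma annihilates_diff:
 assumes "annihilates p A" "annihilates q A"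
 shows "annihilates (p - q) A"
 unfolding annihilates_def
proof (intro allI impI)
 fix i j assume ij: "i < dim_row A" "j < dim_row A"
 define N where "N = max (degree p) (degree q)"
 have d: "degree (p - q) <= N" by (simp add: N_def degree_diff_le_max)
 have "(SUM k<=N. coeff (p - q) k*(A ^\<^sub>m k) $$ (i, j))
  = (SUM k<=N. coeff p k*(A ^\<^sub>m k) $$ (i, j)) - (SUM k<=N. coeff q k*(A ^\<^sub>m k) $$ (i, j))"
  by (simp add: left_diff_distrib sum_subtractf)
 also have "... = 0"
  using assms ij sum_coeff_upto[of p N] sum_coeff_upto[of q N] by (simp add: N_def annihilates_def)
 finally show "(SUM k<=degree (p - q). coeff (p - q) k*(A ^\<^sub>m k) $$ (i, j)) = 0"
  using sum_coeff_upto[OF d] by metis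
qed

lemma annihilates_smult: "annihilates q A ==> annihilates (Polynomial.smult c q) A"
proof -
 assume q: "annihilates q A"
 have "(SUM k<=degree q. coeff (Polynomial.smult c q) k*(A ^\<^sub>m k) $$ (i, j)) = c*(SUM k<=degree q. coeff q k*(A ^\<^sub>m k) $$ (i, j))" for i j
  by (simp add: sum_distrib_left mult_ac)
 moreover have "(SUM k<=degree q. coeff (Polynomial.smult c q) k*f k) = (SUM k<=degree (Polynomial.smult c q). coeff (Polynomial.smult c q) k*f k)"
  for f :: "nat => real" by (rule sum_coeff_upto) (rule degree_smult_le)
 ultimately show ?thesis using q unfolding annihilates_def by simp
qed

text \<open>Discharges the definite description: the difference of two monic annihilators of least
  degree would be a nonzero annihilator of smaller degree.\<close>

lemma min_poly_props:
 assumes A: "A : carrier_mat n n"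
 shows min_poly_monic: "lead_coeff (min_poly A) = 1"
  and min_poly_annihilates: "annihilates (min_poly A) A"
  and min_poly_minimal: "q ~= 0 ==> annihilates q A ==> degree (min_poly A) <= degree q"
proof -
 define mp where "mp q \<longleftrightarrow> lead_coeff q = 1 & annihilates q A & (ALL q'. q' ~= 0 & annihilates q' A --> degree q <= degree q')" for q
 define d where "d = (LEAST d. EX q. q ~= 0 & annihilates q A & degree q = d)"
 have "EX d q. q ~= 0 & annihilates q A & degree q = d" using annihilating_poly_exists[OF A] by blast
 then obtain q where q: "q ~= 0" "annihilates q A" "degree q = d"
  using LeastI_ex[of "%d. EX q. q ~= 0 & annihilates q A & degree q = d"] unfolding d_def by blast
 have min: "d <= degree q'" if "q' ~= 0" "annihilates q' A" for q'
  unfolding d_def by (rule Least_le) (use that in blast)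
 define m where "m = Polynomial.smult (inverse (lead_coeff q)) q"
 have "mp m"
 proof -
  have "lead_coeff q ~= 0" using q(1) by simp
  then show ?thesis unfolding mp_def m_def using q min annihilates_smult[OF q(2)] by simp
 qed
 have uniq: "p = m" if "mp p" for p
 proof (rule ccontr)
  assume "p ~= m"
  then have nz: "p - m ~= 0" by simp
  have mm: "lead_coeff m = 1" "annihilates m A" and pp: "lead_coeff p = 1" "annihilates p A"
   using \<open>mp m\<close> \<open>mp p\<close> unfolding mp_def by auto
  have "m ~= 0" "p ~= 0" using mm pp by auto
  then have dd: "degree p = degree m" using \<open>mp m\<close> \<open>mp p\<close> mm pp unfolding mp_def by (intro antisym) blast+
  have ann: "annihilates (p - m) A" by (rule annihilates_diff[OF pp(2) mm(2)])
  then have "degree m <= degree (p - m)" using \<open>mp m\<close> nz unfolding mp_def by blast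
  moreover have "degree (p - m) <= degree m" using dd degree_diff_le_max[of p m] by simp
  ultimately have "lead_coeff (p - m) = 0" using dd mm(1) pp(1) by simp
  then show False using nz leading_coeff_0_iff by blast
 qed
 have "min_poly A = m"
  unfolding min_poly_def poly_mat_zero_iff mp_def[symmetric]
  by (rule the_equality[of mp, OF \<open>mp m\<close> uniq])
 with \<open>mp m\<close> have "mp (min_poly A)" by simp
 then show "lead_coeff (min_poly A) = 1" "annihilates (min_poly A) A"
  "q ~= 0 ==> annihilates q A ==> degree (min_poly A) <= degree q" for q
  unfolding mp_def by blast+
qed

text \<open>Write m = (s - \<mu>) q. By minimality q(A) is not zero, and (A - \<mu>) q(A) = m(A) = 0
  makes each nonzero column of q(A) an eigenvector.\<close>

lemma min_poly_root_eigenvalue: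
 assumes A: "A : carrier_mat n n" and n: "0 < n"
  and root: "poly (map_poly complex_of_real (min_poly A)) \<mu> = 0"
 shows "eigenvalue (cmat A) \<mu>"
proof -
 let ?m = "min_poly A"
 define p where "p = map_poly complex_of_real ?m"
 have m0: "?m ~= 0" using min_poly_monic[OF A] by auto
 have dp: "degree p = degree ?m" unfolding p_def by (simp add: degree_map_poly)
 have cp: "coeff p k = complex_of_real (coeff ?m k)" for k unfolding p_def by (simp add: coeff_map_poly)
 from root obtain q where q: "p = [:- \<mu>, 1:]*q" unfolding p_def[symmetric] poly_eq_0_iff_dvd by (elim dvdE)
 have p0: "p ~= 0" using m0 unfolding p_def by (simp add: map_poly_eq_0_iff)
 then have q0: "q ~= 0" using q by auto
 have "degree p = Suc (degree q)" unfolding q using q0 by (subst degree_mult_eq) auto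
 then have dq: "degree ?m = Suc (degree q)" using dp by simp
 have cpq: "coeff p (Suc k) = coeff q k - \<mu>*coeff q (Suc k)" "coeff p 0 = - \<mu>*coeff q 0" for k
  unfolding q by simp_all
 define B where "B k i j = (A ^\<^sub>m k) $$ (i, j)" for k i j
 have BS: "B (Suc k) i j = (SUM l<n. A $$ (i, l)*B k l j)" if "i < n" "j < n" for k i j
  unfolding B_def pow_mat_Suc_left[OF A] using A that by (subst index_mult_mat_sum[of A n n _ n]) auto
 define X where "X i j = (SUM k<=degree q. coeff q k*complex_of_real (B k i j))" for i j
 have XN: "X i j = (SUM k<=Suc (degree q). coeff q k*complex_of_real (B k i j))" for i j
  unfolding X_def by (rule sum_coeff_upto[symmetric]) simp
 have "EX i<n. EX j<n. X i j ~= 0"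
 proof (rule ccontr)
  assume "~ ?thesis"
  then have X0: "X i j = 0" if "i < n" "j < n" for i j using that by blast
  \<comment> \<open>q is complex; after normalising its leading coefficient, the real part of c q is
    a nonzero real polynomial of degree below that of m which would annihilate A.\<close>
  define c where "c = inverse (lead_coeff q)"
  define s where "s = map_poly Re (Polynomial.smult c q)"
  have cs: "coeff s k = Re (c*coeff q k)" for k unfolding s_def by (simp add: coeff_map_poly)
  have "coeff s (degree q) = 1" unfolding cs c_def using q0 by simp
  then have "s ~= 0" by auto
  have ds: "degree s <= degree q" by (rule degree_le) (simp add: cs coeff_eq_0)
  have "annihilates s A"
   unfolding annihilates_def
  proof (intro allI impI)
   fix i j assume "i < dim_row A" "j < dim_row A"
   then have ij: "i < n" "j < n" using A by auto
   have "(SUM k<=degree q. coeff s k*B k i j) = Re (c*X i j)"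
    unfolding X_def sum_distrib_left Re_sum cs by (intro sum.cong refl) (simp flip: mult.assoc)
   also have "... = 0" using X0[OF ij] by simp
   finally show "(SUM k<=degree s. coeff s k*(A ^\<^sub>m k) $$ (i, j)) = 0"
    unfolding B_def[symmetric] sum_coeff_upto[OF ds] .
  qed
  from min_poly_minimal[OF A \<open>s ~= 0\<close> this] dq ds show False by simp
 qed
 then obtain i0 j where j: "i0 < n" "j < n" "X i0 j ~= 0" by blast
 have "(SUM l<n. cmat A $$ (i, l)*X l j) = \<mu>*X i j" if i: "i < n" for i
 proof -
  have "(SUM l<n. cmat A $$ (i, l)*X l j) = (SUM l<n. complex_of_real (A $$ (i, l))*X l j)"
   by (rule sum.cong[OF refl]) (use A i in simp)
  also have "... = (SUM l<n. SUM k<=degree q. coeff q k*complex_of_real (A $$ (i, l)*B k l j))"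
   unfolding X_def sum_distrib_left by (rule sum.cong[OF refl], rule sum.cong[OF refl]) simp
  also have "... = (SUM k<=degree q. SUM l<n. coeff q k*complex_of_real (A $$ (i, l)*B k l j))" by (rule sum.swap)
  also have "... = (SUM k<=degree q. coeff q k*complex_of_real (B (Suc k) i j))"
   unfolding BS[OF i j(2)] by (simp add: sum_distrib_left)
  finally have 1: "(SUM l<n. cmat A $$ (i, l)*X l j) = (SUM k<=degree q. coeff q k*complex_of_real (B (Suc k) i j))" .
  have "(SUM k<=Suc (degree q). coeff p k*complex_of_real (B k i j)) = complex_of_real (SUM k<=degree ?m. coeff ?m k*B k i j)"
   unfolding cp dq by simp
  also have "... = 0" using min_poly_annihilates[OF A] i j A unfolding annihilates_def B_def by simp
  finally have "0 = (SUM k<=Suc (degree q). coeff p k*complex_of_real (B k i j))" by simp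
  also have "... = (SUM k<=degree q. coeff q k*complex_of_real (B (Suc k) i j)) - \<mu>*X i j"
   unfolding XN sum.atMost_Suc_shift cpq by (simp add: sum_subtractf left_diff_distrib sum_distrib_left algebra_simps)
  finally show ?thesis using 1 by simp
 qed
 then have "ALL i<n. (SUM l<n. cmat A $$ (i, l)*X l j) = \<mu>*X i j" by blast
 moreover have "cmat A : carrier_mat n n" using A by simp
 ultimately show ?thesis using j by (subst eigenvalue_iff_fun[of _ n]) (auto intro!: exI[of _ "%i. X i j"])
qed

lemma min_poly_degree_pos:
 assumes A: "A : carrier_mat n n" and n: "0 < n"
 shows "0 < degree (min_poly A)"
proof (rule ccontr)
 assume "~ 0 < degree (min_poly A)"
 then have d: "degree (min_poly A) = 0" by simp
 then have "coeff (min_poly A) 0 = 1" using min_poly_monic[OF A] by simp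
 moreover have "coeff (min_poly A) 0*(A ^\<^sub>m 0) $$ (0, 0) = 0"
 proof -
  have "(SUM k<=degree (min_poly A). coeff (min_poly A) k*(A ^\<^sub>m k) $$ (0, 0)) = 0"
   using min_poly_annihilates[OF A] n A unfolding annihilates_def by blast
  then show ?thesis unfolding d by simp
 qed
 ultimately show False using A n by simp
qed

text \<open>The shift rows make an eigenvector a geometric sequence with nonzero first entry; the
  last row is then the polynomial equation.\<close>

lemma companion_eigenvalue_root:
 assumes n: "0 < n" and x: "EX i<n. x i ~= 0"
  and eq: "ALL i<n. (SUM j<n. complex_of_real (companion n a $$ (i, j))*x j) = \<mu>*x i"
 shows "\<mu> ^ n = (SUM j<n. complex_of_real (a j)*\<mu> ^ j)"
proof -
 have shift: "x (Suc i) = \<mu>*x i" if "Suc i < n" for i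
 proof -
  have "(SUM j<n. complex_of_real (companion n a $$ (i, j))*x j) = (SUM j<n. if j = Suc i then x j else 0)"
  proof (rule sum.cong[OF refl])
   fix j assume "j : {..<n}"
   then have "companion n a $$ (i, j) = (if j = Suc i then 1 else 0)" using that by (simp add: companion_def)
   then show "complex_of_real (companion n a $$ (i, j))*x j = (if j = Suc i then x j else 0)" by simp
  qed
  then show ?thesis using eq[rule_format, of i] that by simp
 qed
 have pw: "x i = \<mu> ^ i*x 0" if "i < n" for i
  using that by (induction i) (auto simp: shift)
 have x0: "x 0 ~= 0" using x pw by force
 have "(SUM j<n. complex_of_real (companion n a $$ (n - 1, j))*x j) = (SUM j<n. complex_of_real (a j)*\<mu> ^ j)*x 0"
  unfolding sum_distrib_right
 proof (rule sum.cong[OF refl])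
  fix j assume "j : {..<n}"
  then have j: "j < n" by simp
  have "companion n a $$ (n - 1, j) = a j" using n j by (simp add: companion_def)
  moreover note pw[OF j]
  ultimately show "complex_of_real (companion n a $$ (n - 1, j))*x j = complex_of_real (a j)*\<mu> ^ j*x 0" by (simp only: mult.assoc)
 qed
 also have "(SUM j<n. complex_of_real (companion n a $$ (n - 1, j))*x j) = \<mu>*x (n - 1)"
  using eq n by simp
 also have "... = \<mu> ^ n*x 0" using pw[of "n - 1"] n by (simp add: power_eq_if)
 finally show ?thesis using x0 by simp
qed

lemma companion_carrier: "companion n a : carrier_mat n n"
 by (simp add: companion_def)

section \<open>Controllability and injectivity of T\<close>

lemma controllable_independent:
 assumes M: "M : carrier_mat l l" and Q: "Q : carrier_mat l 1" and ctr: "controllable l M Q"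
  and c: "ALL i<l. (SUM j<l. ((M ^\<^sub>m j)*Q) $$ (i, 0)*c j) = 0"
 shows "ALL j<l. c j = 0"
proof (rule ccontr)
 assume nz: "~ (ALL j<l. c j = 0)"
 define R where "R = mat l l (%(i, j). ((M ^\<^sub>m j)*Q) $$ (i, 0))"
 have R: "R : carrier_mat l l" by (simp add: R_def)
 have "vec_space.rank l R = l" using ctr unfolding controllable_def R_def .
 then have "det R ~= 0" using vec_space.det_rank_iff[OF R] by simp
 moreover have "vec l c ~= 0\<^sub>v l" using nz by (auto simp: vec_eq_iff)
 moreover have "R *\<^sub>v vec l c = 0\<^sub>v l"
 proof (rule eq_vecI)
  fix i assume "i < dim_vec (0\<^sub>v l :: real Matrix.vec)"
  then have i: "i < l" by simp
  have "(R *\<^sub>v vec l c) $ i = (SUM j<l. R $$ (i, j)*vec l c $ j)"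
   by (rule index_mult_mat_vec_sum[OF R _ i]) simp
  also have "... = (SUM j<l. ((M ^\<^sub>m j)*Q) $$ (i, 0)*c j)"
   by (rule sum.cong[OF refl]) (use i in \<open>simp add: R_def\<close>)
  also have "... = 0" using c i by blast
  finally show "(R *\<^sub>v vec l c) $ i = (0\<^sub>v l :: real Matrix.vec) $ i" using i by simp
 qed (simp add: R_def)
 ultimately show False using det_0_iff_vec_prod_zero_field[OF R] vec_carrier by blast
qed

lemma sum_triangle_reindex:
 fixes f :: "nat => nat => 'a::comm_monoid_add"
 shows "(SUM k<=l. SUM j<k. f (k - 1 - j) j) = (SUM i<l. SUM j<l - i. f i j)"
proof (induction l)
 case (Suc l)
 have "(SUM i<Suc l. SUM j<Suc l - i. f i j) = (SUM i<Suc l. (SUM j<l - i. f i j) + f i (l - i))"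
  by (rule sum.cong[OF refl]) (simp add: Suc_diff_le)
 also have "... = (SUM i<l. SUM j<l - i. f i j) + (SUM i<Suc l. f i (l - i))"
  by (simp add: sum.distrib)
 also have "(SUM i<Suc l. f i (l - i)) = (SUM j<Suc l. f (l - j) j)"
  by (rule sum.reindex_bij_witness[of _ "%j. l - j" "%j. l - j"]) auto
 finally show ?case using Suc by (simp add: add.commute)
qed simp

text \<open>If \<open>T x = 0\<close>, pushing \<open>x\<close> through \<open>m(\<Phi>) = 0\<close> expresses \<open>0\<close> as a combination of the
 columns \<open>M\<^sup>i Q\<close> whose coefficients form a triangular (Hankel) system in \<open>x\<close>.\<close>
lemma sylvester_companion_injective:
 fixes T :: "nat => nat => real"
 assumes l: "0 < l" and M: "M : carrier_mat l l" and Q: "Q : carrier_mat l 1" and ctr: "controllable l M Q"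
  and T: "ALL i<l. ALL j<l. (SUM k<l. M $$ (i, k)*T k j) - (SUM k<l. T i k*companion l a $$ (k, j)) = - (Q $$ (i, 0)*(if j = 0 then 1 else 0))"
  and x: "ALL i<l. mv l T x i = 0"
 shows "ALL i<l. x i = 0"
proof -
 \<comment> \<open>The action of the companion matrix: a shift with feedback in the last
   entry.\<close>
 define \<phi> where "\<phi> y = (%i. if i = l - 1 then (SUM j<l. a j*y j) else y (Suc i))" for y :: "nat => real"
 have \<phi>: "(SUM j<l. companion l a $$ (i, j)*y j) = \<phi> y i" if "i < l" for y i
 proof (cases "i = l - 1")
  case True
  then show ?thesis using that by (auto simp: companion_def \<phi>_def intro!: sum.cong)
 next
  case False
  have "(SUM j<l. companion l a $$ (i, j)*y j) = (SUM j<l. if j = Suc i then y j else 0)"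
  proof (rule sum.cong[OF refl])
   fix j assume "j : {..<l}"
   then have "companion l a $$ (i, j) = (if j = Suc i then 1 else 0)" using that False by (simp add: companion_def)
   then show "companion l a $$ (i, j)*y j = (if j = Suc i then y j else 0)" by simp
  qed
  then show ?thesis using that False by (simp add: \<phi>_def)
 qed
 have T\<phi>: "mv l T (\<phi> y) i = (SUM k<l. M $$ (i, k)*mv l T y k) + Q $$ (i, 0)*y 0" if i: "i < l" for y i
 proof -
  have "mv l T (\<phi> y) i = (SUM k<l. T i k*(SUM j<l. companion l a $$ (k, j)*y j))"
   unfolding mv_def by (rule sum.cong[OF refl]) (simp add: \<phi>)
  also have "... = (SUM k<l. SUM j<l. T i k*companion l a $$ (k, j)*y j)"
   by (simp only: sum_distrib_left mult.assoc)
  also have "... = (SUM j<l. SUM k<l. T i k*companion l a $$ (k, j)*y j)" by (rule sum.swap)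
  also have "... = (SUM j<l. (SUM k<l. T i k*companion l a $$ (k, j))*y j)" by (simp only: sum_distrib_right)
  also have "... = (SUM j<l. ((SUM k<l. M $$ (i, k)*T k j) + Q $$ (i, 0)*(if j = 0 then 1 else 0))*y j)"
  proof (rule sum.cong[OF refl])
   fix j assume "j : {..<l}"
   then have "(SUM k<l. T i k*companion l a $$ (k, j)) = (SUM k<l. M $$ (i, k)*T k j) + Q $$ (i, 0)*(if j = 0 then 1 else 0)"
    using T[rule_format, OF i, of j] by simp
   then show "(SUM k<l. T i k*companion l a $$ (k, j))*y j = ((SUM k<l. M $$ (i, k)*T k j) + Q $$ (i, 0)*(if j = 0 then 1 else 0))*y j"
    by (simp only:)
  qed
  also have "... = (SUM j<l. SUM k<l. M $$ (i, k)*T k j*y j) + (SUM j<l. if j = 0 then Q $$ (i, 0)*y j else 0)"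
   unfolding sum.distrib[symmetric] by (rule sum.cong[OF refl]) (simp add: distrib_right sum_distrib_right)
  also have "(SUM j<l. SUM k<l. M $$ (i, k)*T k j*y j) = (SUM k<l. SUM j<l. M $$ (i, k)*T k j*y j)" by (rule sum.swap)
  also have "... = (SUM k<l. M $$ (i, k)*mv l T y k)" by (simp add: mv_def sum_distrib_left mult_ac)
  finally show ?thesis using l by simp
 qed
 define z where "z k = (\<phi> ^^ k) x" for k
 \<comment> \<open>The iterates under the companion matrix are windows of one recurrence sequence s,
   whose first l terms are the entries of x.\<close>
 define s where "s k = z k 0" for k
 have z0: "z 0 = x" and zS: "z (Suc k) = \<phi> (z k)" for k by (simp_all add: z_def)
 have zs: "z k i = s (k + i)" if "i < l" for k i
  using that
 proof (induction i arbitrary: k)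
  case (Suc i)
  have "z k (Suc i) = z (Suc k) i" using Suc.prems by (simp add: zS \<phi>_def)
  then show ?case using Suc by simp
 qed (simp add: s_def)
 have rec: "s (l + i) = (SUM j<l. a j*s (j + i))" for i
 proof -
  have "s (l + i) = z (Suc i) (l - 1)" using l by (simp add: zs add.commute)
  also have "... = (SUM j<l. a j*z i j)" by (simp add: zS \<phi>_def)
  finally show ?thesis by (simp add: zs add.commute)
 qed
 define \<alpha> where "\<alpha> k = (if k = l then 1 else - a k)" for k
 have ann: "(SUM k<=l. \<alpha> k*z k i) = 0" if "i < l" for i
 proof -
  have "(SUM k<=l. \<alpha> k*z k i) = (SUM k<l. \<alpha> k*z k i) + z l i"
   by (simp add: lessThan_Suc_atMost[symmetric] \<alpha>_def)
  also have "(SUM k<l. \<alpha> k*z k i) = - (SUM k<l. a k*s (k + i))"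
   unfolding sum_negf[symmetric] by (rule sum.cong[OF refl]) (simp add: \<alpha>_def zs that)
  finally show ?thesis using rec[of i] zs[OF that, of l] by simp
 qed
 define q where "q j i = ((M ^\<^sub>m j)*Q) $$ (i, 0)" for j i
 have q0: "q 0 i = Q $$ (i, 0)" if "i < l" for i using that Q M by (simp add: q_def)
 have qS: "q (Suc j) i = (SUM k<l. M $$ (i, k)*q j k)" if "i < l" for i j
 proof -
  have "M ^\<^sub>m Suc j*Q = M*(M ^\<^sub>m j*Q)"
   unfolding pow_mat_Suc_left[OF M] by (rule assoc_mult_mat[of _ l l _ l _ 1]) (use M Q in auto)
  then have "q (Suc j) i = (M*(M ^\<^sub>m j*Q)) $$ (i, 0)" by (simp only: q_def)
  also have "... = (SUM k<l. M $$ (i, k)*(M ^\<^sub>m j*Q) $$ (k, 0))"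
   by (rule index_mult_mat_sum[OF M _ that, of _ 1]) (use M Q in auto)
  finally show ?thesis by (simp only: q_def)
 qed
 \<comment> \<open>Since T x = 0, iterating T \<Phi> = M T + Q \<Gamma> leaves only the input
   contributions.\<close>
 have Tz: "ALL i<l. mv l T (z k) i = (SUM j<k. q (k - 1 - j) i*s j)" for k
 proof (induction k)
  case 0 then show ?case using x by (simp add: z0)
 next
  case (Suc k)
  show ?case
  proof (intro allI impI)
   fix i assume i: "i < l"
   have "mv l T (z (Suc k)) i = (SUM p<l. M $$ (i, p)*(SUM j<k. q (k - 1 - j) p*s j)) + Q $$ (i, 0)*s k"
    unfolding zS T\<phi>[OF i] using Suc by (simp add: s_def)
   also have "(SUM p<l. M $$ (i, p)*(SUM j<k. q (k - 1 - j) p*s j)) = (SUM p<l. SUM j<k. M $$ (i, p)*q (k - 1 - j) p*s j)"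
    by (simp only: sum_distrib_left mult.assoc)
   also have "... = (SUM j<k. SUM p<l. M $$ (i, p)*q (k - 1 - j) p*s j)" by (rule sum.swap)
   also have "... = (SUM j<k. q (Suc (k - 1 - j)) i*s j)" unfolding qS[OF i] by (simp only: sum_distrib_right)
   also have "... = (SUM j<k. q (Suc k - 1 - j) i*s j)" by (rule sum.cong[OF refl]) (simp add: Suc_diff_Suc)
   finally show "mv l T (z (Suc k)) i = (SUM j<Suc k. q (Suc k - 1 - j) i*s j)" using q0[OF i] by simp
  qed
 qed
 have key: "(SUM i<l. q i p*(SUM j<l - i. \<alpha> (i + j + 1)*s j)) = 0" if p: "p < l" for p
 proof -
  have "0 = mv l T (%i. SUM k<=l. \<alpha> k*z k i) p" unfolding mv_def using ann by simp
  also have "... = (SUM k<=l. \<alpha> k*mv l T (z k) p)"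
   unfolding mv_def sum_distrib_left by (subst sum.swap) (simp add: mult_ac)
  also have "... = (SUM k<=l. \<alpha> k*(SUM j<k. q (k - 1 - j) p*s j))" using Tz p by simp
  also have "... = (SUM k<=l. SUM j<k. (%i j. \<alpha> (i + j + 1)*(q i p*s j)) (k - 1 - j) j)"
   unfolding sum_distrib_left by (intro sum.cong refl) auto
  also have "... = (SUM i<l. SUM j<l - i. \<alpha> (i + j + 1)*(q i p*s j))" by (rule sum_triangle_reindex)
  also have "... = (SUM i<l. q i p*(SUM j<l - i. \<alpha> (i + j + 1)*s j))"
   by (simp add: sum_distrib_left mult_ac)
  finally show ?thesis by simp
 qed
 have hankel: "(SUM j<l - i. \<alpha> (i + j + 1)*s j) = 0" if "i < l" for i
 proof -
  have "ALL p<l. (SUM i<l. ((M ^\<^sub>m i)*Q) $$ (p, 0)*(SUM j<l - i. \<alpha> (i + j + 1)*s j)) = 0"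
   using key unfolding q_def by blast
  from controllable_independent[OF M Q ctr this] that show ?thesis by blast
 qed
 \<comment> \<open>Row l - 1 - j of the Hankel system contains s_j with the leading coefficient 1
   and otherwise only earlier terms.\<close>
 have "s j = 0" if "j < l" for j
  using that
 proof (induction j rule: less_induct)
  case (less j)
  have "l - (l - 1 - j) = Suc j" using less.prems by simp
  then have "(SUM k<Suc j. \<alpha> (l - 1 - j + k + 1)*s k) = 0" using hankel[of "l - 1 - j"] less.prems by simp
  moreover have "(SUM k<j. \<alpha> (l - 1 - j + k + 1)*s k) = 0"
   by (rule sum.neutral) (use less in auto)
  moreover have "\<alpha> (l - 1 - j + j + 1) = 1" using less.prems by (simp add: \<alpha>_def)
  ultimately show ?case by simp
 qed
 then show ?thesis using zs[of _ 0] z0 by simp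
qed

section \<open>Connected digraphs\<close>

text \<open>The depth is the length of a shortest path from the root; the last edge of such a path
  starts at a node of depth one less.\<close>

lemma spanning_tree_depth:
 assumes "spanning_tree N R"
 shows "EX dep :: nat => nat. dep 0 = 0 & (ALL i:{1..N}. dep i > 0 & (EX j. (j, i) : R & dep i = Suc (dep j)))"
proof -
 define dep where "dep i = (LEAST n. (0, i) : R ^^ n)" for i
 have d0: "dep 0 = 0" unfolding dep_def by (rule Least_eq_0) simp
 have "dep i > 0 & (EX j. (j, i) : R & dep i = Suc (dep j))" if i: "i : {1..N}" for i
 proof -
  have "(0, i) : R\<^sup>+" using assms i unfolding spanning_tree_def by blast
  then have ex: "EX n. (0, i) : R ^^ n" by (auto simp: trancl_power)
  have di: "(0, i) : R ^^ dep i" unfolding dep_def by (rule LeastI_ex[OF ex])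
  have pos: "dep i > 0"
  proof (rule ccontr)
   assume "~ dep i > 0"
   then have "i = 0" using di by simp
   then show False using i by simp
  qed
  then obtain n where n: "dep i = Suc n" by (cases "dep i") auto
  with di obtain j where j: "(0, j) : R ^^ n" "(j, i) : R" by auto
  have "dep j <= n" unfolding dep_def by (rule Least_le) (rule j(1))
  moreover have "dep i <= Suc (dep j)"
  proof -
   have "(0, j) : R ^^ dep j" unfolding dep_def by (rule LeastI[of _ n]) (rule j(1))
   then have "(0, i) : R ^^ Suc (dep j)" using j(2) by auto
   then show ?thesis unfolding dep_def by (rule Least_le)
  qed
  ultimately show ?thesis using pos n j(2) by (intro conjI exI[of _ j]) auto
 qed
 with d0 show ?thesis by (intro exI[of _ dep]) blast
qed

text \<open>Pinning the value 0 at the leader turns a row of \<open>H\<close> into a row of the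
  graph Laplacian on all N + 1 nodes.\<close>

lemma Hmat_sum:
 assumes i: "i < N" and E: "digraph N E"
 shows "(SUM j<N. Hmat N E $$ (i, j)*x (Suc j)) = (SUM k:{0..N}. adj E (Suc i) k*(x (Suc i) - (if k = 0 then 0 else x k)))"
  (is "_ = ?R")
proof -
 have ii: "adj E (Suc i) (Suc i) = 0" using E by (simp add: digraph_def adj_def)
 have ent: "Hmat N E $$ (i, j) = (if i = j then (SUM k:{0..N}. adj E (Suc i) k) else 0) - adj E (Suc i) (Suc j)" if "j < N" for j
  using i that ii by (cases "i = j") (simp_all add: Hmat_def)
 have "(SUM j<N. Hmat N E $$ (i, j)*x (Suc j)) = (SUM j<N. (if i = j then (SUM k:{0..N}. adj E (Suc i) k)*x (Suc j) else 0) - adj E (Suc i) (Suc j)*x (Suc j))"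
  by (rule sum.cong[OF refl]) (simp add: ent left_diff_distrib)
 also have "... = (SUM k:{0..N}. adj E (Suc i) k)*x (Suc i) - (SUM j<N. adj E (Suc i) (Suc j)*x (Suc j))"
  using i by (simp add: sum_subtractf)
 also have "(SUM j<N. adj E (Suc i) (Suc j)*x (Suc j)) = (SUM k:{0..N}. adj E (Suc i) k*(if k = 0 then 0 else x k))"
 proof -
  have "(SUM k:{0..N}. adj E (Suc i) k*(if k = 0 then 0 else x k)) = (SUM k<Suc N. adj E (Suc i) k*(if k = 0 then 0 else x k))"
   by (rule sum.cong) auto
  then show ?thesis by (simp only: sum.lessThan_Suc_shift) simp
 qed
 finally show ?thesis by (simp add: right_diff_distrib sum_subtractf sum_distrib_right)
qed

lemma Hmat_carrier: "Hmat N E : carrier_mat N N"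
 by (simp add: Hmat_def)

text \<open>Along a spanning tree the vector \<open>1 - \<epsilon>\<^sup>d\<^sup>e\<^sup>p\<^sup>t\<^sup>h\<close> is mapped by \<open>H\<close> to a positive vector.\<close>
lemma Hmat_positive_vector:
 assumes E: "digraph N E" and conn: "connected_digraph N E"
 shows "EX x. (ALL i<N. x i > 0) & (ALL i<N. (SUM j<N. Hmat N E $$ (i, j)*x j) > (0::real))"
proof -
 obtain R where R: "R \<subseteq> E" "spanning_tree N R" using conn unfolding connected_digraph_def by blast
 obtain dep :: "nat => nat" where d0: "dep 0 = 0"
  and dep: "ALL i:{1..N}. dep i > 0 & (EX j. (j, i) : R & dep i = Suc (dep j))"
  using spanning_tree_depth[OF R(2)] by blast
 \<comment> \<open>With e the power of \<epsilon> at the tree parent, the parent contributes e -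
   \<epsilon> e to the row sum, and each of the at most N other neighbours costs at most \<epsilon>
   e; this value of \<epsilon> makes the total positive.\<close>
 define \<epsilon> where "\<epsilon> = 1 / (real N + 3)"
 have \<epsilon>: "\<epsilon> > 0" "\<epsilon> < 1" "\<epsilon>*(real N + 2) < 1" by (auto simp: \<epsilon>_def field_simps)
 define x where "x i = 1 - \<epsilon> ^ dep i" for i
 have x0: "x 0 = 0" by (simp add: x_def d0)
 have pos: "x (Suc i) > 0" if "i < N" for i
  using dep that \<epsilon> power_Suc_less_one[of \<epsilon>] by (auto simp: x_def power_less_one_iff)
 have "(SUM j<N. Hmat N E $$ (i, j)*x (Suc j)) > 0" if i: "i < N" for i
 proof -
  have "(SUM j<N. Hmat N E $$ (i, j)*x (Suc j)) = (SUM k:{0..N}. adj E (Suc i) k*(x (Suc i) - x k))"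
   unfolding Hmat_sum[OF i E] by (rule sum.cong[OF refl]) (simp add: x0)
  also have "... > 0"
  proof -
   have "Suc i : {1..N}" using i by simp
   with dep obtain j where j: "(j, Suc i) : R" "dep (Suc i) = Suc (dep j)" by blast
   define e where "e = \<epsilon> ^ dep j"
   have e: "e > 0" using \<epsilon> by (simp add: e_def)
   have jN: "j : {0..N}" using j(1) R(1) E unfolding digraph_def by auto
   have aj: "adj E (Suc i) j = 1" using j(1) R(1) by (auto simp: adj_def)
   have xi: "x (Suc i) = 1 - \<epsilon>*e" by (simp add: x_def j(2) e_def)
   have ge: "adj E (Suc i) k*(x (Suc i) - x k) >= - (\<epsilon>*e)" for k
   proof -
    have "x (Suc i) - x k >= - (\<epsilon>*e)" using \<epsilon> unfolding xi by (simp add: x_def)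
    moreover have "0 <= \<epsilon>*e" using \<epsilon> e by simp
    ultimately show ?thesis by (simp add: adj_def)
   qed
   have "(SUM k:{0..N}. adj E (Suc i) k*(x (Suc i) - x k)) = adj E (Suc i) j*(x (Suc i) - x j) + (SUM k:{0..N} - {j}. adj E (Suc i) k*(x (Suc i) - x k))"
    by (rule sum.remove) (use jN in auto)
   also have "(SUM k:{0..N} - {j}. adj E (Suc i) k*(x (Suc i) - x k)) >= (SUM k:{0..N} - {j}. - (\<epsilon>*e))"
    by (rule sum_mono) (rule ge)
   moreover have "(SUM k:{0..N} - {j}. - (\<epsilon>*e)) = - (real N*(\<epsilon>*e))"
    using jN by (simp add: card_Diff_singleton)
   moreover have "adj E (Suc i) j*(x (Suc i) - x j) = e - \<epsilon>*e" by (simp add: aj xi) (simp add: x_def e_def)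
   moreover have "e - \<epsilon>*e - real N*(\<epsilon>*e) > 0"
   proof -
    have "\<epsilon> + real N*\<epsilon> < 1" using \<epsilon> by (simp add: algebra_simps)
    then have "(\<epsilon> + real N*\<epsilon>)*e < 1*e" using e by (intro mult_strict_right_mono) auto
    then show ?thesis by (simp add: algebra_simps)
   qed
   ultimately show ?thesis by linarith
  qed
  finally show ?thesis .
 qed
 with pos show ?thesis by (intro exI[of _ "%i. x (Suc i)"]) blast
qed

section \<open>Diagonal weighting of \<open>H\<close>\<close>

lemma Hmat_offdiag: "i < N ==> j < N ==> i ~= j ==> Hmat N E $$ (i, j) <= 0"
 by (simp add: Hmat_def adj_def)

text \<open>At an index i minimising v_i / x_i with a negative minimum q, the nonpositive
  off-diagonal entries give (h v)_i \<le> q (h x)_i < 0.\<close>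

lemma Z_matrix_monotone:
 fixes h :: "nat => nat => real"
 assumes off: "ALL i<N. ALL j<N. i ~= j --> h i j <= 0"
  and x: "ALL i<N. x i > 0" "ALL i<N. (SUM j<N. h i j*x j) > 0"
  and v: "ALL i<N. (SUM j<N. h i j*v j) >= 0"
 shows "ALL i<N. v i >= 0"
proof (rule ccontr)
 assume "~ (ALL i<N. v i >= 0)"
 then obtain i1 where i1: "i1 < N" "v i1 < 0" by force
 define q where "q = Min ((%i. v i / x i) ` {..<N})"
 have fin: "finite ((%i. v i / x i) ` {..<N})" "(%i. v i / x i) ` {..<N} ~= {}" using i1 by auto
 have "q : (%i. v i / x i) ` {..<N}" unfolding q_def by (rule Min_in[OF fin])
 then obtain i where i: "i < N" "q = v i / x i" by auto
 have qle: "q*x j <= v j" if "j < N" for j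
 proof -
  have "q <= v j / x j" unfolding q_def by (rule Min_le[OF fin(1)]) (use that in auto)
  then show ?thesis using x(1) that by (simp add: field_simps)
 qed
 have "q < 0"
 proof -
  have "q*x i1 < 0" using qle[OF i1(1)] i1(2) by linarith
  then show ?thesis using x(1) i1(1) by (simp add: mult_less_0_iff) (metis less_asym)
 qed
 have "(SUM j<N. h i j*v j) <= (SUM j<N. h i j*(q*x j))"
 proof (rule sum_mono)
  fix j assume "j : {..<N}"
  then have j: "j < N" by simp
  show "h i j*v j <= h i j*(q*x j)"
  proof (cases "i = j")
   case True
   have "x i ~= 0" using x(1) i(1) by (metis less_irrefl)
   then have "v i = q*x i" using i(2) by simp
   then show ?thesis using True by simp
  next
   case False
   then have "h i j <= 0" using off i(1) j by blast
   then show ?thesis by (rule mult_left_mono_neg[OF qle[OF j]])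
  qed
 qed
 also have "... = q*(SUM j<N. h i j*x j)" by (simp add: sum_distrib_left mult_ac)
 also have "... < 0" using \<open>q < 0\<close> x(2) i(1) by (intro mult_neg_pos) auto
 finally show False using v i(1) by (meson not_le)
qed

text \<open>\<open>H\<close> is a nonsingular M-matrix: its inverse is nonnegative, with column sums
  y. Besides x with H x > 0 this gives a positive y with y^T H = (1, ..., 1). The weights y_i / x_i
  make the symmetric part of the weighted \<open>H\<close> positive definite: after the substitution
  v_i = x_i u_i the off-diagonal entries are nonpositive while all row and column sums are
  positive.\<close>

lemma Hmat_dissipative:
 assumes E: "digraph N E" and conn: "connected_digraph N E"
 shows "EX d c. c > 0 & (ALL i<N. d i > 0) &
  (ALL v::nat => real. c*(SUM i<N. (v i)^2) <= (SUM i<N. d i*v i*(SUM j<N. Hmat N E $$ (i, j)*v j)))"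
proof -
 define h where "h i j = Hmat N E $$ (i, j)" for i j
 obtain x where x: "ALL i<N. x i > 0" "ALL i<N. (SUM j<N. h i j*x j) > 0"
  using Hmat_positive_vector[OF E conn] unfolding h_def by blast
 have off: "ALL i<N. ALL j<N. i ~= j --> h i j <= 0" using Hmat_offdiag unfolding h_def by blast
 have mono: "ALL i<N. v i >= 0" if "ALL i<N. (SUM j<N. h i j*v j) >= 0" for v
  by (rule Z_matrix_monotone[OF off x that])
 have inj: "ALL i<N. v i = 0" if "ALL i<N. mv N h v i = 0" for v
 proof -
  have "ALL i<N. v i >= 0" by (rule mono) (use that in \<open>simp add: mv_def\<close>)
  moreover have "ALL i<N. - v i >= 0" by (rule mono) (use that in \<open>simp add: mv_def sum_negf\<close>)
  ultimately show ?thesis by force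
 qed
 have "ALL b. EX v. ALL i<N. mv N h v i = (if i = b then 1 else 0)" 
 proof
  fix b
  show "EX v. ALL i<N. mv N h v i = (if i = b then 1 else 0)"
   by (rule linear_system_solvable) (rule inj)
 qed
 from choice[OF this] obtain g where g: "ALL b. ALL i<N. mv N h (g b) i = (if i = b then 1 else 0)" by blast
 have g0: "ALL i<N. g b i >= 0" for b
  by (rule mono) (use g in \<open>simp add: mv_def\<close>)
 text \<open>\<open>g b\<close> is column \<open>b\<close> of the inverse.\<close>
 define y where "y b = (SUM i<N. g b i)" for b
 have hg: "(SUM b<N. g b i*h b j) = (if i = j then 1 else 0)" if ij: "i < N" "j < N" for i j
 proof -
  define u where "u i = (SUM b<N. g b i*h b j) - (if i = j then 1 else 0)" for i
  have "mv N h u k = 0" if k: "k < N" for k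
  proof -
   have "mv N h u k = (SUM i<N. SUM b<N. h k i*g b i*h b j) - (SUM i<N. h k i*(if i = j then 1 else 0))"
    unfolding mv_def u_def by (simp add: right_diff_distrib sum_subtractf sum_distrib_left mult_ac)
   also have "(SUM i<N. SUM b<N. h k i*g b i*h b j) = (SUM b<N. SUM i<N. h k i*g b i*h b j)" by (rule sum.swap)
   also have "... = (SUM b<N. mv N h (g b) k*h b j)" by (simp only: mv_def sum_distrib_right)
   also have "... = (SUM b<N. if b = k then h b j else 0)" by (rule sum.cong[OF refl]) (use g k in auto)
   finally show ?thesis using k ij by (simp add: if_distrib[of "%t. _*t"] cong: if_cong)
  qed
  then have "u i = 0" using inj[of u] ij by blast
  then show ?thesis by (simp add: u_def)
 qed
 have ycol: "(SUM b<N. y b*h b j) = 1" if "j < N" for j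
 proof -
  have "(SUM b<N. y b*h b j) = (SUM i<N. SUM b<N. g b i*h b j)"
   unfolding y_def sum_distrib_right by (rule sum.swap)
  also have "... = (SUM i<N. if i = j then 1 else 0)" by (rule sum.cong[OF refl]) (use hg that in auto)
  finally show ?thesis using that by simp
 qed
 \<comment> \<open>A column of the inverse is nonnegative and not zero, so its sum is
   positive.\<close>
 have ypos: "y b > 0" if b: "b < N" for b
 proof (rule ccontr)
  assume "~ y b > 0"
  then have "y b = 0" using sum_nonneg[of "{..<N}" "g b"] g0 unfolding y_def by force
  then have "ALL i:{..<N}. g b i = 0" unfolding y_def using g0 by (subst (asm) sum_nonneg_eq_0_iff) auto
  then have "mv N h (g b) b = 0" by (simp add: mv_def)
  then show False using g b by simp
 qed
 define d where "d i = y i / x i" for i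
 \<comment> \<open>Half of the i-th row sum plus column sum of the matrix \<open>G\<close> below,
   divided by x_i^2: what remains once every product u_i u_j is replaced by the mean of the
   squares.\<close>
 define \<rho> where "\<rho> i = (y i*(SUM j<N. h i j*x j) + x i) / (2*(x i)^2)" for i
 have \<rho>: "\<rho> i > 0" if "i : {..<N}" for i
 proof -
  have i: "i < N" using that by simp
  have "y i*(SUM j<N. h i j*x j) > 0" using x(2) ypos[OF i] i by simp
  moreover have "x i > 0" using x(1) i by blast
  ultimately show ?thesis unfolding \<rho>_def by (intro divide_pos_pos add_pos_pos) auto
 qed
 obtain c where c: "c > 0" "!!i. i : {..<N} ==> c <= \<rho> i"
  by (rule finite_pos_lower_bound[of "{..<N}" \<rho>]) (use \<rho> in auto)
 have "c*(SUM i<N. (v i)^2) <= (SUM i<N. d i*v i*(SUM j<N. h i j*v j))" for v :: "nat => real"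
 proof -
  define u where "u i = v i / x i" for i
  have v: "v i = x i*u i" if "i < N" for i using x(1) that by (simp add: u_def less_imp_neq[symmetric])
  define G where "G i j = y i*h i j*x j" for i j
  have "(SUM i<N. d i*v i*(SUM j<N. h i j*v j)) = (SUM i<N. SUM j<N. G i j*(u i*u j))"
  proof (rule sum.cong[OF refl])
   fix i assume "i : {..<N}"
   then have i: "i < N" by simp
   have dv: "d i*v i = y i*u i" using x(1) i by (simp add: d_def u_def)
   show "d i*v i*(SUM j<N. h i j*v j) = (SUM j<N. G i j*(u i*u j))"
    unfolding dv sum_distrib_left by (rule sum.cong[OF refl]) (simp add: G_def v)
  qed
  also have "... >= (SUM i<N. SUM j<N. G i j*(((u i)^2 + (u j)^2) / 2))"
  proof (rule sum_mono, rule sum_mono)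
   fix i j assume "i : {..<N}" "j : {..<N}"
   then have ij: "i < N" "j < N" by auto
   show "G i j*(((u i)^2 + (u j)^2) / 2) <= G i j*(u i*u j)"
   proof (cases "i = j")
    case True then show ?thesis by (simp add: power2_eq_square)
   next
    case False
    then have "y i*x j*h i j <= 0" using off ij ypos[OF ij(1)] x(1) by (intro mult_nonneg_nonpos) auto
    then have "G i j <= 0" by (simp add: G_def mult_ac)
    moreover have "u i*u j <= ((u i)^2 + (u j)^2) / 2" using sum_squares_bound[of "u i" "u j"] by simp
    ultimately show ?thesis by (rule mult_left_mono_neg[rotated])
   qed
  qed
  moreover have "(SUM i<N. SUM j<N. G i j*(((u i)^2 + (u j)^2) / 2)) = (SUM i<N. \<rho> i*(v i)^2)"
  proof -
   have "(SUM i<N. SUM j<N. G i j*(((u i)^2 + (u j)^2) / 2)) = (SUM i<N. SUM j<N. G i j*(u i)^2 / 2) + (SUM i<N. SUM j<N. G i j*(u j)^2 / 2)"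
    by (simp only: sum.distrib distrib_left add_divide_distrib times_divide_eq_right)
   also have "(SUM i<N. SUM j<N. G i j*(u j)^2 / 2) = (SUM j<N. SUM i<N. G i j*(u j)^2 / 2)" by (rule sum.swap)
   also have "(SUM i<N. SUM j<N. G i j*(u i)^2 / 2) + (SUM j<N. SUM i<N. G i j*(u j)^2 / 2)
     = (SUM i<N. ((SUM j<N. G i j) + (SUM j<N. G j i))*(u i)^2 / 2)"
    by (simp only: sum.distrib sum_distrib_right sum_divide_distrib distrib_right add_divide_distrib)
   also have "... = (SUM i<N. \<rho> i*(v i)^2)"
   proof (rule sum.cong[OF refl])
    fix i assume "i : {..<N}"
    then have i: "i < N" by simp
    have "(SUM j<N. G i j) = y i*(SUM j<N. h i j*x j)" by (simp add: G_def sum_distrib_left mult_ac)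
    moreover have "(SUM j<N. G j i) = x i"
     using ycol[OF i] by (simp add: G_def flip: sum_distrib_right)
    moreover have "(v i)^2 = (x i)^2*(u i)^2" by (simp add: v[OF i] power_mult_distrib)
    moreover have "x i ~= 0" using x(1) i by auto
    ultimately show "((SUM j<N. G i j) + (SUM j<N. G j i))*(u i)^2 / 2 = \<rho> i*(v i)^2"
     by (simp add: \<rho>_def)
   qed
   finally show ?thesis .
  qed
  moreover have "c*(SUM i<N. (v i)^2) <= (SUM i<N. \<rho> i*(v i)^2)"
   unfolding sum_distrib_left by (intro sum_mono mult_right_mono) (use c in auto)
  ultimately show ?thesis by linarith
 qed
 moreover have "ALL i<N. d i > 0" using x(1) ypos by (simp add: d_def)
 ultimately show ?thesis using c(1) unfolding h_def by blast
qed

section \<open>High-gain feedback\<close>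

text \<open>Collects what the eigenvalue argument takes from the plant: one bound B for all
  coefficients, one constant R for the resolvents of the four stable blocks on the closed right
  half-plane, and the weighted dissipativity of \<open>H\<close>. The constants do not depend on w
  or \<mu>, so neither do the thresholds for the gains.\<close>

locale high_gain =
 fixes W :: "'w set" and N r m l :: nat
  and a1 :: "'w => nat => nat => nat => real" and a2 a3 c :: "'w => nat => nat => real" and b :: "'w => nat => real"
  and M :: "nat => nat => real" and Q \<psi> gam del :: "nat => real" and H :: "nat => nat => real" and d :: "nat => real"
  and B R cH :: real
 assumes r: "1 <= r" and B: "1 <= B" and R: "0 <= R" and cH: "0 < cH"
  and a2_le: "!!w i j. w : W ==> i < N ==> j < m ==> \<bar>a2 w i j\<bar> <= B"
  and a3_le: "!!w i j. w : W ==> i < N ==> j < m ==> \<bar>a3 w i j\<bar> <= B"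
  and c_le: "!!w i s. w : W ==> i < N ==> s < r ==> \<bar>c w i s\<bar> <= B"
  and b_pos: "!!w i. w : W ==> i < N ==> 0 < b w i"
  and b_le: "!!w i. w : W ==> i < N ==> b w i <= B"
  and b_inv_le: "!!w i. w : W ==> i < N ==> 1 / b w i <= B"
  and M_le: "!!i j. i < l ==> j < l ==> \<bar>M i j\<bar> <= B"
  and Q_le: "!!i. i < l ==> \<bar>Q i\<bar> <= B" and \<psi>_le: "!!i. i < l ==> \<bar>\<psi> i\<bar> <= B"
  and gam_le: "!!s. s < r ==> \<bar>gam s\<bar> <= B"
  and H_le: "!!i j. i < N ==> j < N ==> \<bar>H i j\<bar> <= B"
  and d_pos: "!!i. i < N ==> 0 < d i" and d_le: "!!i. i < N ==> d i <= B"
  and diss: "!!v :: nat => real. cH*(SUM i<N. (v i)^2) <= (SUM i<N. d i*v i*(SUM j<N. H i j*v j))"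
  and res_a1: "!!w i \<mu> x f. w : W ==> i < N ==> Re \<mu> >= 0 ==>
   (ALL j<m. \<mu>*x j = (SUM k<m. of_real (a1 w i j k)*x k) + f j) ==> (SUM j<m. cmod (x j)) <= R*(SUM j<m. cmod (f j))"
  and res_M: "!!\<mu> x f. Re \<mu> >= 0 ==>
   (ALL j<l. \<mu>*x j = (SUM k<l. of_real (M j k)*x k) + f j) ==> (SUM j<l. cmod (x j)) <= R*(SUM j<l. cmod (f j))"
  and res_gam: "!!\<mu> x f. Re \<mu> >= 0 ==>
   (ALL s<r - 1. \<mu>*x s = (if s = r - 2 then - (SUM j<r - 1. of_real (gam j)*x j) else x (s + 1)) + f s) ==>
   (SUM s<r - 1. cmod (x s)) <= R*(SUM s<r - 1. cmod (f s))"
  and res_del: "!!\<mu> x f. Re \<mu> >= 0 ==>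
   (ALL s<r. \<mu>*x s = - of_real (del (r - 1 - s))*x 0 + (if s + 1 < r then x (s + 1) else 0) + f s) ==>
   (SUM s<r. cmod (x s)) <= R*(SUM s<r. cmod (f s))"
begin

definition om :: "nat => real" where "om s = (if s = r - 1 then 1 else gam s)"

text \<open>Gains from \<theta> to the blocks: \<open>C1\<close> for \<xi>, \<open>C2\<close> for z,
  \<open>C3\<close> for the input-free part \<phi> of the \<theta> equation, \<open>C4\<close> and
  \<open>C5\<close> for the shifted and the original \<eta>, \<open>C6\<close> for \<phi> together
  with the feedback of \<eta>; \<open>C9\<close> is the gain from the observer error to \<theta>.
  \<open>GK\<close> bounds the forcing of the observer error and grows with K.\<close>

definition C1 :: real where "C1 = R + 1 + B*R"
definition C2 :: real where "C2 = R*(real m*B*C1)"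
definition C3 :: real where "C3 = B*C2 + B*C1 + B*C1"
definition C4 :: real where "C4 = R*(real l*(B*(real l*B*B + B*C3)))"
definition C5 :: real where "C5 = C4 + real l*B*B"
definition C6 :: real where "C6 = C3 + B*B*C5"
definition C9 :: real where "C9 = real N*(2*B*B / cH)"
definition GK :: "real => real" where "GK K = B*(B*C2 + B*C1 + B*B*C5 + B*K*B + real N*(B*K*B))"

lemma B0: "0 <= B" using B by simp

lemma C_nonneg: "0 <= C1" "0 <= C2" "0 <= C3" "0 <= C4" "0 <= C5" "0 <= C6" "0 <= C9"
 using B0 R cH by (simp_all add: C1_def C2_def C3_def C4_def C5_def C6_def C9_def)

lemma om_le: "s < r ==> \<bar>om s\<bar> <= B"
 using gam_le B by (simp add: om_def)

lemma weighted_sum_le: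
 fixes x :: "nat => complex"
 assumes "!!k. k < n ==> \<bar>a k\<bar> <= B"
 shows "cmod (SUM k<n. of_real (a k)*x k) <= B*(SUM k<n. cmod (x k))"
proof -
 have "cmod (SUM k<n. of_real (a k)*x k) <= (SUM k<n. cmod (of_real (a k)*x k))" by (rule norm_sum)
 also have "... <= (SUM k<n. B*cmod (x k))"
  by (rule sum_mono) (use assms in \<open>simp add: norm_mult mult_right_mono\<close>)
 finally show ?thesis by (simp add: sum_distrib_left)
qed

end

text \<open>An eigenvector equation for \<mu> in the closed right half-plane, written agent by
  agent; the aim is that all components vanish. Taking h at least 1 lets unscaled observer errors be
  bounded by scaled ones.\<close>

locale high_gain_eig = high_gain +
 fixes w and K h :: real and \<mu> :: complex and z \<xi> \<eta> \<zeta> :: "nat => nat => complex"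
 assumes w: "w : W" and \<mu>: "0 <= Re \<mu>" and K0: "0 < K" and h1: "1 <= h"
  and eq_z: "!!i j. i < N ==> j < m ==> \<mu>*z i j = (SUM k<m. of_real (a1 w i j k)*z i k) + of_real (a2 w i j)*\<xi> i 0"
  and eq_\<xi>: "!!i s. i < N ==> s + 1 < r ==> \<mu>*\<xi> i s = \<xi> i (s + 1)"
  and eq_\<xi>r: "!!i. i < N ==> \<mu>*\<xi> i (r - 1) = (SUM k<m. of_real (a3 w i k)*z i k) + (SUM s<r. of_real (c w i s)*\<xi> i s)
   + of_real (b w i)*((SUM k<l. of_real (\<psi> k)*\<eta> i k) - of_real K*(SUM s<r. of_real (om s)*\<zeta> i s))"
  and eq_\<eta>: "!!i k. i < N ==> k < l ==> \<mu>*\<eta> i k = (SUM q<l. of_real (M k q)*\<eta> i q)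
   + of_real (Q k)*((SUM k<l. of_real (\<psi> k)*\<eta> i k) - of_real K*(SUM s<r. of_real (om s)*\<zeta> i s))"
  and eq_\<zeta>: "!!i s. i < N ==> s < r ==> \<mu>*\<zeta> i s = of_real (h ^ (s + 1)*del (r - 1 - s))*((SUM j<N. of_real (H i j)*\<xi> j 0) - \<zeta> i 0)
   + (if s + 1 < r then \<zeta> i (s + 1) else 0)"
begin

text \<open>\<theta> has relative degree one with respect to the input, and stability of the
  polynomial \<gamma> lets it dominate the whole chain \<xi>. \<phi> is the part of \<mu> \<theta>
  that does not come from the input.\<close>

definition \<theta> :: "nat => complex" where "\<theta> i = (SUM s<r. of_real (om s)*\<xi> i s)"
definition \<phi> :: "nat => complex" where "\<phi> i = (SUM k<m. of_real (a3 w i k)*z i k) + (SUM s<r. of_real (c w i s)*\<xi> i s) + (SUM s<r - 1. of_real (gam s)*\<xi> i (s + 1))"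
definition U :: "nat => complex" where "U i = (SUM k<l. of_real (\<psi> k)*\<eta> i k) - of_real K*(SUM s<r. of_real (om s)*\<zeta> i s)"
definition \<kappa> :: "nat => nat => complex" where "\<kappa> i s = \<zeta> i s - (SUM j<N. of_real (H i j)*\<xi> j s)"
definition kn :: "nat => real" where "kn i = (SUM s<r. cmod (\<kappa> i s))"

lemma split_last: "(SUM s<r. f s) = (SUM s<r - 1. f s) + (f (r - 1) :: 'b::comm_monoid_add)"
 using r by (cases r) auto

lemma om_sum: "(SUM s<r. of_real (om s)*f s) = (SUM s<r - 1. of_real (gam s)*f s) + (f (r - 1) :: complex)"
proof -
 have "(SUM s<r - 1. of_real (om s)*f s) = (SUM s<r - 1. of_real (gam s)*f s)"
  by (rule sum.cong[OF refl]) (simp add: om_def)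
 then show ?thesis unfolding split_last by (simp add: om_def)
qed

text \<open>The first r - 1 entries of \<xi> form a companion system of the stable polynomial
  \<gamma>, driven by \<theta> in its last row; the remaining entry is \<theta> minus a combination
  of the others.\<close>

lemma \<xi>_le: assumes i: "i < N" shows "(SUM s<r. cmod (\<xi> i s)) <= C1*cmod (\<theta> i)"
proof -
 define f where "f s = (if s = r - 2 then \<theta> i else 0)" for s
 have fsum: "(SUM s<r - 1. cmod (f s)) <= cmod (\<theta> i)"
 proof -
  have "(SUM s<r - 1. cmod (f s)) = (SUM s<r - 1. if s = r - 2 then cmod (\<theta> i) else 0)"
   by (rule sum.cong[OF refl]) (simp add: f_def)
  then show ?thesis by simp
 qed
 have last: "\<xi> i (r - 1) = \<theta> i - (SUM s<r - 1. of_real (gam s)*\<xi> i s)"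
  unfolding \<theta>_def om_sum by simp
 have "ALL s<r - 1. \<mu>*\<xi> i s = (if s = r - 2 then - (SUM j<r - 1. of_real (gam j)*\<xi> i j) else \<xi> i (s + 1)) + f s"
 proof (intro allI impI)
  fix s assume s: "s < r - 1"
  then have e: "\<mu>*\<xi> i s = \<xi> i (s + 1)" by (intro eq_\<xi>[OF i]) simp
  show "\<mu>*\<xi> i s = (if s = r - 2 then - (SUM j<r - 1. of_real (gam j)*\<xi> i j) else \<xi> i (s + 1)) + f s"
  proof (cases "s = r - 2")
   case True
   then have "s + 1 = r - 1" using s by simp
   then show ?thesis using e last True by (simp add: f_def)
  next
   case False then show ?thesis using e by (simp add: f_def)
  qed
 qed
 from res_gam[OF \<mu> this] have 1: "(SUM s<r - 1. cmod (\<xi> i s)) <= R*cmod (\<theta> i)"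
  using fsum R by (meson mult_left_mono order_trans)
 have "cmod (SUM s<r - 1. of_real (gam s)*\<xi> i s) <= B*(SUM s<r - 1. cmod (\<xi> i s))"
  by (rule weighted_sum_le) (use gam_le in simp)
 also have "... <= B*(R*cmod (\<theta> i))" using 1 B0 by (rule mult_left_mono)
 finally have "cmod (\<xi> i (r - 1)) <= cmod (\<theta> i) + B*(R*cmod (\<theta> i))"
  unfolding last using norm_triangle_ineq4[of "\<theta> i" "SUM s<r - 1. of_real (gam s)*\<xi> i s"] by linarith
 with 1 show ?thesis unfolding split_last C1_def by (simp add: algebra_simps)
qed

lemma \<xi>0_le: assumes i: "i < N" shows "cmod (\<xi> i 0) <= C1*cmod (\<theta> i)"
proof -
 have "cmod (\<xi> i 0) <= (SUM s<r. cmod (\<xi> i s))" by (rule member_le_sum) (use r in auto)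
 then show ?thesis using \<xi>_le[OF i] by linarith
qed

lemma z_le: assumes i: "i < N" shows "(SUM j<m. cmod (z i j)) <= C2*cmod (\<theta> i)"
proof -
 have "(SUM j<m. cmod (z i j)) <= R*(SUM j<m. cmod (of_real (a2 w i j)*\<xi> i 0))"
  by (rule res_a1[OF w i \<mu>]) (use eq_z[OF i] in simp)
 also have "... <= R*(SUM j<m. B*(C1*cmod (\<theta> i)))"
  using a2_le[OF w i] \<xi>0_le[OF i] B0 R
  by (intro mult_left_mono sum_mono) (auto simp: norm_mult intro!: mult_mono)
 also have "... = C2*cmod (\<theta> i)" by (simp add: C2_def)
 finally show ?thesis .
qed

lemma \<phi>_le: assumes i: "i < N" shows "cmod (\<phi> i) <= C3*cmod (\<theta> i)"
proof -
 have 1: "cmod (SUM k<m. of_real (a3 w i k)*z i k) <= B*(C2*cmod (\<theta> i))"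
  by (rule order_trans[OF weighted_sum_le mult_left_mono[OF z_le[OF i] B0]]) (rule a3_le[OF w i])
 have 2: "cmod (SUM s<r. of_real (c w i s)*\<xi> i s) <= B*(C1*cmod (\<theta> i))"
  by (rule order_trans[OF weighted_sum_le mult_left_mono[OF \<xi>_le[OF i] B0]]) (rule c_le[OF w i])
 have "cmod (SUM s<r - 1. of_real (gam s)*\<xi> i (s + 1)) <= B*(SUM s<r - 1. cmod (\<xi> i (s + 1)))"
  by (rule weighted_sum_le) (use gam_le in simp)
 also have "(SUM s<r - 1. cmod (\<xi> i (s + 1))) <= (SUM s<r. cmod (\<xi> i s))"
 proof -
  obtain r' where r': "r = Suc r'" using r by (cases r) auto
  show ?thesis unfolding r' sum.lessThan_Suc_shift by simp
 qed
 finally have 3: "cmod (SUM s<r - 1. of_real (gam s)*\<xi> i (s + 1)) <= B*(C1*cmod (\<theta> i))"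
  using mult_left_mono[OF \<xi>_le[OF i] B0] B0 by (smt (verit) mult_left_mono)
 show ?thesis unfolding \<phi>_def C3_def
  using 1 2 3 norm_triangle_ineq[of "(SUM k<m. of_real (a3 w i k)*z i k) + (SUM s<r. of_real (c w i s)*\<xi> i s)" "SUM s<r - 1. of_real (gam s)*\<xi> i (s + 1)"]
   norm_triangle_ineq[of "SUM k<m. of_real (a3 w i k)*z i k" "SUM s<r. of_real (c w i s)*\<xi> i s"]
  by (simp add: algebra_simps)
qed

lemma eq_\<theta>: assumes i: "i < N" shows "\<mu>*\<theta> i = \<phi> i + of_real (b w i)*U i"
proof -
 have "\<mu>*\<theta> i = (SUM s<r - 1. of_real (gam s)*(\<mu>*\<xi> i s)) + \<mu>*\<xi> i (r - 1)"
  unfolding \<theta>_def om_sum by (simp add: distrib_left sum_distrib_left mult_ac)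
 also have "(SUM s<r - 1. of_real (gam s)*(\<mu>*\<xi> i s)) = (SUM s<r - 1. of_real (gam s)*\<xi> i (s + 1))"
  by (rule sum.cong[OF refl]) (use eq_\<xi>[OF i] in auto)
 finally show ?thesis unfolding \<phi>_def U_def eq_\<xi>r[OF i] by simp
qed

text \<open>The shifted state \<eta> - Q \<theta> / b no longer contains the input, so the resolvent
  of M bounds it by \<theta> and \<phi> with a constant free of K.\<close>

lemma \<eta>_le: assumes i: "i < N" shows "(SUM k<l. cmod (\<eta> i k)) <= C5*cmod (\<theta> i)"
proof -
 define \<beta> where "\<beta> = 1 / b w i"
 have \<beta>: "0 <= \<beta>" "\<beta> <= B" using b_pos[OF w i] b_inv_le[OF w i] by (auto simp: \<beta>_def)
 have \<beta>b: "complex_of_real \<beta>*of_real (b w i) = 1" using b_pos[OF w i] by (simp add: \<beta>_def)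
 define e where "e k = \<eta> i k - of_real (Q k*\<beta>)*\<theta> i" for k
 define f where "f k = of_real \<beta>*((SUM q<l. of_real (M k q)*of_real (Q q))*\<theta> i - of_real (Q k)*\<phi> i)" for k
 have "ALL k<l. \<mu>*e k = (SUM q<l. of_real (M k q)*e q) + f k"
 proof (intro allI impI)
  fix k assume k: "k < l"
  have "\<mu>*e k = \<mu>*\<eta> i k - of_real (Q k*\<beta>)*(\<mu>*\<theta> i)" by (simp add: e_def algebra_simps)
  also have "... = (SUM q<l. of_real (M k q)*\<eta> i q) + of_real (Q k)*U i - of_real (Q k)*of_real \<beta>*\<phi> i - of_real (Q k)*(of_real \<beta>*of_real (b w i))*U i"
   unfolding eq_\<theta>[OF i] eq_\<eta>[OF i k] U_def[symmetric] by (simp add: algebra_simps)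
  also have "... = (SUM q<l. of_real (M k q)*\<eta> i q) - of_real (Q k)*of_real \<beta>*\<phi> i"
   unfolding \<beta>b by simp
  also have "(SUM q<l. of_real (M k q)*\<eta> i q) = (SUM q<l. of_real (M k q)*e q) + of_real \<beta>*(SUM q<l. of_real (M k q)*of_real (Q q))*\<theta> i"
  proof -
   have "(SUM q<l. of_real (M k q)*\<eta> i q) = (SUM q<l. of_real (M k q)*e q + of_real \<beta>*(of_real (M k q)*of_real (Q q))*\<theta> i)"
    by (rule sum.cong[OF refl]) (simp add: e_def algebra_simps)
   then show ?thesis by (simp add: sum.distrib sum_distrib_left sum_distrib_right)
  qed
  finally show "\<mu>*e k = (SUM q<l. of_real (M k q)*e q) + f k"
   unfolding f_def by (simp add: algebra_simps)
 qed
 from res_M[OF \<mu> this] have 1: "(SUM k<l. cmod (e k)) <= R*(SUM k<l. cmod (f k))" .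
 have "(SUM k<l. cmod (f k)) <= (SUM k<l. B*(real l*B*B + B*C3)*cmod (\<theta> i))"
 proof (rule sum_mono)
  fix k assume "k : {..<l}"
  then have k: "k < l" by simp
  have "cmod (SUM q<l. of_real (M k q)*of_real (Q q)) <= B*(SUM q<l. cmod (of_real (Q q) :: complex))"
   by (rule weighted_sum_le) (use M_le k in auto)
  also have "... <= B*(SUM q<l. B)" using Q_le B0 by (intro mult_left_mono sum_mono) auto
  finally have "cmod (SUM q<l. of_real (M k q)*of_real (Q q)) <= real l*B*B" by (simp add: mult_ac)
  then have t1: "cmod ((SUM q<l. of_real (M k q)*of_real (Q q))*\<theta> i) <= real l*B*B*cmod (\<theta> i)"
   by (simp only: norm_mult mult_right_mono norm_ge_zero)
  have t2: "cmod (of_real (Q k)*\<phi> i) <= B*(C3*cmod (\<theta> i))"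
   unfolding norm_mult using Q_le[OF k] \<phi>_le[OF i] B0 by (intro mult_mono) auto
  have "cmod (f k) = \<beta>*cmod ((SUM q<l. of_real (M k q)*of_real (Q q))*\<theta> i - of_real (Q k)*\<phi> i)"
   unfolding f_def norm_mult[of "of_real \<beta>"] using \<beta> by simp
  also have "... <= B*(real l*B*B*cmod (\<theta> i) + B*(C3*cmod (\<theta> i)))"
   using t1 t2 \<beta> B0 by (intro mult_mono order_trans[OF norm_triangle_ineq4] add_mono) auto
  finally show "cmod (f k) <= B*(real l*B*B + B*C3)*cmod (\<theta> i)" by (simp add: algebra_simps)
 qed
 then have "(SUM k<l. cmod (e k)) <= R*(SUM k<l. B*(real l*B*B + B*C3)*cmod (\<theta> i))"
  using 1 R by (meson mult_left_mono order_trans)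
 then have 2: "(SUM k<l. cmod (e k)) <= C4*cmod (\<theta> i)" by (simp add: C4_def mult_ac)
 have "(SUM k<l. cmod (\<eta> i k)) <= (SUM k<l. cmod (e k) + B*B*cmod (\<theta> i))"
 proof (rule sum_mono)
  fix k assume "k : {..<l}"
  then have "\<bar>Q k*\<beta>\<bar> <= B*B" using Q_le \<beta> B0 by (auto simp: abs_mult intro!: mult_mono)
  then have "cmod (of_real (Q k*\<beta>)*\<theta> i) <= B*B*cmod (\<theta> i)"
   by (simp only: norm_mult norm_of_real mult_right_mono norm_ge_zero)
  moreover have "\<eta> i k = e k + of_real (Q k*\<beta>)*\<theta> i" by (simp add: e_def)
  ultimately show "cmod (\<eta> i k) <= cmod (e k) + B*B*cmod (\<theta> i)"
   using norm_triangle_ineq[of "e k" "of_real (Q k*\<beta>)*\<theta> i"] by simp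
 qed
 with 2 show ?thesis by (simp add: sum.distrib C5_def algebra_simps)
qed

lemma om_\<zeta>: assumes i: "i < N"
 shows "(SUM s<r. of_real (om s)*\<zeta> i s) = (SUM j<N. of_real (H i j)*\<theta> j) + (SUM s<r. of_real (om s)*\<kappa> i s)"
proof -
 have "(SUM s<r. of_real (om s)*\<zeta> i s) = (SUM s<r. SUM j<N. of_real (om s)*(of_real (H i j)*\<xi> j s)) + (SUM s<r. of_real (om s)*\<kappa> i s)"
  unfolding sum.distrib[symmetric] by (rule sum.cong[OF refl]) (simp add: \<kappa>_def algebra_simps sum_distrib_left)
 also have "(SUM s<r. SUM j<N. of_real (om s)*(of_real (H i j)*\<xi> j s)) = (SUM j<N. SUM s<r. of_real (om s)*(of_real (H i j)*\<xi> j s))"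
  by (rule sum.swap)
 also have "... = (SUM j<N. of_real (H i j)*\<theta> j)"
  by (simp add: \<theta>_def sum_distrib_left mult_ac)
 finally show ?thesis .
qed

lemma complex_diss: "cH*(SUM i<N. (cmod (\<theta> i))^2) <= (SUM i<N. d i*Re (cnj (\<theta> i)*(SUM j<N. of_real (H i j)*\<theta> j)))"
proof -
 have "Re (cnj (\<theta> i)*(SUM j<N. of_real (H i j)*\<theta> j)) =
  Re (\<theta> i)*(SUM j<N. H i j*Re (\<theta> j)) + Im (\<theta> i)*(SUM j<N. H i j*Im (\<theta> j))" for i
  by simp
 then have "(SUM i<N. d i*Re (cnj (\<theta> i)*(SUM j<N. of_real (H i j)*\<theta> j)))
  = (SUM i<N. d i*Re (\<theta> i)*(SUM j<N. H i j*Re (\<theta> j))) + (SUM i<N. d i*Im (\<theta> i)*(SUM j<N. H i j*Im (\<theta> j)))"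
  by (simp only: distrib_left sum.distrib mult.assoc)
 moreover have "cH*(SUM i<N. (cmod (\<theta> i))^2) = cH*(SUM i<N. (Re (\<theta> i))^2) + cH*(SUM i<N. (Im (\<theta> i))^2)"
  unfolding cmod_power2 by (simp add: sum.distrib distrib_left)
 ultimately show ?thesis using diss[of "%i. Re (\<theta> i)"] diss[of "%i. Im (\<theta> i)"] by linarith
qed

text \<open>Multiply the \<theta> equation by d_i / b_i times the conjugate of \<theta>_i and take
  real parts: the unknown b_i cancels in front of K, the sum over agents is dissipative, and for
  large K half of it absorbs the terms with \<open>C6\<close>. What remains pairs \<theta> with the
  observer error and carries the same factor K, which cancels.\<close>

lemma \<theta>_sum_le:
 assumes K: "2*B*B*C6 / cH < K"
 shows "(SUM i<N. cmod (\<theta> i)) <= C9*(SUM i<N. kn i)"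
proof -
 define t where "t i = cmod (\<theta> i)" for i
 have t0: "0 <= t i" for i by (simp add: t_def)
 have k0: "0 <= kn i" for i by (simp add: kn_def sum_nonneg)
 have le: "K*(d i*Re (cnj (\<theta> i)*(SUM j<N. of_real (H i j)*\<theta> j))) <= B*B*C6*(t i)^2 + K*(B*B*(t i*kn i))"
  if i: "i < N" for i
 proof -
  define \<beta> where "\<beta> = d i / b w i"
  have \<beta>: "0 <= \<beta>" "\<beta> <= B*B" "\<beta>*b w i = d i"
   using b_pos[OF w i] b_inv_le[OF w i] d_pos[OF i] d_le[OF i] B0 mult_mono[of "d i" B "1 / b w i" B] by (auto simp: \<beta>_def)
  define P where "P = \<phi> i + of_real (b w i)*(SUM k<l. of_real (\<psi> k)*\<eta> i k)"
  define S where "S = (SUM j<N. of_real (H i j)*\<theta> j)"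
  define Y where "Y = (SUM s<r. of_real (om s)*\<kappa> i s)"
  have P: "cmod P <= C6*t i"
  proof -
   have "cmod (SUM k<l. of_real (\<psi> k)*\<eta> i k) <= B*(C5*t i)"
    unfolding t_def by (rule order_trans[OF weighted_sum_le mult_left_mono[OF \<eta>_le[OF i] B0]]) (rule \<psi>_le)
   then have "cmod (of_real (b w i)*(SUM k<l. of_real (\<psi> k)*\<eta> i k)) <= B*(B*(C5*t i))"
    unfolding norm_mult norm_of_real using b_pos[OF w i] b_le[OF w i] B0 by (intro mult_mono) auto
   then show ?thesis unfolding P_def C6_def using \<phi>_le[OF i]
     norm_triangle_ineq[of "\<phi> i" "of_real (b w i)*(SUM k<l. of_real (\<psi> k)*\<eta> i k)"]
    by (simp add: t_def algebra_simps)
  qed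
  have Y: "cmod Y <= B*kn i" unfolding Y_def kn_def by (rule weighted_sum_le) (rule om_le)
  have e: "\<mu>*\<theta> i = P - of_real (b w i*K)*(S + Y)"
   unfolding eq_\<theta>[OF i] U_def om_\<zeta>[OF i] P_def S_def Y_def by (simp add: algebra_simps)
  have "Re (cnj (\<theta> i)*(\<mu>*\<theta> i)) = Re \<mu>*(t i)^2"
  proof -
   have "cnj (\<theta> i)*(\<mu>*\<theta> i) = of_real ((t i)^2)*\<mu>"
    unfolding t_def complex_norm_square by (simp only: mult_ac)
   then show ?thesis by (simp only: Re_complex_of_real Im_complex_of_real times_complex.sel mult_zero_left diff_zero mult.commute)
  qed
  then have "0 <= Re (cnj (\<theta> i)*(P - of_real (b w i*K)*(S + Y)))" unfolding e[symmetric] using \<mu> by simp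
  also have "cnj (\<theta> i)*(P - of_real (b w i*K)*(S + Y)) = cnj (\<theta> i)*P - of_real (b w i*K)*(cnj (\<theta> i)*S) - of_real (b w i*K)*(cnj (\<theta> i)*Y)"
   by (simp add: algebra_simps)
  also have "Re ... = Re (cnj (\<theta> i)*P) - (b w i*K)*Re (cnj (\<theta> i)*S) - (b w i*K)*Re (cnj (\<theta> i)*Y)"
   by (simp only: minus_complex.sel Re_complex_of_real Im_complex_of_real times_complex.sel(1)[of "of_real _"] mult_zero_left diff_zero)
  finally have "(b w i*K)*Re (cnj (\<theta> i)*S) <= Re (cnj (\<theta> i)*P) - (b w i*K)*Re (cnj (\<theta> i)*Y)" by linarith
  also have "... <= t i*(C6*t i) + (b w i*K)*(t i*(B*kn i))"
  proof -
   have "Re (cnj (\<theta> i)*P) <= cmod (\<theta> i)*cmod P"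
    using complex_Re_le_cmod[of "cnj (\<theta> i)*P"] unfolding norm_mult complex_mod_cnj .
   also have "... <= t i*(C6*t i)" unfolding t_def[symmetric] by (rule mult_left_mono[OF P t0])
   finally have 1: "Re (cnj (\<theta> i)*P) <= t i*(C6*t i)" .
   have "- Re (cnj (\<theta> i)*Y) <= cmod (\<theta> i)*cmod Y"
    using abs_Re_le_cmod[of "cnj (\<theta> i)*Y"] unfolding norm_mult complex_mod_cnj by linarith
   also have "... <= t i*(B*kn i)" unfolding t_def[symmetric] by (rule mult_left_mono[OF Y t0])
   finally have "(b w i*K)*(- Re (cnj (\<theta> i)*Y)) <= (b w i*K)*(t i*(B*kn i))"
    using b_pos[OF w i] K0 by (intro mult_left_mono) auto
   with 1 show ?thesis unfolding mult_minus_right by linarith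
  qed
  finally have "\<beta>*((b w i*K)*Re (cnj (\<theta> i)*S)) <= \<beta>*(t i*(C6*t i) + (b w i*K)*(t i*(B*kn i)))"
   by (rule mult_left_mono) (rule \<beta>(1))
  then have "(\<beta>*b w i)*K*Re (cnj (\<theta> i)*S) <= \<beta>*(t i*(C6*t i)) + (\<beta>*b w i)*K*(t i*(B*kn i))"
   by (simp only: distrib_left mult.assoc)
  also have "... <= B*B*(t i*(C6*t i)) + B*K*(t i*(B*kn i))"
  proof (rule add_mono)
   show "\<beta>*(t i*(C6*t i)) <= B*B*(t i*(C6*t i))"
    using \<beta> t0[of i] C_nonneg by (intro mult_right_mono) auto
   show "(\<beta>*b w i)*K*(t i*(B*kn i)) <= B*K*(t i*(B*kn i))"
    unfolding \<beta>(3) using d_le[OF i] K0 t0[of i] k0[of i] B0 by (intro mult_right_mono) auto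
  qed
  finally have "K*(d i*Re (cnj (\<theta> i)*S)) <= B*B*(t i*(C6*t i)) + B*K*(t i*(B*kn i))"
   unfolding \<beta>(3) by (simp only: mult_ac)
  then show ?thesis unfolding S_def by (simp only: power2_eq_square mult_ac)
 qed
 have "K*(cH*(SUM i<N. (t i)^2)) <= K*(SUM i<N. d i*Re (cnj (\<theta> i)*(SUM j<N. of_real (H i j)*\<theta> j)))"
  using complex_diss K0 unfolding t_def by (intro mult_left_mono) auto
 also have "... <= (SUM i<N. B*B*C6*(t i)^2 + K*(B*B*(t i*kn i)))"
  by (subst sum_distrib_left) (rule sum_mono, rule le, simp)
 also have "... = B*B*C6*(SUM i<N. (t i)^2) + K*(B*B*(SUM i<N. t i*kn i))"
  by (simp add: sum.distrib sum_distrib_left)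
 also have "... <= (K*cH / 2)*(SUM i<N. (t i)^2) + K*(B*B*(SUM i<N. t i*kn i))"
 proof -
  have "2*B*B*C6 <= K*cH" using K cH by (simp add: pos_divide_less_eq less_imp_le)
  then have "B*B*C6*(SUM i<N. (t i)^2) <= (K*cH / 2)*(SUM i<N. (t i)^2)"
   by (intro mult_right_mono sum_nonneg) auto
  then show ?thesis by simp
 qed
 finally have "K*(cH / 2*(SUM i<N. (t i)^2)) <= K*(B*B*(SUM i<N. t i*kn i))" by (simp add: algebra_simps)
 then have "cH / 2*(SUM i<N. (t i)^2) <= B*B*(SUM i<N. t i*kn i)" using K0 by simp
 then have s2: "(SUM i<N. (t i)^2) <= (2*B*B / cH)*(SUM i<N. t i*kn i)" using cH by (simp add: field_simps)
 define T where "T = (SUM i<N. t i)"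
 define KK where "KK = (SUM i<N. kn i)"
 have T0: "0 <= T" "0 <= KK" by (simp_all add: T_def KK_def t0 k0 sum_nonneg)
 have "(SUM i<N. t i*kn i) <= (SUM i<N. T*kn i)"
 proof (rule sum_mono)
  fix i assume "i : {..<N}"
  then have "t i <= T" unfolding T_def by (intro member_le_sum) (auto simp: t0)
  then show "t i*kn i <= T*kn i" by (rule mult_right_mono[OF _ k0])
 qed
 then have "(SUM i<N. t i*kn i) <= T*KK" by (simp add: KK_def sum_distrib_left)
 then have "(2*B*B / cH)*(SUM i<N. t i*kn i) <= (2*B*B / cH)*(T*KK)"
  using B0 cH by (intro mult_left_mono) auto
 with s2 have "(SUM i<N. (t i)^2) <= (2*B*B / cH)*(T*KK)" by linarith
 then have "real N*(SUM i<N. (t i)^2) <= real N*((2*B*B / cH)*(T*KK))" by (rule mult_left_mono) simp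
 moreover have "T^2 <= real N*(SUM i<N. (t i)^2)" unfolding T_def by (rule sum_squared_le_card_mult)
 ultimately have "T*T <= T*(C9*KK)" unfolding C9_def by (simp add: power2_eq_square mult_ac)
 then have "T <= C9*KK"
  using T0 C_nonneg(7) by (cases "T = 0") (auto simp: mult_le_cancel_left)
 then show ?thesis unfolding T_def KK_def t_def .
qed

text \<open>The observer copies the integrator chain, so the difference \<kappa> obeys an observer
  chain again; only its last entry sees the unknown derivative of the chain, which acts as
  forcing.\<close>

lemma eq_\<kappa>: assumes i: "i < N" and s: "s < r"
 shows "\<mu>*\<kappa> i s = - of_real (h ^ (s + 1)*del (r - 1 - s))*\<kappa> i 0 + (if s + 1 < r then \<kappa> i (s + 1) else - (SUM j<N. of_real (H i j)*(\<mu>*\<xi> j (r - 1))))"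
proof -
 have 1: "\<mu>*\<kappa> i s = \<mu>*\<zeta> i s - (SUM j<N. of_real (H i j)*(\<mu>*\<xi> j s))"
  by (simp add: \<kappa>_def right_diff_distrib sum_distrib_left mult_ac)
 show ?thesis
 proof (cases "s + 1 < r")
  case True
  have "(SUM j<N. of_real (H i j)*(\<mu>*\<xi> j s)) = (SUM j<N. of_real (H i j)*\<xi> j (s + 1))"
   by (rule sum.cong[OF refl]) (use eq_\<xi> True in simp)
  then show ?thesis unfolding 1 eq_\<zeta>[OF i s] using True by (simp add: \<kappa>_def algebra_simps)
 next
  case False
  then have "s = r - 1" using s by simp
  then show ?thesis unfolding 1 eq_\<zeta>[OF i s] using False by (simp add: \<kappa>_def algebra_simps)
 qed
qed

lemma \<mu>\<xi>_le: assumes i: "i < N"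
 shows "cmod (\<mu>*\<xi> i (r - 1)) <= B*(C2*cmod (\<theta> i)) + B*(C1*cmod (\<theta> i)) + B*(B*(C5*cmod (\<theta> i)) + K*(B*(SUM j<N. cmod (\<theta> j)) + B*kn i))"
proof -
 have 1: "cmod (SUM k<m. of_real (a3 w i k)*z i k) <= B*(C2*cmod (\<theta> i))"
  by (rule order_trans[OF weighted_sum_le mult_left_mono[OF z_le[OF i] B0]]) (rule a3_le[OF w i])
 have 2: "cmod (SUM s<r. of_real (c w i s)*\<xi> i s) <= B*(C1*cmod (\<theta> i))"
  by (rule order_trans[OF weighted_sum_le mult_left_mono[OF \<xi>_le[OF i] B0]]) (rule c_le[OF w i])
 have 3: "cmod (SUM k<l. of_real (\<psi> k)*\<eta> i k) <= B*(C5*cmod (\<theta> i))"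
  by (rule order_trans[OF weighted_sum_le mult_left_mono[OF \<eta>_le[OF i] B0]]) (rule \<psi>_le)
 have "cmod (SUM j<N. of_real (H i j)*\<theta> j) <= B*(SUM j<N. cmod (\<theta> j))"
  by (rule weighted_sum_le) (use H_le i in auto)
 moreover have "cmod (SUM s<r. of_real (om s)*\<kappa> i s) <= B*kn i" unfolding kn_def by (rule weighted_sum_le) (rule om_le)
 ultimately have "cmod (SUM s<r. of_real (om s)*\<zeta> i s) <= B*(SUM j<N. cmod (\<theta> j)) + B*kn i"
  unfolding om_\<zeta>[OF i] by (rule order_trans[OF norm_triangle_ineq add_mono])
 then have "cmod (of_real K*(SUM s<r. of_real (om s)*\<zeta> i s)) <= K*(B*(SUM j<N. cmod (\<theta> j)) + B*kn i)"
  unfolding norm_mult norm_of_real using K0 by (intro mult_mono) auto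
 with 3 have "cmod (U i) <= B*(C5*cmod (\<theta> i)) + K*(B*(SUM j<N. cmod (\<theta> j)) + B*kn i)"
  unfolding U_def by (rule order_trans[OF norm_triangle_ineq4 add_mono])
 then have "cmod (of_real (b w i)*U i) <= B*(B*(C5*cmod (\<theta> i)) + K*(B*(SUM j<N. cmod (\<theta> j)) + B*kn i))"
  unfolding norm_mult norm_of_real using b_pos[OF w i] b_le[OF w i] B0 by (intro mult_mono) auto
 then show ?thesis
  unfolding eq_\<xi>r[OF i] U_def[symmetric]
  by (intro order_trans[OF norm_triangle_ineq] add_mono 1 2)
qed

text \<open>Closes the loop by a small-gain argument: \<open>\<theta>_sum_le\<close> bounds \<theta>
  by \<kappa>, and \<kappa> is bounded by \<theta> + \<kappa> times a constant over h that depends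
  on K. For large h this forces \<kappa> = 0, and then \<theta> and all other blocks vanish.\<close>

lemma all_zero:
 assumes K: "2*B*B*C6 / cH < K" and h: "real N*(R*(GK K*(C9 + 1))) < h"
 shows "ALL i<N. (ALL j<m. z i j = 0) & (ALL s<r. \<xi> i s = 0) & (ALL k<l. \<eta> i k = 0) & (ALL s<r. \<zeta> i s = 0)"
proof -
 define T KK where "T = (SUM i<N. cmod (\<theta> i))" and "KK = (SUM i<N. kn i)"
 have T0: "0 <= T" by (simp add: T_def sum_nonneg)
 have kn0: "0 <= kn i" for i by (simp add: kn_def sum_nonneg)
 have KK0: "0 <= KK" by (simp add: KK_def sum_nonneg kn0)
 have TK: "T <= C9*KK" unfolding T_def KK_def by (rule \<theta>_sum_le[OF K])
 have GK0: "0 <= GK K" unfolding GK_def using B0 C_nonneg K0 by simp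
 have g: "cmod (SUM j<N. of_real (H i j)*(\<mu>*\<xi> j (r - 1))) <= GK K*(T + KK)" if i: "i < N" for i
 proof -
  have "cmod (SUM j<N. of_real (H i j)*(\<mu>*\<xi> j (r - 1))) <= B*(SUM j<N. cmod (\<mu>*\<xi> j (r - 1)))"
   by (rule weighted_sum_le) (use H_le i in auto)
  also have "... <= B*(SUM j<N. B*(C2*cmod (\<theta> j)) + B*(C1*cmod (\<theta> j)) + B*(B*(C5*cmod (\<theta> j)) + K*(B*T + B*kn j)))"
   unfolding T_def by (intro mult_left_mono sum_mono \<mu>\<xi>_le B0) auto
  also have "(SUM j<N. B*(C2*cmod (\<theta> j)) + B*(C1*cmod (\<theta> j)) + B*(B*(C5*cmod (\<theta> j)) + K*(B*T + B*kn j)))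
    = B*(C2*T) + B*(C1*T) + B*(B*(C5*T)) + real N*(B*(K*(B*T))) + B*(K*(B*KK))"
   unfolding T_def KK_def by (simp add: sum.distrib sum_distrib_left distrib_left)
  also have "... <= (B*C2 + B*C1 + B*B*C5 + B*K*B + real N*(B*K*B))*(T + KK)"
  proof -
   have "0 <= B*K*B" "0 <= B*C2" "0 <= B*C1" "0 <= B*B*C5" "0 <= real N*(B*K*B)"
    using B0 K0 C_nonneg by simp_all
   then have "0 <= (B*C2 + B*C1 + B*B*C5 + real N*(B*K*B))*KK + B*K*B*T"
    using KK0 T0 by simp
   then show ?thesis by (simp add: algebra_simps)
  qed
  finally show ?thesis using B0 unfolding GK_def by (simp add: mult_left_mono mult.assoc)
 qed
 \<comment> \<open>The usual high-gain scaling: with weights h^(r-1-s), and \<mu>/h in place of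
   \<mu>, the observer matrix no longer depends on h and the forcing acquires a factor 1/h.\<close>
 define kh where "kh i s = of_real (h ^ (r - 1 - s))*\<kappa> i s" for i s
 have hpos: "h > 0" using h1 by simp
 have khn: "(SUM s<r. cmod (kh i s)) <= R*(GK K*(T + KK) / h)" if i: "i < N" for i
 proof -
  define f where "f s = (if s = r - 1 then - of_real (1 / h)*(SUM j<N. of_real (H i j)*(\<mu>*\<xi> j (r - 1))) else 0)" for s
  have "ALL s<r. (\<mu> / of_real h)*kh i s = - of_real (del (r - 1 - s))*kh i 0 + (if s + 1 < r then kh i (s + 1) else 0) + f s"
  proof (intro allI impI)
   fix s assume s: "s < r"
   define p where "p = r - 1 - s"
   have r1: "r - 1 = p + s" using s by (simp add: p_def)
   define hc where "hc = complex_of_real h"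
   have hc: "hc ~= 0" using hpos by (simp add: hc_def)
   have kh: "kh i t = hc ^ (r - 1 - t)*\<kappa> i t" for t by (simp add: kh_def hc_def)
   have e: "(\<mu> / hc)*kh i s = hc ^ p / hc*(\<mu>*\<kappa> i s)"
    by (simp add: kh p_def)
   have k0: "hc ^ p / hc*(hc ^ (s + 1)*of_real (del p)*\<kappa> i 0) = of_real (del p)*kh i 0"
    unfolding kh diff_zero r1 using hc by (simp add: power_add)
   have \<kappa>e: "\<mu>*\<kappa> i s = - (hc ^ (s + 1)*of_real (del p)*\<kappa> i 0) + (if s + 1 < r then \<kappa> i (s + 1) else - (SUM j<N. of_real (H i j)*(\<mu>*\<xi> j (r - 1))))"
    unfolding eq_\<kappa>[OF i s] p_def hc_def by simp
   have m: "(\<mu> / hc)*kh i s = - (of_real (del p)*kh i 0) + hc ^ p / hc*(if s + 1 < r then \<kappa> i (s + 1) else - (SUM j<N. of_real (H i j)*(\<mu>*\<xi> j (r - 1))))"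
    unfolding e \<kappa>e k0[symmetric] by (simp only: distrib_left mult_minus_right)
   show "(\<mu> / of_real h)*kh i s = - of_real (del (r - 1 - s))*kh i 0 + (if s + 1 < r then kh i (s + 1) else 0) + f s"
   proof (cases "s + 1 < r")
    case True
    then have pp: "p = Suc (r - 1 - (s + 1))" by (simp add: p_def)
    have "hc ^ p / hc*\<kappa> i (s + 1) = kh i (s + 1)"
     unfolding kh pp using hc by simp
    moreover have "f s = 0" using True by (simp add: f_def)
    ultimately show ?thesis
     using m True unfolding hc_def p_def by simp
   next
    case False
    then have p0: "s = r - 1" "p = 0" using s by (auto simp: p_def)
    then have "f s = hc ^ p / hc * - (SUM j<N. of_real (H i j)*(\<mu>*\<xi> j (r - 1)))" by (simp add: f_def hc_def)
    then show ?thesis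
     using m False unfolding hc_def p_def by simp
   qed
  qed
  moreover have "Re (\<mu> / of_real h) >= 0" using \<mu> hpos by simp
  ultimately have "(SUM s<r. cmod (kh i s)) <= R*(SUM s<r. cmod (f s))" by (intro res_del)
  also have "(SUM s<r. cmod (f s)) = (SUM s<r. if s = r - 1 then cmod (f s) else 0)"
   by (rule sum.cong[OF refl]) (simp add: f_def)
  also have "... = cmod (f (r - 1))" using r by simp
  also have "... = cmod (SUM j<N. of_real (H i j)*(\<mu>*\<xi> j (r - 1))) / h"
   using hpos by (simp add: f_def norm_mult norm_divide del: of_real_divide)
  also have "... <= GK K*(T + KK) / h" using g[OF i] hpos by (simp add: divide_right_mono)
  finally show ?thesis using R by (simp add: mult_left_mono)
 qed
 have knkh: "kn i <= (SUM s<r. cmod (kh i s))" for i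
  unfolding kn_def
 proof (rule sum_mono)
  fix s
  have "1*cmod (\<kappa> i s) <= h ^ (r - 1 - s)*cmod (\<kappa> i s)" using h1 by (intro mult_right_mono one_le_power) auto
  then show "cmod (\<kappa> i s) <= cmod (kh i s)" unfolding kh_def norm_mult norm_of_real using hpos by simp
 qed
 have "KK <= (SUM i<N. R*(GK K*(T + KK) / h))"
  unfolding KK_def by (rule sum_mono) (use order_trans[OF knkh khn] in \<open>auto simp: KK_def\<close>)
 also have "... = real N*(R*(GK K*(T + KK))) / h" by simp
 also have "... <= real N*(R*(GK K*((C9 + 1)*KK))) / h"
  using TK hpos R GK0 by (intro divide_right_mono mult_left_mono) (auto simp: algebra_simps)
 finally have "KK*h <= real N*(R*(GK K*(C9 + 1)))*KK" using hpos by (simp add: field_simps)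
 then have "KK*h - KK*(real N*(R*(GK K*(C9 + 1)))) <= 0" by (simp add: mult.commute)
 then have "KK*(h - real N*(R*(GK K*(C9 + 1)))) <= 0" by (simp only: right_diff_distrib)
 then have KKz: "KK = 0" using h KK0 by (simp add: mult_le_0_iff)
 then have Tz: "T = 0" using TK T0 by simp
 have \<theta>0: "\<theta> i = 0" if "i < N" for i
  using Tz that unfolding T_def by (subst (asm) sum_nonneg_eq_0_iff) auto
 have kn00: "kn i = 0" if "i < N" for i
  using KKz that unfolding KK_def by (subst (asm) sum_nonneg_eq_0_iff) (auto simp: kn0)
 have \<xi>0: "\<xi> i s = 0" if i: "i < N" and s: "s < r" for i s
 proof -
  have "cmod (\<xi> i s) <= (SUM s<r. cmod (\<xi> i s))" by (rule member_le_sum) (use s in auto)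
  with \<xi>_le[OF i] have "cmod (\<xi> i s) <= C1*cmod (\<theta> i)" by linarith
  then show ?thesis unfolding \<theta>0[OF i] by simp
 qed
 have \<kappa>0: "\<kappa> i s = 0" if i: "i < N" and s: "s < r" for i s
 proof -
  have "cmod (\<kappa> i s) <= kn i" unfolding kn_def by (rule member_le_sum) (use s in auto)
  then show ?thesis using kn00[OF i] by simp
 qed
 show ?thesis
 proof (intro allI impI conjI)
  fix i assume i: "i < N"
  show "z i j = 0" if "j < m" for j
  proof -
   have "cmod (z i j) <= (SUM j<m. cmod (z i j))" by (rule member_le_sum) (use that in auto)
   with z_le[OF i] have "cmod (z i j) <= C2*cmod (\<theta> i)" by linarith
   then show ?thesis unfolding \<theta>0[OF i] by simp
  qed
  show "\<eta> i k = 0" if "k < l" for k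
  proof -
   have "cmod (\<eta> i k) <= (SUM k<l. cmod (\<eta> i k))" by (rule member_le_sum) (use that in auto)
   with \<eta>_le[OF i] have "cmod (\<eta> i k) <= C5*cmod (\<theta> i)" by linarith
   then show ?thesis unfolding \<theta>0[OF i] by simp
  qed
  show "\<zeta> i s = 0" if "s < r" for s
   using \<kappa>0[OF i that] \<xi>0 that unfolding \<kappa>_def by simp
  show "\<xi> i s = 0" if "s < r" for s by (rule \<xi>0[OF i that])
 qed
qed

end

section \<open>Block structure of the closed loop\<close>

definition pack :: "nat => nat => (nat => nat => 'a) => 'a Matrix.vec" where
 "pack N n f = vec (N*n) (%k. f (k div n) (k mod n))"

lemma pack_carrier: "pack N n f : carrier_vec (N*n)"
 by (simp add: pack_def)

lemma div_less_of_less_mult: "k < N*n ==> k div n < (N::nat)"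
 by (simp add: less_mult_imp_div_less)

lemma mod_less_of_less_mult: "k < N*n ==> k mod n < (n::nat)"
 by (cases "n = 0") auto

lemma mult_add_less: "i < N ==> j < n ==> i*n + j < N*(n::nat)"
proof -
 assume "i < N" "j < n"
 then have "i*n + j < i*n + n" by simp
 also have "... = Suc i*n" by simp
 also have "... <= N*n" using \<open>i < N\<close> by (intro mult_right_mono) auto
 finally show ?thesis .
qed

lemma pack_cong: "(!!i j. i < N ==> j < n ==> f i j = g i j) ==> pack N n f = pack N n g"
 unfolding pack_def by (intro eq_vecI) (auto simp: div_less_of_less_mult mod_less_of_less_mult)

lemma sum_div_mod:
 fixes g :: "nat => nat => 'a::comm_monoid_add"
 shows "(SUM k<N*n. g (k div n) (k mod n)) = (SUM i<N. SUM j<n. g i j)"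
proof -
 have "(SUM i<N. SUM j<n. g i j) = (SUM q:{..<N} \<times> {..<n}. g (fst q) (snd q))"
  by (simp add: sum.cartesian_product case_prod_beta)
 also have "... = (SUM k<N*n. g (k div n) (k mod n))"
  by (rule sum.reindex_bij_witness[of _ "%k. (k div n, k mod n)" "%q. fst q*n + snd q"])
   (auto simp: mult_add_less div_less_of_less_mult mod_less_of_less_mult)
 finally show ?thesis by simp
qed

text \<open>Blocks of equal size allow a closed formula for the entries by division and remainder,
  in place of the recursive definition.\<close>

lemma diag_block_mat_uniform:
 assumes "ALL A:set As. A : carrier_mat a b"
 shows "diag_block_mat As : carrier_mat (length As*a) (length As*b) &
  (ALL I<length As*a. ALL J<length As*b. diag_block_mat As $$ (I, J) =
   (if I div a = J div b then As ! (I div a) $$ (I mod a, J mod b) else 0))"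
 using assms
proof (induction As rule: rev_induct)
 case (snoc B As)
 let ?D = "diag_block_mat As"
 let ?n = "length As"
 from snoc have D: "?D : carrier_mat (?n*a) (?n*b)"
  and IH: "ALL I<?n*a. ALL J<?n*b. ?D $$ (I, J) = (if I div a = J div b then As ! (I div a) $$ (I mod a, J mod b) else 0)"
  and B: "B : carrier_mat a b" by auto
 have eq: "diag_block_mat (As @ [B]) = four_block_mat ?D (0\<^sub>m (?n*a) b) (0\<^sub>m a (?n*b)) B"
  unfolding diag_block_mat_last Let_def using D B by auto
 have car: "diag_block_mat (As @ [B]) : carrier_mat (length (As @ [B])*a) (length (As @ [B])*b)"
  unfolding eq using D B by (auto simp: algebra_simps)
 have hi: "I div a = ?n & I mod a = I - ?n*a" if "~ I < ?n*a" "I < Suc ?n*a" for I a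
 proof -
  have "I = ?n*a + (I - ?n*a)" "I - ?n*a < a" using that by auto
  then show ?thesis by (metis add.commute div_mult_self3 div_less mod_less mod_mult_self3 add_0 less_zeroE neq0_conv)
 qed
 have lo: "I div a < ?n" if "I < ?n*a" for I a using that by (rule div_less_of_less_mult)
 show ?case
 proof (intro conjI car allI impI)
  fix I J assume "I < length (As @ [B])*a" "J < length (As @ [B])*b"
  then have I: "I < Suc ?n*a" and J: "J < Suc ?n*b" by auto
  have e: "diag_block_mat (As @ [B]) $$ (I, J) = (if I < ?n*a then if J < ?n*b then ?D $$ (I, J) else 0\<^sub>m (?n*a) b $$ (I, J - ?n*b)
   else if J < ?n*b then 0\<^sub>m a (?n*b) $$ (I - ?n*a, J) else B $$ (I - ?n*a, J - ?n*b))"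
   unfolding eq using I J D B by (subst index_mat_four_block) auto
  consider "I < ?n*a" "J < ?n*b" | "I < ?n*a" "~ J < ?n*b" | "~ I < ?n*a" "J < ?n*b" | "~ I < ?n*a" "~ J < ?n*b" by blast
  then show "diag_block_mat (As @ [B]) $$ (I, J) = (if I div a = J div b then (As @ [B]) ! (I div a) $$ (I mod a, J mod b) else 0)"
  proof cases
   case 1
   then show ?thesis unfolding e using IH lo[OF 1(1)] by (simp add: nth_append)
  next
   case 2
   then have "I div a ~= J div b" using lo[OF 2(1)] hi[OF 2(2) J] by simp
   then show ?thesis unfolding e using 2 I J by auto
  next
   case 3
   then have "I div a ~= J div b" using lo[OF 3(2)] hi[OF 3(1) I] by simp
   then show ?thesis unfolding e using 3 I J by auto
  next
   case 4
   then show ?thesis unfolding e using hi[OF 4(1) I] hi[OF 4(2) J] by simp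
  qed
 qed
qed simp

abbreviation rmat :: "real mat => 'a::real_field mat" where
 "rmat A \<equiv> map_mat of_real A"

text \<open>The entry type is any real field, so one computation serves real trajectories and
  complex eigenvectors.\<close>

lemma block_mult_pack:
 fixes f :: "nat => nat => 'a::real_field"
 assumes A: "A : carrier_mat (N*a) (N*b)"
  and ent: "ALL I<N*a. ALL J<N*b. A $$ (I, J) = (if I div a = J div b then X (I div a) (I mod a) (J mod b) else 0)"
 shows "rmat A *\<^sub>v pack N b f = pack N a (%i s. SUM k<b. of_real (X i s k)*f i k)"
proof (rule eq_vecI)
 fix I assume "I < dim_vec (pack N a (%i s. SUM k<b. of_real (X i s k)*f i k))"
 then have I: "I < N*a" by (simp add: pack_def)
 have cA: "rmat A : carrier_mat (N*a) (N*b)" using A by simp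
 have "(rmat A *\<^sub>v pack N b f) $ I = (SUM J<N*b. rmat A $$ (I, J)*pack N b f $ J)"
  by (rule index_mult_mat_vec_sum[OF cA pack_carrier I])
 also have "... = (SUM J<N*b. (%i k. if I div a = i then of_real (X (I div a) (I mod a) k)*f i k else 0) (J div b) (J mod b))"
 proof (rule sum.cong[OF refl])
  fix J assume "J : {..<N*b}"
  then have J: "J < N*b" by simp
  have "(rmat A $$ (I, J) :: 'a) = of_real (A $$ (I, J))" using A I J by simp
  then show "rmat A $$ (I, J)*pack N b f $ J = (%i k. if I div a = i then of_real (X (I div a) (I mod a) k)*f i k else 0) (J div b) (J mod b)"
   using ent I J by (simp add: pack_def)
 qed
 also have "... = (SUM i<N. SUM k<b. if I div a = i then of_real (X (I div a) (I mod a) k)*f i k else 0)"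
  by (rule sum_div_mod)
 also have "... = (SUM i<N. if I div a = i then (SUM k<b. of_real (X (I div a) (I mod a) k)*f i k) else 0)"
  by (rule sum.cong[OF refl]) simp
 also have "... = (SUM k<b. of_real (X (I div a) (I mod a) k)*f (I div a) k)"
  using div_less_of_less_mult[OF I] by simp
 finally show "(rmat A *\<^sub>v pack N b f) $ I = pack N a (%i s. SUM k<b. of_real (X i s k)*f i k) $ I"
  using I by (simp add: pack_def)
qed (use A in \<open>simp add: pack_def\<close>)

lemma agent_diag_block:
 assumes "ALL i:{1..agents p}. X i : carrier_mat a b"
 shows "agent_diag p X : carrier_mat (agents p*a) (agents p*b)"
  and "ALL I<agents p*a. ALL J<agents p*b. agent_diag p X $$ (I, J) =
   (if I div a = J div b then X (Suc (I div a)) $$ (I mod a, J mod b) else 0)"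
proof -
 let ?L = "map X [1..<Suc (agents p)]"
 have "ALL A:set ?L. A : carrier_mat a b" using assms by auto
 note u = diag_block_mat_uniform[OF this]
 have len: "length ?L = agents p" by simp
 show "agent_diag p X : carrier_mat (agents p*a) (agents p*b)"
  using u unfolding len agent_diag_def by blast
 have nth: "?L ! i = X (Suc i)" if "i < agents p" for i using that by (simp del: upt_Suc)
 show "ALL I<agents p*a. ALL J<agents p*b. agent_diag p X $$ (I, J) =
   (if I div a = J div b then X (Suc (I div a)) $$ (I mod a, J mod b) else 0)"
 proof (intro allI impI)
  fix I J assume I: "I < agents p*a" and J: "J < agents p*b"
  have "diag_block_mat ?L $$ (I, J) = (if I div a = J div b then ?L ! (I div a) $$ (I mod a, J mod b) else 0)"
   using u I J unfolding len by blast
  then show "agent_diag p X $$ (I, J) = (if I div a = J div b then X (Suc (I div a)) $$ (I mod a, J mod b) else 0)"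
   unfolding agent_diag_def nth[OF div_less_of_less_mult[OF I]] .
 qed
qed

lemma agent_diag_mult:
 fixes f :: "nat => nat => 'a::real_field"
 assumes "ALL i:{1..agents p}. X i : carrier_mat a b"
 shows "rmat (agent_diag p X) *\<^sub>v pack (agents p) b f = pack (agents p) a (%i s. SUM k<b. of_real (X (Suc i) $$ (s, k))*f i k)"
 by (rule block_mult_pack[OF agent_diag_block[OF assms]])

lemma kron_one_block:
 assumes B: "B : carrier_mat a b"
 shows "kron (1\<^sub>m N) B : carrier_mat (N*a) (N*b)"
  and "ALL I<N*a. ALL J<N*b. kron (1\<^sub>m N) B $$ (I, J) = (if I div a = J div b then B $$ (I mod a, J mod b) else 0)"
proof -
 show "kron (1\<^sub>m N) B : carrier_mat (N*a) (N*b)" using B by (simp add: kron_def)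
 show "ALL I<N*a. ALL J<N*b. kron (1\<^sub>m N) B $$ (I, J) = (if I div a = J div b then B $$ (I mod a, J mod b) else 0)"
  using B by (auto simp: kron_def div_less_of_less_mult)
qed

lemma kron_one_mult:
 fixes f :: "nat => nat => 'a::real_field"
 assumes "B : carrier_mat a b"
 shows "rmat (kron (1\<^sub>m N) B) *\<^sub>v pack N b f = pack N a (%i s. SUM k<b. of_real (B $$ (s, k))*f i k)"
 by (rule block_mult_pack[OF kron_one_block[OF assms]])

lemma kron_id_mult:
 fixes f :: "nat => nat => 'a::real_field"
 assumes H: "H : carrier_mat N N"
 shows "rmat (kron H (1\<^sub>m n)) *\<^sub>v pack N n f = pack N n (%i s. SUM j<N. of_real (H $$ (i, j))*f j s)"
proof (rule eq_vecI)
 have A: "kron H (1\<^sub>m n) : carrier_mat (N*n) (N*n)" using H by (simp add: kron_def)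
 then have cA: "rmat (kron H (1\<^sub>m n)) : carrier_mat (N*n) (N*n)" by simp
 fix I assume "I < dim_vec (pack N n (%i s. SUM j<N. of_real (H $$ (i, j))*f j s))"
 then have I: "I < N*n" by (simp add: pack_def)
 have "(rmat (kron H (1\<^sub>m n)) *\<^sub>v pack N n f) $ I = (SUM J<N*n. rmat (kron H (1\<^sub>m n)) $$ (I, J)*pack N n f $ J)"
  by (rule index_mult_mat_vec_sum[OF cA pack_carrier I])
 also have "... = (SUM J<N*n. (%j s. if s = I mod n then of_real (H $$ (I div n, j))*f j s else 0) (J div n) (J mod n))"
 proof (rule sum.cong[OF refl])
  fix J assume "J : {..<N*n}"
  then have J: "J < N*n" by simp
  have "(rmat (kron H (1\<^sub>m n)) $$ (I, J) :: 'a) = of_real (kron H (1\<^sub>m n) $$ (I, J))" using A I J by simp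
  also have "kron H (1\<^sub>m n) $$ (I, J) = H $$ (I div n, J div n)*(if J mod n = I mod n then 1 else 0)"
   using H I J mod_less_of_less_mult[OF I] mod_less_of_less_mult[OF J] by (auto simp: kron_def)
  finally show "rmat (kron H (1\<^sub>m n)) $$ (I, J)*pack N n f $ J = (%j s. if s = I mod n then of_real (H $$ (I div n, j))*f j s else 0) (J div n) (J mod n)"
   using J by (simp add: pack_def)
 qed
 also have "... = (SUM j<N. SUM s<n. if s = I mod n then of_real (H $$ (I div n, j))*f j s else 0)"
  by (rule sum_div_mod)
 also have "... = (SUM j<N. of_real (H $$ (I div n, j))*f j (I mod n))"
  using mod_less_of_less_mult[OF I] by simp
 finally show "(rmat (kron H (1\<^sub>m n)) *\<^sub>v pack N n f) $ I = pack N n (%i s. SUM j<N. of_real (H $$ (i, j))*f j s) $ I"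
  using I by (simp add: pack_def)
qed (use H in \<open>simp add: pack_def kron_def\<close>)

text \<open>The nesting in pairs matches the nested block matrices of \<open>Ac\<close>.\<close>

definition st :: "nat => nat => nat => nat => (nat => nat => 'a) => (nat => nat => 'a) => (nat => nat => 'a) => (nat => nat => 'a) => 'a Matrix.vec" where
 "st N m r l z x e y = (pack N m z @\<^sub>v pack N r x) @\<^sub>v (pack N l e @\<^sub>v pack N r y)"

definition sdim :: "nat => nat => nat => nat => nat" where
 "sdim N m r l = (N*m + N*r) + (N*l + N*r)"

lemma st_carrier: "st N m r l z x e y : carrier_vec (sdim N m r l)"
 by (auto simp: st_def sdim_def pack_def)

text \<open>The position k is resolved once for all stacked functions, so a claim that compares
  several stacked vectors at k reduces to one component of one agent.\<close>

lemma st_cases: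
 assumes "k < sdim N m r l"
 shows "(EX i<N. EX j<m. ALL z x e y. st N m r l z x e y $ k = (z i j :: 'a)) |
  (EX i<N. EX j<r. ALL z x e y. st N m r l z x e y $ k = (x i j :: 'a)) |
  (EX i<N. EX j<l. ALL z x e y. st N m r l z x e y $ k = (e i j :: 'a)) |
  (EX i<N. EX j<r. ALL z x e y. st N m r l z x e y $ k = (y i j :: 'a))"
proof -
 have pk: "pack N n f $ q = f (q div n) (q mod n) & q div n < N & q mod n < n" if "q < N*n" for q n and f :: "nat => nat => 'a"
  using that by (simp add: pack_def div_less_of_less_mult mod_less_of_less_mult)
 have d: "dim_vec (pack N n f) = N*n" for n and f :: "nat => nat => 'a" by (simp add: pack_def)
 consider "k < N*m" | "~ k < N*m" "k < N*m + N*r" | "~ k < N*m + N*r" "k - (N*m + N*r) < N*l"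
  | "~ k < N*m + N*r" "~ k - (N*m + N*r) < N*l" by blast
 then show ?thesis
 proof cases
  case 1
  then have "st N m r l z x e y $ k = z (k div m) (k mod m)" for z x e y :: "nat => nat => 'a"
   using assms pk[OF 1, of z] by (simp add: st_def d sdim_def)
  then have "ALL z x e y. st N m r l z x e y $ k = (z (k div m) (k mod m) :: 'a)" by blast
  moreover have "k div m < N" "k mod m < m" using pk[OF 1] by auto
  ultimately show ?thesis by - (rule disjI1, intro exI conjI, assumption+)
 next
  case 2
  define q where "q = k - N*m"
  have q: "q < N*r" using 2 by (simp add: q_def)
  have "st N m r l z x e y $ k = x (q div r) (q mod r)" for z x e y :: "nat => nat => 'a"
   using assms 2 pk[OF q, of x] by (simp add: st_def d sdim_def q_def)
  then have "ALL z x e y. st N m r l z x e y $ k = (x (q div r) (q mod r) :: 'a)" by blast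
  moreover have "q div r < N" "q mod r < r" using pk[OF q] by auto
  ultimately show ?thesis by - (rule disjI2, rule disjI1, intro exI conjI, assumption+)
 next
  case 3
  define q where "q = k - (N*m + N*r)"
  have q: "q < N*l" using 3 by (simp add: q_def)
  have "st N m r l z x e y $ k = e (q div l) (q mod l)" for z x e y :: "nat => nat => 'a"
   using assms 3 pk[OF q, of e] by (simp add: st_def d sdim_def q_def)
  then have "ALL z x e y. st N m r l z x e y $ k = (e (q div l) (q mod l) :: 'a)" by blast
  moreover have "q div l < N" "q mod l < l" using pk[OF q] by auto
  ultimately show ?thesis by - (rule disjI2, rule disjI2, rule disjI1, intro exI conjI, assumption+)
 next
  case 4
  define q where "q = k - (N*m + N*r) - N*l"
  have q: "q < N*r" using 4 assms by (simp add: q_def sdim_def)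
  have "st N m r l z x e y $ k = y (q div r) (q mod r)" for z x e y :: "nat => nat => 'a"
   using assms 4 pk[OF q, of y] by (simp add: st_def d sdim_def q_def)
  then have "ALL z x e y. st N m r l z x e y $ k = (y (q div r) (q mod r) :: 'a)" by blast
  moreover have "q div r < N" "q mod r < r" using pk[OF q] by auto
  ultimately show ?thesis by - (rule disjI2, rule disjI2, rule disjI2, intro exI conjI, assumption+)
 qed
qed

lemma sum_split_offset: "(SUM k<a + b. g k) = (SUM k<a. g k) + (SUM k<b. g (a + k) :: 'a::comm_monoid_add)" for a b :: nat
 by (induction b) (auto simp: add_ac)

lemma append_vec_index: "u : carrier_vec a ==> v : carrier_vec b ==> k < a ==> (u @\<^sub>v v) $ k = u $ k"
 "u : carrier_vec a ==> v : carrier_vec b ==> k < b ==> (u @\<^sub>v v) $ (a + k) = v $ k"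
 by auto

lemma sum_append_vec:
 assumes "u : carrier_vec a" "v : carrier_vec b" "u' : carrier_vec a" "v' : carrier_vec b"
 shows "(SUM k<a + b. g ((u @\<^sub>v v) $ k) ((u' @\<^sub>v v') $ k)) = (SUM k<a. g (u $ k) (u' $ k)) + (SUM k<b. g (v $ k) (v' $ k) :: 'b::comm_monoid_add)"
 unfolding sum_split_offset using append_vec_index[OF assms(1,2)] append_vec_index[OF assms(3,4)] by simp

lemma sum_pack:
 "(SUM k<N*n. g (pack N n f $ k) (pack N n f' $ k)) = (SUM i<N. SUM j<n. g (f i j) (f' i j) :: 'b::comm_monoid_add)"
proof -
 have "(SUM k<N*n. g (pack N n f $ k) (pack N n f' $ k)) = (SUM k<N*n. g (f (k div n) (k mod n)) (f' (k div n) (k mod n)))"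
  by (rule sum.cong[OF refl]) (simp only: pack_def index_vec lessThan_iff)
 also have "... = (SUM i<N. SUM j<n. g (f i j) (f' i j))"
  by (rule sum_div_mod[of "%i j. g (f i j) (f' i j)"])
 finally show ?thesis .
qed

lemma sum_st:
 "(SUM k<sdim N m r l. g (st N m r l z x e y $ k) (st N m r l z' x' e' y' $ k)) =
  (SUM i<N. SUM j<m. g (z i j) (z' i j)) + (SUM i<N. SUM j<r. g (x i j) (x' i j)) +
  ((SUM i<N. SUM j<l. g (e i j) (e' i j)) + (SUM i<N. SUM j<r. g (y i j) (y' i j)) :: 'b::comm_monoid_add)"
proof -
 note c = append_carrier_vec[OF pack_carrier pack_carrier]
 show ?thesis
  unfolding st_def sdim_def sum_append_vec[OF c c c c, where g = g]
   sum_append_vec[OF pack_carrier pack_carrier pack_carrier pack_carrier, where g = g] sum_pack[where g = g] ..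
qed

lemma st_surj:
 assumes v: "v : carrier_vec (sdim N m r l)"
 shows "EX z x e y. v = st N m r l z x e y"
proof -
 define z x e y where "z i j = v $ (i*m + j)" and "x i j = v $ (N*m + (i*r + j))"
  and "e i j = v $ (N*m + N*r + (i*l + j))" and "y i j = v $ (N*m + N*r + (N*l + (i*r + j)))" for i j
 have "v $ k = st N m r l z x e y $ k" if k: "k < sdim N m r l" for k
 proof -
  consider "k < N*m" | "~ k < N*m" "k < N*m + N*r" | "~ k < N*m + N*r" "k - (N*m + N*r) < N*l"
   | "~ k < N*m + N*r" "~ k - (N*m + N*r) < N*l" by blast
  then show ?thesis
   using k by cases (auto simp: st_def sdim_def pack_def z_def x_def e_def y_def)
 qed
 then have "v = st N m r l z x e y" using v st_carrier[of N m r l z x e y] by (intro eq_vecI) (auto simp: sdim_def)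
 then show ?thesis by blast
qed

lemma pack_index: "i < N ==> j < n ==> pack N n f $ (i*n + j) = f i j"
 using mult_add_less[of i N j n] by (simp add: pack_def)

lemma st_index:
 assumes i: "i < N"
 shows "j < m ==> st N m r l z x e y $ (i*m + j) = z i j"
  and "j < r ==> st N m r l z x e y $ (N*m + (i*r + j)) = x i j"
  and "j < l ==> st N m r l z x e y $ (N*m + N*r + (i*l + j)) = e i j"
  and "j < r ==> st N m r l z x e y $ (N*m + N*r + (N*l + (i*r + j))) = y i j"
proof -
 note pc = pack_carrier and ac = append_carrier_vec[OF pack_carrier pack_carrier]
 show "j < m ==> st N m r l z x e y $ (i*m + j) = z i j"
  unfolding st_def by (subst append_vec_index(1)[OF ac ac], (use mult_add_less[OF i, of j m] in simp),
   subst append_vec_index(1)[OF pc pc], (use mult_add_less[OF i, of j m] in simp), rule pack_index[OF i])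
 show "j < r ==> st N m r l z x e y $ (N*m + (i*r + j)) = x i j"
  unfolding st_def by (subst append_vec_index(1)[OF ac ac], (use mult_add_less[OF i, of j r] in simp),
   subst append_vec_index(2)[OF pc pc], (use mult_add_less[OF i, of j r] in simp), rule pack_index[OF i])
 show "j < l ==> st N m r l z x e y $ (N*m + N*r + (i*l + j)) = e i j"
  unfolding st_def by (subst append_vec_index(2)[OF ac ac], (use mult_add_less[OF i, of j l] in simp),
   subst append_vec_index(1)[OF pc pc], (use mult_add_less[OF i, of j l] in simp), rule pack_index[OF i])
 show "j < r ==> st N m r l z x e y $ (N*m + N*r + (N*l + (i*r + j))) = y i j"
  unfolding st_def by (subst append_vec_index(2)[OF ac ac], (use mult_add_less[OF i, of j r] in simp),
   subst append_vec_index(2)[OF pc pc], (use mult_add_less[OF i, of j r] in simp), rule pack_index[OF i])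
qed

lemma st_inj:
 assumes "st N m r l z x e y = st N m r l z' x' e' y'" and i: "i < N"
 shows "j < m ==> z i j = z' i j" "j < r ==> x i j = x' i j" "j < l ==> e i j = e' i j" "j < r ==> y i j = y' i j"
 using assms(1) st_index[OF i] by metis+

lemma pack_add: "pack N n f + pack N n g = pack N n (%i j. f i j + g i j :: 'a::ring_1)"
 unfolding pack_def by (rule eq_vecI) auto

lemma pack_smult: "c \<cdot>\<^sub>v pack N n f = pack N n (%i j. c*f i j :: 'a::ring_1)"
 unfolding pack_def by (rule eq_vecI) auto

lemma st_smult: "c \<cdot>\<^sub>v st N m r l z x e y = st N m r l (%i j. c*z i j) (%i j. c*x i j) (%i j. c*e i j) (%i j. c*y i j :: 'a::comm_ring_1)"
proof -
 have "c \<cdot>\<^sub>v (u @\<^sub>v v) = (c \<cdot>\<^sub>v u) @\<^sub>v (c \<cdot>\<^sub>v v)" for u v :: "'a Matrix.vec" by (rule eq_vecI) auto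
 then show ?thesis by (simp add: st_def pack_smult)
qed

section \<open>Stable polynomials, observer matrices and resolvent bounds\<close>

lemma stable_poly_root:
 assumes "stable_poly (monom 1 n + (SUM j<n. monom (a j) j))"
  and "\<mu> ^ n = - (SUM j<n. complex_of_real (a j)*\<mu> ^ j)"
 shows "Re \<mu> < 0"
proof -
 have "map_poly complex_of_real (monom 1 n + (SUM j<n. monom (a j) j)) = monom 1 n + (SUM j<n. monom (complex_of_real (a j)) j)"
  by (rule poly_eqI) (simp add: coeff_map_poly coeff_sum if_distrib[of complex_of_real])
 then have "poly (map_poly complex_of_real (monom 1 n + (SUM j<n. monom (a j) j))) \<mu> = 0"
  using assms(2) by (simp add: poly_monom poly_sum)
 then show ?thesis using assms(1) unfolding stable_poly_def by blast
qed

lemma hurwitz_companion: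
 assumes "stable_poly (monom 1 n + (SUM j<n. monom (a j) j))"
 shows "hurwitz (companion n (%j. - a j))"
 unfolding hurwitz_iff_fun[OF companion_carrier]
proof (intro allI impI, elim conjE)
 fix \<mu> x assume x: "EX i<n. x i ~= 0"
  and eq: "ALL i<n. (SUM j<n. complex_of_real (companion n (%j. - a j) $$ (i, j))*x j) = \<mu>*x i"
 have "0 < n" using x by auto
 from companion_eigenvalue_root[OF this x eq] have "\<mu> ^ n = - (SUM j<n. complex_of_real (a j)*\<mu> ^ j)"
  by (simp add: sum_negf)
 then show "Re \<mu> < 0" by (rule stable_poly_root[OF assms])
qed

text \<open>The rows determine an eigenvector from its first entry; extended by 0 beyond its length,
  its entry of index n gives the characteristic equation.\<close>

lemma hurwitz_observer:
 assumes st: "stable_poly (monom 1 n + (SUM j<n. monom (a j) j))"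
 shows "hurwitz (mat n n (%(i, j). (if j = 0 then - a (n - 1 - i) else 0) + (if j = i + 1 then 1 else 0)))"
proof -
 have m: "mat n n (%(i, j). (if j = 0 then - a (n - 1 - i) else 0) + (if j = i + 1 then 1 else 0)) : carrier_mat n n" by simp
 show ?thesis unfolding hurwitz_iff_fun[OF m]
 proof (intro allI impI, elim conjE)
  fix \<mu> and x :: "nat => complex" assume x: "EX i<n. x i ~= 0"
   and eq: "ALL i<n. (SUM j<n. complex_of_real (mat n n (%(i, j). (if j = 0 then - a (n - 1 - i) else 0) + (if j = i + 1 then 1 else 0)) $$ (i, j))*x j) = \<mu>*x i"
  have n: "0 < n" using x by auto
  define X where "X i = (if i < n then x i else 0)" for i
  have step: "X (Suc i) = \<mu>*X i + complex_of_real (a (n - 1 - i))*X 0" if i: "i < n" for i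
  proof -
   have "(SUM j<n. complex_of_real (mat n n (%(i, j). (if j = 0 then - a (n - 1 - i) else 0) + (if j = i + 1 then 1 else 0)) $$ (i, j))*x j)
    = (SUM j<n. (if j = 0 then - complex_of_real (a (n - 1 - i))*x j else 0) + (if j = Suc i then x j else 0))"
    by (rule sum.cong[OF refl]) (use i in \<open>simp add: distrib_right\<close>)
   also have "... = - complex_of_real (a (n - 1 - i))*X 0 + X (Suc i)"
    using n by (simp add: sum.distrib X_def)
   finally show ?thesis using eq i by (simp add: X_def)
  qed
  have sol: "X i = (\<mu> ^ i + (SUM q<i. complex_of_real (a (n - 1 - q))*\<mu> ^ (i - 1 - q)))*X 0" if "i <= n" for i
   using that
  proof (induction i)
   case (Suc i)
   have "(SUM q<i. complex_of_real (a (n - 1 - q))*\<mu> ^ (Suc i - 1 - q)) = \<mu>*(SUM q<i. complex_of_real (a (n - 1 - q))*\<mu> ^ (i - 1 - q))"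
    unfolding sum_distrib_left
   proof (rule sum.cong[OF refl])
    fix q assume "q : {..<i}"
    then have "Suc i - 1 - q = Suc (i - 1 - q)" by auto
    then show "complex_of_real (a (n - 1 - q))*\<mu> ^ (Suc i - 1 - q) = \<mu>*(complex_of_real (a (n - 1 - q))*\<mu> ^ (i - 1 - q))"
     by (simp only: power_Suc mult_ac)
   qed
   then show ?case using step[of i] Suc by (simp add: algebra_simps)
  qed simp
  have x0: "X 0 ~= 0"
  proof
   assume "X 0 = 0"
   then have "X i = 0" if "i <= n" for i using sol[OF that] by simp
   then show False using x unfolding X_def by (metis less_imp_le)
  qed
  have "(SUM q<n. complex_of_real (a (n - 1 - q))*\<mu> ^ (n - 1 - q)) = (SUM j<n. complex_of_real (a j)*\<mu> ^ j)"
   by (rule sum.reindex_bij_witness[of _ "%j. n - 1 - j" "%j. n - 1 - j"]) auto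
  with sol[of n] x0 have "\<mu> ^ n + (SUM j<n. complex_of_real (a j)*\<mu> ^ j) = 0" by (simp add: X_def)
  then have "\<mu> ^ n = - (SUM j<n. complex_of_real (a j)*\<mu> ^ j)" by (simp add: eq_neg_iff_add_eq_0)
  then show "Re \<mu> < 0" by (rule stable_poly_root[OF st])
 qed
qed

text \<open>A bound for the inverse of \<mu> - a in the sum norm, uniform over the closed right
  half-plane.\<close>

definition resolvent_bound :: "nat => (nat => nat => real) => real => bool" where
 "resolvent_bound n a R \<longleftrightarrow> 0 <= R & (ALL \<mu> x f. 0 <= Re \<mu> --> (ALL i<n. \<mu>*x i = (SUM j<n. complex_of_real (a i j)*x j) + f i) -->
  (SUM i<n. cmod (x i)) <= R*(SUM i<n. cmod (f i)))"

lemma resolvent_boundD: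
 assumes "resolvent_bound n a R" "R <= R'" "0 <= Re \<mu>" "ALL i<n. \<mu>*x i = (SUM j<n. complex_of_real (a i j)*x j) + f i"
 shows "(SUM i<n. cmod (x i)) <= R'*(SUM i<n. cmod (f i))"
proof -
 have "(SUM i<n. cmod (x i)) <= R*(SUM i<n. cmod (f i))" using assms unfolding resolvent_bound_def by blast
 also have "... <= R'*(SUM i<n. cmod (f i))" by (intro mult_right_mono assms(2) sum_nonneg) simp
 finally show ?thesis .
qed

lemma resolvent_bound_mono: "resolvent_bound n a R ==> R <= R' ==> resolvent_bound n a R'"
 using resolvent_boundD[of n a R R'] unfolding resolvent_bound_def[of n a R'] by (auto simp: resolvent_bound_def[of n a R])

lemma lyap_cert_resolvent_bound:
 assumes "lyap_cert n a p c" "c > 0" "ALL i<n. ALL j<n. \<bar>p i j\<bar> <= B" "B >= 0"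
 shows "resolvent_bound n a (2*real n*B / c)"
 unfolding resolvent_bound_def using lyap_cert_resolvent[OF assms(1-3)] assms(2,4) by simp

lemma hurwitz_resolvent:
 assumes "hurwitz (mat n n (%(i, j). a i j))"
 shows "EX R. resolvent_bound n a R"
proof -
 obtain p c where pc: "c > 0" "lyap_cert n a p c" using hurwitz_imp_lyap_cert[OF assms] by blast
 obtain B where B: "B >= 0" "!!s. s : {..<n} \<times> {..<n} ==> \<bar>p (fst s) (snd s)\<bar> <= B"
  by (rule finite_upper_bound[of "{..<n} \<times> {..<n}" "%s. \<bar>p (fst s) (snd s)\<bar>"]) auto
 have "ALL i<n. ALL j<n. \<bar>p i j\<bar> <= B" using B(2) by fastforce
 from lyap_cert_resolvent_bound[OF pc(2,1) this B(1)] show ?thesis ..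
qed

section \<open>The closed-loop matrix in coordinates\<close>

locale regulation =
 fixes p :: plant and d :: design and E :: "(nat \<times> nat) set" and W :: "real Matrix.vec set"
 assumes plant: "plant_wf p"
  and graph: "digraph (agents p) E"
  and ctrl: "design_wf p d"
  and W: "compact_vecs (wdim p) W" and W0: "0\<^sub>v (wdim p) : W"
  and b_pos: "ALL w:W. ALL i:{1..agents p}. bb p w i > 0"
  and S_imag: "ALL \<mu>. eigenvalue (cmat (exo_S p)) \<mu> --> Re \<mu> = 0"
  and A1_hurwitz: "ALL w:W. ALL i:{1..agents p}. hurwitz (A1 p w i)"
  and conn: "connected_digraph (agents p) E"
begin

abbreviation "N \<equiv> agents p"
abbreviation "r \<equiv> reldeg p"
abbreviation "l \<equiv> ldim p"
abbreviation "nv \<equiv> exodim p"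
definition m :: nat where "m = zdim p 1"

lemma N1: "1 <= N" and r1: "1 <= r" and nv1: "1 <= nv"
 using plant by (auto simp: plant_wf_def)

lemma zdim_m: assumes "i : {1..N}" shows "zdim p i = m"
proof -
 have "A1_nom p : carrier_mat (zdim p i) (zdim p i)" "A1_nom p : carrier_mat (zdim p 1) (zdim p 1)"
  using plant assms N1 unfolding plant_wf_def by auto
 then show ?thesis unfolding m_def by (metis carrier_matD(1))
qed

lemma carriers:
 assumes "i : {1..N}"
 shows A1_carrier: "A1 p w i : carrier_mat m m" and A2_carrier: "A2 p w i : carrier_mat m 1"
  and A3_carrier: "A3 p w i : carrier_mat 1 m" and E0_carrier: "E0 p w i : carrier_mat m nv"
  and Er_carrier: "Er p w i : carrier_mat 1 nv"
 by (simp_all add: A1_def A2_def A3_def E0_def Er_def zdim_m[OF assms])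

lemma Fw_carrier: "Fw p w : carrier_mat 1 nv"
 by (simp add: Fw_def)

lemma S_carrier: "exo_S p : carrier_mat nv nv"
 using plant by (simp add: plant_wf_def)

lemma l_pos: "0 < l"
 unfolding ldim_def using min_poly_degree_pos[OF S_carrier] nv1 by simp

lemma M_carrier: "ctrl_M d : carrier_mat l l" and Q_carrier: "ctrl_Q d : carrier_mat l 1"
 and M_hurwitz: "hurwitz (ctrl_M d)" and MQ: "controllable l (ctrl_M d) (ctrl_Q d)"
 and gam_stable: "stable_poly (monom 1 (r - 1) + (SUM j<r - 1. monom (ctrl_gamma d j) j))"
 and del_stable: "stable_poly (monom 1 r + (SUM j<r. monom (ctrl_delta d j) j))"
 using ctrl by (auto simp: design_wf_def)

lemma Phi_carrier: "Phi p : carrier_mat l l"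
 by (simp add: Phi_def companion_carrier)

text \<open>Eigenvalues of the companion matrix are roots of the minimal polynomial and so
  eigenvalues of S.\<close>

lemma Phi_eigenvalue: assumes "eigenvalue (cmat (Phi p)) \<mu>" shows "Re \<mu> = 0"
proof -
 let ?m = "min_poly (exo_S p)"
 have c: "cmat (Phi p) : carrier_mat l l" using Phi_carrier by simp
 obtain x where x: "EX i<l. x i ~= 0" "ALL i<l. (SUM j<l. cmat (Phi p) $$ (i, j)*x j) = \<mu>*x i"
  using assms unfolding eigenvalue_iff_fun[OF c] by blast
 have "(SUM j<l. cmat (Phi p) $$ (i, j)*x j) = (SUM j<l. complex_of_real (companion l (%j. - coeff ?m j) $$ (i, j))*x j)" if "i < l" for i
  by (rule sum.cong[OF refl]) (use that Phi_carrier in \<open>simp add: Phi_def[symmetric]\<close>)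
 then have "ALL i<l. (SUM j<l. complex_of_real (companion l (%j. - coeff ?m j) $$ (i, j))*x j) = \<mu>*x i" using x(2) by simp
 from companion_eigenvalue_root[OF l_pos x(1) this]
 have 1: "\<mu> ^ l = - (SUM j<l. complex_of_real (coeff ?m j)*\<mu> ^ j)" by (simp add: sum_negf)
 have "poly (map_poly complex_of_real ?m) \<mu> = (SUM j<=l. complex_of_real (coeff ?m j)*\<mu> ^ j)"
  unfolding ldim_def poly_altdef by (simp add: degree_map_poly coeff_map_poly)
 also have "... = (SUM j<l. complex_of_real (coeff ?m j)*\<mu> ^ j) + \<mu> ^ l"
  using min_poly_monic[OF S_carrier] by (simp add: lessThan_Suc_atMost[symmetric] ldim_def)
 finally have "poly (map_poly complex_of_real ?m) \<mu> = 0" using 1 by simp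
 from min_poly_root_eigenvalue[OF S_carrier _ this] nv1 have "eigenvalue (cmat (exo_S p)) \<mu>" by simp
 then show ?thesis using S_imag by blast
qed

text \<open>\<Phi> has imaginary spectrum and M is Hurwitz, so the Sylvester operator is bijective;
  this discharges the definite description of T.\<close>

lemma T_props:
 shows Tmat_carrier: "Tmat p d : carrier_mat l l"
  and Tmat_eq: "Tmat p d*Phi p - ctrl_M d*Tmat p d = ctrl_Q d*Gam p"
proof -
 let ?M = "ctrl_M d" and ?Q = "ctrl_Q d"
 have disj: "ALL \<mu>. eigenvalue (cmat ?M) \<mu> --> ~ eigenvalue (cmat (Phi p)) \<mu>"
  using M_hurwitz Phi_eigenvalue unfolding hurwitz_def by force
 define C where "C i j = - (?Q*Gam p) $$ (i, j)" for i j
 have Gc: "Gam p : carrier_mat 1 l" by (simp add: Gam_def e1row_def)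
 obtain X where X: "ALL i<l. ALL j<l. (SUM k<l. ?M $$ (i, k)*X k j) - (SUM k<l. X i k*Phi p $$ (k, j)) = C i j"
  using sylvester_real_exists[OF M_carrier Phi_carrier disj] by blast
 have ent: "(R*Phi p - ?M*R) $$ (i, j) = - ((SUM k<l. ?M $$ (i, k)*R $$ (k, j)) - (SUM k<l. R $$ (i, k)*Phi p $$ (k, j)))"
  if "R : carrier_mat l l" "i < l" "j < l" for R i j
 proof -
  have "(R*Phi p - ?M*R) $$ (i, j) = (R*Phi p) $$ (i, j) - (?M*R) $$ (i, j)"
   using that M_carrier Phi_carrier by (intro index_minus_mat) auto
  then show ?thesis using index_mult_mat_sum[OF that(1) Phi_carrier that(2,3)] index_mult_mat_sum[OF M_carrier that] by simp
 qed
 define TT where "TT = mat l l (%(i, j). X i j)"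
 have TT: "TT : carrier_mat l l" by (simp add: TT_def)
 have car: "R*Phi p - ?M*R : carrier_mat l l" if "R : carrier_mat l l" for R
  using that M_carrier by (intro minus_carrier_mat mult_carrier_mat) auto
 have QG: "?Q*Gam p : carrier_mat l l" using Q_carrier Gc by (rule mult_carrier_mat)
 have eqT: "TT*Phi p - ?M*TT = ?Q*Gam p"
 proof (rule eq_matI)
  fix i j assume "i < dim_row (?Q*Gam p)" "j < dim_col (?Q*Gam p)"
  then have ij: "i < l" "j < l" using QG by auto
  have "(SUM k<l. ?M $$ (i, k)*TT $$ (k, j)) - (SUM k<l. TT $$ (i, k)*Phi p $$ (k, j)) = C i j"
   using X ij by (simp add: TT_def)
  then show "(TT*Phi p - ?M*TT) $$ (i, j) = (?Q*Gam p) $$ (i, j)"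
   unfolding ent[OF TT ij] by (simp only: C_def minus_minus)
 qed (simp_all only: carrier_matD[OF car[OF TT]] carrier_matD[OF QG])
 have uniq: "R = TT" if R: "R : carrier_mat l l & R*Phi p - ?M*R = ?Q*Gam p" for R
 proof (rule eq_matI)
  fix i j assume "i < dim_row TT" "j < dim_col TT"
  then have ij: "i < l" "j < l" by (auto simp: TT_def)
  define D where "D i j = R $$ (i, j) - TT $$ (i, j)" for i j
  have "ALL i<l. ALL j<l. (SUM k<l. ?M $$ (i, k)*D k j) = (SUM k<l. D i k*Phi p $$ (k, j))"
  proof (intro allI impI)
   fix i j assume ij: "i < l" "j < l"
   have "(R*Phi p - ?M*R) $$ (i, j) = (TT*Phi p - ?M*TT) $$ (i, j)" using R eqT by simp
   then show "(SUM k<l. ?M $$ (i, k)*D k j) = (SUM k<l. D i k*Phi p $$ (k, j))"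
    unfolding ent[OF conjunct1[OF R] ij] ent[OF TT ij] D_def
    by (simp only: left_diff_distrib right_diff_distrib sum_subtractf)
  qed
  from sylvester_real_unique[OF M_carrier Phi_carrier disj this ij] show "R $$ (i, j) = TT $$ (i, j)" by (simp add: D_def)
 qed (use R in \<open>auto simp: TT_def\<close>)
 have "Tmat p d = TT" unfolding Tmat_def by (rule the_equality, rule conjI[OF TT eqT], rule uniq)
 then show "Tmat p d : carrier_mat l l" "Tmat p d*Phi p - ctrl_M d*Tmat p d = ctrl_Q d*Gam p" using TT eqT by auto
qed

definition T :: "nat => nat => real" where "T i j = Tmat p d $$ (i, j)"
definition \<psi> :: "nat => real" where "\<psi> k = GamTinv p d $$ (0, k)"
definition om :: "nat => real" where "om s = (if s = r - 1 then 1 else ctrl_gamma d s)"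
definition Mc :: "nat => nat => real" where "Mc i j = ctrl_M d $$ (i, j)"
definition Qc :: "nat => real" where "Qc i = ctrl_Q d $$ (i, 0)"

lemma T_sylvester: assumes ij: "i < l" "j < l"
 shows "(SUM k<l. T i k*Phi p $$ (k, j)) = (SUM k<l. Mc i k*T k j) + Qc i*(if j = 0 then 1 else 0)"
proof -
 have Gc: "Gam p : carrier_mat 1 l" by (simp add: Gam_def e1row_def)
 have "(Tmat p d*Phi p - ctrl_M d*Tmat p d) $$ (i, j) = (Tmat p d*Phi p) $$ (i, j) - (ctrl_M d*Tmat p d) $$ (i, j)"
  using ij M_carrier Phi_carrier Tmat_carrier by (intro index_minus_mat) auto
 moreover have "(ctrl_Q d*Gam p) $$ (i, j) = Qc i*(if j = 0 then 1 else 0)"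
  using index_mult_mat_sum[OF Q_carrier Gc ij] ij by (simp add: Qc_def Gam_def e1row_def)
 ultimately show ?thesis
  using Tmat_eq index_mult_mat_sum[OF Tmat_carrier Phi_carrier ij] index_mult_mat_sum[OF M_carrier Tmat_carrier ij]
  unfolding T_def Mc_def by simp
qed

lemma T_injective: assumes "ALL i<l. mv l T x i = 0" shows "ALL i<l. x i = 0"
proof (rule sylvester_companion_injective[OF l_pos M_carrier Q_carrier MQ _ assms, where a = "%j. - coeff (min_poly (exo_S p)) j"])
 show "ALL i<l. ALL j<l. (SUM k<l. ctrl_M d $$ (i, k)*T k j) - (SUM k<l. T i k*companion l (%j. - coeff (min_poly (exo_S p)) j) $$ (k, j))
  = - (ctrl_Q d $$ (i, 0)*(if j = 0 then 1 else 0))"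
  using T_sylvester unfolding Phi_def Mc_def Qc_def by simp
qed

text \<open>Controllability makes T injective, so \<open>mat_inverse\<close> returns a matrix; then
  \<psi> T = \<Gamma>, which is what lets \<eta> reproduce the feedforward input.\<close>

lemma GamTinv_props:
 shows GamTinv_carrier: "GamTinv p d : carrier_mat 1 l"
  and \<psi>_T: "k < l ==> (SUM j<l. \<psi> j*T j k) = (if k = 0 then 1 else 0)"
proof -
 have "det (Tmat p d) ~= 0"
 proof
  assume "det (Tmat p d) = 0"
  then obtain v where v: "v : carrier_vec l" "v ~= 0\<^sub>v l" "Tmat p d *\<^sub>v v = 0\<^sub>v l"
   using det_0_iff_vec_prod_zero_field[OF Tmat_carrier] by blast
  have "ALL i<l. mv l T (%i. v $ i) i = 0"
  proof (intro allI impI)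
   fix i assume i: "i < l"
   have "(Tmat p d *\<^sub>v v) $ i = mv l T (%i. v $ i) i"
    using index_mult_mat_vec_sum[OF Tmat_carrier v(1) i] by (simp only: mv_def T_def)
   then show "mv l T (%i. v $ i) i = 0" using v(3) i by simp
  qed
  from T_injective[OF this] have "v = 0\<^sub>v l" using v(1) by (intro eq_vecI) auto
  then show False using v(2) by simp
 qed
 from det_non_zero_imp_unit[OF Tmat_carrier this, of "()"]
 have "mat_inverse (Tmat p d) ~= None" using mat_inverse(1)[OF Tmat_carrier, of "()"] by blast
 then obtain R where R: "mat_inverse (Tmat p d) = Some R" by blast
 note Ri = mat_inverse(2)[OF Tmat_carrier R]
 have Gc: "Gam p : carrier_mat 1 l" by (simp add: Gam_def e1row_def)
 show c: "GamTinv p d : carrier_mat 1 l" unfolding GamTinv_def R using Gc Ri by simp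
 assume k: "k < l"
 have "GamTinv p d*Tmat p d = Gam p*(R*Tmat p d)"
  unfolding GamTinv_def R option.sel by (rule assoc_mult_mat[OF Gc _ Tmat_carrier]) (use Ri in blast)
 also have "... = Gam p" using Ri Gc by simp
 finally have "(GamTinv p d*Tmat p d) $$ (0, k) = Gam p $$ (0, k)" by simp
 then show "(SUM j<l. \<psi> j*T j k) = (if k = 0 then 1 else 0)"
  using index_mult_mat_sum[OF c Tmat_carrier, of 0 k] k by (simp add: \<psi>_def T_def Gam_def e1row_def)
qed

text \<open>With \<open>dx\<close>, \<open>de\<close> and \<open>dy\<close> below: the block rows of
  \<open>Ac\<close> applied to a stacked state. Agents are counted from 0 here, hence
  \<open>Suc i\<close> in the coefficients; \<open>uu\<close> is the feedback as a function of
  \<eta> and \<zeta>.\<close>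

definition dz :: "real Matrix.vec => (nat => nat => 'a::real_field) => (nat => nat => 'a) => nat => nat => 'a" where
 "dz w z x i j = (SUM k<m. of_real (A1 p w (Suc i) $$ (j, k))*z i k) + of_real (A2 p w (Suc i) $$ (j, 0))*x i 0"
definition uu :: "real => (nat => nat => 'a::real_field) => (nat => nat => 'a) => nat => 'a" where
 "uu K e y i = (SUM k<l. of_real (\<psi> k)*e i k) - of_real K*(SUM s<r. of_real (om s)*y i s)"
definition dx :: "real Matrix.vec => real => (nat => nat => 'a::real_field) => (nat => nat => 'a) => (nat => nat => 'a) => (nat => nat => 'a) => nat => nat => 'a" where
 "dx w K z x e y i s = (if s + 1 < r then x i (s + 1) else (SUM k<m. of_real (A3 p w (Suc i) $$ (0, k))*z i k)
  + (SUM q<r. of_real (cc p w (q + 1) (Suc i))*x i q) + of_real (bb p w (Suc i))*uu K e y i)"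
definition de :: "real => (nat => nat => 'a::real_field) => (nat => nat => 'a) => nat => nat => 'a" where
 "de K e y i k = (SUM q<l. of_real (Mc k q)*e i q) + of_real (Qc k)*uu K e y i"
definition dy :: "real => (nat => nat => 'a::real_field) => (nat => nat => 'a) => nat => nat => 'a" where
 "dy h x y i s = of_real (h ^ (s + 1)*ctrl_delta d (r - 1 - s))*((SUM j<N. of_real (Hmat N E $$ (i, j))*x j 0) - y i 0)
  + (if s + 1 < r then y i (s + 1) else 0)"

abbreviation "nst \<equiv> sdim N m r l"

lemma nz: "(SUM i:{1..N}. zdim p i) = N*m"
 using zdim_m by simp

lemma rmat_zero: "rmat (0\<^sub>m a b) *\<^sub>v v = (0\<^sub>v a :: 'a::real_field Matrix.vec)" if "v : carrier_vec b"
proof -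
 have "rmat (0\<^sub>m a b) = (0\<^sub>m a b :: 'a mat)" by (rule eq_matI) auto
 then show ?thesis using that by (simp only:) (intro eq_vecI, auto)
qed

lemma Omega_carrier: "Omega p d : carrier_mat 1 r" by (simp add: Omega_def)

text \<open>Multiplies the block matrices out once, so that later arguments can work with the action
  of \<open>Ac\<close> on stacked states, over the reals as well as over the complex
  numbers.\<close>

lemma Ac_carrier: "Ac p d E K h w : carrier_mat nst nst"
 and Ac_st: "rmat (Ac p d E K h w) *\<^sub>v st N m r l z x e y = st N m r l (dz w z x) (dx w K z x e y) (de K e y) (dy h x y :: nat => nat => 'a::real_field)"
proof -
 have c1: "ALL i:{1..N}. A1 p w i : carrier_mat m m" using A1_carrier by blast
 have c2: "ALL i:{1..N}. A2 p w i*e1row r : carrier_mat m r"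
  using A2_carrier by (intro ballI mult_carrier_mat) (auto simp: e1row_def)
 have c4: "ALL i:{1..N}. A4 p w i : carrier_mat r m" using zdim_m by (simp add: A4_def)
 have c5: "ALL i:{1..N}. A5 p w i : carrier_mat r r" by (simp add: A5_def companion_carrier)
 have c6: "ALL i:{1..N}. B0 p w i*GamTinv p d : carrier_mat r l"
  using GamTinv_carrier by (intro ballI mult_carrier_mat) (auto simp: B0_def)
 have c7: "ALL i:{1..N}. - (B0 p w i*(K \<cdot>\<^sub>m Omega p d)) : carrier_mat r r"
  using Omega_carrier by (intro ballI uminus_carrier_mat mult_carrier_mat) (auto simp: B0_def)
 have c8: "ctrl_M d + ctrl_Q d*GamTinv p d : carrier_mat l l"
  using M_carrier Q_carrier GamTinv_carrier by (intro add_carrier_mat mult_carrier_mat)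
 have c9: "ctrl_Q d*(K \<cdot>\<^sub>m Omega p d) : carrier_mat l r"
  using Q_carrier Omega_carrier by (intro mult_carrier_mat) auto
 define Bm where "Bm = mat r r (%(i, j). if j = 0 then Bo p d h $$ (i, 0) else 0)"
 have cB: "Bm : carrier_mat r r" by (simp add: Bm_def)
 have cAo: "Ao p d h : carrier_mat r r" by (simp add: Ao_def)
 have k1: "kron (Hmat N E) (1\<^sub>m r) : carrier_mat (N*r) (N*r)" using Hmat_carrier[of N E] by (simp add: kron_def)
 have k2: "kron (1\<^sub>m N) Bm : carrier_mat (N*r) (N*r)" by (rule kron_one_block(1)[OF cB])
 note a1 = agent_diag_block(1)[OF c1] and a2 = agent_diag_block(1)[OF c2] and a4 = agent_diag_block(1)[OF c4]
  and a5 = agent_diag_block(1)[OF c5] and a6 = agent_diag_block(1)[OF c6] and a7 = agent_diag_block(1)[OF c7]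
  and a8 = kron_one_block(1)[OF c8, of N] and a9 = kron_one_block(1)[OF c9, of N] and a12 = kron_one_block(1)[OF cAo, of N]
 have a11: "Abar11 p d E h : carrier_mat (N*r) (N*r)"
  unfolding Abar11_def Bm_def[symmetric] by (rule mult_carrier_mat[OF k1 k2])
 have a9': "Abar9 p d K : carrier_mat (N*l) (N*r)" unfolding Abar9_def using a9 by simp
 note defs = Abar1_def Abar2_def Abar4_def Abar5_def Abar6_def Abar7_def Abar8_def Abar12_def
 define TL where "TL = four_block_mat (Abar1 p w) (Abar2 p w) (Abar4 p w) (Abar5 p w)"
 define TR where "TR = four_block_mat (0\<^sub>m (N*m) (N*l)) (0\<^sub>m (N*m) (N*r)) (Abar6 p d w) (Abar7 p d K w)"
 define BL where "BL = four_block_mat (0\<^sub>m (N*l) (N*m)) (0\<^sub>m (N*l) (N*r)) (0\<^sub>m (N*r) (N*m)) (Abar11 p d E h)"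
 define BR where "BR = four_block_mat (Abar8 p d) (Abar9 p d K) (0\<^sub>m (N*r) (N*l)) (Abar12 p d h)"
 have Ac: "Ac p d E K h w = four_block_mat TL TR BL BR"
  unfolding Ac_def Let_def nz TL_def TR_def BL_def BR_def ..
 have z: "0\<^sub>m a b : carrier_mat a b" for a b by simp
 have cTL: "TL : carrier_mat (N*m + N*r) (N*m + N*r)" unfolding TL_def defs by (rule four_block_carrier_mat[OF a1 a5])
 have cTR: "TR : carrier_mat (N*m + N*r) (N*l + N*r)" unfolding TR_def defs by (rule four_block_carrier_mat[OF z a7])
 have cBL: "BL : carrier_mat (N*l + N*r) (N*m + N*r)" unfolding BL_def by (rule four_block_carrier_mat[OF z a11])
 have cBR: "BR : carrier_mat (N*l + N*r) (N*l + N*r)" unfolding BR_def defs by (rule four_block_carrier_mat[OF a8 a12])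
 show "Ac p d E K h w : carrier_mat nst nst" unfolding Ac sdim_def by (rule four_block_carrier_mat[OF cTL cBR])
 have rc: "rmat A : carrier_mat a b" if "A : carrier_mat a b" for A a b using that by simp
 let ?z = "pack N m z" and ?x = "pack N r x" and ?e = "pack N l e" and ?y = "pack N r y"
 have four: "rmat (four_block_mat A B C D) *\<^sub>v (u @\<^sub>v v) = (rmat A *\<^sub>v u + rmat B *\<^sub>v v) @\<^sub>v (rmat C *\<^sub>v u + rmat D *\<^sub>v v)"
  if "A : carrier_mat a a'" "B : carrier_mat a b'" "C : carrier_mat b a'" "D : carrier_mat b b'"
   "u : carrier_vec a'" "v : carrier_vec b'" for A B C D and u v :: "'a Matrix.vec" and a a' b b'
  unfolding map_four_block_mat[OF that(1-4)]
  by (rule four_block_mat_mult_vec[OF rc[OF that(1)] rc[OF that(2)] rc[OF that(3)] rc[OF that(4)] that(5,6)])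
 note pc = pack_carrier
 have TLv: "rmat TL *\<^sub>v (?z @\<^sub>v ?x) = (rmat (Abar1 p w) *\<^sub>v ?z + rmat (Abar2 p w) *\<^sub>v ?x) @\<^sub>v (rmat (Abar4 p w) *\<^sub>v ?z + rmat (Abar5 p w) *\<^sub>v ?x)"
  unfolding TL_def defs by (rule four[OF a1 a2 a4 a5 pc pc])
 have TRv: "rmat TR *\<^sub>v (?e @\<^sub>v ?y) = (rmat (0\<^sub>m (N*m) (N*l)) *\<^sub>v ?e + rmat (0\<^sub>m (N*m) (N*r)) *\<^sub>v ?y) @\<^sub>v (rmat (Abar6 p d w) *\<^sub>v ?e + rmat (Abar7 p d K w) *\<^sub>v ?y)"
  unfolding TR_def defs by (rule four[OF z z a6 a7 pc pc])
 have BLv: "rmat BL *\<^sub>v (?z @\<^sub>v ?x) = (rmat (0\<^sub>m (N*l) (N*m)) *\<^sub>v ?z + rmat (0\<^sub>m (N*l) (N*r)) *\<^sub>v ?x) @\<^sub>v (rmat (0\<^sub>m (N*r) (N*m)) *\<^sub>v ?z + rmat (Abar11 p d E h) *\<^sub>v ?x)"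
  unfolding BL_def by (rule four[OF z z z a11 pc pc])
 have BRv: "rmat BR *\<^sub>v (?e @\<^sub>v ?y) = (rmat (Abar8 p d) *\<^sub>v ?e + rmat (Abar9 p d K) *\<^sub>v ?y) @\<^sub>v (rmat (0\<^sub>m (N*r) (N*l)) *\<^sub>v ?e + rmat (Abar12 p d h) *\<^sub>v ?y)"
  unfolding BR_def using four[OF a8 a9' z a12 pc pc] unfolding defs .
 have v1: "rmat (Abar1 p w) *\<^sub>v ?z = pack N m (%i j. SUM k<m. of_real (A1 p w (Suc i) $$ (j, k))*z i k)"
  unfolding Abar1_def by (rule agent_diag_mult[OF c1])
 have v2: "rmat (Abar2 p w) *\<^sub>v ?x = pack N m (%i j. of_real (A2 p w (Suc i) $$ (j, 0))*x i 0)"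
  unfolding Abar2_def agent_diag_mult[OF c2]
 proof (rule pack_cong)
  fix i j assume i: "i < N" and j: "j < m"
  have A2c: "A2 p w (Suc i) : carrier_mat m 1" using A2_carrier i by simp
  have "(A2 p w (Suc i)*e1row r) $$ (j, k) = A2 p w (Suc i) $$ (j, 0)*(if k = 0 then 1 else 0)" if "k < r" for k
   using index_mult_mat_sum[OF A2c, of "e1row r" r j k] j that by (simp add: e1row_def)
  then have "(SUM k<r. of_real ((A2 p w (Suc i)*e1row r) $$ (j, k))*x i k) = (SUM k<r. if k = 0 then of_real (A2 p w (Suc i) $$ (j, 0))*x i k else 0)"
   by (intro sum.cong refl) simp
  then show "(SUM k<r. of_real ((A2 p w (Suc i)*e1row r) $$ (j, k))*x i k) = of_real (A2 p w (Suc i) $$ (j, 0))*x i 0"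
   using r1 by simp
 qed
 have v4: "rmat (Abar4 p w) *\<^sub>v ?z = pack N r (%i s. if s = r - 1 then (SUM k<m. of_real (A3 p w (Suc i) $$ (0, k))*z i k) else 0)"
  unfolding Abar4_def agent_diag_mult[OF c4] by (rule pack_cong) (auto simp: A4_def zdim_m)
 have v5: "rmat (Abar5 p w) *\<^sub>v ?x = pack N r (%i s. if s = r - 1 then (SUM q<r. of_real (cc p w (q + 1) (Suc i))*x i q) else x i (s + 1))"
  unfolding Abar5_def agent_diag_mult[OF c5]
 proof (rule pack_cong)
  fix i s assume i: "i < N" and s: "s < r"
  show "(SUM k<r. of_real (A5 p w (Suc i) $$ (s, k))*x i k) = (if s = r - 1 then (SUM q<r. of_real (cc p w (q + 1) (Suc i))*x i q) else x i (s + 1))"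
  proof (cases "s = r - 1")
   case True then show ?thesis using s by (simp add: A5_def companion_def)
  next
   case False
   have "(SUM k<r. of_real (A5 p w (Suc i) $$ (s, k))*x i k) = (SUM k<r. if k = s + 1 then x i k else 0)"
    by (rule sum.cong[OF refl]) (use s False in \<open>simp add: A5_def companion_def\<close>)
   then show ?thesis using s False by simp
  qed
 qed
 have B0e: "(B0 p w i*R) $$ (s, k) = (if s = r - 1 then bb p w i*R $$ (0, k) else 0)" if "R : carrier_mat 1 q" "s < r" "k < q" for R q i s k
  using index_mult_mat_sum[of "B0 p w i" r 1 R q s k] that by (simp add: B0_def)
 have v6: "rmat (Abar6 p d w) *\<^sub>v ?e = pack N r (%i s. if s = r - 1 then of_real (bb p w (Suc i))*(SUM k<l. of_real (\<psi> k)*e i k) else 0)"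
  unfolding Abar6_def agent_diag_mult[OF c6]
  by (rule pack_cong) (simp add: B0e[OF GamTinv_carrier] \<psi>_def sum_distrib_left mult_ac)
 have Ome: "Omega p d $$ (0, k) = om k" if "k < r" for k using that by (simp add: Omega_def om_def)
 have v7: "rmat (Abar7 p d K w) *\<^sub>v ?y = pack N r (%i s. if s = r - 1 then - (of_real (bb p w (Suc i))*(of_real K*(SUM q<r. of_real (om q)*y i q))) else 0)"
  unfolding Abar7_def agent_diag_mult[OF c7]
 proof (rule pack_cong)
  fix i s assume i: "i < N" and s: "s < r"
  have KO: "K \<cdot>\<^sub>m Omega p d : carrier_mat 1 r" using Omega_carrier by simp
  have BK: "B0 p w (Suc i)*(K \<cdot>\<^sub>m Omega p d) : carrier_mat r r" using KO by (intro mult_carrier_mat) (auto simp: B0_def)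
  have "(- (B0 p w (Suc i)*(K \<cdot>\<^sub>m Omega p d))) $$ (s, k) = (if s = r - 1 then - (bb p w (Suc i)*(K*om k)) else 0)" if k: "k < r" for k
  proof -
   have "(- (B0 p w (Suc i)*(K \<cdot>\<^sub>m Omega p d))) $$ (s, k) = - ((B0 p w (Suc i)*(K \<cdot>\<^sub>m Omega p d)) $$ (s, k))"
    using BK s k by (intro index_uminus_mat) auto
   also have "(K \<cdot>\<^sub>m Omega p d) $$ (0, k) = K*om k" using Omega_carrier k Ome by simp
   then have "(B0 p w (Suc i)*(K \<cdot>\<^sub>m Omega p d)) $$ (s, k) = (if s = r - 1 then bb p w (Suc i)*(K*om k) else 0)"
    by (simp only: B0e[OF KO s k])
   finally show ?thesis by simp
  qed
  then have "(SUM k<r. of_real ((- (B0 p w (Suc i)*(K \<cdot>\<^sub>m Omega p d))) $$ (s, k))*y i k) =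
   (SUM k<r. of_real (if s = r - 1 then - (bb p w (Suc i)*(K*om k)) else 0)*y i k)"
   by (intro sum.cong refl) simp
  then show "(SUM k<r. of_real ((- (B0 p w (Suc i)*(K \<cdot>\<^sub>m Omega p d))) $$ (s, k))*y i k) =
   (if s = r - 1 then - (of_real (bb p w (Suc i))*(of_real K*(SUM q<r. of_real (om q)*y i q))) else 0)"
   by (simp add: sum_distrib_left sum_negf mult_ac)
 qed
 have v8: "rmat (Abar8 p d) *\<^sub>v ?e = pack N l (%i k. (SUM q<l. of_real (Mc k q)*e i q) + of_real (Qc k)*(SUM q<l. of_real (\<psi> q)*e i q))"
  unfolding Abar8_def kron_one_mult[OF c8]
 proof (rule pack_cong)
  fix i k assume k: "k < l"
  have "(ctrl_M d + ctrl_Q d*GamTinv p d) $$ (k, q) = Mc k q + Qc k*\<psi> q" if q: "q < l" for q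
  proof -
   have "(ctrl_M d + ctrl_Q d*GamTinv p d) $$ (k, q) = ctrl_M d $$ (k, q) + (ctrl_Q d*GamTinv p d) $$ (k, q)"
    using Q_carrier GamTinv_carrier k q by (intro index_add_mat) auto
   then show ?thesis using index_mult_mat_sum[OF Q_carrier GamTinv_carrier k q] by (simp add: Mc_def Qc_def \<psi>_def)
  qed
  then have "(SUM q<l. of_real ((ctrl_M d + ctrl_Q d*GamTinv p d) $$ (k, q))*e i q) = (SUM q<l. of_real (Mc k q + Qc k*\<psi> q)*e i q)"
   by (intro sum.cong refl) simp
  then show "(SUM q<l. of_real ((ctrl_M d + ctrl_Q d*GamTinv p d) $$ (k, q))*e i q) = (SUM q<l. of_real (Mc k q)*e i q) + of_real (Qc k)*(SUM q<l. of_real (\<psi> q)*e i q)"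
   by (simp only: of_real_add of_real_mult distrib_right sum.distrib sum_distrib_left mult.assoc)
 qed
 have v9: "rmat (Abar9 p d K) *\<^sub>v ?y = pack N l (%i k. - (of_real (Qc k)*(of_real K*(SUM q<r. of_real (om q)*y i q))))"
 proof -
  have "rmat (Abar9 p d K) = - (rmat (kron (1\<^sub>m N) (ctrl_Q d*(K \<cdot>\<^sub>m Omega p d))) :: 'a mat)"
   unfolding Abar9_def by (rule eq_matI) auto
  then have "rmat (Abar9 p d K) *\<^sub>v ?y = - (rmat (kron (1\<^sub>m N) (ctrl_Q d*(K \<cdot>\<^sub>m Omega p d))) *\<^sub>v ?y)"
   using uminus_mult_mat_vec[of ?y "rmat (kron (1\<^sub>m N) (ctrl_Q d*(K \<cdot>\<^sub>m Omega p d))) :: 'a mat"] a9 by (simp add: pack_def)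
  also have "... = pack N l (%i k. - (SUM q<r. of_real ((ctrl_Q d*(K \<cdot>\<^sub>m Omega p d)) $$ (k, q))*y i q))"
   unfolding kron_one_mult[OF c9] by (simp add: pack_def) (rule eq_vecI, auto)
  also have "... = pack N l (%i k. - (of_real (Qc k)*(of_real K*(SUM q<r. of_real (om q)*y i q))))"
  proof (rule pack_cong)
   fix i k assume k: "k < l"
   have KO: "K \<cdot>\<^sub>m Omega p d : carrier_mat 1 r" using Omega_carrier by simp
   have "(ctrl_Q d*(K \<cdot>\<^sub>m Omega p d)) $$ (k, q) = Qc k*(K*om q)" if q: "q < r" for q
    using index_mult_mat_sum[OF Q_carrier KO k q] Omega_carrier q Ome[OF q] by (simp add: Qc_def)
   then have "(SUM q<r. of_real ((ctrl_Q d*(K \<cdot>\<^sub>m Omega p d)) $$ (k, q))*y i q) = (SUM q<r. of_real (Qc k*(K*om q))*y i q)"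
    by (intro sum.cong refl) simp
   then show "- (SUM q<r. of_real ((ctrl_Q d*(K \<cdot>\<^sub>m Omega p d)) $$ (k, q))*y i q) = - (of_real (Qc k)*(of_real K*(SUM q<r. of_real (om q)*y i q)))"
    by (simp add: sum_distrib_left mult_ac)
  qed
  finally show ?thesis .
 qed
 have Boe: "Bo p d h $$ (s, 0) = h ^ (s + 1)*ctrl_delta d (r - 1 - s)" if "s < r" for s using that by (simp add: Bo_def)
 have v11: "rmat (Abar11 p d E h) *\<^sub>v ?x = pack N r (%i s. SUM j<N. of_real (Hmat N E $$ (i, j))*(of_real (h ^ (s + 1)*ctrl_delta d (r - 1 - s))*x j 0))"
 proof -
  have "rmat (Abar11 p d E h) = rmat (kron (Hmat N E) (1\<^sub>m r))*(rmat (kron (1\<^sub>m N) Bm) :: 'a mat)"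
   unfolding Abar11_def Bm_def[symmetric] by (rule of_real_hom.mat_hom_mult[OF k1 k2])
  then have "rmat (Abar11 p d E h) *\<^sub>v ?x = rmat (kron (Hmat N E) (1\<^sub>m r)) *\<^sub>v (rmat (kron (1\<^sub>m N) Bm) *\<^sub>v ?x)"
   using assoc_mult_mat_vec[OF rc[OF k1] rc[OF k2] pc, of x] by simp
  also have "rmat (kron (1\<^sub>m N) Bm) *\<^sub>v ?x = pack N r (%i s. of_real (h ^ (s + 1)*ctrl_delta d (r - 1 - s))*x i 0)"
   unfolding kron_one_mult[OF cB]
  proof (rule pack_cong)
   fix i s assume s: "s < r"
   have "(SUM k<r. of_real (Bm $$ (s, k))*x i k) = (SUM k<r. if k = 0 then of_real (Bo p d h $$ (s, 0))*x i k else 0)"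
    by (rule sum.cong[OF refl]) (use s in \<open>simp add: Bm_def\<close>)
   then show "(SUM k<r. of_real (Bm $$ (s, k))*x i k) = of_real (h ^ (s + 1)*ctrl_delta d (r - 1 - s))*x i 0"
    using r1 Boe[OF s] by simp
  qed
  finally show ?thesis unfolding kron_id_mult[OF Hmat_carrier] .
 qed
 have v12: "rmat (Abar12 p d h) *\<^sub>v ?y = pack N r (%i s. - of_real (h ^ (s + 1)*ctrl_delta d (r - 1 - s))*y i 0 + (if s + 1 < r then y i (s + 1) else 0))"
  unfolding Abar12_def kron_one_mult[OF cAo]
 proof (rule pack_cong)
  fix i s assume s: "s < r"
  have "(SUM k<r. of_real (Ao p d h $$ (s, k))*y i k) = (SUM k<r. (if k = 0 then - of_real (h ^ (s + 1)*ctrl_delta d (r - 1 - s))*y i k else 0) + (if k = s + 1 then y i k else 0))"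
   by (rule sum.cong[OF refl]) (use s Boe[OF s] in \<open>simp add: Ao_def\<close>)
  then show "(SUM k<r. of_real (Ao p d h $$ (s, k))*y i k) = - of_real (h ^ (s + 1)*ctrl_delta d (r - 1 - s))*y i 0 + (if s + 1 < r then y i (s + 1) else 0)"
   using r1 by (simp add: sum.distrib)
 qed
 have app_add: "(u @\<^sub>v v) + (u' @\<^sub>v v') = (u + u') @\<^sub>v (v + v')"
  if "u : carrier_vec a" "u' : carrier_vec a" "v : carrier_vec b" "v' : carrier_vec b" for u v u' v' :: "'a Matrix.vec" and a b
  by (rule eq_vecI) (use that in auto)
 define X1 where "X1 i s = (if s = r - 1 then (SUM k<m. of_real (A3 p w (Suc i) $$ (0, k))*z i k) else 0) +
  (if s = r - 1 then (SUM q<r. of_real (cc p w (q + 1) (Suc i))*x i q) else x i (s + 1))" for i s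
 define X2 where "X2 i s = (if s = r - 1 then of_real (bb p w (Suc i))*(SUM k<l. of_real (\<psi> k)*e i k) else 0) +
  (if s = r - 1 then - (of_real (bb p w (Suc i))*(of_real K*(SUM q<r. of_real (om q)*y i q))) else 0)" for i s
 define Y1 where "Y1 i s = (SUM j<N. of_real (Hmat N E $$ (i, j))*(of_real (h ^ (s + 1)*ctrl_delta d (r - 1 - s))*x j 0))" for i s
 define Y2 where "Y2 i s = - of_real (h ^ (s + 1)*ctrl_delta d (r - 1 - s))*y i 0 + (if s + 1 < r then y i (s + 1) else 0)" for i s
 have TL': "rmat TL *\<^sub>v (?z @\<^sub>v ?x) = pack N m (dz w z x) @\<^sub>v pack N r X1"
  unfolding TLv v1 v2 v4 v5 pack_add dz_def[abs_def] X1_def[abs_def] ..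
 have z0: "0\<^sub>v a + 0\<^sub>v a = (0\<^sub>v a :: 'a Matrix.vec)" for a by (rule right_zero_vec) simp
 have TR': "rmat TR *\<^sub>v (?e @\<^sub>v ?y) = 0\<^sub>v (N*m) @\<^sub>v pack N r X2"
  unfolding TRv rmat_zero[OF pc] z0 v6 v7 pack_add X2_def[abs_def] ..
 have BL': "rmat BL *\<^sub>v (?z @\<^sub>v ?x) = 0\<^sub>v (N*l) @\<^sub>v pack N r Y1"
  unfolding BLv rmat_zero[OF pc] z0 v11 left_zero_vec[OF pc] Y1_def[abs_def] ..
 have deq: "pack N l (%i k. ((SUM q<l. of_real (Mc k q)*e i q) + of_real (Qc k)*(SUM q<l. of_real (\<psi> q)*e i q))
   + - (of_real (Qc k)*(of_real K*(SUM q<r. of_real (om q)*y i q)))) = pack N l (de K e y)"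
  by (rule pack_cong) (simp add: de_def uu_def right_diff_distrib)
 have BR': "rmat BR *\<^sub>v (?e @\<^sub>v ?y) = pack N l (de K e y) @\<^sub>v pack N r Y2"
  unfolding BRv rmat_zero[OF pc] v8 v9 v12 pack_add deq left_zero_vec[OF pc] Y2_def[abs_def] ..
 have "rmat (Ac p d E K h w) *\<^sub>v st N m r l z x e y =
  (rmat TL *\<^sub>v (?z @\<^sub>v ?x) + rmat TR *\<^sub>v (?e @\<^sub>v ?y)) @\<^sub>v (rmat BL *\<^sub>v (?z @\<^sub>v ?x) + rmat BR *\<^sub>v (?e @\<^sub>v ?y))"
  unfolding Ac st_def by (rule four[OF cTL cTR cBL cBR append_carrier_vec[OF pc pc] append_carrier_vec[OF pc pc]])
 also have "rmat TL *\<^sub>v (?z @\<^sub>v ?x) + rmat TR *\<^sub>v (?e @\<^sub>v ?y) = pack N m (dz w z x) @\<^sub>v pack N r (dx w K z x e y)"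
 proof -
  have "pack N r (%i j. X1 i j + X2 i j) = pack N r (dx w K z x e y)"
   by (rule pack_cong) (auto simp: X1_def X2_def dx_def uu_def right_diff_distrib)
  then show ?thesis unfolding TL' TR' app_add[OF pc zero_carrier_vec pc pc] right_zero_vec[OF pc] pack_add by simp
 qed
 also have "rmat BL *\<^sub>v (?z @\<^sub>v ?x) + rmat BR *\<^sub>v (?e @\<^sub>v ?y) = pack N l (de K e y) @\<^sub>v pack N r (dy h x y)"
 proof -
  have "pack N r (%i j. Y1 i j + Y2 i j) = pack N r (dy h x y)"
   by (rule pack_cong) (simp add: Y1_def Y2_def dy_def right_diff_distrib sum_distrib_left mult_ac)
  then show ?thesis unfolding BL' BR' app_add[OF zero_carrier_vec pc pc pc] left_zero_vec[OF pc] pack_add by simp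
 qed
 finally show "rmat (Ac p d E K h w) *\<^sub>v st N m r l z x e y = st N m r l (dz w z x) (dx w K z x e y) (de K e y) (dy h x y)"
  unfolding st_def .
qed

end

section \<open>Uniform bounds and stabilisation\<close>

lemma compact_vecs_bounded:
 assumes X: "compact_vecs n X"
 shows "EX D>=0. ALL x:X. ALL k<n. \<bar>x $ k\<bar> <= D"
proof (cases "X = {}")
 case False
 let ?F = "(%x i. if i < n then x $ i else 0 :: real) ` X"
 have ne: "?F ~= {}" using False by blast
 have ex: "EX D. ALL w:X. k < n --> \<bar>w $ k\<bar> <= D" for k
 proof -
  have c: "continuous_on ?F (%f. \<bar>f k\<bar>)" by (intro continuous_intros continuous_on_coord)
  from continuous_attains_sup[OF compact_vecs_pad_image[OF X] ne c] obtain f where f: "ALL g:?F. \<bar>g k\<bar> <= \<bar>f k\<bar>" by (elim bexE)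
  have "\<bar>w $ k\<bar> <= \<bar>f k\<bar>" if "w : X" "k < n" for w
   using bspec[OF f imageI[OF that(1)]] that(2) by simp
  then show ?thesis by blast
 qed
 then have "ALL k. EX D. ALL w:X. k < n --> \<bar>w $ k\<bar> <= D" ..
 from choice[OF this] obtain D where D: "ALL k. ALL w:X. k < n --> \<bar>w $ k\<bar> <= D k" ..
 obtain B where B: "B >= 0" "!!k. k : {..<n} ==> D k <= B" by (rule finite_upper_bound[of "{..<n}" D]) auto
 have "\<bar>w $ k\<bar> <= B" if "w : X" "k < n" for w k
  using D B(2)[of k] that by (meson lessThan_iff order_trans)
 then show ?thesis using B(1) by blast
qed (auto intro: exI[of _ 0])

section \<open>Dependence on the parameter w and choice of the gains\<close>

context regulation
begin

lemma slot_index_less: "s : slots p ==> slot_index p s < wdim p"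
 using plant unfolding plant_wf_def bij_betw_def by auto

lemma pert_lip: "s : slots p ==> ALL k<wdim p. \<bar>w $ k - w' $ k\<bar> <= \<eta> ==> \<bar>pert p w s - pert p w' s\<bar> <= \<eta>"
 using slot_index_less unfolding pert_def by blast

text \<open>Each coefficient is its nominal value plus a single coordinate of w, hence Lipschitz
  with constant 1.\<close>

lemma coeff_lip:
 assumes \<eta>: "ALL k<wdim p. \<bar>w $ k - w' $ k\<bar> <= \<eta>" and i: "i < N"
 shows A1_lip: "j < m ==> k < m ==> \<bar>A1 p w (Suc i) $$ (j, k) - A1 p w' (Suc i) $$ (j, k)\<bar> <= \<eta>"
  and A2_lip: "j < m ==> \<bar>A2 p w (Suc i) $$ (j, 0) - A2 p w' (Suc i) $$ (j, 0)\<bar> <= \<eta>"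
  and A3_lip: "k < m ==> \<bar>A3 p w (Suc i) $$ (0, k) - A3 p w' (Suc i) $$ (0, k)\<bar> <= \<eta>"
  and cc_lip: "q < r ==> \<bar>cc p w (q + 1) (Suc i) - cc p w' (q + 1) (Suc i)\<bar> <= \<eta>"
  and bb_lip: "\<bar>bb p w (Suc i) - bb p w' (Suc i)\<bar> <= \<eta>"
proof -
 have i': "Suc i : {1..N}" using i by simp
 note z = zdim_m[OF i']
 show "\<bar>A1 p w (Suc i) $$ (j, k) - A1 p w' (Suc i) $$ (j, k)\<bar> <= \<eta>" if jk: "j < m" "k < m"
 proof -
  have "Slot_A1 (Suc i) j k : slots p" using i' jk z by (auto simp: slots_def)
  from pert_lip[OF this \<eta>] show ?thesis using jk z by (simp add: A1_def)
 qed
 show "\<bar>A2 p w (Suc i) $$ (j, 0) - A2 p w' (Suc i) $$ (j, 0)\<bar> <= \<eta>" if j: "j < m"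
 proof -
  have "Slot_A2 (Suc i) j : slots p" using i' j z by (auto simp: slots_def)
  from pert_lip[OF this \<eta>] show ?thesis using j z by (simp add: A2_def)
 qed
 show "\<bar>A3 p w (Suc i) $$ (0, k) - A3 p w' (Suc i) $$ (0, k)\<bar> <= \<eta>" if k: "k < m"
 proof -
  have "Slot_A3 (Suc i) k : slots p" using i' k z by (auto simp: slots_def)
  from pert_lip[OF this \<eta>] show ?thesis using k z by (simp add: A3_def)
 qed
 show "\<bar>cc p w (q + 1) (Suc i) - cc p w' (q + 1) (Suc i)\<bar> <= \<eta>" if q: "q < r"
 proof -
  have "Slot_c (Suc i) (q + 1) : slots p" using i' q by (auto simp: slots_def)
  from pert_lip[OF this \<eta>] show ?thesis by (simp add: cc_def)
 qed
 show "\<bar>bb p w (Suc i) - bb p w' (Suc i)\<bar> <= \<eta>"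
 proof -
  have "Slot_b (Suc i) : slots p" using i' by (auto simp: slots_def)
  from pert_lip[OF this \<eta>] show ?thesis by (simp add: bb_def)
 qed
qed

lemma compact_pad: "compact ((%x i. if i < wdim p then x $ i else 0) ` W)"
 by (rule compact_vecs_pad_image[OF W])

lemma continuous_pad_coord: "continuous_on ((%x i. if i < wdim p then x $ i else 0) ` W) (%f. f k :: real)"
 by (rule continuous_on_coord)

lemma W_bounded: "EX D>=0. ALL w:W. ALL k<wdim p. \<bar>w $ k\<bar> <= D"
 by (rule compact_vecs_bounded[OF W])

lemma W_diameter: "EX D>=0. ALL w:W. ALL w':W. ALL k<wdim p. \<bar>w $ k - w' $ k\<bar> <= D"
proof -
 obtain D where D: "D >= 0" "ALL w:W. ALL k<wdim p. \<bar>w $ k\<bar> <= D" using W_bounded by blast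
 have "\<bar>w $ k - w' $ k\<bar> <= 2*D" if "w : W" "w' : W" "k < wdim p" for w w' k
 proof -
  have "\<bar>w $ k\<bar> <= D" "\<bar>w' $ k\<bar> <= D" using D(2) that by blast+
  then show ?thesis by linarith
 qed
 then show ?thesis using D(1) by (intro exI[of _ "2*D"]) auto
qed

text \<open>b_i depends on one coordinate of w, which attains its minimum on the compact set W; b_i
  is positive at the minimiser.\<close>

lemma bb_lower: "EX \<beta>>0. ALL w:W. ALL i<N. \<beta> <= bb p w (Suc i)"
proof -
 let ?F = "(%x i. if i < wdim p then x $ i else 0 :: real) ` W"
 have ne: "?F ~= {}" using W0 by blast
 have "ALL i. EX \<beta>. i < N --> \<beta> > 0 & (ALL w:W. \<beta> <= bb p w (Suc i))"
 proof
  fix i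
  show "EX \<beta>. i < N --> \<beta> > 0 & (ALL w:W. \<beta> <= bb p w (Suc i))"
  proof (cases "i < N")
   case True
   define \<kappa> where "\<kappa> = slot_index p (Slot_b (Suc i))"
   have \<kappa>: "\<kappa> < wdim p" unfolding \<kappa>_def by (rule slot_index_less) (use True in \<open>auto simp: slots_def\<close>)
   from continuous_attains_inf[OF compact_pad ne continuous_pad_coord[of \<kappa>]] obtain f where
    f: "f : ?F" "ALL g:?F. f \<kappa> <= g \<kappa>" by (elim bexE)
   obtain w0 where w0: "w0 : W" "f = (%i. if i < wdim p then w0 $ i else 0)" using f(1) by blast
   have "w0 $ \<kappa> <= w $ \<kappa>" if "w : W" for w
    using bspec[OF f(2) imageI[OF that]] \<kappa> unfolding w0(2) by simp
   then have "bb p w0 (Suc i) <= bb p w (Suc i)" if "w : W" for w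
    using that by (simp add: bb_def pert_def \<kappa>_def)
   moreover have "bb p w0 (Suc i) > 0" using b_pos w0(1) True by auto
   ultimately show ?thesis by (intro exI[of _ "bb p w0 (Suc i)"]) blast
  qed simp
 qed
 from choice[OF this] obtain \<beta> where \<beta>: "ALL i. i < N --> \<beta> i > 0 & (ALL w:W. \<beta> i <= bb p w (Suc i))" ..
 obtain c where c: "c > 0" "!!i. i : {..<N} ==> c <= \<beta> i" by (rule finite_pos_lower_bound[of "{..<N}" \<beta>]) (use \<beta> in auto)
 have "c <= bb p w (Suc i)" if "w : W" "i < N" for w i
  using \<beta> c(2)[of i] that by (meson lessThan_iff order_trans)
 then show ?thesis using c(1) by blast
qed

lemma A1_resolvent: "EX R. ALL w:W. ALL i<N. resolvent_bound m (%j k. A1 p w (Suc i) $$ (j, k)) R"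
proof -
 have "EX R. i < N --> (ALL w:W. resolvent_bound m (%j k. A1 p w (Suc i) $$ (j, k)) R)" for i
 proof (cases "i < N")
  case True
  have lip: "ALL w:W. ALL w':W. ALL \<eta>>=0. (ALL k<wdim p. \<bar>w $ k - w' $ k\<bar> <= \<eta>) -->
    (ALL j<m. ALL k<m. \<bar>A1 p w (Suc i) $$ (j, k) - A1 p w' (Suc i) $$ (j, k)\<bar> <= 1*\<eta>)"
   using A1_lip[OF _ True] by simp
  have "mat m m (%(j, k). A1 p w (Suc i) $$ (j, k)) = A1 p w (Suc i)" for w
   using A1_carrier[of "Suc i" w] True by (intro eq_matI) auto
  then have hw: "ALL w:W. hurwitz (mat m m (%(j, k). A1 p w (Suc i) $$ (j, k)))" using A1_hurwitz True by simp
  obtain c B where c: "c > 0" and B: "B >= 0"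
   and cert: "ALL w:W. EX P. lyap_cert m (%j k. A1 p w (Suc i) $$ (j, k)) P c & (ALL i<m. ALL j<m. \<bar>P i j\<bar> <= B)"
   using lyap_cert_uniform[OF W lip zero_le_one hw] by (elim exE conjE)
  have "resolvent_bound m (%j k. A1 p w (Suc i) $$ (j, k)) (2*real m*B / c)" if "w : W" for w
   using bspec[OF cert that] lyap_cert_resolvent_bound[OF _ c _ B] by (elim exE conjE)
  then show ?thesis by blast
 qed simp
 from choice[OF allI[OF this]] obtain R where R: "ALL i. i < N --> (ALL w:W. resolvent_bound m (%j k. A1 p w (Suc i) $$ (j, k)) (R i))" ..
 obtain C where C: "C >= 0" "!!i. i : {..<N} ==> R i <= C" by (rule finite_upper_bound[of "{..<N}" R]) auto
 show ?thesis by (intro exI[of _ C] ballI allI impI) (use R C(2) resolvent_bound_mono in blast)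
qed

text \<open>All coefficients are compared with their values at w = 0, which lies in W, by means of
  the diameter of W; the inverse of b_i uses its positive lower bound.\<close>

lemma coefficients_bounded:
 "EX B>=1. (ALL w:W. ALL i<N. (ALL j<m. \<bar>A2 p w (Suc i) $$ (j, 0)\<bar> <= B & \<bar>A3 p w (Suc i) $$ (0, j)\<bar> <= B) &
  (ALL q<r. \<bar>cc p w (q + 1) (Suc i)\<bar> <= B) & bb p w (Suc i) <= B & 1 / bb p w (Suc i) <= B)"
proof -
 let ?w0 = "0\<^sub>v (wdim p) :: real Matrix.vec"
 obtain D where D: "ALL w:W. ALL w':W. ALL k<wdim p. \<bar>w $ k - w' $ k\<bar> <= D" using W_diameter by blast
 have D0: "ALL k<wdim p. \<bar>w $ k - ?w0 $ k\<bar> <= D" if "w : W" for w using D W0 that by blast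
 obtain B2 where B2: "!!q. q : {..<N} \<times> {..<m} ==> \<bar>A2 p ?w0 (Suc (fst q)) $$ (snd q, 0)\<bar> <= B2"
  by (rule finite_upper_bound[of "{..<N} \<times> {..<m}" "%q. \<bar>A2 p ?w0 (Suc (fst q)) $$ (snd q, 0)\<bar>"]) auto
 obtain B3 where B3: "!!q. q : {..<N} \<times> {..<m} ==> \<bar>A3 p ?w0 (Suc (fst q)) $$ (0, snd q)\<bar> <= B3"
  by (rule finite_upper_bound[of "{..<N} \<times> {..<m}" "%q. \<bar>A3 p ?w0 (Suc (fst q)) $$ (0, snd q)\<bar>"]) auto
 obtain B4 where B4: "!!q. q : {..<N} \<times> {..<r} ==> \<bar>cc p ?w0 (snd q + 1) (Suc (fst q))\<bar> <= B4"
  by (rule finite_upper_bound[of "{..<N} \<times> {..<r}" "%q. \<bar>cc p ?w0 (snd q + 1) (Suc (fst q))\<bar>"]) auto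
 obtain B5 where B5: "!!q. q : {..<N} ==> \<bar>bb p ?w0 (Suc q)\<bar> <= B5" by (rule finite_upper_bound[of "{..<N}" "%q. \<bar>bb p ?w0 (Suc q)\<bar>"]) auto
 obtain \<beta> where \<beta>: "\<beta> > 0" "ALL w:W. ALL i<N. \<beta> <= bb p w (Suc i)" using bb_lower by blast
 define B where "B = 1 + \<bar>B2\<bar> + \<bar>B3\<bar> + \<bar>B4\<bar> + \<bar>B5\<bar> + \<bar>D\<bar> + 1 / \<beta>"
 have B: "B2 + D <= B" "B3 + D <= B" "B4 + D <= B" "B5 + D <= B" "1 / \<beta> <= B" "1 <= B"
 proof -
  have "1 / \<beta> > 0" using \<beta>(1) by simp
  then show "B2 + D <= B" "B3 + D <= B" "B4 + D <= B" "B5 + D <= B" "1 / \<beta> <= B" "1 <= B" unfolding B_def by linarith+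
 qed
 show ?thesis
 proof (intro exI[of _ B] conjI ballI allI impI B(6))
  fix w i assume w: "w : W" and i: "i < N"
  note lip = A2_lip[OF D0[OF w] i] A3_lip[OF D0[OF w] i] cc_lip[OF D0[OF w] i] bb_lip[OF D0[OF w] i]
  show "\<bar>A2 p w (Suc i) $$ (j, 0)\<bar> <= B" if "j < m" for j using B2[of "(i, j)"] lip(1)[OF that] B(1) i that by auto
  show "\<bar>A3 p w (Suc i) $$ (0, j)\<bar> <= B" if "j < m" for j using B3[of "(i, j)"] lip(2)[OF that] B(2) i that by auto
  show "\<bar>cc p w (q + 1) (Suc i)\<bar> <= B" if "q < r" for q using B4[of "(i, q)"] lip(3)[OF that] B(3) i that by auto
  show "bb p w (Suc i) <= B" using B5[of i] lip(4) B(4) i by auto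
  have "1 / bb p w (Suc i) <= 1 / \<beta>" using \<beta> w i by (intro frac_le) auto
  then show "1 / bb p w (Suc i) <= B" using B(5) by linarith
 qed
qed

lemma high_gain_exists:
 "EX dd B R cH. high_gain W N r m l (%w i j k. A1 p w (Suc i) $$ (j, k)) (%w i j. A2 p w (Suc i) $$ (j, 0)) (%w i k. A3 p w (Suc i) $$ (0, k))
  (%w i s. cc p w (s + 1) (Suc i)) (%w i. bb p w (Suc i)) Mc Qc \<psi> (ctrl_gamma d) (ctrl_delta d) (%i j. Hmat N E $$ (i, j)) dd B R cH"
proof -
 obtain B1 where B1: "B1 >= 1" and cb: "ALL w:W. ALL i<N. (ALL j<m. \<bar>A2 p w (Suc i) $$ (j, 0)\<bar> <= B1 & \<bar>A3 p w (Suc i) $$ (0, j)\<bar> <= B1) &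
  (ALL q<r. \<bar>cc p w (q + 1) (Suc i)\<bar> <= B1) & bb p w (Suc i) <= B1 & 1 / bb p w (Suc i) <= B1"
  using coefficients_bounded by blast
 obtain dd cH where cH: "cH > 0" and dd: "ALL i<N. dd i > 0"
  and diss: "ALL v::nat => real. cH*(SUM i<N. (v i)^2) <= (SUM i<N. dd i*v i*(SUM j<N. Hmat N E $$ (i, j)*v j))"
  using Hmat_dissipative[OF graph conn] by blast
 obtain R1 where R1: "ALL w:W. ALL i<N. resolvent_bound m (%j k. A1 p w (Suc i) $$ (j, k)) R1" using A1_resolvent by blast
 have "mat l l (%(i, j). Mc i j) = ctrl_M d" using M_carrier by (intro eq_matI) (auto simp: Mc_def)
 then have "hurwitz (mat l l (%(i, j). Mc i j))" using M_hurwitz by simp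
 from hurwitz_resolvent[OF this] obtain R2 where R2: "resolvent_bound l Mc R2" ..
 define g where "g i j = (if i = r - 2 then - ctrl_gamma d j else if j = i + 1 then 1 else 0 :: real)" for i j
 have "mat (r - 1) (r - 1) (%(i, j). g i j) = companion (r - 1) (%j. - ctrl_gamma d j)"
  unfolding companion_def g_def by (rule eq_matI) auto
 then have "hurwitz (mat (r - 1) (r - 1) (%(i, j). g i j))" using hurwitz_companion[OF gam_stable] by simp
 from hurwitz_resolvent[OF this] obtain R3 where R3: "resolvent_bound (r - 1) g R3" ..
 have gs: "(SUM j<r - 1. complex_of_real (g i j)*x j) = (if i = r - 2 then - (SUM j<r - 1. of_real (ctrl_gamma d j)*x j) else x (i + 1))"
  if "i < r - 1" for i x
 proof (cases "i = r - 2")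
  case True then show ?thesis by (simp add: g_def sum_negf)
 next
  case False
  have "(SUM j<r - 1. complex_of_real (g i j)*x j) = (SUM j<r - 1. if j = i + 1 then x j else 0)"
   by (rule sum.cong[OF refl]) (use False in \<open>simp add: g_def\<close>)
  then show ?thesis using False that by simp
 qed
 \<comment> \<open>The observer matrix at h = 1; the scaling by powers of h reduces every h to
   it.\<close>
 define ob where "ob i j = (if j = 0 then - ctrl_delta d (r - 1 - i) else 0) + (if j = i + 1 then 1 else 0 :: real)" for i j
 have "hurwitz (mat r r (%(i, j). ob i j))" using hurwitz_observer[OF del_stable] unfolding ob_def .
 from hurwitz_resolvent[OF this] obtain R4 where R4: "resolvent_bound r ob R4" ..
 have os: "(SUM j<r. complex_of_real (ob i j)*x j) = - of_real (ctrl_delta d (r - 1 - i))*x 0 + (if i + 1 < r then x (i + 1) else 0)" for i x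
 proof -
  have "(SUM j<r. complex_of_real (ob i j)*x j) = (SUM j<r. (if j = 0 then - of_real (ctrl_delta d (r - 1 - i))*x j else 0) + (if j = i + 1 then x j else 0))"
   by (rule sum.cong[OF refl]) (simp add: ob_def distrib_right)
  then show ?thesis using r1 by (simp add: sum.distrib)
 qed
 define R where "R = \<bar>R1\<bar> + \<bar>R2\<bar> + \<bar>R3\<bar> + \<bar>R4\<bar>"
 have Rle: "R1 <= R" "R2 <= R" "R3 <= R" "R4 <= R" "0 <= R" by (auto simp: R_def)
 obtain C1 where C1: "C1 >= 0" "!!q. q : {..<l} \<times> {..<l} ==> \<bar>Mc (fst q) (snd q)\<bar> <= C1"
  by (rule finite_upper_bound[of "{..<l} \<times> {..<l}" "%q. \<bar>Mc (fst q) (snd q)\<bar>"]) auto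
 obtain C2 where C2: "C2 >= 0" "!!q. q : {..<l} ==> \<bar>Qc q\<bar> <= C2" by (rule finite_upper_bound[of "{..<l}" "%q. \<bar>Qc q\<bar>"]) auto
 obtain C3 where C3: "C3 >= 0" "!!q. q : {..<l} ==> \<bar>\<psi> q\<bar> <= C3" by (rule finite_upper_bound[of "{..<l}" "%q. \<bar>\<psi> q\<bar>"]) auto
 obtain C4 where C4: "C4 >= 0" "!!q. q : {..<r} ==> \<bar>ctrl_gamma d q\<bar> <= C4" by (rule finite_upper_bound[of "{..<r}" "%q. \<bar>ctrl_gamma d q\<bar>"]) auto
 obtain C5 where C5: "C5 >= 0" "!!q. q : {..<N} \<times> {..<N} ==> \<bar>Hmat N E $$ (fst q, snd q)\<bar> <= C5"
  by (rule finite_upper_bound[of "{..<N} \<times> {..<N}" "%q. \<bar>Hmat N E $$ (fst q, snd q)\<bar>"]) auto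
 obtain C6 where C6: "C6 >= 0" "!!q. q : {..<N} ==> dd q <= C6" by (rule finite_upper_bound[of "{..<N}" dd]) auto
 define B where "B = B1 + C1 + C2 + C3 + C4 + C5 + C6"
 have Ble: "B1 <= B" "C1 <= B" "C2 <= B" "C3 <= B" "C4 <= B" "C5 <= B" "C6 <= B" "1 <= B"
  using B1 C1(1) C2(1) C3(1) C4(1) C5(1) C6(1) by (auto simp: B_def)
 have "high_gain W N r m l (%w i j k. A1 p w (Suc i) $$ (j, k)) (%w i j. A2 p w (Suc i) $$ (j, 0)) (%w i k. A3 p w (Suc i) $$ (0, k))
  (%w i s. cc p w (s + 1) (Suc i)) (%w i. bb p w (Suc i)) Mc Qc \<psi> (ctrl_gamma d) (ctrl_delta d) (%i j. Hmat N E $$ (i, j)) dd B R cH"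
 proof
  show "\<bar>A2 p w (Suc i) $$ (j, 0)\<bar> <= B" if "w : W" "i < N" "j < m" for w i j
   using cb that Ble(1) by (meson order_trans)
  show "\<bar>A3 p w (Suc i) $$ (0, j)\<bar> <= B" if "w : W" "i < N" "j < m" for w i j
   using cb that Ble(1) by (meson order_trans)
  show "\<bar>cc p w (s + 1) (Suc i)\<bar> <= B" if "w : W" "i < N" "s < r" for w i s
   using cb that Ble(1) by (meson order_trans)
  show "0 < bb p w (Suc i)" if "w : W" "i < N" for w i using b_pos that by simp
  show "bb p w (Suc i) <= B" if "w : W" "i < N" for w i using cb that Ble(1) by (meson order_trans)
  show "1 / bb p w (Suc i) <= B" if "w : W" "i < N" for w i using cb that Ble(1) by (meson order_trans)
  show "\<bar>Mc i j\<bar> <= B" if "i < l" "j < l" for i j using C1(2)[of "(i, j)"] that Ble(2) by simp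
  show "\<bar>Qc i\<bar> <= B" if "i < l" for i using C2(2)[of i] that Ble(3) by simp
  show "\<bar>\<psi> i\<bar> <= B" if "i < l" for i using C3(2)[of i] that Ble(4) by simp
  show "\<bar>ctrl_gamma d s\<bar> <= B" if "s < r" for s using C4(2)[of s] that Ble(5) by simp
  show "\<bar>Hmat N E $$ (i, j)\<bar> <= B" if "i < N" "j < N" for i j using C5(2)[of "(i, j)"] that Ble(6) by simp
  show "0 < dd i" if "i < N" for i using dd that by blast
  show "dd i <= B" if "i < N" for i using C6(2)[of i] that Ble(7) by simp
  show "cH*(SUM i<N. (v i)^2) <= (SUM i<N. dd i*v i*(SUM j<N. Hmat N E $$ (i, j)*v j))" for v by (rule spec[OF diss])
  show "(SUM j<m. cmod (x j)) <= R*(SUM j<m. cmod (f j))"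
   if "w : W" "i < N" "0 <= Re \<mu>" "ALL j<m. \<mu>*x j = (SUM k<m. of_real (A1 p w (Suc i) $$ (j, k))*x k) + f j" for w i \<mu> x f
   by (rule resolvent_boundD[OF _ Rle(1) that(3,4)]) (use R1 that in blast)
  show "(SUM j<l. cmod (x j)) <= R*(SUM j<l. cmod (f j))"
   if "0 <= Re \<mu>" "ALL j<l. \<mu>*x j = (SUM k<l. of_real (Mc j k)*x k) + f j" for \<mu> x f
   by (rule resolvent_boundD[OF R2 Rle(2) that])
  show "(SUM s<r - 1. cmod (x s)) <= R*(SUM s<r - 1. cmod (f s))"
   if "0 <= Re \<mu>" "ALL s<r - 1. \<mu>*x s = (if s = r - 2 then - (SUM j<r - 1. of_real (ctrl_gamma d j)*x j) else x (s + 1)) + f s" for \<mu> x f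
  proof (rule resolvent_boundD[OF R3 Rle(3) that(1)])
   show "ALL i<r - 1. \<mu>*x i = (SUM j<r - 1. complex_of_real (g i j)*x j) + f i" 
   proof (intro allI impI)
    fix i assume "i < r - 1"
    with that(2) have "\<mu>*x i = (if i = r - 2 then - (SUM j<r - 1. of_real (ctrl_gamma d j)*x j) else x (i + 1)) + f i" by blast
    then show "\<mu>*x i = (SUM j<r - 1. complex_of_real (g i j)*x j) + f i" unfolding gs[OF \<open>i < r - 1\<close>] .
   qed
  qed
  show "(SUM s<r. cmod (x s)) <= R*(SUM s<r. cmod (f s))"
   if "0 <= Re \<mu>" "ALL s<r. \<mu>*x s = - of_real (ctrl_delta d (r - 1 - s))*x 0 + (if s + 1 < r then x (s + 1) else 0) + f s" for \<mu> x f
   by (rule resolvent_boundD[OF R4 Rle(4) that(1)]) (unfold os, rule that(2))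
 qed (use r1 Ble(8) Rle(5) cH in auto)
 then show ?thesis by blast
qed

text \<open>An eigenvector at \<mu> with nonnegative real part would vanish by
  \<open>all_zero\<close>. The threshold for h is chosen after K because the forcing constant
  \<open>GK K\<close> enters it.\<close>

lemma Ac_hurwitz:
 "EX Ks>0. ALL K>Ks. EX hs>=1. ALL h>hs. ALL w:W. hurwitz (Ac p d E K h w)"
proof -
 obtain dd B R cH where hg: "high_gain W N r m l (%w i j k. A1 p w (Suc i) $$ (j, k)) (%w i j. A2 p w (Suc i) $$ (j, 0)) (%w i k. A3 p w (Suc i) $$ (0, k))
  (%w i s. cc p w (s + 1) (Suc i)) (%w i. bb p w (Suc i)) Mc Qc \<psi> (ctrl_gamma d) (ctrl_delta d) (%i j. Hmat N E $$ (i, j)) dd B R cH"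
  using high_gain_exists by (elim exE)
 interpret hg: high_gain W N r m l "%w i j k. A1 p w (Suc i) $$ (j, k)" "%w i j. A2 p w (Suc i) $$ (j, 0)" "%w i k. A3 p w (Suc i) $$ (0, k)"
  "%w i s. cc p w (s + 1) (Suc i)" "%w i. bb p w (Suc i)" Mc Qc \<psi> "ctrl_gamma d" "ctrl_delta d" "%i j. Hmat N E $$ (i, j)" dd B R cH
  by (rule hg)
 have omeq: "hg.om = om" by (rule ext) (simp add: hg.om_def om_def)
 define Ks where "Ks = max 1 (2*B*B*hg.C6 / cH)"
 show ?thesis
 proof (rule exI[of _ Ks], intro conjI allI impI)
  show "Ks > 0" by (simp add: Ks_def)
  fix K assume K: "K > Ks"
  define hs where "hs = max 1 (real N*(R*(hg.GK K*(hg.C9 + 1))))"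
  show "EX hs>=1. ALL h>hs. ALL w:W. hurwitz (Ac p d E K h w)"
  proof (rule exI[of _ hs], intro conjI allI impI ballI)
   show "hs >= 1" by (simp add: hs_def)
   fix h w assume h: "h > hs" and w: "w : W"
   show "hurwitz (Ac p d E K h w)"
    unfolding hurwitz_def
   proof (intro allI impI, rule ccontr)
    fix \<mu> assume ev: "eigenvalue (cmat (Ac p d E K h w)) \<mu>" and "~ Re \<mu> < 0"
    then have \<mu>: "0 <= Re \<mu>" by simp
    have c: "cmat (Ac p d E K h w) : carrier_mat nst nst" using Ac_carrier by simp
    obtain v where v: "v : carrier_vec nst" "v ~= 0\<^sub>v nst" "cmat (Ac p d E K h w) *\<^sub>v v = \<mu> \<cdot>\<^sub>v v"
     using ev carrier_matD[OF c] unfolding eigenvalue_def eigenvector_def by auto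
    obtain z x e y where vst: "v = st N m r l z x e y" using st_surj[OF v(1)] by (elim exE)
    have eq: "st N m r l (dz w z x) (dx w K z x e y) (de K e y) (dy h x y) =
     st N m r l (%i j. \<mu>*z i j) (%i j. \<mu>*x i j) (%i j. \<mu>*e i j) (%i j. \<mu>*y i j)"
     using v(3) unfolding vst Ac_st st_smult .
    note inj = st_inj[OF eq]
    interpret he: high_gain_eig W N r m l "%w i j k. A1 p w (Suc i) $$ (j, k)" "%w i j. A2 p w (Suc i) $$ (j, 0)" "%w i k. A3 p w (Suc i) $$ (0, k)"
     "%w i s. cc p w (s + 1) (Suc i)" "%w i. bb p w (Suc i)" Mc Qc \<psi> "ctrl_gamma d" "ctrl_delta d" "%i j. Hmat N E $$ (i, j)" dd B R cH
     w K h \<mu> z x e y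
    proof
     show "\<mu>*z i j = (SUM k<m. of_real (A1 p w (Suc i) $$ (j, k))*z i k) + of_real (A2 p w (Suc i) $$ (j, 0))*x i 0" if "i < N" "j < m" for i j
      using inj(1)[OF that] by (simp add: dz_def)
     show "\<mu>*x i s = x i (s + 1)" if "i < N" "s + 1 < r" for i s
      using inj(2)[OF that(1), of s] that(2) by (simp add: dx_def)
     show "\<mu>*x i (r - 1) = (SUM k<m. of_real (A3 p w (Suc i) $$ (0, k))*z i k) + (SUM s<r. of_real (cc p w (s + 1) (Suc i))*x i s)
      + of_real (bb p w (Suc i))*((SUM k<l. of_real (\<psi> k)*e i k) - of_real K*(SUM s<r. of_real (hg.om s)*y i s))" if "i < N" for i
      using inj(2)[OF that, of "r - 1"] r1 unfolding omeq by (simp add: dx_def uu_def)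
     show "\<mu>*e i k = (SUM q<l. of_real (Mc k q)*e i q) + of_real (Qc k)*((SUM k<l. of_real (\<psi> k)*e i k) - of_real K*(SUM s<r. of_real (hg.om s)*y i s))"
      if "i < N" "k < l" for i k
      using inj(3)[OF that] unfolding omeq by (simp add: de_def uu_def)
     show "\<mu>*y i s = of_real (h ^ (s + 1)*ctrl_delta d (r - 1 - s))*((SUM j<N. of_real (Hmat N E $$ (i, j))*x j 0) - y i 0)
      + (if s + 1 < r then y i (s + 1) else 0)" if "i < N" "s < r" for i s
      using inj(4)[OF that] by (simp only: dy_def)
    qed (use w \<mu> K h in \<open>auto simp: Ks_def hs_def\<close>)
    have z0: "ALL i<N. (ALL j<m. z i j = 0) & (ALL s<r. x i s = 0) & (ALL k<l. e i k = 0) & (ALL s<r. y i s = 0)"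
     by (rule he.all_zero) (use K h in \<open>auto simp: Ks_def hs_def\<close>)
    have "v = 0\<^sub>v nst"
    proof (rule eq_vecI)
     fix k assume "k < dim_vec (0\<^sub>v nst :: complex Matrix.vec)"
     then have k: "k < nst" by simp
     from st_cases[OF k, where 'a = complex] have "v $ k = 0" unfolding vst using z0 by (elim disjE exE conjE) auto
     then show "v $ k = 0\<^sub>v nst $ k" using k by simp
    qed (use v(1) in simp)
    then show False using v(2) by simp
   qed
  qed
 qed
qed

end

section \<open>Dissipation under sampling errors\<close>

lemma abs_sum_mult_le:
 fixes a f :: "nat => real"
 assumes "ALL k<n. \<bar>f k\<bar> <= C"
 shows "\<bar>SUM k<n. a k*f k\<bar> <= (SUM k<n. \<bar>a k\<bar>)*C"
proof -
 have "\<bar>SUM k<n. a k*f k\<bar> <= (SUM k<n. \<bar>a k*f k\<bar>)" by (rule sum_abs)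
 also have "... <= (SUM k<n. \<bar>a k\<bar>*C)" by (intro sum_mono) (use assms in \<open>simp add: abs_mult mult_left_mono\<close>)
 finally show ?thesis by (simp add: sum_distrib_right)
qed

text \<open>A weighted Cauchy-Schwarz inequality for the pair (a, b): the cross term is bounded by
  the geometric mean of A Y and K^2 B X, hence by their arithmetic mean s.\<close>

lemma combined_square_bound:
 fixes a b A B X Y K :: real
 assumes a: "a^2 <= A*X" and b: "b^2 <= B*Y" and nn: "0 <= A" "0 <= B" "0 <= X" "0 <= Y"
 shows "(a - K*b)^2 <= (A + K^2*B)*(X + Y)"
proof -
 define s where "s = (A*Y + K^2*B*X) / 2"
 have s0: "0 <= s" using nn by (simp add: s_def)
 have "(K*a*b)^2 = K^2*(a^2*b^2)" by (simp add: power_mult_distrib)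
 also have "... <= K^2*((A*X)*(B*Y))" using a b nn by (intro mult_left_mono mult_mono) auto
 also have "... = (A*Y)*(K^2*B*X)" by (simp only: mult_ac)
 also have "... <= s^2"
  using sum_squares_bound[of "A*Y - K^2*B*X" 0] by (simp add: s_def power2_eq_square field_simps)
 finally have "\<bar>K*a*b\<bar> <= \<bar>s\<bar>" by (simp only: abs_le_square_iff)
 then have k: "\<bar>K*a*b\<bar> <= s" using s0 by simp
 have "(a - K*b)^2 = a^2 - 2*(K*a*b) + K^2*b^2" by (simp add: power2_eq_square algebra_simps)
 also have "... <= A*X + 2*s + K^2*(B*Y)"
  using a mult_left_mono[OF b, of "K^2"] k by simp
 also have "... = (A + K^2*B)*(X + Y)" by (simp add: s_def algebra_simps)
 finally show ?thesis .
qed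

lemma rmat_real: "(rmat A :: real mat) = A"
 by (rule eq_matI) auto

context regulation
begin

lemma nst_pos: "0 < nst"
 using N1 r1 by (simp add: sdim_def)

lemma Ac_st_real: "Ac p d E K h w *\<^sub>v st N m r l z x e y = st N m r l (dz w z x) (dx w K z x e y) (de K e y) (dy h x y)"
 using Ac_st[where 'a = real, of K h w z x e y] unfolding rmat_real .

text \<open>Absolute row sum of the feedback: a bound for the input when all entries of \<eta> and
  \<zeta> are at most 1 in modulus.\<close>

definition U0 :: "real => real" where "U0 K = (SUM k<l. \<bar>\<psi> k\<bar>) + \<bar>K\<bar>*(SUM s<r. \<bar>om s\<bar>)"

text \<open>An entry of \<open>Ac\<close> is read off by applying it to a unit vector; among the
  block rows only \<open>dz\<close> and \<open>dx\<close> contain w, through coefficients that are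
  Lipschitz with constant 1.\<close>

lemma Ac_lip:
 assumes \<eta>: "ALL k<wdim p. \<bar>w $ k - w' $ k\<bar> <= \<eta>" and I: "I < nst" and J: "J < nst"
 shows "\<bar>entries (Ac p d E K h w) I J - entries (Ac p d E K h w') I J\<bar> <= (real m + 1 + real r + U0 K)*\<eta>"
proof -
 have wd: "0 < wdim p" using slot_index_less[of "Slot_b 1"] N1 by (auto simp: slots_def)
 then have \<eta>0: "0 <= \<eta>" using \<eta> by force
 have col: "entries (Ac p d E K h w) I J = (Ac p d E K h w *\<^sub>v unit_vec nst J) $ I" for w
 proof -
  have "(Ac p d E K h w *\<^sub>v unit_vec nst J) $ I = (SUM k<nst. Ac p d E K h w $$ (I, k)*unit_vec nst J $ k)"
   by (rule index_mult_mat_vec_sum[OF Ac_carrier _ I]) simp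
  also have "... = (SUM k<nst. if k = J then Ac p d E K h w $$ (I, k) else 0)"
   by (rule sum.cong[OF refl]) (use J in simp)
  finally show ?thesis using J by (simp add: entries_def)
 qed
 obtain z x e y where u: "unit_vec nst J = (st N m r l z x e y :: real Matrix.vec)" using st_surj[OF unit_vec_carrier[of nst J]] by (elim exE)
 have u1: "\<bar>st N m r l z x e y $ k\<bar> <= 1" if "k < nst" for k unfolding u[symmetric] using that J by simp
 have z1: "\<bar>z i j\<bar> <= 1" if "i < N" "j < m" for i j
  using u1[of "i*m + j"] st_index(1)[OF that(1,2), of r l z x e y] mult_add_less[OF that] by (simp add: sdim_def)
 have x1: "\<bar>x i j\<bar> <= 1" if "i < N" "j < r" for i j
  using u1[of "N*m + (i*r + j)"] st_index(2)[OF that(1,2), of m l z x e y] mult_add_less[OF that] by (simp add: sdim_def)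
 have e1: "\<bar>e i j\<bar> <= 1" if "i < N" "j < l" for i j
  using u1[of "N*m + N*r + (i*l + j)"] st_index(3)[OF that(1,2), of m r z x e y] mult_add_less[OF that] by (simp add: sdim_def)
 have y1: "\<bar>y i j\<bar> <= 1" if "i < N" "j < r" for i j
  using u1[of "N*m + N*r + (N*l + (i*r + j))"] st_index(4)[OF that(1,2), of m l z x e y] mult_add_less[OF that] by (simp add: sdim_def)
 have U: "\<bar>uu K e y i\<bar> <= U0 K" if i: "i < N" for i
 proof -
  have "\<bar>SUM k<l. \<psi> k*e i k\<bar> <= (SUM k<l. \<bar>\<psi> k\<bar>)" using abs_sum_mult_le[of l "e i" 1 \<psi>] e1[OF i] by simp
  moreover have "\<bar>SUM s<r. om s*y i s\<bar> <= (SUM s<r. \<bar>om s\<bar>)" using abs_sum_mult_le[of r "y i" 1 om] y1[OF i] by simp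
  then have "\<bar>K*(SUM s<r. om s*y i s)\<bar> <= \<bar>K\<bar>*(SUM s<r. \<bar>om s\<bar>)" by (simp add: abs_mult mult_left_mono)
  ultimately show ?thesis unfolding uu_def U0_def by simp
 qed
 have U00: "0 <= U0 K" by (simp add: U0_def sum_nonneg)
 define L where "L = real m + 1 + real r + U0 K"
 have L: "(real m + 1)*\<eta> <= L*\<eta>" "(real m + real r + U0 K)*\<eta> <= L*\<eta>" "0 <= L*\<eta>"
  using \<eta>0 U00 by (auto simp: L_def intro!: mult_right_mono)
 have diff: "\<bar>(SUM k<n. a k*f k) - (SUM k<n. b k*f k)\<bar> <= real n*\<eta>" if "!!k. k < n ==> \<bar>a k - b k\<bar> <= \<eta>" "!!k. k < n ==> \<bar>f k\<bar> <= 1" for n and a b f :: "nat => real"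
 proof -
  have "(SUM k<n. a k*f k) - (SUM k<n. b k*f k) = (SUM k<n. (a k - b k)*f k)" by (simp add: sum_subtractf left_diff_distrib)
  also have "\<bar>...\<bar> <= (SUM k<n. \<bar>a k - b k\<bar>)" using abs_sum_mult_le[of n f 1 "%k. a k - b k"] that(2) by simp
  also have "... <= (SUM k<n. \<eta>)" by (rule sum_mono) (use that(1) in simp)
  finally show ?thesis by simp
 qed
 have dzd: "\<bar>dz w z x i j - dz w' z x i j\<bar> <= L*\<eta>" if i: "i < N" and j: "j < m" for i j
 proof -
  have "\<bar>(SUM k<m. A1 p w (Suc i) $$ (j, k)*z i k) - (SUM k<m. A1 p w' (Suc i) $$ (j, k)*z i k)\<bar> <= real m*\<eta>"
   by (rule diff[OF A1_lip[OF \<eta> i j] z1[OF i]])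
  moreover have "\<bar>A2 p w (Suc i) $$ (j, 0)*x i 0 - A2 p w' (Suc i) $$ (j, 0)*x i 0\<bar> <= \<eta>"
  proof -
   have "\<bar>A2 p w (Suc i) $$ (j, 0)*x i 0 - A2 p w' (Suc i) $$ (j, 0)*x i 0\<bar> = \<bar>A2 p w (Suc i) $$ (j, 0) - A2 p w' (Suc i) $$ (j, 0)\<bar>*\<bar>x i 0\<bar>"
    by (simp add: abs_mult left_diff_distrib[symmetric])
   also have "... <= \<eta>*1" using A2_lip[OF \<eta> i j] x1[OF i, of 0] r1 \<eta>0 by (intro mult_mono) auto
   finally show ?thesis by simp
  qed
  ultimately have "\<bar>dz w z x i j - dz w' z x i j\<bar> <= (real m + 1)*\<eta>" unfolding dz_def by (simp add: algebra_simps)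
  then show ?thesis using L(1) by linarith
 qed
 have dxd: "\<bar>dx w K z x e y i s - dx w' K z x e y i s\<bar> <= L*\<eta>" if i: "i < N" for i s
 proof (cases "s + 1 < r")
  case True then show ?thesis using L(3) by (simp add: dx_def)
 next
  case False
  have "\<bar>(SUM k<m. A3 p w (Suc i) $$ (0, k)*z i k) - (SUM k<m. A3 p w' (Suc i) $$ (0, k)*z i k)\<bar> <= real m*\<eta>"
   by (rule diff[OF A3_lip[OF \<eta> i] z1[OF i]])
  moreover have "\<bar>(SUM q<r. cc p w (q + 1) (Suc i)*x i q) - (SUM q<r. cc p w' (q + 1) (Suc i)*x i q)\<bar> <= real r*\<eta>"
   by (rule diff[OF cc_lip[OF \<eta> i] x1[OF i]])
  moreover have "\<bar>bb p w (Suc i)*uu K e y i - bb p w' (Suc i)*uu K e y i\<bar> <= U0 K*\<eta>"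
  proof -
   have "\<bar>bb p w (Suc i)*uu K e y i - bb p w' (Suc i)*uu K e y i\<bar> = \<bar>uu K e y i\<bar>*\<bar>bb p w (Suc i) - bb p w' (Suc i)\<bar>"
    by (simp add: abs_mult left_diff_distrib[symmetric] mult.commute)
   also have "... <= U0 K*\<eta>" using U[OF i] bb_lip[OF \<eta> i] U00 by (intro mult_mono) auto
   finally show ?thesis .
  qed
  ultimately have "\<bar>dx w K z x e y i s - dx w' K z x e y i s\<bar> <= (real m + real r + U0 K)*\<eta>"
   using False unfolding dx_def by (simp add: algebra_simps)
  then show ?thesis using L(2) by linarith
 qed
 have "\<bar>st N m r l (dz w z x) (dx w K z x e y) (de K e y) (dy h x y) $ I - st N m r l (dz w' z x) (dx w' K z x e y) (de K e y) (dy h x y) $ I\<bar> <= L*\<eta>"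
  using st_cases[OF I, where 'a = real]
 proof (elim disjE exE conjE)
  fix i j assume ij: "i < N" "j < m" and s: "ALL z x e y. st N m r l z x e y $ I = (z i j :: real)"
  show ?thesis unfolding s[rule_format] by (rule dzd[OF ij])
 next
  fix i j assume ij: "i < N" "j < r" and s: "ALL z x e y. st N m r l z x e y $ I = (x i j :: real)"
  show ?thesis unfolding s[rule_format] by (rule dxd[OF ij(1)])
 next
  fix i j assume ij: "i < N" "j < l" and s: "ALL z x e y. st N m r l z x e y $ I = (e i j :: real)"
  show ?thesis unfolding s[rule_format] using L(3) by simp
 next
  fix i j assume ij: "i < N" "j < r" and s: "ALL z x e y. st N m r l z x e y $ I = (y i j :: real)"
  show ?thesis unfolding s[rule_format] using L(3) by simp
 qed
 then show ?thesis unfolding col u Ac_st_real L_def .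
qed

lemma PP_bounds:
 assumes hw: "ALL w:W. hurwitz (Ac p d E K h w)"
 shows "EX lo>0. EX hi. ALL w:W. lo <= eig_min (PP p d E K h w) & lo <= eig_max (PP p d E K h w) &
  eig_max (PP p d E K h w) <= hi & mnorm (PP p d E K h w) <= hi"
proof -
 define L where "L = real m + 1 + real r + U0 K"
 have L0: "0 <= L" by (simp add: L_def U0_def sum_nonneg)
 obtain D where D: "D >= 0" "ALL w:W. ALL w':W. ALL k<wdim p. \<bar>w $ k - w' $ k\<bar> <= D" using W_diameter by blast
 obtain B where B: "B >= 0" "ALL i<nst. ALL j<nst. \<bar>Ac p d E K h (0\<^sub>v (wdim p)) $$ (i, j)\<bar> <= B" by (rule matrix_entries_bounded)
 have bd: "ALL w:W. ALL i<nst. ALL j<nst. \<bar>entries (Ac p d E K h w) i j\<bar> <= B + L*D"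
 proof (intro ballI allI impI)
  fix w i j assume w: "w : W" and ij: "i < nst" "j < nst"
  have "ALL k<wdim p. \<bar>w $ k - 0\<^sub>v (wdim p) $ k\<bar> <= D" using D(2) w W0 by blast
  from Ac_lip[OF this ij, of K h] have "\<bar>entries (Ac p d E K h w) i j - entries (Ac p d E K h (0\<^sub>v (wdim p))) i j\<bar> <= L*D"
   unfolding L_def .
  moreover have "\<bar>entries (Ac p d E K h (0\<^sub>v (wdim p))) i j\<bar> <= B" unfolding entries_def using B(2) ij by blast
  ultimately show "\<bar>entries (Ac p d E K h w) i j\<bar> <= B + L*D" by linarith
 qed
 have car: "ALL w:W. Ac p d E K h w : carrier_mat nst nst" using Ac_carrier by blast
 have lip: "ALL w:W. ALL w':W. ALL \<eta>>=0. (ALL k<wdim p. \<bar>w $ k - w' $ k\<bar> <= \<eta>) -->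
   (ALL i<nst. ALL j<nst. \<bar>entries (Ac p d E K h w) i j - entries (Ac p d E K h w') i j\<bar> <= L*\<eta>)"
  unfolding L_def using Ac_lip by blast
 show ?thesis unfolding PP_def by (rule lyap_bounds_uniform[OF W nst_pos car lip L0 bd hw])
qed

text \<open>\<open>PP_bounds\<close> makes the families bounded, so the suprema and the infimum over
  W are genuine bounds. Positivity of \<open>lam1\<close> comes from the largest eigenvalue at w =
  0, which the norm dominates.\<close>

lemma PP_lam:
 assumes hw: "ALL w:W. hurwitz (Ac p d E K h w)"
 shows lam_M_pos: "0 < lam_M p d E W K h" and lam_m_pos: "0 < lam_m p d E W K h" and lam1_pos: "0 < lam1 p d E W K h"
  and lam_M_upper: "w : W ==> eig_max (PP p d E K h w) <= lam_M p d E W K h"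
  and lam_m_lower: "w : W ==> lam_m p d E W K h <= eig_min (PP p d E K h w)"
  and lam1_upper: "w : W ==> (mnorm (PP p d E K h w))^2 <= lam1 p d E W K h"
proof -
 obtain lo hi where lo: "lo > 0" and b: "ALL w:W. lo <= eig_min (PP p d E K h w) & lo <= eig_max (PP p d E K h w) &
  eig_max (PP p d E K h w) <= hi & mnorm (PP p d E K h w) <= hi"
  using PP_bounds[OF hw] by blast
 have P: "PP p d E K h w : carrier_mat nst nst" if "w : W" for w
  unfolding PP_def using lyap_carrier[OF Ac_carrier] hw that by blast
 have sym: "ALL i<nst. ALL j<nst. entries (PP p d E K h w) i j = entries (PP p d E K h w) j i" if "w : W" for w
  unfolding PP_def using lyap_symmetric[OF Ac_carrier] hw that by blast
 show M: "eig_max (PP p d E K h w) <= lam_M p d E W K h" if "w : W" for w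
  unfolding lam_M_def by (rule cSUP_upper[OF that]) (rule bdd_aboveI2[of _ _ hi], use b in blast)
 show "lam_m p d E W K h <= eig_min (PP p d E K h w)" if "w : W" for w
  unfolding lam_m_def by (rule cINF_lower[OF _ that]) (rule bdd_belowI2[of _ lo], use b in blast)
 have m2: "(mnorm (PP p d E K h w))^2 <= hi^2" if "w : W" for w
  using b that mnorm_nonneg[OF P[OF that]] by (intro power_mono) auto
 show l1: "(mnorm (PP p d E K h w))^2 <= lam1 p d E W K h" if "w : W" for w
  unfolding lam1_def by (rule cSUP_upper[OF that]) (rule bdd_aboveI2[of _ _ "hi^2"], rule m2)
 let ?w = "0\<^sub>v (wdim p)"
 show "0 < lam_M p d E W K h" using M[OF W0] b W0 lo by (meson less_le_trans)
 show "0 < lam_m p d E W K h"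
 proof -
  have "lo <= lam_m p d E W K h" unfolding lam_m_def by (rule cINF_greatest) (use W0 b in blast)+
  then show ?thesis using lo by linarith
 qed
 show "0 < lam1 p d E W K h"
 proof -
  let ?P = "PP p d E K h ?w"
  have ev: "eigenvalue ?P (eig_max ?P)" by (rule eig_max_upper(2)[OF P[OF W0] nst_pos sym[OF W0]])
  then obtain v where v: "v : carrier_vec nst" "v ~= 0\<^sub>v nst" "?P *\<^sub>v v = eig_max ?P \<cdot>\<^sub>v v"
   using carrier_matD[OF P[OF W0]] unfolding eigenvalue_def eigenvector_def by auto
  have "vnorm v ~= 0"
  proof
   assume "vnorm v = 0"
   then have "(SUM i<nst. (v $ i)^2) = 0" using vnorm_sq[of v nst] v(1) by simp
   then have "ALL i:{..<nst}. (v $ i)^2 = 0" by (subst (asm) sum_nonneg_eq_0_iff) auto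
   then have "v = 0\<^sub>v nst" using v(1) by (intro eq_vecI) auto
   then show False using v(2) by simp
  qed
  then have vp: "vnorm v > 0" using vnorm_nonneg[of v] by simp
  have em: "eig_max ?P >= lo" using b W0 by blast
  have "vnorm (?P *\<^sub>v v) <= mnorm ?P*vnorm v" by (rule vnorm_mult_le[OF P[OF W0] v(1)])
  then have "eig_max ?P*vnorm v <= mnorm ?P*vnorm v" unfolding v(3) vnorm_smult using em lo by simp
  then have "eig_max ?P <= mnorm ?P" using vp by simp
  then have "0 < mnorm ?P" using em lo by linarith
  then have "0 < (mnorm ?P)^2" by simp
  then show ?thesis using l1[OF W0] by linarith
 qed
qed

section \<open>The constants of the triggering condition\<close>

lemma H_norm_le: "(mnorm (Hmat N E))^2 <= lam2 N"
proof -
 let ?S = "{(mnorm (Hmat N E))^2 | E. digraph N E & connected_digraph N E}"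
 have "?S \<subseteq> (%E. (mnorm (Hmat N E))^2) ` Pow ({0..N} \<times> {0..N})" by (auto simp: digraph_def)
 then have "finite ?S" by (rule finite_subset) auto
 then show ?thesis unfolding lam2_def by (rule Max_ge) (use graph conn in blast)
qed

lemma He_le:
 fixes v :: "nat => real"
 shows "(SUM i<N. (SUM j<N. Hmat N E $$ (i, j)*v j)^2) <= lam2 N*(SUM i<N. (v i)^2)"
proof -
 have c: "vec N v : carrier_vec N" by simp
 have "(SUM i<N. (SUM j<N. Hmat N E $$ (i, j)*v j)^2) = (vnorm (Hmat N E *\<^sub>v vec N v))^2"
 proof -
  have "dim_vec (Hmat N E *\<^sub>v vec N v) = N" using Hmat_carrier[of N E] by simp
  then show ?thesis unfolding vnorm_sq[OF \<open>dim_vec (Hmat N E *\<^sub>v vec N v) = N\<close>]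
  proof (intro sum.cong refl)
   fix i assume "i : {..<N}"
   then have "(Hmat N E *\<^sub>v vec N v) $ i = (SUM j<N. Hmat N E $$ (i, j)*vec N v $ j)"
    by (intro index_mult_mat_vec_sum[OF Hmat_carrier c]) (simp only: lessThan_iff)
   also have "... = (SUM j<N. Hmat N E $$ (i, j)*v j)" by (intro sum.cong refl) simp
   finally show "(SUM j<N. Hmat N E $$ (i, j)*v j)^2 = ((Hmat N E *\<^sub>v vec N v) $ i)^2" by (simp only:)
  qed
 qed
 also have "... <= (mnorm (Hmat N E)*vnorm (vec N v))^2"
  by (intro power_mono vnorm_mult_le[OF Hmat_carrier c] vnorm_nonneg)
 also have "... = (mnorm (Hmat N E))^2*(SUM i<N. (v i)^2)"
  by (simp add: power_mult_distrib vnorm_sq[of _ N])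
 also have "... <= lam2 N*(SUM i<N. (v i)^2)" by (intro mult_right_mono H_norm_le sum_nonneg) simp
 finally show ?thesis .
qed

definition bo :: "real => nat => real" where "bo h s = h ^ (s + 1)*ctrl_delta d (r - 1 - s)"

lemma Bo_norm_le: "(SUM s<r. (bo h s)^2) <= lam3 p d h"
proof -
 have c: "Bo p d h : carrier_mat r 1" by (simp add: Bo_def)
 let ?e = "vec 1 (%_. 1) :: real Matrix.vec"
 have ec: "?e : carrier_vec 1" by simp
 have ve: "vnorm ?e = 1" by (simp add: vnorm_def scalar_prod_def)
 have d: "dim_vec (Bo p d h *\<^sub>v ?e) = r" using c by simp
 have "(SUM s<r. (bo h s)^2) = (vnorm (Bo p d h *\<^sub>v ?e))^2"
  unfolding vnorm_sq[OF d]
 proof (rule sum.cong[OF refl])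
  fix s assume "s : {..<r}"
  then have s: "s < r" by simp
  have "(Bo p d h *\<^sub>v ?e) $ s = Bo p d h $$ (s, 0)" unfolding index_mult_mat_vec_sum[OF c ec s] by simp
  then show "(bo h s)^2 = ((Bo p d h *\<^sub>v ?e) $ s)^2" using s by (simp only:) (simp add: Bo_def bo_def)
 qed
 also have "... <= (mnorm (Bo p d h)*vnorm ?e)^2" by (intro power_mono vnorm_mult_le[OF c ec] vnorm_nonneg)
 finally show ?thesis unfolding ve lam3_def by simp
qed

text \<open>Squared norm of the input column (b_i, Q) times that of the feedback row (\<psi>, K
  \<Omega>): the gain from the sampling errors of \<eta>_i and \<zeta>_i to the disturbance they
  cause.\<close>

definition gain :: "real Matrix.vec => real => nat => real" where
 "gain w K i = ((bb p w (Suc i))^2 + (SUM k<l. (Qc k)^2))*((SUM k<l. (\<psi> k)^2) + K^2*(SUM s<r. (om s)^2))"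

text \<open>For large \<open>h\<close> the observer gain dominates \<open>\<lambda>\<^sub>3\<close>, which absorbs the cross terms of the
 inputs \<open>\<eta>\<close> and \<open>\<zeta>\<close> that \<open>max {\<lambda>\<^sub>4, \<lambda>\<^sub>5}\<close> alone does not cover.\<close>
lemma lam3_dominates: "EX hs>=1. ALL h>hs. ALL w:W. ALL i<N. gain w K i <= lam3 p d h"
proof -
 obtain B where B: "B >= 1" "ALL w:W. ALL i<N. (ALL j<m. \<bar>A2 p w (Suc i) $$ (j, 0)\<bar> <= B & \<bar>A3 p w (Suc i) $$ (0, j)\<bar> <= B) &
  (ALL q<r. \<bar>cc p w (q + 1) (Suc i)\<bar> <= B) & bb p w (Suc i) <= B & 1 / bb p w (Suc i) <= B"
  using coefficients_bounded by blast
 define G where "G = (B^2 + (SUM k<l. (Qc k)^2))*((SUM k<l. (\<psi> k)^2) + K^2*(SUM s<r. (om s)^2))"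
 have gG: "gain w K i <= G" if "w : W" "i < N" for w i
 proof -
  have "bb p w (Suc i) <= B" using B(2) that by blast
  moreover have "0 < bb p w (Suc i)" using b_pos that by simp
  ultimately have "(bb p w (Suc i))^2 <= B^2" by (intro power_mono) auto
  then show ?thesis unfolding gain_def G_def by (intro mult_right_mono) (auto intro!: add_nonneg_nonneg sum_nonneg mult_nonneg_nonneg)
 qed
 \<comment> \<open>0 is not a root of a stable polynomial.\<close>
 have d0: "ctrl_delta d 0 ~= 0"
 proof
  assume "ctrl_delta d 0 = 0"
  then have "(0::complex) ^ r = - (SUM j<r. complex_of_real (ctrl_delta d j)*0 ^ j)"
   using r1 by (simp add: power_0_left if_distrib[of "%t. _*t"] cong: if_cong)
  from stable_poly_root[OF del_stable this] show False by simp
 qed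
 \<comment> \<open>The last entry h^r \<delta>_0 of \<open>Bo\<close> alone makes \<lambda>_3 exceed
   the bound \<open>G\<close> of the gains.\<close>
 define hs where "hs = max 1 (G / (ctrl_delta d 0)^2)"
 have "gain w K i <= lam3 p d h" if h: "h > hs" and w: "w : W" "i < N" for h w i
 proof -
  have h1: "1 <= h" using h by (simp add: hs_def)
  have "G / (ctrl_delta d 0)^2 <= h" using h by (simp add: hs_def)
  then have "G <= h*(ctrl_delta d 0)^2" using d0 by (simp add: divide_le_eq)
  also have "... <= h ^ (2*r)*(ctrl_delta d 0)^2"
   using h1 r1 self_le_power[of h "2*r"] by (intro mult_right_mono) auto
  also have "... = (bo h (r - 1))^2" using r1 by (simp add: bo_def power_mult_distrib flip: power_mult) (simp add: mult.commute)
  also have "... <= (SUM s<r. (bo h s)^2)" by (rule member_le_sum) (use r1 in auto)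
  also have "... <= lam3 p d h" by (rule Bo_norm_le)
  finally show ?thesis using gG[OF w] by linarith
 qed
 then show ?thesis by (intro exI[of _ hs]) (auto simp: hs_def)
qed

lemma lam2_bar_ge: "1 <= lam2_bar N" "lam2 N <= lam2_bar N"
 by (simp_all add: lam2_bar_def)

lemma lamM_bar_ge: "lam3 p d h <= lamM_bar p d W K h"
 unfolding lamM_bar_def by (rule Max_ge) auto

definition gz :: "real Matrix.vec => real => (nat => nat => real) => (nat => nat => real) => nat => nat => real" where
 "gz w K e y i s = (if s + 1 < r then 0 else bb p w (Suc i)*uu K e y i)"

definition V :: "real => real => real Matrix.vec => real Matrix.vec => real" where
 "V K h w v = bil nst (entries (PP p d E K h w)) (%i. v $ i) (%i. v $ i)"

text \<open>With g the disturbance due to sampling, V' = -2|x|^2 + 2 x.Pg, and Young's inequality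
  leaves -|x|^2 + \<lambda>_1 |g|^2. The triggering condition bounds |g|^2 by the measured part of
  x, and \<open>sigma_bar\<close> is built so that \<lambda>_1 |g|^2 costs at most \<sigma> |x|^2 +
  \<lambda>_0 b.\<close>

lemma dissipation:
 assumes hw: "ALL w:W. hurwitz (Ac p d E K h w)" and gn: "ALL w:W. ALL i<N. gain w K i <= lam3 p d h"
  and w: "w : W" and \<sigma>: "0 < \<sigma>" "\<sigma> < 1"
  and lam: "lam = (1 - \<sigma>) / lam_M p d E W K h"
  and sb: "sigma_bar = \<sigma> / (lam1 p d E W K h*lamM_bar p d W K h*lam2_bar N)"
  and trig: "ALL i<N. (SUM k<l. (et i k)^2) + (SUM s<r. (yt i s)^2) + (vt i)^2
   <= sigma_bar*((SUM s<r. (y i s)^2) + (SUM j<N. Hmat N E $$ (i, j)*x j 0)^2) + b"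
  and v: "v = st N m r l z x e y"
  and v': "v' = st N m r l (dz w z x) (%i s. dx w K z x e y i s + gz w K et yt i s)
   (%i k. de K e y i k + Qc k*uu K et yt i) (%i s. dy h x y i s + bo h s*vt i)"
  and MB: "0 < lamM_bar p d W K h" and b0: "0 <= b"
 shows "2*bil nst (entries (PP p d E K h w)) (%i. v $ i) (%i. v' $ i) <= - lam*V K h w v + lam0 p d E W K h*b"
proof -
 let ?P = "PP p d E K h w" and ?n = nst
 let ?A = "Ac p d E K h w"
 define \<Lambda> where "\<Lambda> = lamM_bar p d W K h"
 note hww = bspec[OF hw w]
 have P: "?P : carrier_mat ?n ?n" unfolding PP_def by (rule lyap_carrier[OF Ac_carrier hww])
 have sym: "ALL i<?n. ALL j<?n. entries ?P i j = entries ?P j i" unfolding PP_def by (rule lyap_symmetric[OF Ac_carrier hww])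
 define g where "g = st N m r l (%i j. 0) (gz w K et yt) (%i k. Qc k*uu K et yt i) (%i s. bo h s*vt i)"
 have vc: "v : carrier_vec ?n" and gc: "g : carrier_vec ?n" unfolding v g_def by (rule st_carrier)+
 define S where "S = (SUM k<?n. (v $ k)^2)"
 define G where "G = (SUM k<?n. (g $ k)^2)"
 have v'eq: "v' $ k = mv ?n (entries ?A) (%i. v $ i) k + g $ k" if k: "k < ?n" for k
 proof -
  have "mv ?n (entries ?A) (%i. v $ i) k = (?A *\<^sub>v v) $ k"
   using index_mult_mat_vec_sum[OF Ac_carrier vc k] by (simp add: mv_def entries_def)
  also have "... = st N m r l (dz w z x) (dx w K z x e y) (de K e y) (dy h x y) $ k" unfolding v Ac_st_real ..
  finally have A: "mv ?n (entries ?A) (%i. v $ i) k = st N m r l (dz w z x) (dx w K z x e y) (de K e y) (dy h x y) $ k" .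
  show ?thesis unfolding A v' g_def using st_cases[OF k, where 'a = real] by (elim disjE exE conjE) simp_all
 qed
 have 1: "bil ?n (entries ?P) (%i. v $ i) (%i. v' $ i) = - S + bil ?n (entries ?P) (%i. v $ i) (%i. g $ i)"
 proof -
  have "bil ?n (entries ?P) (%i. v $ i) (%i. v' $ i) = bil ?n (entries ?P) (%i. v $ i) (%k. mv ?n (entries ?A) (%i. v $ i) k + g $ k)"
   by (rule bil_cong) (simp_all add: v'eq)
  then show ?thesis unfolding bil_add_right PP_def lyap_bil[OF Ac_carrier hww] S_def by simp
 qed
 have 2: "2*bil ?n (entries ?P) (%i. v $ i) (%i. g $ i) <= S + lam1 p d E W K h*G"
 proof -
  have Pg: "dim_vec (?P *\<^sub>v g) = ?n" using P by simp
  have "bil ?n (entries ?P) (%i. v $ i) (%i. g $ i) = (SUM i<?n. v $ i*(?P *\<^sub>v g) $ i)"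
   unfolding quadratic_form_bil[OF P vc gc, symmetric] by (rule scalar_prod_sum[OF Pg])
  then have "2*bil ?n (entries ?P) (%i. v $ i) (%i. g $ i) = (SUM i<?n. 2*(v $ i)*(?P *\<^sub>v g) $ i)" by (simp add: sum_distrib_left mult_ac)
  also have "... <= (SUM i<?n. (v $ i)^2 + ((?P *\<^sub>v g) $ i)^2)" by (rule sum_mono) (rule sum_squares_bound)
  also have "... = S + (vnorm (?P *\<^sub>v g))^2" unfolding vnorm_sq[OF Pg] S_def by (simp add: sum.distrib)
  also have "(vnorm (?P *\<^sub>v g))^2 <= (mnorm ?P*vnorm g)^2" by (intro power_mono vnorm_mult_le[OF P gc] vnorm_nonneg)
  also have "... = (mnorm ?P)^2*G" unfolding power_mult_distrib G_def using vnorm_sq[of g ?n] gc by simp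
  also have "... <= lam1 p d E W K h*G" by (intro mult_right_mono lam1_upper[OF hw w]) (simp add: G_def sum_nonneg)
  finally show ?thesis by simp
 qed
 \<comment> \<open>The errors of \<eta> and \<zeta> enter through one scalar input, so they are
   estimated jointly; this is where the product in \<open>gain\<close> comes from.\<close>
 have u2: "(uu K et yt i)^2 <= ((SUM k<l. (\<psi> k)^2) + K^2*(SUM s<r. (om s)^2))*((SUM k<l. (et i k)^2) + (SUM s<r. (yt i s)^2))" for i
  unfolding uu_def of_real_eq_id id_apply
  by (rule combined_square_bound) (simp_all add: Cauchy_Schwarz_sum sum_nonneg)
 have Geq: "G = (SUM i<N. (bb p w (Suc i)*uu K et yt i)^2 + (SUM k<l. (Qc k)^2)*(uu K et yt i)^2 + (SUM s<r. (bo h s)^2)*(vt i)^2)"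
 proof -
  have "(SUM s<r. (gz w K et yt i s)^2) = (SUM s<r. if s = r - 1 then (bb p w (Suc i)*uu K et yt i)^2 else 0)" for i
   by (rule sum.cong[OF refl]) (auto simp: gz_def)
  then have s1: "(SUM s<r. (gz w K et yt i s)^2) = (bb p w (Suc i)*uu K et yt i)^2" for i using r1 by simp
  have "G = (SUM i<N. SUM s<r. (gz w K et yt i s)^2) + ((SUM i<N. SUM k<l. (Qc k*uu K et yt i)^2) + (SUM i<N. SUM s<r. (bo h s*vt i)^2))"
   unfolding G_def g_def using sum_st[of "%a b. a^2" N m r l "%i j. 0" "gz w K et yt" "%i k. Qc k*uu K et yt i" "%i s. bo h s*vt i"] by simp
  then show ?thesis unfolding s1 by (simp add: sum.distrib power_mult_distrib sum_distrib_right)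
 qed
 have "G <= (SUM i<N. \<Lambda>*((SUM k<l. (et i k)^2) + (SUM s<r. (yt i s)^2) + (vt i)^2))"
  unfolding Geq
 proof (rule sum_mono)
  fix i assume "i : {..<N}"
  then have i: "i < N" by simp
  let ?X = "(SUM k<l. (et i k)^2) + (SUM s<r. (yt i s)^2)"
  have X0: "0 <= ?X" by (simp add: sum_nonneg)
  have "(bb p w (Suc i)*uu K et yt i)^2 + (SUM k<l. (Qc k)^2)*(uu K et yt i)^2 = ((bb p w (Suc i))^2 + (SUM k<l. (Qc k)^2))*(uu K et yt i)^2"
   by (simp add: power_mult_distrib distrib_right)
  also have "... <= ((bb p w (Suc i))^2 + (SUM k<l. (Qc k)^2))*(((SUM k<l. (\<psi> k)^2) + K^2*(SUM s<r. (om s)^2)) * ?X)"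
   by (intro mult_left_mono u2) (simp add: sum_nonneg)
  also have "... = gain w K i * ?X" by (simp add: gain_def mult.assoc)
  also have "... <= \<Lambda> * ?X" using gn w i lamM_bar_ge[of h K] X0 unfolding \<Lambda>_def by (intro mult_right_mono) (auto intro: order_trans)
  finally have a: "(bb p w (Suc i)*uu K et yt i)^2 + (SUM k<l. (Qc k)^2)*(uu K et yt i)^2 <= \<Lambda> * ?X" .
  have "(SUM s<r. (bo h s)^2)*(vt i)^2 <= \<Lambda>*(vt i)^2"
   using Bo_norm_le[of h] lamM_bar_ge[of h K] unfolding \<Lambda>_def by (intro mult_right_mono) auto
  with a show "(bb p w (Suc i)*uu K et yt i)^2 + (SUM k<l. (Qc k)^2)*(uu K et yt i)^2 + (SUM s<r. (bo h s)^2)*(vt i)^2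
    <= \<Lambda>*(?X + (vt i)^2)" by (simp add: distrib_left)
 qed
 also have "... <= (SUM i<N. \<Lambda>*(sigma_bar*((SUM s<r. (y i s)^2) + (SUM j<N. Hmat N E $$ (i, j)*x j 0)^2) + b))"
  using trig MB unfolding \<Lambda>_def by (intro sum_mono mult_left_mono) auto
 also have "... = \<Lambda>*sigma_bar*((SUM i<N. SUM s<r. (y i s)^2) + (SUM i<N. (SUM j<N. Hmat N E $$ (i, j)*x j 0)^2)) + real N*(\<Lambda>*b)"
  by (simp add: sum.distrib sum_distrib_left distrib_left mult_ac)
 also have "... <= \<Lambda>*sigma_bar*(lam2_bar N*S) + real N*(\<Lambda>*b)"
 proof -
  have Seq: "S = (SUM i<N. SUM j<m. (z i j)^2) + (SUM i<N. SUM s<r. (x i s)^2) + ((SUM i<N. SUM k<l. (e i k)^2) + (SUM i<N. SUM s<r. (y i s)^2))"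
   unfolding S_def v using sum_st[of "%a b. a^2" N m r l z x e y z x e y] by simp
  \<comment> \<open>Of \<xi> only the first entries reach e_v, through \<open>H\<close>, while
    \<zeta> enters directly. Both are parts of S, at the price of the factor
    \<lambda>_2-bar.\<close>
  have x0: "(SUM i<N. (x i 0)^2) <= (SUM i<N. SUM s<r. (x i s)^2)"
   by (rule sum_mono, rule member_le_sum) (use r1 in auto)
  have "(SUM i<N. (SUM j<N. Hmat N E $$ (i, j)*x j 0)^2) <= lam2 N*(SUM i<N. (x i 0)^2)" by (rule He_le)
  also have "... <= lam2_bar N*(SUM i<N. (x i 0)^2)" by (intro mult_right_mono lam2_bar_ge sum_nonneg) simp
  also have "... <= lam2_bar N*(SUM i<N. SUM s<r. (x i s)^2)" using lam2_bar_ge(1) by (intro mult_left_mono x0) auto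
  finally have h1: "(SUM i<N. (SUM j<N. Hmat N E $$ (i, j)*x j 0)^2) <= lam2_bar N*(SUM i<N. SUM s<r. (x i s)^2)" .
  have y0: "0 <= (SUM i<N. SUM s<r. (y i s)^2)" by (simp add: sum_nonneg)
  have h2: "(SUM i<N. SUM s<r. (y i s)^2) <= lam2_bar N*(SUM i<N. SUM s<r. (y i s)^2)"
   using mult_right_mono[OF lam2_bar_ge(1) y0] by simp
  have h3: "0 <= lam2_bar N*((SUM i<N. SUM j<m. (z i j)^2) + (SUM i<N. SUM k<l. (e i k)^2))"
   using lam2_bar_ge(1) by (intro mult_nonneg_nonneg add_nonneg_nonneg sum_nonneg) auto
  have "(SUM i<N. SUM s<r. (y i s)^2) + (SUM i<N. (SUM j<N. Hmat N E $$ (i, j)*x j 0)^2) <= lam2_bar N*S"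
   unfolding Seq using h1 h2 h3 by (simp add: algebra_simps)
  moreover have "0 <= \<Lambda>*sigma_bar"
   unfolding sb \<Lambda>_def using MB lam1_pos[OF hw] lam2_bar_ge(1) \<sigma> by (intro mult_nonneg_nonneg divide_nonneg_nonneg) auto
  ultimately show ?thesis by (simp add: mult_left_mono)
 qed
 finally have G: "G <= \<Lambda>*sigma_bar*(lam2_bar N*S) + real N*(\<Lambda>*b)" .
 have "lam1 p d E W K h*G <= lam1 p d E W K h*(\<Lambda>*sigma_bar*(lam2_bar N*S) + real N*(\<Lambda>*b))"
  using lam1_pos[OF hw] by (intro mult_left_mono G) simp
 also have "... = \<sigma>*S + lam0 p d E W K h*b"
 proof -
  have "lam1 p d E W K h*(\<Lambda>*sigma_bar*lam2_bar N) = \<sigma>"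
   unfolding sb \<Lambda>_def using MB lam1_pos[OF hw] lam2_bar_ge(1) by (simp add: field_simps)
  moreover have "lam1 p d E W K h*(\<Lambda>*sigma_bar*(lam2_bar N*S) + real N*(\<Lambda>*b))
   = (lam1 p d E W K h*(\<Lambda>*sigma_bar*lam2_bar N))*S + (lam1 p d E W K h*\<Lambda>*real N)*b"
   by (simp only: distrib_left mult_ac)
  ultimately show ?thesis unfolding lam0_def \<Lambda>_def by simp
 qed
 finally have 3: "lam1 p d E W K h*G <= \<sigma>*S + lam0 p d E W K h*b" .
 \<comment> \<open>Turns the remaining decrease (1 - \<sigma>) S into the decay rate lam of
   V.\<close>
 have "V K h w v <= lam_M p d E W K h*S"
 proof -
  have "V K h w v <= eig_max ?P*S" unfolding V_def S_def by (rule eig_max_upper(1)[OF P nst_pos sym])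
  also have "... <= lam_M p d E W K h*S" by (intro mult_right_mono lam_M_upper[OF hw w]) (simp add: S_def sum_nonneg)
  finally show ?thesis .
 qed
 then have "lam*V K h w v <= lam*(lam_M p d E W K h*S)"
  unfolding lam using \<sigma> lam_M_pos[OF hw] by (intro mult_left_mono) auto
 also have "... = (1 - \<sigma>)*S" unfolding lam using lam_M_pos[OF hw] by simp
 finally have 4: "lam*V K h w v <= S - \<sigma>*S" by (simp add: left_diff_distrib)
 show ?thesis using 1 2 3 4 by linarith
qed

end

section \<open>Linear differential equations\<close>

text \<open>At events only one-sided derivatives are available, so the mean value theorem does not
  apply. The set where f stays below a line of small slope k > 0 through its initial value is
  closed, and it extends to the right of each of its points before b; its largest point is therefore
  b.\<close>

lemma right_derivative_nonpos:
 fixes f :: "real => real"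
 assumes ab: "a <= b" and c: "continuous_on {a..b} f"
  and d: "ALL t:{a..<b}. EX D<=0. (f has_real_derivative D) (at_right t)"
 shows "f b <= f a"
proof (rule field_le_epsilon)
 fix e :: real assume e: "e > 0"
 define k where "k = e / (b - a + 1)"
 have k: "k > 0" "k*(b - a) <= e" using e ab by (auto simp: k_def field_simps)
 define A where "A = {t:{a..b}. f t <= f a + k*(t - a)}"
 have "closed A" unfolding A_def by (rule continuous_on_closed_Collect_le[OF c]) (auto intro!: continuous_intros)
 then have "compact ({a..b} \<inter> A)" by (intro compact_Int_closed) auto
 then have cA: "compact A" by (rule back_subst[of compact]) (auto simp: A_def)
 have "A ~= {}" using ab by (auto simp: A_def)
 from compact_attains_sup[OF cA this] obtain s where s: "s : A" "ALL t:A. t <= s" by blast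
 have "s = b"
 proof (rule ccontr)
  assume "s ~= b"
  then have sb: "s < b" "a <= s" using s(1) by (auto simp: A_def)
  then have "s : {a..<b}" by simp
  with d obtain D where D: "D <= 0" "(f has_real_derivative D) (at_right s)" by blast
  have "((%t. f t - k*t) has_real_derivative (D - k)) (at_right s)"
   using DERIV_diff[OF D(2) DERIV_cmult_Id] .
  from has_real_derivative_neg_dec_right[OF this] D(1) k(1)
  obtain q where q: "q > 0" "ALL h>0. s + h : {s<..} --> h < q --> f (s + h) - k*(s + h) < f s - k*s" by auto
  define h where "h = min (q / 2) (b - s)"
  have h: "h > 0" "h < q" "s + h <= b" using q(1) sb by (auto simp: h_def min_def)
  have "f (s + h) - k*(s + h) < f s - k*s" using q(2) h by simp
  moreover have "f s <= f a + k*(s - a)" using s(1) by (simp add: A_def)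
  ultimately have "f (s + h) <= f a + k*(s + h - a)" by (simp add: algebra_simps)
  then have "s + h : A" using h sb by (simp add: A_def)
  with s(2) h(1) show False by force
 qed
 then have "f b <= f a + k*(b - a)" using s(1) by (simp add: A_def)
 then show "f b <= f a + e" using k(2) by linarith
qed

lemma right_derivative_lipschitz:
 fixes f :: "real => real"
 assumes ab: "a <= b" and c: "continuous_on {a..b} f"
  and d: "ALL t:{a..<b}. EX D. \<bar>D\<bar> <= C & (f has_real_derivative D) (at_right t)"
 shows "\<bar>f b - f a\<bar> <= C*(b - a)"
proof -
 have "s*f b - C*b <= s*f a - C*a" if s: "\<bar>s\<bar> = 1" for s
 proof (rule right_derivative_nonpos[where f = "%t. s*f t - C*t", OF ab])
  show "continuous_on {a..b} (%t. s*f t - C*t)" by (intro continuous_intros c)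
  show "ALL t:{a..<b}. EX D<=0. ((%t. s*f t - C*t) has_real_derivative D) (at_right t)"
  proof
   fix t assume "t : {a..<b}"
   with d obtain D where D: "\<bar>D\<bar> <= C" "(f has_real_derivative D) (at_right t)" by blast
   have "\<bar>s*D\<bar> <= C" using D(1) s by (simp add: abs_mult)
   then show "EX D<=0. ((%t. s*f t - C*t) has_real_derivative D) (at_right t)"
    by (intro exI[of _ "s*D - C"]) (use DERIV_diff[OF DERIV_cmult[OF D(2), of s] DERIV_cmult_Id] in auto)
  qed
 qed
 from this[of 1] this[of "- 1"] show ?thesis by (simp add: abs_le_iff algebra_simps)
qed

text \<open>The subtracted function a exp(-\<alpha> t) + k solves the comparison equation, so the
  difference multiplied by exp(lam t) does not increase.\<close>

lemma exponential_comparison: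
 fixes V :: "real => real"
 assumes b: "0 <= b" and c: "continuous_on {0..b} V"
  and d: "ALL t:{0..<b}. EX D. (V has_real_derivative D) (at_right t) & D <= - lam*V t + c*(\<beta>*exp (- \<alpha>*t) + \<delta>)"
  and \<alpha>: "0 < \<alpha>" "\<alpha> < lam" and nn: "0 <= c" "0 <= \<beta>" "0 <= \<delta>"
 shows "V b <= exp (- lam*b)*V 0 + c*\<beta> / (lam - \<alpha>)*exp (- \<alpha>*b) + c*\<delta> / lam"
proof -
 define a k where "a = c*\<beta> / (lam - \<alpha>)" and "k = c*\<delta> / lam"
 have a: "0 <= a" "a*(lam - \<alpha>) = c*\<beta>" and k: "0 <= k" "lam*k = c*\<delta>" using \<alpha> nn by (auto simp: a_def k_def)
 let ?G = "%t. exp (lam*t)*(V t - a*exp (- \<alpha>*t) - k)"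
 have "?G b <= ?G 0"
 proof (rule right_derivative_nonpos[OF b])
  show "continuous_on {0..b} ?G" by (intro continuous_intros c)
  show "ALL t:{0..<b}. EX D<=0. (?G has_real_derivative D) (at_right t)"
  proof
   fix t assume "t : {0..<b}"
   with d obtain D where D: "(V has_real_derivative D) (at_right t)" "D <= - lam*V t + c*(\<beta>*exp (- \<alpha>*t) + \<delta>)" by blast
   let ?D = "exp (lam*t)*(lam*(V t - a*exp (- \<alpha>*t) - k) + (D + a*\<alpha>*exp (- \<alpha>*t)))"
   have "(?G has_real_derivative ?D) (at_right t)"
    by (rule derivative_eq_intros D(1) refl)+ (simp add: algebra_simps)
   moreover have "lam*(V t - a*exp (- \<alpha>*t) - k) + (D + a*\<alpha>*exp (- \<alpha>*t)) <= 0"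
   proof -
    have "lam*(V t - a*exp (- \<alpha>*t) - k) + (D + a*\<alpha>*exp (- \<alpha>*t))
     = lam*V t + D - (a*(lam - \<alpha>))*exp (- \<alpha>*t) - lam*k" by (simp add: algebra_simps)
    also have "... = lam*V t + D - c*(\<beta>*exp (- \<alpha>*t) + \<delta>)" unfolding a(2) k(2) by (simp add: algebra_simps)
    finally show ?thesis using D(2) by linarith
   qed
   then have "?D <= 0" by (intro mult_nonneg_nonpos) auto
   ultimately show "EX D<=0. (?G has_real_derivative D) (at_right t)" by blast
  qed
 qed
 then have 1: "?G b <= V 0" using a k by simp
 have "V b - a*exp (- \<alpha>*b) - k = exp (- lam*b) * ?G b" by (simp add: exp_minus)
 also have "... <= exp (- lam*b)*V 0" using 1 by (intro mult_left_mono) auto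
 finally show ?thesis unfolding a_def k_def by linarith
qed

text \<open>The exponential series with coefficients A^n x / n!, dominated termwise by a scalar
  exponential. The index set is an arbitrary finite one because it is applied to pairs of block and
  entry.\<close>

lemma linear_ode_exists:
 fixes A :: "'i => 'i => real"
 assumes fin: "finite I"
 shows "EX y. ALL i:I. y i 0 = x i & (ALL t. (y i has_real_derivative (SUM j:I. A i j*y j t)) (at t))"
proof -
 define X where "X n = ((%x i. SUM j:I. A i j*x j) ^^ n) x" for n
 have XS: "X (Suc n) i = (SUM j:I. A i j*X n j)" for n i by (simp add: X_def)
 define C B where "C = (SUM i:I. SUM j:I. \<bar>A i j\<bar>)" and "B = (SUM i:I. \<bar>x i\<bar>)"
 have C0: "0 <= C" by (simp add: C_def sum_nonneg)
 have B0: "0 <= B" by (simp add: B_def sum_nonneg)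
 have bd: "\<bar>X n i\<bar> <= B*C ^ n" if "i : I" for n i
  using that
 proof (induction n arbitrary: i)
  case 0
  have "\<bar>x i\<bar> <= B" unfolding B_def by (rule member_le_sum[of i I "%i. \<bar>x i\<bar>"]) (use 0 fin in auto)
  then show ?case by (simp add: X_def)
 next
  case (Suc n)
  have "\<bar>X (Suc n) i\<bar> <= (SUM j:I. \<bar>A i j\<bar>*(B*C ^ n))"
   unfolding XS by (rule order_trans[OF sum_abs]) (intro sum_mono, simp add: abs_mult mult_left_mono Suc.IH)
  also have "... = (SUM j:I. \<bar>A i j\<bar>)*(B*C ^ n)" by (simp add: sum_distrib_right)
  also have "... <= C*(B*C ^ n)" unfolding C_def
   by (intro mult_right_mono member_le_sum[of i I "%i. SUM j:I. \<bar>A i j\<bar>"])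
    (use Suc.prems fin B0 C0 in \<open>auto simp: sum_nonneg C_def[symmetric]\<close>)
  finally show ?case by (simp add: mult_ac)
 qed
 define c where "c i n = X n i / fact n" for i n
 have sm: "summable (%n. c i n*t ^ n)" if i: "i : I" for i t
 proof (rule summable_comparison_test[OF _ summable_mult[OF summable_exp[of "C*\<bar>t\<bar>"]]], intro exI allI impI)
  fix n
  have "\<bar>X n i\<bar>*(inverse (fact n)*\<bar>t\<bar> ^ n) <= B*C ^ n*(inverse (fact n)*\<bar>t\<bar> ^ n)"
   by (intro mult_right_mono bd[OF i]) auto
  then show "norm (c i n*t ^ n) <= B*(inverse (fact n)*(C*\<bar>t\<bar>) ^ n)"
   by (simp add: c_def abs_mult power_abs power_mult_distrib field_simps)
 qed
 define y where "y i t = (\<Sum>n. c i n*t ^ n)" for i t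
 have "y i 0 = x i" for i unfolding y_def using powser_zero[of "c i"] by (simp add: c_def X_def)
 moreover have "(y i has_real_derivative (SUM j:I. A i j*y j t)) (at t)" if i: "i : I" for i t
 proof -
  have df: "diffs (c i) n = (SUM j:I. A i j*c j n)" for n
  proof -
   have "diffs (c i) n = X (Suc n) i / fact n"
    by (simp add: diffs_def c_def field_simps del: of_nat_Suc)
   then show ?thesis unfolding XS by (simp add: c_def sum_divide_distrib)
  qed
  have "(%n. A i j*(c j n*t ^ n)) sums (A i j*y j t)" if "j : I" for j
   unfolding y_def by (rule sums_mult[OF summable_sums[OF sm[OF that]]])
  then have "(%n. SUM j:I. A i j*(c j n*t ^ n)) sums (SUM j:I. A i j*y j t)" by (intro sums_sum)
  then have "(%n. diffs (c i) n*t ^ n) sums (SUM j:I. A i j*y j t)" unfolding df by (simp add: sum_distrib_right mult.assoc)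
  then have "(\<Sum>n. diffs (c i) n*t ^ n) = (SUM j:I. A i j*y j t)" by (rule sums_unique[symmetric])
  moreover have "(y i has_real_derivative (\<Sum>n. diffs (c i) n*t ^ n)) (at t)"
   unfolding y_def by (rule termdiffs_strong_converges_everywhere) (rule sm[OF i])
  ultimately show ?thesis by simp
 qed
 ultimately show ?thesis by blast
qed

text \<open>With C the sum of all entries of A in modulus, exp(-2 C t) times the squared norm does
  not increase.\<close>

lemma linear_ode_zero:
 fixes d :: "nat => real => real"
 assumes ab: "a <= b" and c: "ALL k<n. continuous_on {a..b} (d k)" and z: "ALL k<n. d k a = 0"
  and d: "ALL t:{a..<b}. ALL k<n. (d k has_real_derivative (SUM j<n. A k j*d j t)) (at_right t)"
 shows "ALL k<n. d k b = 0"
proof -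
 define C where "C = (SUM k<n. SUM j<n. \<bar>A k j\<bar>)"
 define D where "D t = (SUM k<n. (d k t)^2)" for t
 let ?G = "%t. exp (- (2*C)*t)*D t"
 have "?G b <= ?G a"
 proof (rule right_derivative_nonpos[OF ab])
  have "continuous_on {a..b} D" unfolding D_def using c by (intro continuous_intros) auto
  then show "continuous_on {a..b} ?G" by (intro continuous_intros)
  show "ALL t:{a..<b}. EX D<=0. (?G has_real_derivative D) (at_right t)"
  proof
   fix t assume t: "t : {a..<b}"
   let ?D = "SUM k<n. 2*d k t*(SUM j<n. A k j*d j t)"
   have "((%t. (d k t)^2) has_real_derivative (2*d k t*(SUM j<n. A k j*d j t))) (at_right t)" if "k < n" for k
    using DERIV_power[OF d[rule_format, OF t that], of 2] by (simp add: mult_ac)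
   then have "(D has_real_derivative ?D) (at_right t)" unfolding D_def by (intro DERIV_sum) simp
   then have 1: "(?G has_real_derivative (exp (- (2*C)*t)*(?D - 2*C*D t))) (at_right t)"
    by (auto intro!: derivative_eq_intros simp: algebra_simps)
   have "?D = (SUM k<n. SUM j<n. A k j*(2*d k t*d j t))" by (simp add: sum_distrib_left mult_ac)
   also have "... <= (SUM k<n. SUM j<n. \<bar>A k j\<bar>*(2*D t))"
   proof (intro sum_mono)
    fix k j assume "k : {..<n}" "j : {..<n}"
    then have "(d k t)^2 <= D t" "(d j t)^2 <= D t"
     unfolding D_def by (auto intro!: member_le_sum[of _ "{..<n}" "%k. (d k t)^2"])
    moreover have "2*(\<bar>d k t\<bar>*\<bar>d j t\<bar>) <= (d k t)^2 + (d j t)^2"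
     using sum_squares_bound[of "\<bar>d k t\<bar>" "\<bar>d j t\<bar>"] by simp
    ultimately have "2*(\<bar>d k t\<bar>*\<bar>d j t\<bar>) <= 2*D t" by linarith
    then have "\<bar>A k j\<bar>*(2*(\<bar>d k t\<bar>*\<bar>d j t\<bar>)) <= \<bar>A k j\<bar>*(2*D t)" by (rule mult_left_mono) simp
    moreover have "A k j*(2*d k t*d j t) <= \<bar>A k j*(2*d k t*d j t)\<bar>" by (rule abs_ge_self)
    moreover have "\<bar>A k j*(2*d k t*d j t)\<bar> = \<bar>A k j\<bar>*(2*(\<bar>d k t\<bar>*\<bar>d j t\<bar>))" by (simp add: abs_mult)
    ultimately show "A k j*(2*d k t*d j t) <= \<bar>A k j\<bar>*(2*D t)" by linarith
   qed
   also have "... = 2*C*D t" unfolding C_def by (simp add: sum_distrib_right[symmetric])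
   finally have "?D - 2*C*D t <= 0" by simp
   then have "exp (- (2*C)*t)*(?D - 2*C*D t) <= 0" by (intro mult_nonneg_nonpos) auto
   with 1 show "EX D<=0. (?G has_real_derivative D) (at_right t)" by blast
  qed
 qed
 moreover have "D a = 0" unfolding D_def using z by simp
 ultimately have "D b <= 0" by (simp add: mult_le_0_iff)
 moreover have "D b >= 0" by (simp add: D_def sum_nonneg)
 ultimately have "D b = 0" by simp
 then have "ALL k:{..<n}. (d k b)^2 = 0" unfolding D_def by (subst (asm) sum_nonneg_eq_0_iff) auto
 then show ?thesis by simp
qed

text \<open>Steady-state quantities are iterated products of coefficient matrices with v; knowing
  only that they are linear in v already gives their derivatives, continuity and bounds.\<close>

definition lin_fun :: "nat => ((nat => real) => real) => bool" where
 "lin_fun n \<phi> \<longleftrightarrow> (EX c. ALL v. \<phi> v = (SUM k<n. c k*v k))"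

lemma lin_fun_scale: assumes "lin_fun n \<phi>" shows "lin_fun n (%v. a*\<phi> v)"
proof -
 obtain c where "ALL v. \<phi> v = (SUM k<n. c k*v k)" using assms unfolding lin_fun_def by blast
 then show ?thesis unfolding lin_fun_def by (intro exI[of _ "%k. a*c k"]) (simp add: sum_distrib_left mult_ac)
qed

lemma lin_fun_sum: assumes "ALL i<q. lin_fun n (\<phi> i)" shows "lin_fun n (%v. SUM i<q. a i*\<phi> i v)"
proof -
 obtain c where "ALL i<q. ALL v. \<phi> i v = (SUM k<n. c i k*v k)" using assms unfolding lin_fun_def by metis
 then have "(SUM i<q. a i*\<phi> i v) = (SUM k<n. (SUM i<q. a i*c i k)*v k)" for v
  unfolding sum_distrib_right by (subst sum.swap) (simp add: sum_distrib_left mult_ac)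
 then show ?thesis unfolding lin_fun_def by (intro exI[of _ "%k. SUM i<q. a i*c i k"] allI)
qed

lemma lin_fun_diff: assumes "lin_fun n \<phi>" "lin_fun n \<theta>" shows "lin_fun n (%v. \<phi> v - \<theta> v)"
proof -
 obtain c c' where "ALL v. \<phi> v = (SUM k<n. c k*v k)" "ALL v. \<theta> v = (SUM k<n. c' k*v k)" using assms unfolding lin_fun_def by blast
 then have "\<phi> v - \<theta> v = (SUM k<n. (c k - c' k)*v k)" for v by (simp add: sum_subtractf left_diff_distrib)
 then show ?thesis unfolding lin_fun_def by (intro exI[of _ "%k. c k - c' k"]) simp
qed

lemma lin_fun_mv: assumes "lin_fun n \<phi>" shows "lin_fun n (%v. \<phi> (mv n A v))"
proof -
 obtain c where "ALL v. \<phi> v = (SUM k<n. c k*v k)" using assms unfolding lin_fun_def by blast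
 then have "\<phi> (mv n A v) = (SUM j<n. (SUM k<n. c k*A k j)*v j)" for v
  unfolding sum_distrib_right by (subst sum.swap) (simp add: mv_def sum_distrib_left mult_ac)
 then show ?thesis unfolding lin_fun_def by (intro exI[of _ "%j. SUM k<n. c k*A k j"] allI)
qed

lemma lin_fun_funpow: "lin_fun n \<phi> ==> lin_fun n (%v. \<phi> ((mv n A ^^ s) v))"
proof (induction s arbitrary: \<phi>)
 case (Suc s)
 show ?case using Suc.IH[OF lin_fun_mv[OF Suc.prems]] by simp
qed simp

lemma lin_fun_cong: assumes "lin_fun n \<phi>" "ALL k<n. u k = v k" shows "\<phi> u = \<phi> v"
 using assms unfolding lin_fun_def by (auto intro!: sum.cong)

lemma lin_fun_comb: assumes "lin_fun n \<phi>" shows "\<phi> (%k. SUM i<q. a i*u i k) = (SUM i<q. a i*\<phi> (u i))"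
proof -
 obtain c where c: "ALL v. \<phi> v = (SUM k<n. c k*v k)" using assms unfolding lin_fun_def by blast
 then show ?thesis unfolding c[rule_format] sum_distrib_left by (subst sum.swap) (simp add: mult_ac)
qed

lemma lin_fun_deriv:
 assumes "lin_fun n \<phi>" "ALL k<n. ((%t. v t k) has_real_derivative D k) (at x within S)"
 shows "((%t. \<phi> (v t)) has_real_derivative \<phi> D) (at x within S)"
proof -
 obtain c where c: "ALL v. \<phi> v = (SUM k<n. c k*v k)" using assms unfolding lin_fun_def by blast
 show ?thesis unfolding c[rule_format] by (intro DERIV_sum DERIV_cmult) (use assms(2) in simp)
qed

lemma lin_fun_continuous:
 assumes "lin_fun n \<phi>" "ALL k<n. continuous_on S (%t. v t k)"
 shows "continuous_on S (%t. \<phi> (v t))"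
proof -
 obtain c where c: "ALL v. \<phi> v = (SUM k<n. c k*v k)" using assms unfolding lin_fun_def by blast
 show ?thesis unfolding c[rule_format] using assms(2) by (intro continuous_intros) simp
qed

lemma lin_fun_bound:
 assumes "lin_fun n \<phi>"
 shows "EX B>=0. ALL v (C :: real). (ALL k<n. \<bar>v k\<bar> <= C) --> \<bar>\<phi> v\<bar> <= B*C"
proof -
 obtain c where c: "ALL v. \<phi> v = (SUM k<n. c k*v k)" using assms unfolding lin_fun_def by blast
 show ?thesis
 proof (rule exI[of _ "SUM k<n. \<bar>c k\<bar>"], intro conjI allI impI)
  fix v :: "nat => real" and C assume v: "ALL k<n. \<bar>v k\<bar> <= C"
  show "\<bar>\<phi> v\<bar> <= (SUM k<n. \<bar>c k\<bar>)*C" unfolding c[rule_format] by (rule abs_sum_mult_le[OF v])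
 qed (simp add: sum_nonneg)
qed

context regulation
begin

lemma delta_nonzero: "ctrl_delta d 0 ~= 0"
proof
 assume z: "ctrl_delta d 0 = 0"
 have "(SUM j<r. complex_of_real (ctrl_delta d j)*0 ^ j) = (0::complex)"
  by (rule sum.neutral) (use z in \<open>auto simp: power_0_left\<close>)
 then have "(0::complex) ^ r = - (SUM j<r. complex_of_real (ctrl_delta d j)*0 ^ j)" using r1 by (simp add: power_0_left)
 from stable_poly_root[OF del_stable this] show False by simp
qed

lemma lamM_bar_pos: assumes "0 < h" shows "0 < lamM_bar p d W K h"
proof -
 have "(bo h (r - 1))^2 <= (SUM s<r. (bo h s)^2)"
  by (rule member_le_sum[of "r - 1" "{..<r}" "%s. (bo h s)^2"]) (use r1 in auto)
 moreover have "0 < (bo h (r - 1))^2" using delta_nonzero assms by (simp add: bo_def)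
 ultimately show ?thesis using Bo_norm_le[of h] lamM_bar_ge[of h K] by linarith
qed

end

section \<open>Steady state and error dynamics\<close>

lemma bil_deriv:
 assumes sym: "ALL i<n. ALL j<n. p i j = p j i"
  and d: "ALL k<n. ((%t. x t k) has_real_derivative D k) (at t within S)"
 shows "((%t. bil n p (x t) (x t)) has_real_derivative 2*bil n p (x t) D) (at t within S)"
proof -
 have "((%t. bil n p (x t) (x t)) has_real_derivative (SUM i<n. SUM j<n. p i j*(D i*x t j + D j*x t i))) (at t within S)"
  unfolding bil_def mult.assoc by (intro DERIV_sum DERIV_cmult DERIV_mult) (use d in auto)
 moreover have "(SUM i<n. SUM j<n. p i j*(D i*x t j + D j*x t i)) = bil n p D (x t) + bil n p (x t) D"
  unfolding bil_def sum.distrib[symmetric] by (intro sum.cong refl) (simp add: algebra_simps)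
 ultimately show ?thesis using bil_sym[OF sym, of D "x t"] by simp
qed

lemma funpow_mv_entries:
 assumes A: "A : carrier_mat n n" and i: "i < n"
 shows "(mv n (entries A) ^^ s) v i = (SUM j<n. (A ^\<^sub>m s) $$ (i, j)*v j)"
 using i
proof (induction s arbitrary: i)
 case 0
 have "(SUM j<n. (A ^\<^sub>m 0) $$ (i, j)*v j) = (SUM j<n. if j = i then v j else 0)"
  by (rule sum.cong[OF refl]) (use A 0 in auto)
 then show ?case using 0 by simp
next
 case (Suc s)
 have c: "A ^\<^sub>m s : carrier_mat n n" by (rule pow_carrier_mat[OF A])
 have "(mv n (entries A) ^^ Suc s) v i = (SUM k<n. A $$ (i, k)*(SUM j<n. (A ^\<^sub>m s) $$ (k, j)*v j))"
  by (simp add: mv_def[of n "entries A" "(mv n (entries A) ^^ s) v"] entries_def Suc.IH)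
 also have "... = (SUM j<n. (SUM k<n. A $$ (i, k)*(A ^\<^sub>m s) $$ (k, j))*v j)"
  unfolding sum_distrib_left sum_distrib_right by (subst sum.swap) (simp add: mult_ac)
 also have "... = (SUM j<n. (A ^\<^sub>m Suc s) $$ (i, j)*v j)"
  by (rule sum.cong[OF refl]) (simp only: lessThan_iff pow_mat_Suc_left[OF A] index_mult_mat_sum[OF A c Suc.prems])
 finally show ?case .
qed

context regulation
begin

definition Sop :: "(nat => real) => nat => real" where "Sop = mv nv (entries (exo_S p))"

definition fl :: "real Matrix.vec => (nat => real) => real" where
 "fl w v = (SUM k<nv. Fw p w $$ (0, k)*v k)"

text \<open>The s-th derivative of y_0 along the exosystem, which is the steady state of \<xi> at
  index s.\<close>

definition sx :: "real Matrix.vec => nat => (nat => real) => real" where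
 "sx w s v = fl w ((Sop ^^ s) v)"

text \<open>A solution of the regulator equation X S = A1 X + A2 F + E0. For w in W one exists
  because the spectra of A1 and S are disjoint.\<close>

definition Xs :: "real Matrix.vec => nat => nat => nat => real" where
 "Xs w i = (SOME X. ALL j<m. ALL k<nv. (SUM q<m. A1 p w (Suc i) $$ (j, q)*X q k) - (SUM q<nv. X j q*exo_S p $$ (q, k))
  = - (A2 p w (Suc i) $$ (j, 0)*Fw p w $$ (0, k) + E0 p w (Suc i) $$ (j, k)))"

definition sz :: "real Matrix.vec => nat => nat => (nat => real) => real" where
 "sz w i j v = (SUM k<nv. Xs w i j k*v k)"

text \<open>The feedforward input that keeps the regulated error at zero.\<close>
definition ff :: "real Matrix.vec => nat => (nat => real) => real" where
 "ff w i v = (1 / bb p w (Suc i))*(sx w r v - (SUM k<m. A3 p w (Suc i) $$ (0, k)*sz w i k v)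
  - (SUM q<r. cc p w (q + 1) (Suc i)*sx w q v) - (SUM k<nv. Er p w (Suc i) $$ (0, k)*v k))"

definition se :: "real Matrix.vec => nat => nat => (nat => real) => real" where
 "se w i j v = (SUM k<l. T j k*ff w i ((Sop ^^ k) v))"

lemma lin_sum_coord: "lin_fun n (%v. SUM k<n. c k*v k)"
 unfolding lin_fun_def by blast

lemma lin_fl: "lin_fun nv (fl w)"
 unfolding fl_def[abs_def] by (rule lin_sum_coord)

lemma lin_sx: "lin_fun nv (sx w s)"
 unfolding sx_def[abs_def] Sop_def by (rule lin_fun_funpow[OF lin_fl])

lemma lin_sz: "lin_fun nv (sz w i j)"
 unfolding sz_def[abs_def] by (rule lin_sum_coord)

lemma lin_ff: "lin_fun nv (ff w i)"
 unfolding ff_def[abs_def]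
 by (intro lin_fun_scale lin_fun_diff lin_fun_sum lin_sum_coord allI impI lin_sx lin_sz)

lemma lin_se: "lin_fun nv (se w i j)"
 unfolding se_def[abs_def] Sop_def by (intro lin_fun_sum allI impI lin_fun_funpow lin_ff)

lemma sx_Sop: "sx w s (Sop v) = sx w (Suc s) v"
 by (simp add: sx_def funpow_swap1)

lemma sx_0: "sx w 0 v = fl w v"
 by (simp add: sx_def)

lemma sz_Sop:
 assumes w: "w : W" and i: "i < N" and j: "j < m"
 shows "sz w i j (Sop v) = (SUM k<m. A1 p w (Suc i) $$ (j, k)*sz w i k v) + A2 p w (Suc i) $$ (j, 0)*fl w v
  + (SUM k<nv. E0 p w (Suc i) $$ (j, k)*v k)"
proof -
 have i': "Suc i : {1..N}" using i by simp
 have disj: "ALL \<mu>. eigenvalue (cmat (A1 p w (Suc i))) \<mu> --> ~ eigenvalue (cmat (exo_S p)) \<mu>"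
 proof (intro allI impI notI)
  fix \<mu> assume "eigenvalue (cmat (A1 p w (Suc i))) \<mu>" and "eigenvalue (cmat (exo_S p)) \<mu>"
  then have "Re \<mu> < 0" "Re \<mu> = 0" using A1_hurwitz w i' S_imag unfolding hurwitz_def by blast+
  then show False by simp
 qed
 have X: "ALL j<m. ALL k<nv. (SUM q<m. A1 p w (Suc i) $$ (j, q)*Xs w i q k) - (SUM q<nv. Xs w i j q*exo_S p $$ (q, k))
  = - (A2 p w (Suc i) $$ (j, 0)*Fw p w $$ (0, k) + E0 p w (Suc i) $$ (j, k))"
  unfolding Xs_def by (rule someI_ex[OF sylvester_real_exists[OF A1_carrier[OF i'] S_carrier disj]])
 have "sz w i j (Sop v) = (SUM k<nv. (SUM q<nv. Xs w i j q*exo_S p $$ (q, k))*v k)"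
  unfolding sz_def Sop_def mv_def entries_def sum_distrib_left sum_distrib_right by (subst sum.swap) (simp add: mult_ac)
 also have "... = (SUM k<nv. ((SUM q<m. A1 p w (Suc i) $$ (j, q)*Xs w i q k)
   + (A2 p w (Suc i) $$ (j, 0)*Fw p w $$ (0, k) + E0 p w (Suc i) $$ (j, k)))*v k)"
 proof (rule sum.cong[OF refl])
  fix k assume "k : {..<nv}"
  with X j have "(SUM q<nv. Xs w i j q*exo_S p $$ (q, k)) = (SUM q<m. A1 p w (Suc i) $$ (j, q)*Xs w i q k)
   + (A2 p w (Suc i) $$ (j, 0)*Fw p w $$ (0, k) + E0 p w (Suc i) $$ (j, k))" by (simp add: algebra_simps)
  then show "(SUM q<nv. Xs w i j q*exo_S p $$ (q, k))*v k = ((SUM q<m. A1 p w (Suc i) $$ (j, q)*Xs w i q k)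
   + (A2 p w (Suc i) $$ (j, 0)*Fw p w $$ (0, k) + E0 p w (Suc i) $$ (j, k)))*v k" by simp
 qed
 also have "... = (SUM k<nv. (SUM q<m. A1 p w (Suc i) $$ (j, q)*Xs w i q k)*v k) + A2 p w (Suc i) $$ (j, 0)*fl w v
  + (SUM k<nv. E0 p w (Suc i) $$ (j, k)*v k)"
  by (simp add: distrib_right sum.distrib fl_def sum_distrib_left mult.assoc)
 also have "(SUM k<nv. (SUM q<m. A1 p w (Suc i) $$ (j, q)*Xs w i q k)*v k) = (SUM k<m. A1 p w (Suc i) $$ (j, k)*sz w i k v)"
  unfolding sz_def sum_distrib_left sum_distrib_right by (subst sum.swap) (simp add: mult_ac)
 finally show ?thesis .
qed

lemma sx_top:
 assumes w: "w : W" and i: "i < N"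
 shows "sx w r v = (SUM k<m. A3 p w (Suc i) $$ (0, k)*sz w i k v) + (SUM q<r. cc p w (q + 1) (Suc i)*sx w q v)
  + (SUM k<nv. Er p w (Suc i) $$ (0, k)*v k) + bb p w (Suc i)*ff w i v"
proof -
 have "bb p w (Suc i) > 0" using b_pos w i by simp
 then show ?thesis by (simp add: ff_def field_simps)
qed

text \<open>The minimal polynomial annihilates S, so the successive derivatives of the feedforward
  input satisfy the recurrence of the companion matrix \<Phi>.\<close>

lemma ff_annihilated: "ff w i ((Sop ^^ l) v) = (SUM j<l. - coeff (min_poly (exo_S p)) j*ff w i ((Sop ^^ j) v))"
proof -
 let ?q = "min_poly (exo_S p)"
 have "(Sop ^^ l) v k = (SUM j<l. - coeff ?q j*(Sop ^^ j) v k)" if k: "k < nv" for k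
 proof -
  have "(SUM j<=l. coeff ?q j*(Sop ^^ j) v k) = (SUM q<nv. (SUM j<=l. coeff ?q j*(exo_S p ^\<^sub>m j) $$ (k, q))*v q)"
   unfolding Sop_def funpow_mv_entries[OF S_carrier k] sum_distrib_left sum_distrib_right by (subst sum.swap) (simp add: mult_ac)
  also have "... = 0"
   using min_poly_annihilates[OF S_carrier] k S_carrier unfolding annihilates_def ldim_def by (intro sum.neutral) simp
  finally have "(SUM j<l. coeff ?q j*(Sop ^^ j) v k) + coeff ?q l*(Sop ^^ l) v k = 0"
   by (simp add: lessThan_Suc_atMost[symmetric])
  moreover have "coeff ?q l = 1" using min_poly_monic[OF S_carrier] by (simp add: ldim_def)
  ultimately show ?thesis by (simp add: sum_negf)
 qed
 then have "ff w i ((Sop ^^ l) v) = ff w i (%k. SUM j<l. - coeff ?q j*(Sop ^^ j) v k)"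
  by (intro lin_fun_cong[OF lin_ff]) simp
 also have "... = (SUM j<l. - coeff ?q j*ff w i ((Sop ^^ j) v))" by (rule lin_fun_comb[OF lin_ff])
 finally show ?thesis .
qed

text \<open>The vector of input derivatives evolves by \<Phi>, and T \<Phi> = M T + Q \<Gamma>
  carries this over to the dynamics of \<eta> driven by the feedforward input.\<close>

lemma se_Sop:
 assumes j: "j < l"
 shows "se w i j (Sop v) = (SUM k<l. Mc j k*se w i k v) + Qc j*ff w i v"
proof -
 define th where "th k = ff w i ((Sop ^^ k) v)" for k
 have shift: "th (Suc k) = (SUM q<l. Phi p $$ (k, q)*th q)" if k: "k < l" for k
 proof (cases "k = l - 1")
  case True
  then have "Suc k = l" using k by simp
  then have "th (Suc k) = (SUM j<l. - coeff (min_poly (exo_S p)) j*th j)" unfolding th_def by (simp only: ff_annihilated)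
  also have "... = (SUM q<l. Phi p $$ (k, q)*th q)"
   by (rule sum.cong[OF refl]) (use k True in \<open>simp add: Phi_def companion_def\<close>)
  finally show ?thesis .
 next
  case False
  have "(SUM q<l. Phi p $$ (k, q)*th q) = (SUM q<l. if q = Suc k then th q else 0)"
   by (rule sum.cong[OF refl]) (use k False in \<open>auto simp: Phi_def companion_def\<close>)
  then show ?thesis using k False by simp
 qed
 have "se w i j (Sop v) = (SUM k<l. T j k*th (Suc k))" by (simp add: se_def th_def funpow_swap1)
 also have "... = (SUM q<l. (SUM k<l. T j k*Phi p $$ (k, q))*th q)"
  unfolding sum_distrib_right by (subst sum.swap) (simp add: shift sum_distrib_left mult_ac)
 also have "... = (SUM q<l. (SUM k<l. Mc j k*T k q)*th q + (if q = 0 then Qc j*th q else 0))"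
  by (rule sum.cong[OF refl]) (simp add: T_sylvester[OF j] distrib_right)
 also have "... = (SUM q<l. (SUM k<l. Mc j k*T k q)*th q) + Qc j*th 0"
  using l_pos by (simp add: sum.distrib)
 also have "(SUM q<l. (SUM k<l. Mc j k*T k q)*th q) = (SUM k<l. Mc j k*se w i k v)"
  unfolding se_def th_def[symmetric] sum_distrib_left sum_distrib_right by (subst sum.swap) (simp add: mult_ac)
 finally show ?thesis by (simp add: th_def)
qed

lemma \<psi>_se: "(SUM j<l. \<psi> j*se w i j v) = ff w i v"
proof -
 have "(SUM j<l. \<psi> j*se w i j v) = (SUM k<l. (SUM j<l. \<psi> j*T j k)*ff w i ((Sop ^^ k) v))"
  unfolding se_def sum_distrib_left sum_distrib_right by (subst sum.swap) (simp add: mult_ac)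
 also have "... = (SUM k<l. if k = 0 then ff w i ((Sop ^^ k) v) else 0)"
  by (rule sum.cong[OF refl]) (simp add: \<psi>_T)
 finally show ?thesis using l_pos by simp
qed

end

text \<open>One closed loop with fixed parameters and one bounded exosystem solution. The size of
  the gains enters through its two consequences \<open>hw\<close> and \<open>gn\<close>.\<close>

locale sampled = regulation +
 fixes K h \<epsilon> \<sigma> \<beta> \<alpha> lam sigma_bar \<delta> Cv :: real and w :: "real Matrix.vec" and v :: "real => real Matrix.vec"
 assumes hw: "ALL w:W. hurwitz (Ac p d E K h w)" and gn: "ALL w:W. ALL i<N. gain w K i <= lam3 p d h"
  and h0: "0 < h" and w: "w : W" and \<sigma>0: "0 < \<sigma>" and \<sigma>1: "\<sigma> < 1" and \<beta>0: "0 < \<beta>"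
  and lam: "lam = (1 - \<sigma>) / lam_M p d E W K h" and \<alpha>0: "0 < \<alpha>" and \<alpha>lam: "\<alpha> < lam"
  and sb: "sigma_bar = \<sigma> / (lam1 p d E W K h*lamM_bar p d W K h*lam2_bar N)"
  and \<epsilon>0: "0 < \<epsilon>" and \<delta>: "\<delta> = lam*lam_m p d E W K h / lam0 p d E W K h*\<epsilon>^2"
  and exo: "exo_solution p v" and v_bd: "ALL t>=0. ALL k<nv. \<bar>v t $ k\<bar> <= Cv"
begin

abbreviation "vv t \<equiv> %k. v t $ k"

lemma lam_pos: "0 < lam" using \<alpha>0 \<alpha>lam by linarith

lemma lam0_pos: "0 < lam0 p d E W K h"
 unfolding lam0_def using lam1_pos[OF hw] lamM_bar_pos[OF h0] N1 by simp

lemma \<delta>_pos: "0 < \<delta>"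
 unfolding \<delta> using lam_pos lam0_pos lam_m_pos[OF hw] \<epsilon>0 by simp

lemma sigma_bar_pos: "0 < sigma_bar"
 unfolding sb using \<sigma>0 lam1_pos[OF hw] lamM_bar_pos[OF h0] lam2_bar_ge(1) by simp

lemma v_carrier: "0 <= t ==> v t : carrier_vec nv"
 using exo by (simp add: exo_solution_def)

lemma v_deriv: assumes t: "0 <= t" and k: "k < nv"
 shows "((%t. v t $ k) has_real_derivative Sop (vv t) k) (at t within {0..})"
proof -
 have "((%t. v t $ k) has_real_derivative (exo_S p *\<^sub>v v t) $ k) (at t within {0..})"
  using exo t k unfolding exo_solution_def has_vec_deriv_def by blast
 then show ?thesis
  using index_mult_mat_vec_sum[OF S_carrier v_carrier[OF t] k] by (simp only: Sop_def mv_def entries_def)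
qed

lemma v_right_deriv: assumes t: "0 <= t" and k: "k < nv"
 shows "((%t. v t $ k) has_real_derivative Sop (vv t) k) (at_right t)"
 by (rule DERIV_subset[OF v_deriv[OF t k]]) (use t in auto)

lemma v_continuous: "k < nv ==> continuous_on {0..} (%t. v t $ k)"
 unfolding continuous_on_eq_continuous_within using v_deriv DERIV_continuous by blast

text \<open>A trajectory is a family \<open>f q i j\<close>: the blocks \<open>q = 0, 1, 2, 3\<close> are \<open>z, \<xi>, \<eta>, \<zeta>\<close>, and \<open>i < N\<close> stands for
 agent \<open>i + 1\<close>. Time \<open>\<tau>\<close> is the last event of the agent, and \<open>gg f i \<tau> t \<ge> 0\<close> is the triggering condition.\<close>
definition dm :: "nat => nat" where
 "dm q = (if q = 0 then m else if q = 2 then l else if q = 4 then nv else if q = 5 then 2 else r)"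

text \<open>Right-hand side of component j in block q of one agent, given its state
  \<open>a\<close>, the exosystem state \<open>vt\<close>, the held input \<open>u\<close> and the
  held value \<open>g\<close> of e_v.\<close>

definition rh :: "nat => (nat => nat => real) => (nat => real) => real => real => nat => nat => real" where
 "rh i a vt u g q j =
  (if q = 0 then (SUM k<m. A1 p w (Suc i) $$ (j, k)*a 0 k) + A2 p w (Suc i) $$ (j, 0)*a 1 0 + (SUM k<nv. E0 p w (Suc i) $$ (j, k)*vt k)
  else if q = 1 then (if j + 1 < r then a 1 (j + 1) else
   (SUM k<m. A3 p w (Suc i) $$ (0, k)*a 0 k) + (SUM s<r. cc p w (s + 1) (Suc i)*a 1 s)
    + (SUM k<nv. Er p w (Suc i) $$ (0, k)*vt k) + bb p w (Suc i)*u)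
  else if q = 2 then (SUM k<l. Mc j k*a 2 k) + Qc j*u
  else bo h j*g - bo h j*a 3 0 + (if j + 1 < r then a 3 (j + 1) else 0))"

definition uh :: "(nat => nat => nat => real => real) => nat => real => real" where
 "uh f i \<tau> = uu K (%i k. f 2 i k \<tau>) (%i s. f 3 i s \<tau>) i"

definition evf :: "(nat => nat => nat => real => real) => nat => real => real" where
 "evf f i t = (SUM j<N. Hmat N E $$ (i, j)*(f 1 j 0 t - fl w (vv t)))"

definition gg :: "(nat => nat => nat => real => real) => nat => real => real => real" where
 "gg f i \<tau> t = ((SUM k<l. (f 2 i k \<tau> - f 2 i k t)^2) + (SUM s<r. (f 3 i s \<tau> - f 3 i s t)^2) + (evf f i \<tau> - evf f i t)^2)
  - (sigma_bar*((SUM s<r. (f 3 i s t)^2) + (evf f i t)^2) + (\<beta>*exp (- \<alpha>*t) + \<delta>))"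

definition flow :: "(nat => nat => nat => real => real) => nat => real => real => real set => bool" where
 "flow f i \<tau> t S \<longleftrightarrow> (ALL q<4. ALL j<dm q. (f q i j has_real_derivative
  rh i (%q j. f q i j t) (vv t) (uh f i \<tau>) (evf f i \<tau>) q j) (at t within S))"

text \<open>Deviation from the steady state. That of \<zeta> is 0 because e_v vanishes
  there.\<close>

definition es :: "(nat => nat => nat => real => real) => real => real Matrix.vec" where
 "es f t = st N m r l (%i j. f 0 i j t - sz w i j (vv t)) (%i s. f 1 i s t - sx w s (vv t))
  (%i k. f 2 i k t - se w i k (vv t)) (%i s. f 3 i s t)"

text \<open>The closed-loop field plus sampling terms, in the shape expected by
  \<open>dissipation\<close>; every agent has its own last event \<open>\<tau> i\<close>.\<close>

definition es' :: "(nat => nat => nat => real => real) => (nat => real) => real => real Matrix.vec" where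
 "es' f \<tau> t = (let z = %i j. f 0 i j t - sz w i j (vv t); x = %i s. f 1 i s t - sx w s (vv t);
   e = %i k. f 2 i k t - se w i k (vv t); y = %i s. f 3 i s t;
   et = %i k. f 2 i k (\<tau> i) - f 2 i k t; yt = %i s. f 3 i s (\<tau> i) - f 3 i s t; vt = %i. evf f i (\<tau> i) - evf f i t in
  st N m r l (dz w z x) (%i s. dx w K z x e y i s + gz w K et yt i s)
   (%i k. de K e y i k + Qc k*uu K et yt i) (%i s. dy h x y i s + bo h s*vt i))"

text \<open>The held input is sampling error plus feedback of the deviation plus feedforward; the
  regulator equations absorb the last part.\<close>

lemma uh_split: "uh f i \<tau> = uu K (%i k. f 2 i k \<tau> - f 2 i k t) (%i s. f 3 i s \<tau> - f 3 i s t) i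
 + uu K (%i k. f 2 i k t - se w i k (vv t)) (%i s. f 3 i s t) i + ff w i (vv t)"
 unfolding uh_def uu_def \<psi>_se[of w i, symmetric] by (simp add: algebra_simps sum_subtractf)

lemma es_deriv:
 assumes t: "0 <= t" and fl: "ALL i<N. flow f i (\<tau> i) t {t<..}" and k: "k < nst"
 shows "((%t. es f t $ k) has_real_derivative es' f \<tau> t $ k) (at_right t)"
 using st_cases[OF k, where 'a = real]
proof (elim disjE exE conjE)
 have vd: "ALL k<nv. ((%t. v t $ k) has_real_derivative Sop (vv t) k) (at_right t)" using v_right_deriv[OF t] by blast
 have f: "(f q i j has_real_derivative rh i (%q j. f q i j t) (vv t) (uh f i (\<tau> i)) (evf f i (\<tau> i)) q j) (at_right t)"
  if "i < N" "q < 4" "j < dm q" for i q j using fl that unfolding flow_def by blast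
 {
  fix i j assume i: "i < N" and j: "j < m" and s: "ALL z x e y. st N m r l z x e y $ k = (z i j :: real)"
  have "((%t. f 0 i j t - sz w i j (vv t)) has_real_derivative
    rh i (%q j. f q i j t) (vv t) (uh f i (\<tau> i)) (evf f i (\<tau> i)) 0 j - sz w i j (Sop (vv t))) (at_right t)"
   by (intro DERIV_diff f[OF i] lin_fun_deriv[OF lin_sz vd]) (use j in \<open>auto simp: dm_def\<close>)
  moreover have "rh i (%q j. f q i j t) (vv t) (uh f i (\<tau> i)) (evf f i (\<tau> i)) 0 j - sz w i j (Sop (vv t))
   = dz w (%i j. f 0 i j t - sz w i j (vv t)) (%i s. f 1 i s t - sx w s (vv t)) i j"
   unfolding sz_Sop[OF w i j] by (simp add: rh_def dz_def sx_0 right_diff_distrib sum_subtractf)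
  ultimately show ?thesis unfolding es_def es'_def Let_def s[rule_format] by simp
 next
  fix i j assume i: "i < N" and j: "j < r" and s: "ALL z x e y. st N m r l z x e y $ k = (x i j :: real)"
  let ?et = "%i k. f 2 i k (\<tau> i) - f 2 i k t" and ?yt = "%i s. f 3 i s (\<tau> i) - f 3 i s t"
  have "((%t. f 1 i j t - sx w j (vv t)) has_real_derivative
    rh i (%q j. f q i j t) (vv t) (uh f i (\<tau> i)) (evf f i (\<tau> i)) 1 j - sx w j (Sop (vv t))) (at_right t)"
   by (intro DERIV_diff f[OF i] lin_fun_deriv[OF lin_sx vd]) (use j in \<open>auto simp: dm_def\<close>)
  moreover have "rh i (%q j. f q i j t) (vv t) (uh f i (\<tau> i)) (evf f i (\<tau> i)) 1 j - sx w j (Sop (vv t))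
   = dx w K (%i j. f 0 i j t - sz w i j (vv t)) (%i s. f 1 i s t - sx w s (vv t))
     (%i k. f 2 i k t - se w i k (vv t)) (%i s. f 3 i s t) i j + gz w K ?et ?yt i j"
  proof (cases "j + 1 < r")
   case True then show ?thesis by (simp add: rh_def dx_def gz_def sx_Sop)
  next
   case False
   then have "Suc j = r" using j by simp
   then have e: "sx w j (Sop (vv t)) = sx w r (vv t)" by (simp add: sx_Sop)
   have u: "uu K ?et ?yt i = uu K (%i' k. f 2 i' k (\<tau> i) - f 2 i' k t) (%i' s. f 3 i' s (\<tau> i) - f 3 i' s t) i" by (simp add: uu_def)
   show ?thesis using False unfolding e sx_top[OF w i] rh_def dx_def gz_def u uh_split[of f i "\<tau> i" t]
    by (simp add: right_diff_distrib sum_subtractf distrib_left)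
  qed
  ultimately show ?thesis unfolding es_def es'_def Let_def s[rule_format] by simp
 next
  fix i j assume i: "i < N" and j: "j < l" and s: "ALL z x e y. st N m r l z x e y $ k = (e i j :: real)"
  let ?et = "%i k. f 2 i k (\<tau> i) - f 2 i k t" and ?yt = "%i s. f 3 i s (\<tau> i) - f 3 i s t"
  have "((%t. f 2 i j t - se w i j (vv t)) has_real_derivative
    rh i (%q j. f q i j t) (vv t) (uh f i (\<tau> i)) (evf f i (\<tau> i)) 2 j - se w i j (Sop (vv t))) (at_right t)"
   by (intro DERIV_diff f[OF i] lin_fun_deriv[OF lin_se vd]) (use j in \<open>auto simp: dm_def\<close>)
  moreover have "rh i (%q j. f q i j t) (vv t) (uh f i (\<tau> i)) (evf f i (\<tau> i)) 2 j - se w i j (Sop (vv t))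
   = de K (%i k. f 2 i k t - se w i k (vv t)) (%i s. f 3 i s t) i j + Qc j*uu K ?et ?yt i"
  proof -
   have u: "uu K ?et ?yt i = uu K (%i' k. f 2 i' k (\<tau> i) - f 2 i' k t) (%i' s. f 3 i' s (\<tau> i) - f 3 i' s t) i" by (simp add: uu_def)
   show ?thesis unfolding se_Sop[OF j] rh_def de_def u uh_split[of f i "\<tau> i" t]
    by (simp add: right_diff_distrib sum_subtractf distrib_left)
  qed
  ultimately show ?thesis unfolding es_def es'_def Let_def s[rule_format] by simp
 next
  fix i j assume i: "i < N" and j: "j < r" and s: "ALL z x e y. st N m r l z x e y $ k = (y i j :: real)"
  have "(f 3 i j has_real_derivative rh i (%q j. f q i j t) (vv t) (uh f i (\<tau> i)) (evf f i (\<tau> i)) 3 j) (at_right t)"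
   by (rule f[OF i]) (use j in \<open>auto simp: dm_def\<close>)
  moreover have "rh i (%q j. f q i j t) (vv t) (uh f i (\<tau> i)) (evf f i (\<tau> i)) 3 j
   = dy h (%i s. f 1 i s t - sx w s (vv t)) (%i s. f 3 i s t) i j + bo h j*(evf f i (\<tau> i) - evf f i t)"
   by (simp add: rh_def dy_def bo_def evf_def[of f i t] sx_0 algebra_simps)
  ultimately show ?thesis unfolding es_def es'_def Let_def s[rule_format] by simp
 }
qed

text \<open>All that the Lyapunov estimate uses: continuity, right derivatives, and for each agent
  at each time some past sampling instant whose threshold is not exceeded. No event sequence is
  mentioned, so partial constructions qualify.\<close>

definition adm :: "(nat => nat => nat => real => real) => real => bool" where
 "adm f b \<longleftrightarrow> (ALL q<4. ALL i<N. ALL j<dm q. continuous_on {0..b} (f q i j)) &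
  (ALL t:{0..<b}. ALL i<N. EX \<tau>. \<tau> : {0..t} & flow f i \<tau> t {t<..} & gg f i \<tau> t <= 0)"

text \<open>Combines \<open>dissipation\<close> with \<open>exponential_comparison\<close>; \<delta>
  is scaled so that its stationary contribution \<lambda>_0 \<delta> / lam is exactly \<lambda>_m
  \<epsilon>^2.\<close>

lemma lyapunov_bound:
 assumes b: "0 <= b" and adm: "adm f b"
 shows "V K h w (es f b) <= exp (- lam*b)*V K h w (es f 0) + lam0 p d E W K h*\<beta> / (lam - \<alpha>)*exp (- \<alpha>*b) + lam_m p d E W K h*\<epsilon>^2"
proof -
 let ?P = "entries (PP p d E K h w)"
 have sym: "ALL i<nst. ALL j<nst. ?P i j = ?P j i" unfolding PP_def by (rule lyap_symmetric[OF Ac_carrier bspec[OF hw w]])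
 have cf: "ALL k<nv. continuous_on {0..b} (%t. v t $ k)"
  using continuous_on_subset[OF v_continuous] by auto
 have ce: "continuous_on {0..b} (%t. es f t $ k)" if k: "k < nst" for k
  using st_cases[OF k, where 'a = real]
 proof (elim disjE exE conjE)
  fix i j assume i: "i < N" and j: "j < m" and s: "ALL z x e y. st N m r l z x e y $ k = (z i j :: real)"
  show ?thesis unfolding es_def s[rule_format] using adm i j unfolding adm_def
   by (intro continuous_intros lin_fun_continuous[OF lin_sz cf]) (simp add: dm_def)
 next
  fix i j assume i: "i < N" and j: "j < r" and s: "ALL z x e y. st N m r l z x e y $ k = (x i j :: real)"
  show ?thesis unfolding es_def s[rule_format] using adm i j unfolding adm_def
   by (intro continuous_intros lin_fun_continuous[OF lin_sx cf]) (simp add: dm_def)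
 next
  fix i j assume i: "i < N" and j: "j < l" and s: "ALL z x e y. st N m r l z x e y $ k = (e i j :: real)"
  show ?thesis unfolding es_def s[rule_format] using adm i j unfolding adm_def
   by (intro continuous_intros lin_fun_continuous[OF lin_se cf]) (simp add: dm_def)
 next
  fix i j assume i: "i < N" and j: "j < r" and s: "ALL z x e y. st N m r l z x e y $ k = (y i j :: real)"
  show ?thesis unfolding es_def s[rule_format] using adm i j unfolding adm_def by (simp add: dm_def)
 qed
 have "V K h w (es f b) <= exp (- lam*b)*V K h w (es f 0) + lam0 p d E W K h*\<beta> / (lam - \<alpha>)*exp (- \<alpha>*b)
  + lam0 p d E W K h*\<delta> / lam"
 proof (rule exponential_comparison[OF b _ _ \<alpha>0 \<alpha>lam])
  show "continuous_on {0..b} (%t. V K h w (es f t))" unfolding V_def bil_def by (intro continuous_intros ce) auto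
  show "ALL t:{0..<b}. EX D. ((%t. V K h w (es f t)) has_real_derivative D) (at_right t) &
   D <= - lam*V K h w (es f t) + lam0 p d E W K h*(\<beta>*exp (- \<alpha>*t) + \<delta>)"
  proof
   fix t assume t: "t : {0..<b}"
   then have t0: "0 <= t" by simp
   have "ALL i. EX \<tau>. i < N --> flow f i \<tau> t {t<..} & gg f i \<tau> t <= 0" using adm t unfolding adm_def by blast
   from choice[OF this] obtain \<tau> where \<tau>: "ALL i. i < N --> flow f i (\<tau> i) t {t<..} & gg f i (\<tau> i) t <= 0" by (elim exE)
   have fl: "ALL i<N. flow f i (\<tau> i) t {t<..}" using \<tau> by simp
   let ?b = "\<beta>*exp (- \<alpha>*t) + \<delta>"
   have b0: "0 <= ?b" using \<beta>0 \<delta>_pos by simp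
   have tr: "ALL i<N. (SUM k<l. (f 2 i k (\<tau> i) - f 2 i k t)^2) + (SUM s<r. (f 3 i s (\<tau> i) - f 3 i s t)^2) + (evf f i (\<tau> i) - evf f i t)^2
    <= sigma_bar*((SUM s<r. (f 3 i s t)^2) + (SUM j<N. Hmat N E $$ (i, j)*(f 1 j 0 t - sx w 0 (vv t)))^2) + ?b"
    using \<tau> unfolding gg_def sx_0 evf_def[of f _ t, symmetric] by simp
   have "2*bil nst ?P (%k. es f t $ k) (%k. es' f \<tau> t $ k) <= - lam*V K h w (es f t) + lam0 p d E W K h * ?b"
    by (rule dissipation[where b = ?b and K = K and h = h and w = w and lam = lam and sigma_bar = sigma_bar and \<sigma> = \<sigma> and v = "es f t" and v' = "es' f \<tau> t" and z = "%i j. f 0 i j t - sz w i j (vv t)" and x = "%i s. f 1 i s t - sx w s (vv t)"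
      and e = "%i k. f 2 i k t - se w i k (vv t)" and y = "%i s. f 3 i s t" and et = "%i k. f 2 i k (\<tau> i) - f 2 i k t"
      and yt = "%i s. f 3 i s (\<tau> i) - f 3 i s t" and vt = "%i. evf f i (\<tau> i) - evf f i t", OF hw gn w \<sigma>0 \<sigma>1 lam sb tr es_def es'_def[unfolded Let_def] lamM_bar_pos[OF h0] b0])
   moreover have "((%t. V K h w (es f t)) has_real_derivative 2*bil nst ?P (%k. es f t $ k) (%k. es' f \<tau> t $ k)) (at_right t)"
    unfolding V_def by (rule bil_deriv[OF sym]) (use es_deriv[OF t0 fl] in blast)
   ultimately show "EX D. ((%t. V K h w (es f t)) has_real_derivative D) (at_right t) &
    D <= - lam*V K h w (es f t) + lam0 p d E W K h * ?b" by blast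
  qed
 qed (use lam0_pos \<beta>0 \<delta>_pos in auto)
 moreover have "lam0 p d E W K h*\<delta> / lam = lam_m p d E W K h*\<epsilon>^2"
  unfolding \<delta> using lam0_pos lam_pos by simp
 ultimately show ?thesis by simp
qed

end

section \<open>A priori bounds and minimal waiting time\<close>

lemma lin_fun_bound_uniform:
 fixes a b :: nat
 assumes "ALL i<a. ALL j<b. lin_fun n (\<phi> i j)"
 shows "EX B>=0. ALL i<a. ALL j<b. ALL v C. 0 <= C --> (ALL k<n. \<bar>v k\<bar> <= C) --> \<bar>\<phi> i j v\<bar> <= B*(C :: real)"
proof -
 define P where "P i j B \<longleftrightarrow> B >= 0 & (ALL v C. (ALL k<n. \<bar>v k\<bar> <= C) --> \<bar>\<phi> i j v\<bar> <= B*(C :: real))" for i j and B :: real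
 have ex: "EX B. P i j B" if "i < a" "j < b" for i j
  using lin_fun_bound[of n "\<phi> i j"] assms that unfolding P_def by blast
 define Q where "Q i j = (SOME B. P i j B)" for i j
 have Q: "P i j (Q i j)" if "i < a" "j < b" for i j unfolding Q_def by (rule someI_ex[OF ex[OF that]])
 obtain B where B: "B >= 0" "!!s. s : {..<a} \<times> {..<b} ==> Q (fst s) (snd s) <= B"
  by (rule finite_upper_bound[OF finite_cartesian_product[OF finite_lessThan[of a] finite_lessThan[of b]], of "%s. Q (fst s) (snd s)"]) blast
 show ?thesis
 proof (rule exI[of _ B], intro conjI allI impI B(1))
  fix i j v C assume ij: "i < a" "j < b" and C: "0 <= (C::real)" and v: "ALL k<n. \<bar>v k\<bar> <= C"
  have "\<bar>\<phi> i j v\<bar> <= Q i j*C" using Q[OF ij] v unfolding P_def by blast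
  also have "... <= B*C" using B(2)[of "(i, j)"] ij C by (intro mult_right_mono) auto
  finally show "\<bar>\<phi> i j v\<bar> <= B*C" .
 qed
qed

lemma sum_lessThan_6: "(SUM q<(6::nat). F q) = F 0 + F 1 + F 2 + F 3 + F 4 + (F 5 :: real)"
 by (simp add: eval_nat_numeral)

context sampled
begin

lemma Cv_nonneg: "0 <= Cv"
proof -
 have "\<bar>v 0 $ 0\<bar> <= Cv" using v_bd nv1 by simp
 then show ?thesis by linarith
qed

text \<open>The index pairs \<open>(q, j)\<close> with \<open>q < 4\<close> are the components of one agent; blocks 4 and 5 hold
 the exosystem state and the two sampled inputs.\<close>
definition idx :: "(nat \<times> nat) set" where "idx = Sigma {..<6} (%q. {..<dm q})"

definition full :: "(nat => nat => real) => (nat => real) => real => real => nat => nat => real" where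
 "full a vt u g q j = (if q < 4 then a q j else if q = 4 then vt j else if j = 0 then u else g)"

text \<open>With v and the held values appended as blocks 4 and 5, the inhomogeneous equation of an
  agent becomes an autonomous linear one, to which \<open>linear_ode_exists\<close> applies. The
  rows of block 5 are zero since held values are constant.\<close>

definition coef :: "nat => nat => nat => nat => nat => real" where
 "coef i q j q' j' =
  (if q = 0 then if q' = 0 then A1 p w (Suc i) $$ (j, j') else if q' = 1 then if j' = 0 then A2 p w (Suc i) $$ (j, 0) else 0
    else if q' = 4 then E0 p w (Suc i) $$ (j, j') else 0
  else if q = 1 then if j + 1 < r then if q' = 1 then if j' = j + 1 then 1 else 0 else 0
    else if q' = 0 then A3 p w (Suc i) $$ (0, j') else if q' = 1 then cc p w (j' + 1) (Suc i)
    else if q' = 4 then Er p w (Suc i) $$ (0, j') else if q' = 5 then if j' = 0 then bb p w (Suc i) else 0 else 0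
  else if q = 2 then if q' = 2 then Mc j j' else if q' = 5 then if j' = 0 then Qc j else 0 else 0
  else if q = 3 then if q' = 3 then (if j' = 0 then - bo h j else 0) + (if j' = j + 1 then 1 else 0)
    else if q' = 5 then if j' = 1 then bo h j else 0 else 0
  else if q = 4 then if q' = 4 then exo_S p $$ (j, j') else 0 else 0)"

lemma finite_idx: "finite idx" by (simp add: idx_def)

lemma sum_idx: "(SUM x:idx. g (fst x) (snd x)) = (SUM q<6. SUM j<dm q. g q j :: real)"
proof -
 have "(SUM q<6. SUM j<dm q. g q j) = (SUM (q, j):Sigma {..<6} (%q. {..<dm q}). g q j)" by (rule sum.Sigma) auto
 then show ?thesis by (simp add: idx_def case_prod_beta)
qed

lemma sum_ite: "(SUM j<n. (if j = c then a else 0)*g j) = (if c < n then a*g c else (0::real))" for c n :: nat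
proof -
 have "(SUM j<n. (if j = c then a else 0)*g j) = (SUM j<n. if j = c then a*g j else 0)" by (rule sum.cong) auto
 then show ?thesis by simp
qed

lemma rh_coef:
 assumes q: "q < 4" and j: "j < dm q"
 shows "rh i a vt u g q j = (SUM x:idx. coef i q j (fst x) (snd x)*full a vt u g (fst x) (snd x))"
proof -
 have two: "(SUM k<2. F k) = F 0 + (F 1 :: real)" for F :: "nat => real" by (simp add: eval_nat_numeral)
 have "(SUM x:idx. coef i q j (fst x) (snd x)*full a vt u g (fst x) (snd x)) = (SUM q'<6. SUM j'<dm q'. coef i q j q' j'*full a vt u g q' j')"
  by (rule sum_idx)
 also have "... = rh i a vt u g q j"
 proof -
  consider "q = 0" | "q = 1" "j + 1 < r" | "q = 1" "~ j + 1 < r" | "q = 2" | "q = 3" using q by linarith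
  then show ?thesis
  proof cases
   case 1
   then show ?thesis using r1 by (simp add: sum_lessThan_6 rh_def coef_def full_def dm_def sum_ite)
  next
   case 2
   then show ?thesis using j by (simp add: sum_lessThan_6 rh_def coef_def full_def dm_def sum_ite)
  next
   case 3
   then show ?thesis using j by (simp add: sum_lessThan_6 rh_def coef_def full_def dm_def sum_ite two)
  next
   case 4
   then show ?thesis by (simp add: sum_lessThan_6 rh_def coef_def full_def dm_def sum_ite two)
  next
   case 5
   then show ?thesis using r1 by (simp add: sum_lessThan_6 rh_def coef_def full_def dm_def sum_ite two distrib_right sum.distrib)
  qed
 qed
 finally show ?thesis ..
qed

lemma rate_bound:
 "EX R>=0. ALL i<N. ALL q<4. ALL j<dm q. ALL a vt u g C. 0 <= C --> (ALL q<4. ALL j<dm q. \<bar>a q j\<bar> <= C) --> (ALL k<nv. \<bar>vt k\<bar> <= C) -->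
  \<bar>u\<bar> <= C --> \<bar>g\<bar> <= C --> \<bar>rh i a vt u g q j\<bar> <= R*C"
proof -
 define R where "R = (SUM i<N. SUM x:idx. SUM y:idx. \<bar>coef i (fst x) (snd x) (fst y) (snd y)\<bar>)"
 show ?thesis
 proof (rule exI[of _ R], intro conjI allI impI)
  show "0 <= R" by (simp add: R_def sum_nonneg)
  fix i q j a vt u g C
  assume i: "i < N" and q: "q < 4" and j: "j < dm q" and C: "0 <= (C::real)" and a: "ALL q<4. ALL j<dm q. \<bar>a q j\<bar> <= C"
   and vt: "ALL k<nv. \<bar>vt k\<bar> <= C" and u: "\<bar>u\<bar> <= C" and g: "\<bar>g\<bar> <= C"
  have fb: "\<bar>full a vt u g (fst x) (snd x)\<bar> <= C" if x: "x : idx" for x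
  proof -
   have "snd x < dm (fst x)" using x by (auto simp: idx_def)
   moreover from this have "fst x = 4 ==> snd x < nv" by (simp add: dm_def)
   ultimately show ?thesis using a vt u g by (simp add: full_def)
  qed
  have "\<bar>rh i a vt u g q j\<bar> <= (SUM x:idx. \<bar>coef i q j (fst x) (snd x)*full a vt u g (fst x) (snd x)\<bar>)"
   unfolding rh_coef[OF q j] by (rule sum_abs)
  also have "... <= (SUM x:idx. \<bar>coef i q j (fst x) (snd x)\<bar>*C)"
   by (intro sum_mono) (simp add: abs_mult mult_left_mono fb)
  also have "... = (SUM x:idx. \<bar>coef i q j (fst x) (snd x)\<bar>)*C" by (simp add: sum_distrib_right)
  also have "... <= R*C"
  proof (rule mult_right_mono[OF _ C])
   have "(q, j) : idx" using q j by (simp add: idx_def)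
   then have "(SUM x:idx. \<bar>coef i q j (fst x) (snd x)\<bar>) <= (SUM x:idx. SUM y:idx. \<bar>coef i (fst x) (snd x) (fst y) (snd y)\<bar>)"
    using member_le_sum[of "(q, j)" idx "%x. SUM y:idx. \<bar>coef i (fst x) (snd x) (fst y) (snd y)\<bar>"] finite_idx by (simp add: sum_nonneg)
   also have "... <= R" unfolding R_def
    by (rule member_le_sum[of i "{..<N}" "%i. SUM x:idx. SUM y:idx. \<bar>coef i (fst x) (snd x) (fst y) (snd y)\<bar>"]) (use i in \<open>auto simp: sum_nonneg\<close>)
   finally show "(SUM x:idx. \<bar>coef i q j (fst x) (snd x)\<bar>) <= R" .
  qed
  finally show "\<bar>rh i a vt u g q j\<bar> <= R*C" .
 qed
qed

lemma adm_mono: "adm f b ==> b' <= b ==> adm f b'"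
 unfolding adm_def by (intro conjI) (fastforce intro: continuous_on_subset[of "{0..b}" _ "{0..b'}"], auto)

lemma V_lower: "lam_m p d E W K h*(SUM k<nst. (x $ k)^2) <= V K h w x"
proof -
 have P: "PP p d E K h w : carrier_mat nst nst" unfolding PP_def by (rule lyap_carrier[OF Ac_carrier bspec[OF hw w]])
 have sym: "ALL i<nst. ALL j<nst. entries (PP p d E K h w) i j = entries (PP p d E K h w) j i"
  unfolding PP_def by (rule lyap_symmetric[OF Ac_carrier bspec[OF hw w]])
 have "lam_m p d E W K h*(SUM k<nst. (x $ k)^2) <= eig_min (PP p d E K h w)*(SUM k<nst. (x $ k)^2)"
  by (intro mult_right_mono lam_m_lower[OF hw w]) (simp add: sum_nonneg)
 also have "... <= V K h w x" unfolding V_def by (rule eig_min_lower(1)[OF P nst_pos sym])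
 finally show ?thesis .
qed

lemma V_nonneg: "0 <= V K h w x"
proof -
 have "0 <= lam_m p d E W K h*(SUM k<nst. (x $ k)^2)" using lam_m_pos[OF hw] by (simp add: sum_nonneg)
 then show ?thesis using V_lower[of x] by linarith
qed

text \<open>The decaying part of the bound on the squared deviation.\<close>

definition tail :: "real => real => real" where
 "tail V0 t = (exp (- lam*t)*V0 + lam0 p d E W K h*\<beta> / (lam - \<alpha>)*exp (- \<alpha>*t)) / lam_m p d E W K h"

lemma error_bound:
 assumes b: "0 <= b" and adm: "adm f b"
 shows "(SUM k<nst. (es f b $ k)^2) <= tail (V K h w (es f 0)) b + \<epsilon>^2"
proof -
 have p: "0 < lam_m p d E W K h" by (rule lam_m_pos[OF hw])
 have "lam_m p d E W K h*tail (V K h w (es f 0)) b = exp (- lam*b)*V K h w (es f 0) + lam0 p d E W K h*\<beta> / (lam - \<alpha>)*exp (- \<alpha>*b)"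
  unfolding tail_def using p by simp
 then have "lam_m p d E W K h*(SUM k<nst. (es f b $ k)^2) <= lam_m p d E W K h*(tail (V K h w (es f 0)) b + \<epsilon>^2)"
  unfolding distrib_left using V_lower[of "es f b"] lyapunov_bound[OF b adm] by linarith
 then show ?thesis using p by simp
qed

lemma tail_upper:
 assumes "0 <= t" "0 <= V0" "V0 <= V1"
 shows "tail V0 t <= (V1 + lam0 p d E W K h*\<beta> / (lam - \<alpha>)) / lam_m p d E W K h"
proof -
 have "exp (- lam*t)*V0 <= 1*V1" using assms lam_pos by (intro mult_mono) auto
 moreover have "lam0 p d E W K h*\<beta> / (lam - \<alpha>)*exp (- \<alpha>*t) <= lam0 p d E W K h*\<beta> / (lam - \<alpha>)*1"
  using assms \<alpha>0 \<alpha>lam \<beta>0 lam0_pos by (intro mult_left_mono) auto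
 ultimately show ?thesis unfolding tail_def using lam_m_pos[OF hw] by (intro divide_right_mono) auto
qed

text \<open>Apart from the fixed data, C depends on \<open>V1\<close> alone, neither on the
  trajectory nor on the horizon b; the waiting time below inherits this uniformity.\<close>

lemma state_bound:
 "EX C>=0. ALL f b. 0 <= b --> adm f b --> V K h w (es f 0) <= V1 --> (ALL i<N. ALL q<4. ALL j<dm q. \<bar>f q i j b\<bar> <= C)"
proof -
 define R where "R = (max 0 V1 + lam0 p d E W K h*\<beta> / (lam - \<alpha>)) / lam_m p d E W K h + \<epsilon>^2"
 obtain Bz where Bz: "Bz >= 0" "ALL i<N. ALL j<m. ALL v C. 0 <= C --> (ALL k<nv. \<bar>v k\<bar> <= C) --> \<bar>sz w i j v\<bar> <= Bz*C"
  using lin_fun_bound_uniform[of N m nv "sz w"] lin_sz by blast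
 obtain Bx where Bx: "Bx >= 0" "ALL i<N. ALL j<r. ALL v C. 0 <= C --> (ALL k<nv. \<bar>v k\<bar> <= C) --> \<bar>sx w j v\<bar> <= Bx*C"
  using lin_fun_bound_uniform[of N r nv "%i. sx w"] lin_sx by blast
 obtain Be where Be: "Be >= 0" "ALL i<N. ALL j<l. ALL v C. 0 <= C --> (ALL k<nv. \<bar>v k\<bar> <= C) --> \<bar>se w i j v\<bar> <= Be*C"
  using lin_fun_bound_uniform[of N l nv "se w"] lin_se by blast
 define C where "C = (1 + R) + (Bz + Bx + Be)*Cv"
 have "R >= 0" unfolding R_def using lam0_pos \<beta>0 \<alpha>lam lam_m_pos[OF hw] by (intro add_nonneg_nonneg divide_nonneg_nonneg) auto
 then have C: "C >= 0" "Bz*Cv <= (Bz + Bx + Be)*Cv" "Bx*Cv <= (Bz + Bx + Be)*Cv" "Be*Cv <= (Bz + Bx + Be)*Cv"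
  "0 <= (Bz + Bx + Be)*Cv"
  using Bz(1) Bx(1) Be(1) Cv_nonneg by (auto simp: C_def intro!: mult_right_mono add_nonneg_nonneg)
 show ?thesis
 proof (rule exI[of _ C], intro conjI allI impI C(1))
  fix f b i q j assume b: "0 <= b" and adm: "adm f b" and V1: "V K h w (es f 0) <= V1" and i: "i < N" and q: "q < 4" and j: "j < dm q"
  have vb: "ALL k<nv. \<bar>vv b k\<bar> <= Cv" using v_bd b by blast
  have "tail (V K h w (es f 0)) b <= (max 0 V1 + lam0 p d E W K h*\<beta> / (lam - \<alpha>)) / lam_m p d E W K h"
   by (rule tail_upper[OF b V_nonneg]) (use V1 in simp)
  then have S: "(SUM k<nst. (es f b $ k)^2) <= R" using error_bound[OF b adm] unfolding R_def by linarith
  have e1: "\<bar>es f b $ k\<bar> <= 1 + R" if k: "k < nst" for k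
  proof -
   have "(es f b $ k)^2 <= R" using member_le_sum[of k "{..<nst}" "%k. (es f b $ k)^2"] k S by simp
   \<comment> \<open>Gives |a| \<le> a^2 + 1/4 without a square root.\<close>
   moreover have "0 <= (\<bar>es f b $ k\<bar> - 1 / 2)^2" by simp
   then have "\<bar>es f b $ k\<bar> <= (es f b $ k)^2 + 1 / 4" by (simp add: power2_eq_square algebra_simps)
   ultimately show ?thesis by linarith
  qed
  consider "q = 0" "j < m" | "q = 1" "j < r" | "q = 2" "j < l" | "q = 3" "j < r"
  proof -
   have "q = 0 | q = 1 | q = 2 | q = 3" using q by linarith
   then show ?thesis using j that by (auto simp: dm_def)
  qed
  then show "\<bar>f q i j b\<bar> <= C"
  proof cases
   case 1
   have "\<bar>f 0 i j b - sz w i j (vv b)\<bar> <= 1 + R"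
    by (rule e1[of "i*m + j", unfolded es_def st_index(1)[OF i 1(2)]]) (use mult_add_less[OF i 1(2)] in \<open>simp add: sdim_def\<close>)
   moreover have "\<bar>sz w i j (vv b)\<bar> <= Bz*Cv" using Bz(2) i 1(2) vb Cv_nonneg by blast
   ultimately show ?thesis using C(2) unfolding 1(1) C_def by linarith
  next
   case 2
   have "\<bar>f 1 i j b - sx w j (vv b)\<bar> <= 1 + R"
    by (rule e1[of "N*m + (i*r + j)", unfolded es_def st_index(2)[OF i 2(2)]]) (use mult_add_less[OF i 2(2)] in \<open>simp add: sdim_def\<close>)
   moreover have "\<bar>sx w j (vv b)\<bar> <= Bx*Cv" using Bx(2) i 2(2) vb Cv_nonneg by blast
   ultimately show ?thesis using C(3) unfolding 2(1) C_def by linarith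
  next
   case 3
   have "\<bar>f 2 i j b - se w i j (vv b)\<bar> <= 1 + R"
    by (rule e1[of "N*m + N*r + (i*l + j)", unfolded es_def st_index(3)[OF i 3(2)]]) (use mult_add_less[OF i 3(2)] in \<open>simp add: sdim_def\<close>)
   moreover have "\<bar>se w i j (vv b)\<bar> <= Be*Cv" using Be(2) i 3(2) vb Cv_nonneg by blast
   ultimately show ?thesis using C(4) unfolding 3(1) C_def by linarith
  next
   case 4
   have "\<bar>f 3 i j b\<bar> <= 1 + R"
    by (rule e1[of "N*m + N*r + (N*l + (i*r + j))", unfolded es_def st_index(4)[OF i 4(2)]]) (use mult_add_less[OF i 4(2)] in \<open>simp add: sdim_def\<close>)
   then show ?thesis using C(5) unfolding 4(1) C_def by linarith
  qed
 qed
qed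

text \<open>Bounded states give a common Lipschitz constant L for all sampled signals. The errors
  start from 0 at \<tau>, and at an event their squares add up to at least \<delta>; as each is at
  most L (t - \<tau>), this takes a time \<kappa>.\<close>

lemma dwell:
 "EX \<kappa>>0. ALL f b i \<tau> t. adm f b --> V K h w (es f 0) <= V1 --> i < N --> 0 <= \<tau> --> \<tau> <= t --> t <= b --> 0 <= gg f i \<tau> t --> \<kappa> <= t - \<tau>"
proof -
 obtain C where C: "C >= 0" "ALL f b. 0 <= b --> adm f b --> V K h w (es f 0) <= V1 --> (ALL i<N. ALL q<4. ALL j<dm q. \<bar>f q i j b\<bar> <= C)"
  using state_bound by blast
 obtain R where R: "R >= 0" "ALL i<N. ALL q<4. ALL j<dm q. ALL a vt u g C. 0 <= C --> (ALL q<4. ALL j<dm q. \<bar>a q j\<bar> <= C) --> (ALL k<nv. \<bar>vt k\<bar> <= C) -->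
  \<bar>u\<bar> <= C --> \<bar>g\<bar> <= C --> \<bar>rh i a vt u g q j\<bar> <= R*C" using rate_bound by blast
 obtain Bf where Bf: "Bf >= 0" "ALL v C. (ALL k<nv. \<bar>v k\<bar> <= C) --> \<bar>fl w v\<bar> <= Bf*(C::real)" using lin_fun_bound[OF lin_fl] by blast
 \<comment> \<open>\<open>sx w 1\<close> is the derivative of the leader output, which enters the
   rate of e_v.\<close>
 obtain Bg where Bg: "Bg >= 0" "ALL v C. (ALL k<nv. \<bar>v k\<bar> <= C) --> \<bar>sx w 1 v\<bar> <= Bg*(C::real)" using lin_fun_bound[OF lin_sx] by blast
 define HH where "HH = (SUM i<N. SUM j<N. \<bar>Hmat N E $$ (i, j)\<bar>)"
 have HH0: "HH >= 0" by (simp add: HH_def sum_nonneg)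
 have Hrow: "(SUM j<N. \<bar>Hmat N E $$ (i, j)\<bar>) <= HH" if "i < N" for i
  unfolding HH_def by (rule member_le_sum[of i "{..<N}" "%i. SUM j<N. \<bar>Hmat N E $$ (i, j)\<bar>"]) (use that in \<open>auto simp: sum_nonneg\<close>)
 have U0: "U0 K >= 0" by (simp add: U0_def sum_nonneg)
 define C1 where "C1 = C + Cv + U0 K*C + HH*(C + Bf*Cv)"
 have C1: "0 <= C1" "C <= C1" "Cv <= C1" "U0 K*C <= C1" "HH*(C + Bf*Cv) <= C1"
 proof -
  have "0 <= U0 K*C" "0 <= HH*(C + Bf*Cv)" using U0 C(1) HH0 Bf(1) Cv_nonneg by auto
  then show "0 <= C1" "C <= C1" "Cv <= C1" "U0 K*C <= C1" "HH*(C + Bf*Cv) <= C1" using C(1) Cv_nonneg unfolding C1_def by linarith+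
 qed
 define L where "L = R*C1 + HH*(R*C1 + Bg*Cv)"
 have L: "0 <= L" "R*C1 <= L" "HH*(R*C1 + Bg*Cv) <= L"
  unfolding L_def using R(1) C1(1) HH0 Bg(1) Cv_nonneg by auto
 define M where "M = (real l + real r + 1)*L^2"
 have M: "M >= 0" by (simp add: M_def)
 \<comment> \<open>M + 1 instead of M avoids a division by 0.\<close>
 define \<kappa> where "\<kappa> = sqrt (\<delta> / (M + 1))"
 show ?thesis
 proof (rule exI[of _ \<kappa>], intro conjI allI impI)
  show "\<kappa> > 0" unfolding \<kappa>_def using \<delta>_pos M by simp
  fix f b i \<tau> t assume adm: "adm f b" and V1: "V K h w (es f 0) <= V1" and i: "i < N" and t: "0 <= \<tau>" "\<tau> <= t" "t <= b" and g: "0 <= gg f i \<tau> t"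
  have fb: "\<bar>f q i j s\<bar> <= C" if "s : {0..b}" "i < N" "q < 4" "j < dm q" for s i q j
  proof -
   have "0 <= s" "adm f s" using that(1) adm_mono[OF adm] by auto
   then show ?thesis using C(2) V1 that by blast
  qed
  have eb: "\<bar>evf f i s\<bar> <= HH*(C + Bf*Cv)" if s: "s : {0..b}" and i: "i < N" for s i
  proof -
   have "\<bar>fl w (vv s)\<bar> <= Bf*Cv" using Bf(2) v_bd s by (meson atLeastAtMost_iff)
   moreover have "\<bar>f 1 j 0 s\<bar> <= C" if "j < N" for j using fb[OF s that, of 1 0] r1 by (simp add: dm_def)
   ultimately have "ALL j<N. \<bar>f 1 j 0 s - fl w (vv s)\<bar> <= C + Bf*Cv" by (smt (verit))
   then have "\<bar>evf f i s\<bar> <= (SUM j<N. \<bar>Hmat N E $$ (i, j)\<bar>)*(C + Bf*Cv)" unfolding evf_def by (rule abs_sum_mult_le)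
   also have "... <= HH*(C + Bf*Cv)" by (intro mult_right_mono Hrow[OF i]) (use C(1) Bf(1) Cv_nonneg in auto)
   finally show ?thesis .
  qed
  have ub: "\<bar>uh f i s\<bar> <= U0 K*C" if s: "s : {0..b}" and i: "i < N" for s i
  proof -
   have "\<bar>SUM k<l. \<psi> k*f 2 i k s\<bar> <= (SUM k<l. \<bar>\<psi> k\<bar>)*C"
    by (rule abs_sum_mult_le) (use fb[OF s i, of 2] in \<open>auto simp: dm_def\<close>)
   moreover have "\<bar>SUM q<r. om q*f 3 i q s\<bar> <= (SUM q<r. \<bar>om q\<bar>)*C"
    by (rule abs_sum_mult_le) (use fb[OF s i, of 3] in \<open>auto simp: dm_def\<close>)
   then have "\<bar>K*(SUM q<r. om q*f 3 i q s)\<bar> <= \<bar>K\<bar>*((SUM q<r. \<bar>om q\<bar>)*C)" unfolding abs_mult by (rule mult_left_mono) simp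
   ultimately show ?thesis unfolding uh_def uu_def U0_def of_real_eq_id id_apply by (simp add: distrib_right)
  qed
  have rd: "EX D. \<bar>D\<bar> <= R*C1 & (f q i j has_real_derivative D) (at_right s)" if s: "s : {0..<b}" and i: "i < N" and q: "q < 4" and j: "j < dm q" for s i q j
  proof -
   obtain \<tau> where \<tau>: "\<tau> : {0..s}" "flow f i \<tau> s {s<..}" using adm s i unfolding adm_def by blast
   have s': "s : {0..b}" "\<tau> : {0..b}" using s \<tau>(1) by auto
   let ?D = "rh i (%q j. f q i j s) (vv s) (uh f i \<tau>) (evf f i \<tau>) q j"
   have "\<bar>?D\<bar> <= R*C1"
   proof (rule R(2)[rule_format, OF i q j C1(1)])
    show "\<bar>f q i j s\<bar> <= C1" if "q < 4" "j < dm q" for q j using fb[OF s'(1) i that] C1(2) by linarith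
    show "\<bar>v s $ k\<bar> <= C1" if "k < nv" for k using v_bd s that C1(3) by fastforce
    show "\<bar>uh f i \<tau>\<bar> <= C1" using ub[OF s'(2) i] C1(4) by linarith
    show "\<bar>evf f i \<tau>\<bar> <= C1" using eb[OF s'(2) i] C1(5) by linarith
   qed
   moreover have "(f q i j has_real_derivative ?D) (at_right s)" using \<tau>(2) q j unfolding flow_def by blast
   ultimately show ?thesis by blast
  qed
  have cf: "continuous_on {0..b} (f q i j)" if "i < N" "q < 4" "j < dm q" for i q j using adm that unfolding adm_def by blast
  have lipf: "\<bar>f q i j t - f q i j \<tau>\<bar> <= L*(t - \<tau>)" if q: "q < 4" and j: "j < dm q" for q j
  proof (rule right_derivative_lipschitz[OF t(2)])
   show "continuous_on {\<tau>..t} (f q i j)" by (rule continuous_on_subset[OF cf[OF i q j]]) (use t in auto)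
   show "ALL s:{\<tau>..<t}. EX D. \<bar>D\<bar> <= L & (f q i j has_real_derivative D) (at_right s)"
   proof
    fix s assume "s : {\<tau>..<t}"
    then have "s : {0..<b}" using t by auto
    from rd[OF this i q j] L(2) show "EX D. \<bar>D\<bar> <= L & (f q i j has_real_derivative D) (at_right s)" by (meson order_trans)
   qed
  qed
  have lipe: "\<bar>evf f i t - evf f i \<tau>\<bar> <= L*(t - \<tau>)"
  proof (rule right_derivative_lipschitz[OF t(2)])
   have cv: "ALL k<nv. continuous_on {\<tau>..t} (%t. v t $ k)" using continuous_on_subset[OF v_continuous] t by auto
   have c1: "continuous_on {\<tau>..t} (f 1 j 0)" if "j < N" for j
    by (rule continuous_on_subset[OF cf[OF that]]) (use t r1 in \<open>auto simp: dm_def\<close>)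
   show "continuous_on {\<tau>..t} (evf f i)" unfolding evf_def[abs_def]
    by (intro continuous_intros lin_fun_continuous[OF lin_fl cv] c1) simp
   show "ALL s:{\<tau>..<t}. EX D. \<bar>D\<bar> <= L & (evf f i has_real_derivative D) (at_right s)"
   proof
    fix s assume "s : {\<tau>..<t}"
    then have s: "s : {0..<b}" "0 <= s" using t by auto
    have "ALL j. EX D. j < N --> \<bar>D\<bar> <= R*C1 & (f 1 j 0 has_real_derivative D) (at_right s)"
     using rd[OF s(1), of _ 1 0] r1 by (auto simp: dm_def)
    from choice[OF this] obtain D where D: "ALL j. j < N --> \<bar>D j\<bar> <= R*C1 & (f 1 j 0 has_real_derivative D j) (at_right s)" by (elim exE)
    have vd: "ALL k<nv. ((%t. v t $ k) has_real_derivative Sop (vv s) k) (at_right s)" using v_right_deriv[OF s(2)] by blast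
    have fd: "((%t. fl w (vv t)) has_real_derivative sx w 1 (vv s)) (at_right s)"
     using lin_fun_deriv[OF lin_fl vd, of w] sx_Sop[of w 0] by (simp add: sx_0)
    have "\<bar>sx w 1 (vv s)\<bar> <= Bg*Cv" using Bg(2) v_bd s(2) by (meson)
    with D have Db: "ALL j<N. \<bar>D j - sx w 1 (vv s)\<bar> <= R*C1 + Bg*Cv" by (smt (verit))
    have "(evf f i has_real_derivative (SUM j<N. Hmat N E $$ (i, j)*(D j - sx w 1 (vv s)))) (at_right s)"
     unfolding evf_def[abs_def] by (intro DERIV_sum DERIV_cmult DERIV_diff fd) (use D in simp)
    moreover have "\<bar>SUM j<N. Hmat N E $$ (i, j)*(D j - sx w 1 (vv s))\<bar> <= L"
    proof -
     have "\<bar>SUM j<N. Hmat N E $$ (i, j)*(D j - sx w 1 (vv s))\<bar> <= (SUM j<N. \<bar>Hmat N E $$ (i, j)\<bar>)*(R*C1 + Bg*Cv)"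
      by (rule abs_sum_mult_le[OF Db])
     also have "... <= HH*(R*C1 + Bg*Cv)" by (intro mult_right_mono Hrow[OF i]) (use R(1) C1(1) Bg(1) Cv_nonneg in auto)
     finally show ?thesis using L(3) by linarith
    qed
    ultimately show "EX D. \<bar>D\<bar> <= L & (evf f i has_real_derivative D) (at_right s)" by blast
   qed
  qed
  let ?y = "(L*(t - \<tau>))^2"
  have sq: "(x' - x)^2 <= ?y" if "\<bar>x - x'\<bar> <= L*(t - \<tau>)" for x x' :: real
   using power_mono[OF that, of 2] by (simp add: power2_commute)
  have "(SUM k<l. (f 2 i k \<tau> - f 2 i k t)^2) <= (SUM k<l. ?y)" by (intro sum_mono sq lipf) (auto simp: dm_def)
  moreover have "(SUM s<r. (f 3 i s \<tau> - f 3 i s t)^2) <= (SUM k<r. ?y)" by (intro sum_mono sq lipf) (auto simp: dm_def)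
  moreover have "(evf f i \<tau> - evf f i t)^2 <= ?y" by (rule sq[OF lipe])
  moreover have "0 <= sigma_bar*((SUM s<r. (f 3 i s t)^2) + (evf f i t)^2)" using sigma_bar_pos by (simp add: sum_nonneg)
  moreover have "0 <= \<beta>*exp (- \<alpha>*t)" using \<beta>0 by simp
  ultimately have "\<delta> <= real l * ?y + real r * ?y + ?y" using g unfolding gg_def by simp
  also have "... = M*(t - \<tau>)^2" unfolding M_def power_mult_distrib by (simp add: distrib_right)
  also have "... <= (M + 1)*(t - \<tau>)^2" by (simp add: mult_right_mono)
  finally have "\<delta> / (M + 1) <= (t - \<tau>)^2" using M by (simp add: divide_le_eq mult.commute)
  then have "\<kappa> <= sqrt ((t - \<tau>)^2)" unfolding \<kappa>_def by (rule real_sqrt_le_mono)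
  then show "\<kappa> <= t - \<tau>" using t by simp
 qed
qed

end

section \<open>Construction of trajectories\<close>

context sampled
begin

text \<open>Solve the extended autonomous system from time s. Uniqueness identifies its block 4 with
  v, and block 5 stays constant, so the other blocks solve the equation with held values.\<close>

lemma agent_ode:
 assumes s: "0 <= s"
 shows "EX y. ALL q<4. ALL j<dm q. y q j s = a q j &
  (ALL t>=s. (y q j has_real_derivative rh i (%q j. y q j t) (vv t) u g q j) (at t))"
proof -
 let ?A = "%x y. coef i (fst x) (snd x) (fst y) (snd y)"
 obtain Y where Y0: "ALL x:idx. Y x 0 = full a (vv s) u g (fst x) (snd x) &
   (ALL t. (Y x has_real_derivative (SUM z:idx. ?A x z*Y z t)) (at t))"
  using linear_ode_exists[OF finite_idx, of "%x. full a (vv s) u g (fst x) (snd x)" ?A] by blast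
 have dY: "((%t. Y x (t - s)) has_real_derivative (SUM z:idx. ?A x z*Y z (t - s))) (at t)" if "x : idx" for x t
  using Y0 that DERIV_shift[of "Y x" "SUM z:idx. ?A x z*Y z (t - s)" t "- s"] by simp
 have in4: "(4, k) : idx" if "k < nv" for k using that by (simp add: idx_def dm_def)
 have sum4: "(SUM z:idx. ?A (4, k) z*Y z t) = (SUM j<nv. exo_S p $$ (k, j)*Y (4, j) t)" for k t
 proof -
  have "(SUM z:idx. ?A (4, k) z*Y z t) = (SUM q<6. SUM j<dm q. coef i 4 k q j*Y (q, j) t)"
   using sum_idx[of "%q j. coef i 4 k q j*Y (q, j) t"] by simp
  then show ?thesis by (simp add: sum_lessThan_6 coef_def dm_def)
 qed
 have sum5: "(SUM z:idx. ?A (5, k) z*Y z t) = 0" for k t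
  by (rule sum.neutral) (simp add: coef_def)
 have v4: "Y (4, k) (t - s) = v t $ k" if t: "s <= t" and k: "k < nv" for t k
 proof -
  have "ALL k<nv. v t $ k - Y (4, k) (t - s) = 0"
  proof (rule linear_ode_zero[OF t, where d = "%k t. v t $ k - Y (4, k) (t - s)" and A = "%k j. exo_S p $$ (k, j)"])
   show "ALL k<nv. continuous_on {s..t} (%t. v t $ k - Y (4, k) (t - s))"
   proof (intro allI impI continuous_on_diff)
    fix k assume k: "k < nv"
    show "continuous_on {s..t} (%t. v t $ k)" using continuous_on_subset[OF v_continuous[OF k]] s by auto
    show "continuous_on {s..t} (%t. Y (4, k) (t - s))"
     by (rule DERIV_continuous_on[where D = "%t. SUM z:idx. ?A (4, k) z*Y z (t - s)"])
      (rule has_field_derivative_at_within[OF dY[OF in4[OF k]]])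
   qed
   show "ALL k<nv. v s $ k - Y (4, k) (s - s) = 0" using Y0 in4 by (fastforce simp: full_def)
   show "ALL t':{s..<t}. ALL k<nv. ((%t. v t $ k - Y (4, k) (t - s)) has_real_derivative
     (SUM j<nv. exo_S p $$ (k, j)*(v t' $ j - Y (4, j) (t' - s)))) (at_right t')"
   proof (intro ballI allI impI)
    fix t' k assume t': "t' : {s..<t}" and k: "k < nv"
    have "((%t. v t $ k - Y (4, k) (t - s)) has_real_derivative
     (Sop (vv t') k - (SUM z:idx. ?A (4, k) z*Y z (t' - s)))) (at_right t')"
     by (intro DERIV_diff v_right_deriv k has_field_derivative_at_within[OF dY[OF in4[OF k]]]) (use t' s in auto)
    then show "((%t. v t $ k - Y (4, k) (t - s)) has_real_derivative
     (SUM j<nv. exo_S p $$ (k, j)*(v t' $ j - Y (4, j) (t' - s)))) (at_right t')"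
     unfolding sum4 by (simp add: Sop_def mv_def entries_def right_diff_distrib sum_subtractf)
   qed
  qed
  then show ?thesis using k by simp
 qed
 have c5: "Y (5, k) t = (if k = 0 then u else g)" if "k < 2" for k t
 proof -
  have x: "(5, k) : idx" using that by (simp add: idx_def dm_def)
  have "(Y (5, k) has_real_derivative 0) (at t)" for t using conjunct2[OF bspec[OF Y0 x], rule_format, of t] unfolding sum5 .
  then have "Y (5, k) t = Y (5, k) 0" using DERIV_isconst_all by blast
  then show ?thesis using Y0 x by (simp add: full_def)
 qed
 define y where "y q j t = Y (q, j) (t - s)" for q j t
 show ?thesis
 proof (rule exI[of _ y], intro allI impI conjI)
  fix q j assume q: "q < (4::nat)" and j: "j < dm q"
  then have x: "(q, j) : idx" by (simp add: idx_def)
  show "y q j s = a q j" using Y0 x q by (simp add: y_def full_def)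
  fix t assume t: "s <= t"
  have "rh i (%q j. y q j t) (vv t) u g q j = (SUM z:idx. ?A (q, j) z*full (%q j. y q j t) (vv t) u g (fst z) (snd z))"
   using rh_coef[OF q j] by simp
  also have "... = (SUM z:idx. ?A (q, j) z*Y z (t - s))"
  proof (rule sum.cong[OF refl])
   fix z assume z: "z : idx"
   obtain q' j' where zq: "z = (q', j')" by (cases z)
   have "q' < 6" "j' < dm q'" using z zq by (auto simp: idx_def)
   then consider "q' < 4" | "q' = 4" "j' < nv" | "q' = 5" "j' < 2"
   proof -
    have "q' < 4 | q' = 4 | q' = 5" using \<open>q' < 6\<close> by linarith
    then show ?thesis using \<open>j' < dm q'\<close> that by (auto simp: dm_def)
   qed
   then have "full (%q j. y q j t) (vv t) u g (fst z) (snd z) = Y z (t - s)"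
    by cases (use v4[OF t] c5 in \<open>auto simp: full_def zq y_def\<close>)
   then show "?A (q, j) z*full (%q j. y q j t) (vv t) u g (fst z) (snd z) = ?A (q, j) z*Y z (t - s)" by simp
  qed
  finally show "(y q j has_real_derivative rh i (%q j. y q j t) (vv t) u g q j) (at t)"
   using dY[OF x, of t] unfolding y_def[abs_def] by simp
 qed
qed

lemma uh_cong: "(ALL q i j. f q i j \<tau> = f' q i j \<tau>) ==> uh f i \<tau> = uh f' i \<tau>"
 by (simp add: uh_def)

lemma evf_cong: "(ALL q i j. f q i j \<tau> = f' q i j \<tau>) ==> evf f i \<tau> = evf f' i \<tau>"
 by (simp add: evf_def)

lemma gg_cong:
 assumes "ALL q i j. ALL t<=S. f q i j t = f' q i j t" "\<tau> <= S" "t <= S"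
 shows "gg f i \<tau> t = gg f' i \<tau> t"
 using assms evf_cong[of f \<tau> f' i] evf_cong[of f t f' i] by (simp add: gg_def)

lemma flow_cong:
 assumes eq: "ALL q i j. ALL t<=S. f q i j t = f' q i j t" and \<tau>: "\<tau> <= S" and t: "t <= S"
  and ev: "\<forall>\<^sub>F s in at t within U. s <= S"
 shows "flow f i \<tau> t U = flow f' i \<tau> t U"
proof -
 have "uh f i \<tau> = uh f' i \<tau>" "evf f i \<tau> = evf f' i \<tau>" using eq \<tau> by (auto intro: uh_cong evf_cong)
 moreover have "(%q j. f q i j t) = (%q j. f' q i j t)" using eq t by auto
 moreover have "(f q i j has_real_derivative D) (at t within U) = (f' q i j has_real_derivative D) (at t within U)" for q j D
 proof (rule has_field_derivative_cong_eventually)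
  show "\<forall>\<^sub>F s in at t within U. f q i j s = f' q i j s" using ev by eventually_elim (use eq in blast)
  show "f q i j t = f' q i j t" using eq t by blast
 qed
 ultimately show ?thesis unfolding flow_def by simp
qed

lemma flow_cong_right:
 assumes eq: "ALL q i j. ALL t<=S. f q i j t = f' q i j t" and "\<tau> <= S" "t < S"
 shows "flow f i \<tau> t {t<..} = flow f' i \<tau> t {t<..}"
 by (rule flow_cong[OF eq]) (use assms in \<open>auto simp: eventually_at_right_field intro: exI[of _ S]\<close>)

lemma flow_cong_left:
 assumes eq: "ALL q i j. ALL t<=S. f q i j t = f' q i j t" and "\<tau> <= S" "t <= S"
 shows "flow f i \<tau> t {..<t} = flow f' i \<tau> t {..<t}"
 by (rule flow_cong[OF eq]) (use assms in \<open>auto simp: eventually_at_filter\<close>)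

text \<open>Right at a sampling instant the error is 0 while the threshold is at least
  \<delta>.\<close>

lemma gg_self: "gg f i t t < 0"
proof -
 have "0 <= sigma_bar*((SUM s<r. (f 3 i s t)^2) + (evf f i t)^2)" using sigma_bar_pos by (simp add: sum_nonneg)
 moreover have "0 < \<beta>*exp (- \<alpha>*t)" using \<beta>0 by simp
 ultimately show ?thesis unfolding gg_def using \<delta>_pos by simp
qed

text \<open>A construction up to time s, in which \<open>\<tau> i\<close> is the last sampling
  instant of agent i and no trigger is pending at s.\<close>

definition state_inv :: "(nat => nat => nat => real) => real => (nat => nat => nat => real => real) => (nat => real) => bool" where
 "state_inv f0 s f \<tau> \<longleftrightarrow> 0 <= s & (ALL i<N. 0 <= \<tau> i & \<tau> i <= s & gg f i (\<tau> i) s < 0) & adm f s & (ALL q i j. f q i j 0 = f0 q i j)"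

text \<open>The grid advances to an event of some agent or by 1, so that time moves on even without
  events. Left and right derivatives are recorded separately because a grid time is interior to the
  sampling interval of every agent that does not sample there.\<close>

definition step :: "real => (nat => nat => nat => real => real) => (nat => real) => real => (nat => nat => nat => real => real) => (nat => real) => bool" where
 "step s f \<tau> s' f' \<tau>' \<longleftrightarrow> s < s' & (ALL q i j. ALL t<=s. f' q i j t = f q i j t) &
  (ALL i<N. (ALL t:{s..<s'}. flow f' i (\<tau> i) t {t<..} & gg f' i (\<tau> i) t < 0) & (ALL t:{s<..s'}. flow f' i (\<tau> i) t {..<t}) &
   \<tau>' i = (if 0 <= gg f' i (\<tau> i) s' then s' else \<tau> i)) &
  (s' = s + 1 | (EX i<N. 0 <= gg f' i (\<tau> i) s'))"

lemma gg_continuous: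
 assumes c: "ALL q<4. ALL i<N. ALL j<dm q. continuous_on S (f q i j)" and i: "i < N" and S: "S \<subseteq> {0..}"
 shows "continuous_on S (gg f i \<tau>)"
proof -
 have cv: "ALL k<nv. continuous_on S (%t. v t $ k)" using continuous_on_subset[OF v_continuous S] by blast
 have c1: "continuous_on S (f 1 j 0)" if "j < N" for j using c that r1 by (simp add: dm_def)
 have c2: "continuous_on S (f 2 i k)" if "k < l" for k using c that i by (simp add: dm_def)
 have c3: "continuous_on S (f 3 i k)" if "k < r" for k using c that i by (simp add: dm_def)
 have ce: "continuous_on S (evf f i)" unfolding evf_def[abs_def]
  by (intro continuous_intros lin_fun_continuous[OF lin_fl cv] c1) simp
 show ?thesis unfolding gg_def by (intro continuous_intros c2 c3 ce) auto
qed

text \<open>Let all agents run on with their samples held and stop at the first trigger in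
  [s, s + 1], if there is one. It exists by compactness and lies strictly after s since all triggers
  are negative at s.\<close>

lemma step_exists:
 assumes inv: "state_inv f0 s f \<tau>"
 shows "EX s' f' \<tau>'. state_inv f0 s' f' \<tau>' & step s f \<tau> s' f' \<tau>'"
proof -
 have s0: "0 <= s" and \<tau>: "ALL i<N. 0 <= \<tau> i & \<tau> i <= s & gg f i (\<tau> i) s < 0" and adm: "adm f s" and f0: "ALL q i j. f q i j 0 = f0 q i j"
  using inv unfolding state_inv_def by blast+
 have "ALL i. EX y. ALL q<4. ALL j<dm q. y q j s = f q i j s &
  (ALL t>=s. (y q j has_real_derivative rh i (%q j. y q j t) (vv t) (uh f i (\<tau> i)) (evf f i (\<tau> i)) q j) (at t))"
  by (rule allI) (rule agent_ode[OF s0])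
 from choice[OF this] obtain y where y: "ALL i. ALL q<4. ALL j<dm q. y i q j s = f q i j s &
  (ALL t>=s. (y i q j has_real_derivative rh i (%q j. y i q j t) (vv t) (uh f i (\<tau> i)) (evf f i (\<tau> i)) q j) (at t))" by (elim exE)
 define f' where "f' q i j t = (if t <= s then f q i j t else y i q j t)" for q i j t
 have old: "ALL q i j. ALL t<=s. f' q i j t = f q i j t" by (simp add: f'_def)
 have new: "f' q i j t = y i q j t" if "s <= t" "q < 4" "j < dm q" for q i j t using that y by (auto simp: f'_def)
 have rhcong: "rh i a vt u g q j = rh i a' vt u g q j" if "ALL q<4. ALL j<dm q. a q j = a' q j" "q < 4" "j < dm q" for i a a' vt u g q j
  unfolding rh_coef[OF that(2,3)] using that(1) by (intro sum.cong refl) (auto simp: full_def idx_def)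
 have flow': "flow f' i (\<tau> i) t U" if i: "i < N" and t: "s <= t" and ev: "\<forall>\<^sub>F x in at t within U. s <= x" for i t U
  unfolding flow_def
 proof (intro allI impI)
  fix q j assume q: "q < (4::nat)" and j: "j < dm q"
  have e: "uh f' i (\<tau> i) = uh f i (\<tau> i)" "evf f' i (\<tau> i) = evf f i (\<tau> i)" using \<tau> i by (auto intro!: uh_cong evf_cong simp: f'_def)
  have "rh i (%q j. f' q i j t) (vv t) (uh f' i (\<tau> i)) (evf f' i (\<tau> i)) q j = rh i (%q j. y i q j t) (vv t) (uh f i (\<tau> i)) (evf f i (\<tau> i)) q j"
   unfolding e by (rule rhcong[OF _ q j]) (use new[OF t] in blast)
  moreover have "(y i q j has_real_derivative rh i (%q j. y i q j t) (vv t) (uh f i (\<tau> i)) (evf f i (\<tau> i)) q j) (at t within U)"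
   using y t q j by (blast intro: has_field_derivative_at_within)
  moreover have "(f' q i j has_real_derivative D) (at t within U) = (y i q j has_real_derivative D) (at t within U)" for D
  proof (rule has_field_derivative_cong_eventually)
   show "\<forall>\<^sub>F x in at t within U. f' q i j x = y i q j x" using ev by eventually_elim (use new q j in blast)
  qed (rule new[OF t q j])
  ultimately show "(f' q i j has_real_derivative rh i (%q j. f' q i j t) (vv t) (uh f' i (\<tau> i)) (evf f' i (\<tau> i)) q j) (at t within U)" by simp
 qed
 have fr: "flow f' i (\<tau> i) t {t<..}" if "i < N" "s <= t" for i t
  by (rule flow'[OF that]) (use that(2) in \<open>auto simp: eventually_at_filter\<close>)
 have fleft: "flow f' i (\<tau> i) t {..<t}" if "i < N" "s < t" for i t
 proof (rule flow'[OF that(1)])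
  show "\<forall>\<^sub>F x in at_left t. s <= x" using that(2) by (auto simp: eventually_at_left_field intro: exI[of _ s])
 qed (use that in simp)
 have cont: "ALL q<4. ALL i<N. ALL j<dm q. continuous_on {0..b} (f' q i j)" for b
 proof (intro allI impI)
  fix q i j assume q: "q < (4::nat)" and i: "i < N" and j: "j < dm q"
  have cf: "continuous_on {0..s} (f q i j)" using adm q i j unfolding adm_def by blast
  have cy: "continuous_on {s..} (y i q j)"
   by (rule DERIV_continuous_on[where D = "%t. rh i (%q j. y i q j t) (vv t) (uh f i (\<tau> i)) (evf f i (\<tau> i)) q j"])
    (use y q j in \<open>blast intro: has_field_derivative_at_within\<close>)
  have "continuous_on {0..b} (%t. if id t <= s then f q i j t else y i q j t)"
  proof (rule continuous_on_cases_le)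
   show "continuous_on {t : {0..b}. id t <= s} (f q i j)" by (rule continuous_on_subset[OF cf]) auto
   show "continuous_on {t : {0..b}. s <= id t} (y i q j)" by (rule continuous_on_subset[OF cy]) auto
  qed (use y q j in \<open>auto simp: id_def intro: continuous_intros\<close>)
  then show "continuous_on {0..b} (f' q i j)" unfolding f'_def[abs_def] by simp
 qed
 have cg: "continuous_on {s..s + 1} (gg f' i (\<tau> i))" if i: "i < N" for i
  by (rule continuous_on_subset[OF gg_continuous[OF cont[of "s + 1"] i]]) (use s0 in auto)
 have gs: "gg f' i (\<tau> i) s < 0" if i: "i < N" for i
  using gg_cong[OF old, of "\<tau> i" s i] \<tau> i by simp
 define Tr where "Tr = (\<Union>i<N. {t : {s..s + 1}. 0 <= gg f' i (\<tau> i) t})"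
 have cT: "compact Tr" unfolding Tr_def
 proof (rule compact_UN)
  fix i assume "i : {..<N}"
  then have "closed {t : {s..s + 1}. 0 <= gg f' i (\<tau> i) t}"
   by (intro continuous_on_closed_Collect_le continuous_on_const cg closed_atLeastAtMost) simp
  then have "compact ({s..s + 1} \<inter> {t : {s..s + 1}. 0 <= gg f' i (\<tau> i) t})" by (intro compact_Int_closed) auto
  then show "compact {t : {s..s + 1}. 0 <= gg f' i (\<tau> i) t}" by (rule back_subst[of compact]) auto
 qed simp
 obtain s' where s': "s < s'" "s' <= s + 1" "ALL i<N. ALL t:{s..<s'}. gg f' i (\<tau> i) t < 0" "s' = s + 1 | (EX i<N. 0 <= gg f' i (\<tau> i) s')"
 proof (cases "Tr = {}")
  case True
  show ?thesis
  proof (rule that[of "s + 1"])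
   show "ALL i<N. ALL t:{s..<s + 1}. gg f' i (\<tau> i) t < 0"
   proof (intro allI impI ballI, rule ccontr)
    fix i t assume "i < N" "t : {s..<s + 1}" "~ gg f' i (\<tau> i) t < 0"
    then have "t : Tr" unfolding Tr_def by (intro UN_I[of i]) auto
    then show False using True by simp
   qed
  qed auto
 next
  case False
  from compact_attains_inf[OF cT False] obtain s' where a: "s' : Tr" "ALL t:Tr. s' <= t" by blast
  then obtain i where i: "i < N" "s' : {s..s + 1}" "0 <= gg f' i (\<tau> i) s'" unfolding Tr_def by blast
  have "s' ~= s" using gs[OF i(1)] i(3) by auto
  show ?thesis
  proof (rule that[of s'])
   show "ALL i<N. ALL t:{s..<s'}. gg f' i (\<tau> i) t < 0"
   proof (intro allI impI ballI, rule ccontr)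
    fix i t assume "i < N" "t : {s..<s'}" "~ gg f' i (\<tau> i) t < 0"
    then have "t : Tr" using \<open>s' : {s..s + 1}\<close> unfolding Tr_def by (intro UN_I[of i]) auto
    then have "s' <= t" using a(2) by blast
    then show False using \<open>t : {s..<s'}\<close> by simp
   qed
  qed (use i \<open>s' ~= s\<close> in auto)
 qed
 \<comment> \<open>Exactly the agents whose trigger fires at s' sample anew, which makes their
   trigger negative again.\<close>
 define \<tau>' where "\<tau>' i = (if 0 <= gg f' i (\<tau> i) s' then s' else \<tau> i)" for i
 have step: "step s f \<tau> s' f' \<tau>'" unfolding step_def using s' old fr fleft by (auto simp: \<tau>'_def)
 have "state_inv f0 s' f' \<tau>'" unfolding state_inv_def
 proof (intro conjI allI impI)
  show "0 <= s'" using s0 s' by simp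
  fix i assume i: "i < N"
  show "0 <= \<tau>' i" "\<tau>' i <= s'" using \<tau> i s0 s' unfolding \<tau>'_def by fastforce+
  show "gg f' i (\<tau>' i) s' < 0" using gg_self[of f' i s'] by (auto simp: \<tau>'_def)
 next
  show "adm f' s'" unfolding adm_def
  proof (rule conjI[OF cont], intro ballI allI impI)
   fix t i assume t: "t : {0..<s'}" and i: "i < N"
   show "EX \<tau>. \<tau> : {0..t} & flow f' i \<tau> t {t<..} & gg f' i \<tau> t <= 0"
   proof (cases "t < s")
    case True
    then have "t : {0..<s}" using t by simp
    then obtain \<rho> where r: "\<rho> : {0..t}" "flow f i \<rho> t {t<..}" "gg f i \<rho> t <= 0" using adm i unfolding adm_def by blast
    have "flow f' i \<rho> t {t<..}" using flow_cong_right[OF old, of \<rho> t i] r True by simp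
    moreover have "gg f' i \<rho> t <= 0" using gg_cong[OF old, of \<rho> t i] r True by simp
    ultimately show ?thesis using r(1) by blast
   next
    case False
    then have t': "s <= t" "t : {s..<s'}" using t by auto
    have "gg f' i (\<tau> i) t < 0" using s'(3) i t'(2) by blast
    moreover have "\<tau> i : {0..t}" using \<tau> i t'(1) by fastforce
    ultimately show ?thesis using fr[OF i t'(1)] by (intro exI[of _ "\<tau> i"] conjI) simp_all
   qed
  qed
  show "f' q i j 0 = f0 q i j" for q i j using old s0 f0 by simp
 qed
 with step show ?thesis by blast
qed

end

text \<open>Relates the common time grid s to the event times T of one agent, which are defined by
  infima: since the trigger stays negative between its events, the sampling interval containing a
  time of the n-th cell begins at \<tau> n.\<close>

lemma event_sequence:
 fixes s \<tau> :: "nat => real" and g :: "real => real => real" and T :: "nat => ereal"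
 assumes s0: "s 0 = 0" and \<tau>0: "\<tau> 0 = 0" and inc: "ALL n. s n < s (Suc n)" and le: "ALL n. \<tau> n <= s n"
  and neg: "ALL n. ALL t:{s n..<s (Suc n)}. g (\<tau> n) t < 0"
  and upd: "ALL n. \<tau> (Suc n) = (if 0 <= g (\<tau> n) (s (Suc n)) then s (Suc n) else \<tau> n)"
  and self: "ALL t. g t t < 0"
  and T0: "T 0 = 0" and TS: "ALL k. T (Suc k) = Inf (ereal ` {t. T k < ereal t & 0 <= g (real_of_ereal (T k)) t})"
 shows "t : {s n..<s (Suc n)} ==> EX k. T k = ereal (\<tau> n) & ereal t < T (Suc k)"
  and "t : {s n..<s (Suc n)} ==> T k <= ereal t ==> ereal t < T (Suc k) ==> T k = ereal (\<tau> n)"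
proof -
 \<comment> \<open>Since its last event the trigger of the agent has stayed negative over all
   intermediate grid cells.\<close>
 have neg': "g (\<tau> n) t < 0" if "t : {\<tau> n..s n}" for n t
  using that
 proof (induction n)
  case 0
  then have "t = \<tau> 0" using s0 \<tau>0 by simp
  then show ?case using self by simp
 next
  case (Suc n)
  show ?case
  proof (cases "0 <= g (\<tau> n) (s (Suc n))")
   case True
   then have e: "\<tau> (Suc n) = s (Suc n)" using upd by simp
   then have "t = \<tau> (Suc n)" using Suc.prems by simp
   then show ?thesis using self by simp
  next
   case False
   then have e: "\<tau> (Suc n) = \<tau> n" using upd by simp
   show ?thesis unfolding e
   proof (cases "t <= s n")
    case True then show "g (\<tau> n) t < 0" using Suc e by simp
   next
    case F: False
    then show "g (\<tau> n) t < 0"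
     using Suc.prems neg False by (cases "t = s (Suc n)") auto
   qed
  qed
 qed
 have low: "s (Suc n) <= t" if "\<tau> n < t" "0 <= g (\<tau> n) t" for n t
 proof (rule ccontr)
  assume "~ s (Suc n) <= t"
  then have "t : {\<tau> n..s n} | t : {s n..<s (Suc n)}" using that(1) by auto
  then have "g (\<tau> n) t < 0" using neg' neg by blast
  then show False using that(2) by simp
 qed
 have Tlow: "ereal (s (Suc n)) <= T (Suc k)" if "T k = ereal (\<tau> n)" for n k
  unfolding TS[rule_format] by (rule Inf_greatest) (use low that in auto)
 have a: "EX k. T k = ereal (\<tau> n)" for n
 proof (induction n)
  case 0
  then show ?case using T0 \<tau>0 by (intro exI[of _ 0]) simp
 next
  case (Suc n)
  then obtain k where k: "T k = ereal (\<tau> n)" by blast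
  show ?case
  proof (cases "0 <= g (\<tau> n) (s (Suc n))")
   case True
   have "\<tau> n < s (Suc n)" using le inc by (meson le_less_trans)
   then have "T (Suc k) <= ereal (s (Suc n))" unfolding TS[rule_format] by (intro Inf_lower imageI) (use True k in simp)
   then have "T (Suc k) = ereal (s (Suc n))" using Tlow[OF k] by (rule antisym)
   then show ?thesis using True upd by (intro exI[of _ "Suc k"]) simp
  next
   case False
   then show ?thesis using k upd by (intro exI[of _ k]) simp
  qed
 qed
 have b: "EX k. T k = ereal (\<tau> n) & ereal t < T (Suc k)" if "t : {s n..<s (Suc n)}" for t n
 proof -
  obtain k where k: "T k = ereal (\<tau> n)" using a by blast
  have "ereal t < ereal (s (Suc n))" using that by simp
  then have "ereal t < T (Suc k)" using Tlow[OF k] by (rule less_le_trans)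
  with k show ?thesis by blast
 qed
 have "T k <= T (Suc k)" for k unfolding TS[rule_format, of k] by (rule Inf_greatest) auto
 then have mono: "k <= k' ==> T k <= T k'" for k k' by (rule lift_Suc_mono_le)
 show "EX k. T k = ereal (\<tau> n) & ereal t < T (Suc k)" if "t : {s n..<s (Suc n)}" by (rule b[OF that])
 show "T k = ereal (\<tau> n)" if t: "t : {s n..<s (Suc n)}" and k: "T k <= ereal t" "ereal t < T (Suc k)"
 proof -
  obtain k' where k': "T k' = ereal (\<tau> n)" "ereal t < T (Suc k')" using b[OF t] by blast
  have t': "T k' <= ereal t" unfolding k'(1) using t le by (meson atLeastLessThan_iff ereal_less_eq(3) order_trans)
  have "~ k < k'" using mono[of "Suc k" k'] k(2) t' by (metis Suc_leI leD order_trans)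
  moreover have "~ k' < k" using mono[of "Suc k'" k] k'(2) k(1) by (metis Suc_leI leD order_trans)
  ultimately have "k = k'" by simp
  then show ?thesis using k'(1) by simp
 qed
qed

lemma continuous_on_atLeastI:
 fixes f :: "real => real"
 assumes "ALL b. continuous_on {a..b} f"
 shows "continuous_on {a..} f"
 unfolding continuous_on_eq_continuous_within
proof
 fix x assume x: "x : {a..}"
 then have "continuous (at x within {a..x + 1}) f" using assms[rule_format, of "x + 1"] unfolding continuous_on_eq_continuous_within by simp
 moreover have "at x within {a..x + 1} = at x within {a..}" by (rule at_within_nhd[of _ "{..<x + 1}"]) auto
 ultimately show "continuous (at x within {a..}) f" by simp
qed

section \<open>Runs that cover all times\<close>

context sampled
begin

lemma es_initial_cong: "(ALL q i j. f q i j 0 = f' q i j 0) ==> es f 0 = es f' 0"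
 by (simp add: es_def)

definition run :: "(nat => nat => nat => real) => (nat => real) => (nat => nat => nat => real => real) => (nat => nat => real) => bool" where
 "run f0 s F \<tau> \<longleftrightarrow> s 0 = 0 & (ALL i. \<tau> 0 i = 0) & (ALL n. s n < s (Suc n)) & (ALL t. EX n. t < s n) & (ALL q i j. F q i j 0 = f0 q i j) &
  (ALL n. ALL i<N. 0 <= \<tau> n i & \<tau> n i <= s n) &
  (ALL n. ALL i<N. (ALL t:{s n..<s (Suc n)}. flow F i (\<tau> n i) t {t<..} & gg F i (\<tau> n i) t < 0) & (ALL t:{s n<..s (Suc n)}. flow F i (\<tau> n i) t {..<t}) &
   \<tau> (Suc n) i = (if 0 <= gg F i (\<tau> n i) (s (Suc n)) then s (Suc n) else \<tau> n i)) &
  (ALL q<4. ALL i<N. ALL j<dm q. continuous_on {0..} (F q i j))"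

text \<open>Iterates \<open>step_exists\<close> by dependent choice. The grid is unbounded because
  of the potential s plus the sum of all \<tau> i: each step raises it by at least a fixed amount,
  through time or through the waiting time of an agent that samples, whereas it never exceeds (N +
  1) s.\<close>

lemma run_exists: "EX s F \<tau>. run f0 s F \<tau>"
proof -
 define ini where "ini = (0 :: real, %q i j (t::real). f0 q i j, %i::nat. 0 :: real)"
 have "EX \<sigma>. ALL n. (state_inv f0 (fst (\<sigma> n)) (fst (snd (\<sigma> n))) (snd (snd (\<sigma> n))) & (n = 0 --> \<sigma> n = ini)) &
   step (fst (\<sigma> n)) (fst (snd (\<sigma> n))) (snd (snd (\<sigma> n))) (fst (\<sigma> (Suc n))) (fst (snd (\<sigma> (Suc n)))) (snd (snd (\<sigma> (Suc n))))"
 proof (rule dependent_nat_choice)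
  have "adm (%q i j t. f0 q i j) 0" unfolding adm_def by simp
  then have "state_inv f0 (fst ini) (fst (snd ini)) (snd (snd ini))" unfolding state_inv_def ini_def by (simp add: gg_self)
  then show "EX x. state_inv f0 (fst x) (fst (snd x)) (snd (snd x)) & (0 = (0::nat) --> x = ini)" by blast
 next
  fix x and n :: nat assume "state_inv f0 (fst x) (fst (snd x)) (snd (snd x)) & (n = 0 --> x = ini)"
  from step_exists[OF conjunct1[OF this]] obtain s' f' \<tau>' where
   a: "state_inv f0 s' f' \<tau>'" "step (fst x) (fst (snd x)) (snd (snd x)) s' f' \<tau>'" by (elim exE conjE)
  show "EX y. (state_inv f0 (fst y) (fst (snd y)) (snd (snd y)) & (Suc n = 0 --> y = ini)) &
    step (fst x) (fst (snd x)) (snd (snd x)) (fst y) (fst (snd y)) (snd (snd y))"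
   by (rule exI[of _ "(s', f', \<tau>')"]) (use a in simp)
 qed
 then obtain \<sigma> where \<sigma>: "ALL n. (state_inv f0 (fst (\<sigma> n)) (fst (snd (\<sigma> n))) (snd (snd (\<sigma> n))) & (n = 0 --> \<sigma> n = ini)) &
   step (fst (\<sigma> n)) (fst (snd (\<sigma> n))) (snd (snd (\<sigma> n))) (fst (\<sigma> (Suc n))) (fst (snd (\<sigma> (Suc n)))) (snd (snd (\<sigma> (Suc n))))" by (elim exE)
 define s f \<tau> where "s n = fst (\<sigma> n)" and "f n = fst (snd (\<sigma> n))" and "\<tau> n = snd (snd (\<sigma> n))" for n
 have inv: "state_inv f0 (s n) (f n) (\<tau> n)" and st: "step (s n) (f n) (\<tau> n) (s (Suc n)) (f (Suc n)) (\<tau> (Suc n))" for n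
  using \<sigma> unfolding s_def f_def \<tau>_def by blast+
 have "\<sigma> 0 = ini" using \<sigma> by blast
 then have init: "s 0 = 0" "ALL i. \<tau> 0 i = 0" by (auto simp: s_def \<tau>_def ini_def)
 have inc: "s n < s (Suc n)" for n using st[of n] unfolding step_def by blast
 have smono: "n <= k ==> s n <= s k" for n k using lift_Suc_mono_le[of s] inc less_imp_le by blast
 have \<tau>b: "0 <= \<tau> n i" "\<tau> n i <= s n" if "i < N" for n i using inv[of n] that unfolding state_inv_def by blast+
 have agree1: "f (Suc n) q i j t = f n q i j t" if "t <= s n" for n q i j t using st[of n] that unfolding step_def by blast
 have agree: "f k q i j t = f n q i j t" if "n <= k" "t <= s n" for n k q i j t
  using that
 proof (induction k rule: dec_induct)
  case (step k)
  then show ?case using agree1[of t k q i j] smono[of n k] by simp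
 qed simp
 have upd: "\<tau> (Suc n) i = (if 0 <= gg (f (Suc n)) i (\<tau> n i) (s (Suc n)) then s (Suc n) else \<tau> n i)" if "i < N" for n i
  using st[of n] that unfolding step_def by blast
 have unb: "EX n. t < s n" for t
 proof -
  define V1 where "V1 = V K h w (es (%q i j t. f0 q i j) 0)"
  have V1: "V K h w (es (f n) 0) <= V1" for n
  proof -
   have "ALL q i j. f n q i j 0 = f0 q i j" using inv[of n] unfolding state_inv_def by blast
   then show ?thesis using es_initial_cong[of "f n" "%q i j t. f0 q i j"] by (simp add: V1_def)
  qed
  obtain \<kappa> where \<kappa>: "\<kappa> > 0" "ALL f b i \<tau> t. adm f b --> V K h w (es f 0) <= V1 --> i < N --> 0 <= \<tau> --> \<tau> <= t --> t <= b --> 0 <= gg f i \<tau> t --> \<kappa> <= t - \<tau>"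
   using dwell by blast
  define c where "c = min 1 \<kappa>"
  have c: "c > 0" "c <= 1" "c <= \<kappa>" using \<kappa>(1) by (auto simp: c_def)
  define \<Phi> where "\<Phi> n = s n + (SUM i<N. \<tau> n i)" for n
  have \<tau>inc: "\<tau> n i <= \<tau> (Suc n) i" if "i < N" for n i
   using upd[OF that, of n] \<tau>b(2)[OF that, of n] inc[of n] by auto
  have \<Phi>S: "\<Phi> n + c <= \<Phi> (Suc n)" for n
  proof -
   have "s (Suc n) = s n + 1 | (EX i<N. 0 <= gg (f (Suc n)) i (\<tau> n i) (s (Suc n)))" using st[of n] unfolding step_def by blast
   then show ?thesis
   proof (elim disjE exE conjE)
    assume "s (Suc n) = s n + 1"
    moreover have "(SUM i<N. \<tau> n i) <= (SUM i<N. \<tau> (Suc n) i)" by (rule sum_mono) (use \<tau>inc in simp)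
    ultimately show ?thesis using c unfolding \<Phi>_def by linarith
   next
    fix i assume i: "i < N" and g: "0 <= gg (f (Suc n)) i (\<tau> n i) (s (Suc n))"
    have "adm (f (Suc n)) (s (Suc n))" using inv[of "Suc n"] unfolding state_inv_def by blast
    moreover have "\<tau> n i <= s (Suc n)" using \<tau>b(2)[OF i, of n] inc[of n] by linarith
    ultimately have "\<kappa> <= s (Suc n) - \<tau> n i" using \<kappa>(2) V1 i \<tau>b(1)[OF i] g by blast
    then have k: "\<kappa> <= \<tau> (Suc n) i - \<tau> n i" using upd[OF i, of n] g by simp
    have "(SUM i<N. \<tau> (Suc n) i - \<tau> n i) >= \<tau> (Suc n) i - \<tau> n i"
     by (rule member_le_sum[of i "{..<N}" "%i. \<tau> (Suc n) i - \<tau> n i"]) (use i \<tau>inc in auto)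
    then have "(SUM i<N. \<tau> (Suc n) i) - (SUM i<N. \<tau> n i) >= \<kappa>" using k by (simp add: sum_subtractf)
    then show ?thesis using c inc[of n] unfolding \<Phi>_def by linarith
   qed
  qed
  have \<Phi>n: "real n*c <= \<Phi> n" for n
  proof (induction n)
   case 0 then show ?case using init by (simp add: \<Phi>_def)
  next
   case (Suc n) then show ?case using \<Phi>S[of n] by (simp add: distrib_right)
  qed
  obtain n where n: "(real N + 1)*t < real n*c" using reals_Archimedean3[OF c(1)] by blast
  have "\<Phi> n <= s n + (SUM i<N. s n)" unfolding \<Phi>_def by (intro add_left_mono sum_mono) (use \<tau>b in simp)
  then have "(real N + 1)*t < (real N + 1)*s n" using n \<Phi>n[of n] by (simp add: distrib_right)
  then have "t < s n" by simp
  then show ?thesis ..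
 qed
 \<comment> \<open>Any grid index n with t \<le> s n gives the same value because later steps keep
   the past.\<close>
 define F where "F q i j t = f (SOME n. t <= s n) q i j t" for q i j t
 have F: "ALL q i j. ALL t<=s n. f n q i j t = F q i j t" for n
 proof (intro allI impI)
  fix q i j t assume t: "t <= s n"
  have "t <= s (SOME n. t <= s n)" by (rule someI[of _ n], rule t)
  then show "f n q i j t = F q i j t" unfolding F_def
   using agree[of n "SOME n. t <= s n" t q i j] agree[of "SOME n. t <= s n" n t q i j] t by (cases "n <= (SOME n. t <= s n)") auto
 qed
 have "run f0 s F \<tau>" unfolding run_def
 proof (intro conjI allI impI)
  show "F q i j 0 = f0 q i j" for q i j
  proof -
   have "f 0 q i j 0 = f0 q i j" using inv[of 0] unfolding state_inv_def by blast
   then show ?thesis using F[of 0] init by simp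
  qed
  fix n i assume i: "i < N"
  have \<tau>S: "\<tau> n i <= s (Suc n)" using \<tau>b(2)[OF i, of n] inc[of n] by linarith
  note st' = st[of n, unfolded step_def, THEN conjunct2, THEN conjunct2, THEN conjunct1, rule_format, OF i]
  show "ALL t:{s n..<s (Suc n)}. flow F i (\<tau> n i) t {t<..} & gg F i (\<tau> n i) t < 0"
  proof
   fix t assume t: "t : {s n..<s (Suc n)}"
   have "flow (f (Suc n)) i (\<tau> n i) t {t<..} & gg (f (Suc n)) i (\<tau> n i) t < 0" using st' t by blast
   then show "flow F i (\<tau> n i) t {t<..} & gg F i (\<tau> n i) t < 0"
    using flow_cong_right[OF F[of "Suc n"] \<tau>S, of t i] gg_cong[OF F[of "Suc n"] \<tau>S, of t i] t by simp
  qed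
  show "ALL t:{s n<..s (Suc n)}. flow F i (\<tau> n i) t {..<t}"
  proof
   fix t assume t: "t : {s n<..s (Suc n)}"
   have "flow (f (Suc n)) i (\<tau> n i) t {..<t}" using st' t by blast
   then show "flow F i (\<tau> n i) t {..<t}" using flow_cong_left[OF F[of "Suc n"] \<tau>S, of t i] t by simp
  qed
  show "\<tau> (Suc n) i = (if 0 <= gg F i (\<tau> n i) (s (Suc n)) then s (Suc n) else \<tau> n i)"
   using upd[OF i, of n] gg_cong[OF F[of "Suc n"] \<tau>S, of "s (Suc n)" i] by simp
 next
  fix q i j assume q: "q < (4::nat)" and i: "i < N" and j: "j < dm q"
  show "continuous_on {0..} (F q i j)"
  proof (rule continuous_on_atLeastI, rule allI)
   fix b
   obtain n where n: "b < s n" using unb by blast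
   have "continuous_on {0..s n} (f n q i j)" using inv[of n] q i j unfolding state_inv_def adm_def by blast
   then have "continuous_on {0..b} (f n q i j)" by (rule continuous_on_subset) (use n in auto)
   then show "continuous_on {0..b} (F q i j)"
    by (rule continuous_on_eq) (use F[of n] n in auto)
  qed
 qed (use init inc unb \<tau>b in auto)
 then show ?thesis by blast
qed

text \<open>A left derivative matters only if U reaches below t, that is, unless t is the left end
  of the sampling interval.\<close>

lemma flow_within:
 assumes r: "flow f i \<tau> t {t<..}" and l: "flow f i \<tau> t {..<t} | U \<subseteq> {t..}"
 shows "flow f i \<tau> t U"
 unfolding flow_def
proof (intro allI impI)
 fix q j assume q: "q < (4::nat)" and j: "j < dm q"
 let ?D = "rh i (%q j. f q i j t) (vv t) (uh f i \<tau>) (evf f i \<tau>) q j"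
 have R: "(f q i j has_real_derivative ?D) (at_right t)" using r q j unfolding flow_def by blast
 show "(f q i j has_real_derivative ?D) (at t within U)"
 proof (cases "U \<subseteq> {t..}")
  case True
  have "at_right t = at t within {t..}" by (rule at_within_Ici_at_right[symmetric])
  then show ?thesis using R True by (auto intro: DERIV_subset)
 next
  case False
  then have "(f q i j has_real_derivative ?D) (at_left t)" using l q j unfolding flow_def by blast
  with R have "(f q i j has_real_derivative ?D) (at t)"
   unfolding has_field_derivative_iff by (intro filterlim_split_at)
  then show ?thesis by (rule has_field_derivative_at_within)
 qed
qed

end

section \<open>Closed-loop trajectories\<close>

lemma less_one_nat: "(0::nat) < 1"
 by simp

lemma all_less_4: "(ALL q<(4::nat). P q) \<longleftrightarrow> P 0 & P 1 & P 2 & P 3"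
 by (auto simp: numeral_eq_Suc less_Suc_eq)

lemma vnorm_sq_scalar: "(vnorm x)^2 = x \<bullet> x"
 unfolding vnorm_def by (rule real_sqrt_pow2) (simp add: scalar_prod_def sum_nonneg)

lemma vnorm_sq_append: "(vnorm (a @\<^sub>v b))^2 = (vnorm a)^2 + (vnorm b)^2"
 unfolding vnorm_sq_scalar by (rule scalar_prod_append[of a "dim_vec a" b "dim_vec b"]) auto

lemma vnorm_le_of_coords:
 assumes "x : carrier_vec n" "ALL k<n. \<bar>x $ k\<bar> <= C"
 shows "vnorm x <= sqrt (real n*C^2)"
proof (rule real_le_rsqrt)
 have "(vnorm x)^2 = (SUM k<n. (x $ k)^2)" using vnorm_sq[of x n] assms(1) by simp
 also have "... <= (SUM k<n. C^2)"
 proof (rule sum_mono)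
  fix k assume "k : {..<n}"
  then have "\<bar>x $ k\<bar> <= C" using assms(2) by simp
  then have "\<bar>x $ k\<bar>^2 <= C^2" by (rule power_mono) simp
  then show "(x $ k)^2 <= C^2" by simp
 qed
 finally show "(vnorm x)^2 <= real n*C^2" by simp
qed

lemma exp_neg_tendsto_0: "0 < a ==> ((%t::real. exp (- a*t)) \<longlongrightarrow> 0) at_top"
 by (rule filterlim_compose[OF exp_at_bot]) (rule filterlim_tendsto_neg_mult_at_bot[OF tendsto_const _ filterlim_ident], simp)

context sampled
begin

definition cp :: "trajectory => nat => nat => nat => real => real" where
 "cp x q i j t = (if q = 0 then zz x (Suc i) t $ j else if q = 1 then xi x (Suc i) t $ j
  else if q = 2 then eta x (Suc i) t $ j else zeta x (Suc i) t $ j)"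

definition dims :: "trajectory => bool" where
 "dims x \<longleftrightarrow> (ALL t>=0. ALL i<N. zz x (Suc i) t : carrier_vec m & xi x (Suc i) t : carrier_vec r &
  eta x (Suc i) t : carrier_vec l & zeta x (Suc i) t : carrier_vec r)"

lemma yout_0: "0 <= t ==> yout p w v x 0 t = fl w (vv t)"
 using index_mult_mat_vec_sum[OF Fw_carrier v_carrier, of t 0] by (simp add: yout_def fl_def)

text \<open>Subtracting the leader output from every output leaves the differences in e_v unchanged
  and pins the leader at 0, as \<open>Hmat_sum\<close> expects.\<close>

lemma ev_evf:
 assumes t: "0 <= t" and i: "i < N"
 shows "ev p E w v x (Suc i) t = evf (cp x) i t"
proof -
 let ?y = "%k. yout p w v x k t - fl w (vv t)"
 have "evf (cp x) i t = (SUM j<N. Hmat N E $$ (i, j) * ?y (Suc j))" by (simp add: evf_def cp_def yout_def)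
 also have "... = (SUM k:{0..N}. adj E (Suc i) k*(?y (Suc i) - (if k = 0 then 0 else ?y k)))"
  by (rule Hmat_sum[OF i graph])
 also have "... = ev p E w v x (Suc i) t" unfolding ev_def
  by (rule sum.cong[OF refl]) (simp add: yout_0[OF t])
 finally show ?thesis ..
qed

lemma err_index: "0 <= t ==> i < N ==> err p w v x t $ i = cp x 1 i 0 t - fl w (vv t)"
 by (simp add: err_def yout_0) (simp add: yout_def cp_def)

lemma trigger_gg:
 assumes x: "dims x" and t: "0 <= \<tau>" "0 <= t" and i: "i < N"
 shows "sigma_bar*((vnorm (zeta x (Suc i) t))^2 + (ev p E w v x (Suc i) t)^2) + \<beta>*exp (- \<alpha>*t) + \<delta>
  <= (vnorm (sampling_error p E w v x (Suc i) \<tau> t))^2 \<longleftrightarrow> 0 <= gg (cp x) i \<tau> t"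
proof -
 have d: "eta x (Suc i) s : carrier_vec l" "zeta x (Suc i) s : carrier_vec r" if "0 <= s" for s
  using x that i unfolding dims_def by blast+
 have "(vnorm (eta x (Suc i) \<tau> - eta x (Suc i) t))^2 = (SUM k<l. (cp x 2 i k \<tau> - cp x 2 i k t)^2)"
  using vnorm_sq[of "eta x (Suc i) \<tau> - eta x (Suc i) t" l] d[OF t(1)] d[OF t(2)] by (simp add: cp_def)
 moreover have "(vnorm (zeta x (Suc i) \<tau> - zeta x (Suc i) t))^2 = (SUM k<r. (cp x 3 i k \<tau> - cp x 3 i k t)^2)"
  using vnorm_sq[of "zeta x (Suc i) \<tau> - zeta x (Suc i) t" r] d[OF t(1)] d[OF t(2)] by (simp add: cp_def)
 moreover have "(vnorm (zeta x (Suc i) t))^2 = (SUM k<r. (cp x 3 i k t)^2)"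
  using vnorm_sq[of "zeta x (Suc i) t" r] d[OF t(2)] by (simp add: cp_def)
 moreover have "(vnorm (scal a))^2 = a^2" for a using vnorm_sq[of "scal a" 1] by (simp add: scal_def)
 ultimately show ?thesis
  unfolding sampling_error_def vnorm_sq_append gg_def ev_evf[OF t(1) i] ev_evf[OF t(2) i] by (simp add: algebra_simps)
qed

lemma control_input_uh:
 assumes x: "dims x" and t: "0 <= \<tau>" and i: "i < N"
 shows "control_input p d K x (Suc i) \<tau> = uh (cp x) i \<tau>"
proof -
 have d: "eta x (Suc i) \<tau> : carrier_vec l" "zeta x (Suc i) \<tau> : carrier_vec r" using x t i unfolding dims_def by blast+
 have "(GamTinv p d *\<^sub>v eta x (Suc i) \<tau>) $ 0 = (SUM k<l. \<psi> k*cp x 2 i k \<tau>)"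
  unfolding index_mult_mat_vec_sum[OF GamTinv_carrier d(1) less_one_nat] by (simp add: \<psi>_def cp_def)
 moreover have "(Omega p d *\<^sub>v zeta x (Suc i) \<tau>) $ 0 = (SUM s<r. om s*cp x 3 i s \<tau>)"
  unfolding index_mult_mat_vec_sum[OF Omega_carrier d(2) less_one_nat]
  by (rule sum.cong[OF refl]) (simp add: Omega_def om_def cp_def)
 ultimately show ?thesis by (simp add: control_input_def uh_def uu_def)
qed

lemma has_vec_deriv_iff:
 assumes "x' : carrier_vec n" "ALL j<n. x' $ j = D j" "ALL j<n. ALL s. y s $ j = f j s"
 shows "has_vec_deriv n y x' t I \<longleftrightarrow> (ALL j<n. (f j has_real_derivative D j) (at t within I))"
proof -
 have "(%s. y s $ j) = f j" if "j < n" for j using assms(3) that by auto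
 then show ?thesis using assms(1,2) unfolding has_vec_deriv_def by auto
qed

lemma agent_dynamics_flow:
 assumes x: "dims x" and i: "i < N" and tk: "0 <= tk" and I: "I \<subseteq> {0..}"
 shows "agent_dynamics p d E K h w v x (Suc i) tk I \<longleftrightarrow> (ALL t:I. flow (cp x) i tk t I)"
proof -
 have i': "Suc i : {1..N}" using i by simp
 let ?u = "uh (cp x) i tk" and ?g = "evf (cp x) i tk"
 have sc: "scal a : carrier_vec 1" for a by (simp add: scal_def)
 have col: "(A *\<^sub>v scal a) $ j = A $$ (j, 0)*a" if "A : carrier_mat n 1" "j < n" for A n a j
  unfolding index_mult_mat_vec_sum[OF that(1) sc that(2)] by (simp add: scal_def)
 have "(let u = control_input p d K x (Suc i) tk; r = reldeg p in
   has_vec_deriv (zdim p (Suc i)) (zz x (Suc i))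
    (A1 p w (Suc i) *\<^sub>v zz x (Suc i) t + A2 p w (Suc i) *\<^sub>v scal (xi x (Suc i) t $ 0) + E0 p w (Suc i) *\<^sub>v v t) t I &
   has_vec_deriv r (xi x (Suc i))
    (vec r (%s. if s + 1 < r then xi x (Suc i) t $ (s + 1)
      else (A3 p w (Suc i) *\<^sub>v zz x (Suc i) t) $ 0 + (SUM q:{1..r}. cc p w q (Suc i)*xi x (Suc i) t $ (q - 1))
        + (Er p w (Suc i) *\<^sub>v v t) $ 0 + bb p w (Suc i)*u)) t I &
   has_vec_deriv (ldim p) (eta x (Suc i)) (ctrl_M d *\<^sub>v eta x (Suc i) t + ctrl_Q d *\<^sub>v scal u) t I &
   has_vec_deriv r (zeta x (Suc i))
    (Ao p d h *\<^sub>v zeta x (Suc i) t + Bo p d h *\<^sub>v scal (ev p E w v x (Suc i) tk)) t I)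
  \<longleftrightarrow> flow (cp x) i tk t I" (is "?L \<longleftrightarrow> _") if t: "t : I" for t
 proof -
  have t0: "0 <= t" using t I by auto
  have dz: "zz x (Suc i) t : carrier_vec m" and dx: "xi x (Suc i) t : carrier_vec r"
   and de: "eta x (Suc i) t : carrier_vec l" and dy: "zeta x (Suc i) t : carrier_vec r"
   using x t0 i unfolding dims_def by blast+
  let ?rh = "rh i (%q j. cp x q i j t) (vv t) ?u ?g"
  have c0: "A1 p w (Suc i) *\<^sub>v zz x (Suc i) t + A2 p w (Suc i) *\<^sub>v scal (xi x (Suc i) t $ 0) + E0 p w (Suc i) *\<^sub>v v t : carrier_vec m"
   using A1_carrier[OF i'] A2_carrier[OF i'] E0_carrier[OF i'] by (intro add_carrier_vec mult_mat_vec_carrier[OF _ dz]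
    mult_mat_vec_carrier[OF _ sc] mult_mat_vec_carrier[OF _ v_carrier[OF t0]]) auto
  have e0: "ALL j<m. (A1 p w (Suc i) *\<^sub>v zz x (Suc i) t + A2 p w (Suc i) *\<^sub>v scal (xi x (Suc i) t $ 0) + E0 p w (Suc i) *\<^sub>v v t) $ j = ?rh 0 j"
  proof (intro allI impI)
   fix j assume j: "j < m"
   have "(A1 p w (Suc i) *\<^sub>v zz x (Suc i) t + A2 p w (Suc i) *\<^sub>v scal (xi x (Suc i) t $ 0) + E0 p w (Suc i) *\<^sub>v v t) $ j
    = (A1 p w (Suc i) *\<^sub>v zz x (Suc i) t) $ j + (A2 p w (Suc i) *\<^sub>v scal (xi x (Suc i) t $ 0)) $ j + (E0 p w (Suc i) *\<^sub>v v t) $ j"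
    using j carrier_matD[OF A1_carrier[OF i', of w]] carrier_matD[OF A2_carrier[OF i', of w]] carrier_matD[OF E0_carrier[OF i', of w]]
    by (simp del: index_mult_mat_vec)
   then show "(A1 p w (Suc i) *\<^sub>v zz x (Suc i) t + A2 p w (Suc i) *\<^sub>v scal (xi x (Suc i) t $ 0) + E0 p w (Suc i) *\<^sub>v v t) $ j = ?rh 0 j"
    unfolding index_mult_mat_vec_sum[OF A1_carrier[OF i'] dz j] col[OF A2_carrier[OF i'] j]
     index_mult_mat_vec_sum[OF E0_carrier[OF i'] v_carrier[OF t0] j] by (simp add: rh_def cp_def)
  qed
  have e1: "ALL j<r. vec r (%s. if s + 1 < r then xi x (Suc i) t $ (s + 1)
      else (A3 p w (Suc i) *\<^sub>v zz x (Suc i) t) $ 0 + (SUM q:{1..r}. cc p w q (Suc i)*xi x (Suc i) t $ (q - 1))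
        + (Er p w (Suc i) *\<^sub>v v t) $ 0 + bb p w (Suc i) * ?u) $ j = ?rh 1 j"
   unfolding index_mult_mat_vec_sum[OF A3_carrier[OF i'] dz less_one_nat]
     index_mult_mat_vec_sum[OF Er_carrier[OF i'] v_carrier[OF t0] less_one_nat]
   by (simp add: rh_def cp_def sum.atLeast1_atMost_eq)
  have c2: "ctrl_M d *\<^sub>v eta x (Suc i) t + ctrl_Q d *\<^sub>v scal ?u : carrier_vec l"
   using M_carrier Q_carrier by (intro add_carrier_vec mult_mat_vec_carrier[OF _ de] mult_mat_vec_carrier[OF _ sc]) auto
  have e2: "ALL j<l. (ctrl_M d *\<^sub>v eta x (Suc i) t + ctrl_Q d *\<^sub>v scal ?u) $ j = ?rh 2 j"
  proof (intro allI impI)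
   fix j assume j: "j < l"
   have "(ctrl_M d *\<^sub>v eta x (Suc i) t + ctrl_Q d *\<^sub>v scal ?u) $ j = (ctrl_M d *\<^sub>v eta x (Suc i) t) $ j + (ctrl_Q d *\<^sub>v scal ?u) $ j"
    using j carrier_matD[OF M_carrier] carrier_matD[OF Q_carrier] by (simp del: index_mult_mat_vec)
   then show "(ctrl_M d *\<^sub>v eta x (Suc i) t + ctrl_Q d *\<^sub>v scal ?u) $ j = ?rh 2 j"
    unfolding index_mult_mat_vec_sum[OF M_carrier de j] col[OF Q_carrier j] by (simp add: rh_def cp_def Mc_def Qc_def)
  qed
  have Aoc: "Ao p d h : carrier_mat r r" and Boc: "Bo p d h : carrier_mat r 1" by (simp_all add: Ao_def Bo_def)
  have c3: "Ao p d h *\<^sub>v zeta x (Suc i) t + Bo p d h *\<^sub>v scal ?g : carrier_vec r"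
   by (intro add_carrier_vec mult_mat_vec_carrier[OF Aoc dy] mult_mat_vec_carrier[OF Boc sc])
  have e3: "ALL j<r. (Ao p d h *\<^sub>v zeta x (Suc i) t + Bo p d h *\<^sub>v scal ?g) $ j = ?rh 3 j"
  proof (intro allI impI)
   fix j assume j: "j < r"
   have bj: "Bo p d h $$ (j, 0) = bo h j" using j by (simp add: Bo_def bo_def)
   have "(Ao p d h *\<^sub>v zeta x (Suc i) t + Bo p d h *\<^sub>v scal ?g) $ j = (Ao p d h *\<^sub>v zeta x (Suc i) t) $ j + (Bo p d h *\<^sub>v scal ?g) $ j"
    using j carrier_matD[OF Aoc] carrier_matD[OF Boc] by (simp del: index_mult_mat_vec)
   moreover have "(Ao p d h *\<^sub>v zeta x (Suc i) t) $ j = - bo h j*cp x 3 i 0 t + (if j + 1 < r then cp x 3 i (j + 1) t else 0)"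
   proof -
    have "(Ao p d h *\<^sub>v zeta x (Suc i) t) $ j = (SUM k<r. (if k = 0 then - bo h j else 0)*cp x 3 i k t + (if k = j + 1 then 1 else 0)*cp x 3 i k t)"
     unfolding index_mult_mat_vec_sum[OF Aoc dy j] by (rule sum.cong[OF refl]) (use j bj in \<open>simp add: Ao_def cp_def\<close>)
    then show ?thesis unfolding sum.distrib sum_ite using r1 by simp
   qed
   moreover have "(Bo p d h *\<^sub>v scal ?g) $ j = bo h j * ?g" unfolding col[OF Boc j] bj ..
   ultimately show "(Ao p d h *\<^sub>v zeta x (Suc i) t + Bo p d h *\<^sub>v scal ?g) $ j = ?rh 3 j" by (simp add: rh_def)
  qed
  have d4: "dm 0 = m" "dm 1 = r" "dm 2 = l" "dm 3 = r" by (simp_all add: dm_def)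
  have "?L \<longleftrightarrow> (ALL j<m. (cp x 0 i j has_real_derivative ?rh 0 j) (at t within I)) & (ALL j<r. (cp x 1 i j has_real_derivative ?rh 1 j) (at t within I)) &
   (ALL j<l. (cp x 2 i j has_real_derivative ?rh 2 j) (at t within I)) & (ALL j<r. (cp x 3 i j has_real_derivative ?rh 3 j) (at t within I))"
   unfolding Let_def control_input_uh[OF x tk i] ev_evf[OF tk i] zdim_m[OF i']
   by (intro arg_cong2[of _ _ _ _ "(&)"] has_vec_deriv_iff c0 e0 e1 c2 e2 c3 e3) (simp_all add: cp_def)
  then show ?thesis unfolding flow_def all_less_4 d4 .
 qed
 then show ?thesis unfolding agent_dynamics_def Let_def by blast
qed

lemma states_continuous_iff:
 "states_continuous p x \<longleftrightarrow> dims x & (ALL q<4. ALL i<N. ALL j<dm q. continuous_on {0..} (cp x q i j))"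
proof -
 have ag: "(ALL i:{1..N}. P i) \<longleftrightarrow> (ALL i<N. P (Suc i))" for P
 proof
  assume a: "ALL i<N. P (Suc i)"
  show "ALL i:{1..N}. P i"
  proof
   fix i assume "i : {1..N}"
   then obtain j where "i = Suc j" "j < N" by (cases i) auto
   then show "P i" using a by simp
  qed
 qed auto
 have d4: "dm 0 = m" "dm 1 = r" "dm 2 = l" "dm 3 = r" by (simp_all add: dm_def)
 have cp4: "cp x 0 i j = (%t. zz x (Suc i) t $ j)" "cp x 1 i j = (%t. xi x (Suc i) t $ j)"
  "cp x 2 i j = (%t. eta x (Suc i) t $ j)" "cp x 3 i j = (%t. zeta x (Suc i) t $ j)" for i j
  by (auto simp: cp_def)
 have "zdim p (Suc i) = m" if "i < N" for i using zdim_m[of "Suc i"] that by simp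
 then show ?thesis unfolding states_continuous_def ag continuous_vec_on_def dims_def all_less_4 d4 cp4 by auto
qed

text \<open>At time t the beginning of the current sampling interval serves as sampling instant: the
  flow holds there by the dynamics, and the threshold is not exceeded before the next event.\<close>

lemma closed_loop_adm:
 assumes cl: "closed_loop p d E K h sigma_bar \<beta> \<alpha> \<delta> w v x"
 shows "dims x" and "adm (cp x) b"
proof -
 have sc: "states_continuous p x" and et: "event_times p E sigma_bar \<beta> \<alpha> \<delta> w v x" using cl unfolding closed_loop_def by blast+
 show x: "dims x" using sc states_continuous_iff by blast
 show "adm (cp x) b" unfolding adm_def
 proof (intro conjI ballI)
  show "ALL q<4. ALL i<N. ALL j<dm q. continuous_on {0..b} (cp x q i j)"
   using sc unfolding states_continuous_iff by (meson atLeastatMost_subset_iff continuous_on_subset Icc_subset_Ici_iff order_refl)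
  fix t assume t: "t : {0..<b}"
  show "ALL i<N. EX \<tau>. \<tau> : {0..t} & flow (cp x) i \<tau> t {t<..} & gg (cp x) i \<tau> t <= 0"
  proof (intro allI impI)
   fix i assume i: "i < N"
   then have i': "Suc i : {1..N}" by simp
   have t0: "0 <= t" using t by simp
   obtain k where k: "tm x (Suc i) k <= ereal t" "ereal t < tm x (Suc i) (Suc k)"
    using cl i' t0 unfolding closed_loop_def by blast
   have e: "tm x (Suc i) 0 = 0" "ALL k. tm x (Suc i) (Suc k) = Inf (ereal ` {t. tm x (Suc i) k < ereal t &
    (vnorm (sampling_error p E w v x (Suc i) (real_of_ereal (tm x (Suc i) k)) t))^2
     >= sigma_bar*((vnorm (zeta x (Suc i) t))^2 + (ev p E w v x (Suc i) t)^2) + \<beta>*exp (- \<alpha>*t) + \<delta>})"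
    using et i' unfolding event_times_def by blast+
   have mono: "tm x (Suc i) k <= tm x (Suc i) (Suc k)" for k unfolding e(2)[rule_format, of k] by (rule Inf_greatest) auto
   have pos: "0 <= tm x (Suc i) k" for k using lift_Suc_mono_le[of "tm x (Suc i)" 0 k] mono e(1) by simp
   define \<tau> where "\<tau> = real_of_ereal (tm x (Suc i) k)"
   have \<tau>: "tm x (Suc i) k = ereal \<tau>"
    unfolding \<tau>_def using pos[of k] k(1) by (cases "tm x (Suc i) k") auto
   have \<tau>t: "0 <= \<tau>" "\<tau> <= t" using pos[of k] k(1) unfolding \<tau> by auto
   let ?I = "{t. tm x (Suc i) k <= ereal t & ereal t < tm x (Suc i) (Suc k)}"
   have I0: "?I \<subseteq> {0..}" using \<tau>t unfolding \<tau> by auto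
   have "agent_dynamics p d E K h w v x (Suc i) \<tau> ?I"
    using cl i' unfolding closed_loop_def \<tau>_def by blast
   then have "flow (cp x) i \<tau> t ?I" using agent_dynamics_flow[OF x i \<tau>t(1) I0] k by blast
   moreover obtain t' where t': "t < t'" "ereal t' < tm x (Suc i) (Suc k)" using ereal_dense2[OF k(2)] by auto
   have "{t..t'} \<subseteq> ?I" using t' \<tau>t unfolding \<tau> by (auto intro: le_less_trans[of _ "ereal t'"])
   ultimately have "flow (cp x) i \<tau> t {t..t'}" unfolding flow_def by (blast intro: DERIV_subset)
   then have "flow (cp x) i \<tau> t {t<..}" unfolding flow_def at_within_Icc_at_right[OF t'(1)] .
   \<comment> \<open>At the event itself the trigger is negative; after it, a positive value would
     put t into the set whose infimum is the next event.\<close>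
   moreover have "gg (cp x) i \<tau> t <= 0"
   proof (cases "t = \<tau>")
    case True then show ?thesis using gg_self[of "cp x" i t] by simp
   next
    case False
    show ?thesis
    proof (rule ccontr)
     assume "~ gg (cp x) i \<tau> t <= 0"
     then have "0 <= gg (cp x) i \<tau> t" by simp
     then have "tm x (Suc i) (Suc k) <= ereal t" unfolding e(2)[rule_format, of k]
      using trigger_gg[OF x \<tau>t(1) t0 i] False \<tau>t by (intro Inf_lower imageI) (simp add: \<tau> algebra_simps)
     then show False using k(2) by simp
    qed
   qed
   ultimately show "EX \<tau>. \<tau> : {0..t} & flow (cp x) i \<tau> t {t<..} & gg (cp x) i \<tau> t <= 0" using \<tau>t by auto
  qed
 qed
qed

lemma closed_loop_bounded:
 assumes cl: "closed_loop p d E K h sigma_bar \<beta> \<alpha> \<delta> w v x"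
 shows "bounded_trajectory p v x"
proof -
 note x = closed_loop_adm[OF cl]
 obtain C where C: "C >= 0" "ALL f b. 0 <= b --> adm f b --> V K h w (es f 0) <= V K h w (es (cp x) 0) --> (ALL i<N. ALL q<4. ALL j<dm q. \<bar>f q i j b\<bar> <= C)"
  using state_bound by blast
 define B where "B = sqrt (real (m + r + l + nv)*(C + Cv)^2)"
 have le: "vnorm y <= B" if y: "y : carrier_vec n" "ALL k<n. \<bar>y $ k\<bar> <= C + Cv" and n: "n <= m + r + l + nv" for y n
 proof -
  have "vnorm y <= sqrt (real n*(C + Cv)^2)" by (rule vnorm_le_of_coords[OF y])
  also have "... <= B" unfolding B_def by (intro real_sqrt_le_mono mult_right_mono) (use n in auto)
  finally show ?thesis .
 qed
 show ?thesis unfolding bounded_trajectory_def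
 proof (rule exI[of _ B], intro allI impI conjI ballI)
  fix t :: real assume t: "0 <= t"
  have cb: "\<bar>cp x q i j t\<bar> <= C + Cv" if "i < N" "q < 4" "j < dm q" for q i j
  proof -
   have "\<bar>cp x q i j t\<bar> <= C" using C(2) t x(2) that by blast
   then show ?thesis using Cv_nonneg by linarith
  qed
  show "vnorm (v t) <= B" by (rule le[OF v_carrier[OF t]]) (use v_bd t C(1) in fastforce)+
  fix i assume i: "i : {1..N}"
  then have i': "i - 1 < N" "Suc (i - 1) = i" by auto
  have d: "zz x i t : carrier_vec m" "xi x i t : carrier_vec r" "eta x i t : carrier_vec l" "zeta x i t : carrier_vec r"
   using x(1) t i' unfolding dims_def by metis+
  show "vnorm (zz x i t) <= B" by (rule le[OF d(1)]) (use cb[OF i'(1), of 0] i'(2) in \<open>auto simp: cp_def dm_def\<close>)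
  show "vnorm (xi x i t) <= B" by (rule le[OF d(2)]) (use cb[OF i'(1), of 1] i'(2) in \<open>auto simp: cp_def dm_def\<close>)
  show "vnorm (eta x i t) <= B" by (rule le[OF d(3)]) (use cb[OF i'(1), of 2] i'(2) in \<open>auto simp: cp_def dm_def\<close>)
  show "vnorm (zeta x i t) <= B" by (rule le[OF d(4)]) (use cb[OF i'(1), of 3] i'(2) in \<open>auto simp: cp_def dm_def\<close>)
 qed
qed

text \<open>The regulated error is part of the deviation, whose squared norm is at most
  \<open>tail\<close> plus \<epsilon>^2, and \<open>tail\<close> tends to 0.\<close>

lemma closed_loop_limsup:
 assumes cl: "closed_loop p d E K h sigma_bar \<beta> \<alpha> \<delta> w v x"
 shows "Limsup at_top (%t. ereal (vnorm (err p w v x t))) <= ereal \<epsilon>"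
proof -
 note x = closed_loop_adm[OF cl]
 define V0 where "V0 = V K h w (es (cp x) 0)"
 have bound: "vnorm (err p w v x t) <= sqrt (tail V0 t + \<epsilon>^2)" if t: "0 <= t" for t
 proof (rule real_le_rsqrt)
  have "(vnorm (err p w v x t))^2 = (SUM i<N. (cp x 1 i 0 t - sx w 0 (vv t))^2)"
   using vnorm_sq[of "err p w v x t" N] err_index[OF t] by (simp add: sx_0) (simp add: err_def)
  also have "... <= (SUM i<N. SUM s<r. (cp x 1 i s t - sx w s (vv t))^2)"
   by (rule sum_mono, rule member_le_sum) (use r1 in auto)
  also have "... <= (SUM k<nst. (es (cp x) t $ k)^2)"
   unfolding es_def using sum_st[of "%a b. a^2" N m r l "%i j. cp x 0 i j t - sz w i j (vv t)" "%i s. cp x 1 i s t - sx w s (vv t)"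
    "%i k. cp x 2 i k t - se w i k (vv t)" "%i s. cp x 3 i s t" undefined undefined undefined undefined]
   by (simp add: sum_nonneg)
  also have "... <= tail V0 t + \<epsilon>^2" unfolding V0_def by (rule error_bound[OF t x(2)])
  finally show "(vnorm (err p w v x t))^2 <= tail V0 t + \<epsilon>^2" .
 qed
 have "(tail V0 \<longlongrightarrow> (0*V0 + lam0 p d E W K h*\<beta> / (lam - \<alpha>)*0) / lam_m p d E W K h) at_top"
  unfolding tail_def[abs_def] using lam_m_pos[OF hw] by (intro tendsto_intros exp_neg_tendsto_0 lam_pos \<alpha>0) simp
 then have "((%t. sqrt (tail V0 t + \<epsilon>^2)) \<longlongrightarrow> sqrt (0 + \<epsilon>^2)) at_top" by (intro tendsto_intros) simp
 then have "((%t. ereal (sqrt (tail V0 t + \<epsilon>^2))) \<longlongrightarrow> ereal \<epsilon>) at_top" using \<epsilon>0 by simp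
 then have lim: "Limsup at_top (%t. ereal (sqrt (tail V0 t + \<epsilon>^2))) = ereal \<epsilon>" by (rule lim_imp_Limsup[rotated]) simp
 have "Limsup at_top (%t. ereal (vnorm (err p w v x t))) <= Limsup at_top (%t. ereal (sqrt (tail V0 t + \<epsilon>^2)))"
 proof (rule Limsup_mono)
  show "\<forall>\<^sub>F t in at_top. ereal (vnorm (err p w v x t)) <= ereal (sqrt (tail V0 t + \<epsilon>^2))"
   using eventually_ge_at_top[of 0] by eventually_elim (use bound in simp)
 qed
 then show ?thesis unfolding lim .
qed

end

section \<open>Existence of closed-loop trajectories\<close>

context sampled
begin

lemma rh_range_cong:
 assumes "ALL q<4. ALL j<dm q. a q j = a' q j" "q < 4" "j < dm q"
 shows "rh i a vt u g q j = rh i a' vt u g q j"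
 unfolding rh_coef[OF assms(2,3)] using assms(1) by (intro sum.cong refl) (auto simp: full_def idx_def)

lemma range_cong:
 assumes eq: "ALL q<4. ALL i<N. ALL j<dm q. f q i j = f' q i j" and i: "i < N"
 shows gg_range_cong: "gg f i \<tau> t = gg f' i \<tau> t" and flow_range_cong: "flow f i \<tau> t U = flow f' i \<tau> t U"
proof -
 have e: "f 1 j 0 = f' 1 j 0" if "j < N" for j using eq that r1 by (simp add: dm_def)
 have e2: "f 2 i k = f' 2 i k" if "k < l" for k using eq i that by (simp add: dm_def)
 have e3: "f 3 i k = f' 3 i k" if "k < r" for k using eq i that by (simp add: dm_def)
 have ev: "evf f i t = evf f' i t" for t unfolding evf_def using e by simp
 then show "gg f i \<tau> t = gg f' i \<tau> t" unfolding gg_def using e2 e3 by simp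
 have u: "uh f i \<tau> = uh f' i \<tau>" unfolding uh_def uu_def using e2 e3 by simp
 have "rh i (%q j. f q i j t) (vv t) (uh f' i \<tau>) (evf f' i \<tau>) q j = rh i (%q j. f' q i j t) (vv t) (uh f' i \<tau>) (evf f' i \<tau>) q j"
  if "q < 4" "j < dm q" for q j
  by (rule rh_range_cong[OF _ that]) (use eq i in simp)
 then show "flow f i \<tau> t U = flow f' i \<tau> t U" unfolding flow_def u ev using eq i by simp
qed

text \<open>The event mechanism applied to a finished run, so that \<open>event_times\<close> holds
  by construction; \<open>event_sequence\<close> identifies these times with the sampling instants
  used in the run.\<close>

primrec events :: "(nat => nat => nat => real => real) => nat => nat => ereal" where
 "events F i 0 = 0"
| "events F i (Suc k) = Inf (ereal ` {t. events F i k < ereal t & 0 <= gg F i (real_of_ereal (events F i k)) t})"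

lemma closed_loop_exists:
 assumes "initial_dims p z0 xi0 eta0 zeta0"
 shows "EX x. closed_loop p d E K h sigma_bar \<beta> \<alpha> \<delta> w v x & starts_at p x z0 xi0 eta0 zeta0"
proof -
 define f0 where "f0 q i j = (if q = 0 then z0 (Suc i) $ j else if q = 1 then xi0 (Suc i) $ j
  else if q = 2 then eta0 (Suc i) $ j else zeta0 (Suc i) $ j)" for q i j :: nat
 obtain s F \<tau> where run: "run f0 s F \<tau>" using run_exists by blast
 have s0: "s 0 = 0" and \<tau>0: "ALL i. \<tau> 0 i = 0" and inc: "ALL n. s n < s (Suc n)" and unb: "ALL t. EX n. t < s n"
  and F0: "ALL q i j. F q i j 0 = f0 q i j" and \<tau>b: "ALL n. ALL i<N. 0 <= \<tau> n i & \<tau> n i <= s n"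
  and cont: "ALL q<4. ALL i<N. ALL j<dm q. continuous_on {0..} (F q i j)"
  using run unfolding run_def by blast+
 have pc: "ALL t:{s n..<s (Suc n)}. flow F i (\<tau> n i) t {t<..} & gg F i (\<tau> n i) t < 0"
  "ALL t:{s n<..s (Suc n)}. flow F i (\<tau> n i) t {..<t}"
  "\<tau> (Suc n) i = (if 0 <= gg F i (\<tau> n i) (s (Suc n)) then s (Suc n) else \<tau> n i)" if "i < N" for n i
  using run that unfolding run_def by blast+
 \<comment> \<open>Agents are numbered from 1 in the record and from 0 in the run, hence i -
   1.\<close>
 define x where "x = \<lparr>zz = %i t. vec m (%j. F 0 (i - 1) j t), xi = %i t. vec r (%j. F 1 (i - 1) j t),
  eta = %i t. vec l (%j. F 2 (i - 1) j t), zeta = %i t. vec r (%j. F 3 (i - 1) j t), tm = %i. events F (i - 1)\<rparr>"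
 have dimx: "dims x" unfolding dims_def x_def by simp
 have cpF: "ALL q<4. ALL i<N. ALL j<dm q. cp x q i j = F q i j"
  unfolding all_less_4 by (auto simp: cp_def x_def dm_def)
 have gF: "gg (cp x) i \<rho> t = gg F i \<rho> t" and fF: "flow (cp x) i \<rho> t U = flow F i \<rho> t U" if "i < N" for i \<rho> t U
  using range_cong[OF cpF that] by blast+
 have tmx: "tm x (Suc i) = events F i" for i by (simp add: x_def)
 have emono: "events F i k <= events F i (Suc k)" for i k unfolding events.simps by (rule Inf_greatest) auto
 have epos: "0 <= events F i k" for i k using lift_Suc_mono_le[of "events F i" 0 k] emono by simp
 have find: "EX n. t : {s n..<s (Suc n)}" if t: "0 <= t" for t
 proof -
  define k where "k = (LEAST k. t < s k)"
  have k: "t < s k" unfolding k_def by (rule LeastI_ex) (use unb in blast)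
  then obtain n where n: "k = Suc n" using t s0 by (cases k) auto
  have "~ t < s n" using not_less_Least[of n "%k. t < s k"] n unfolding k_def by simp
  then show ?thesis using k n by (intro exI[of _ n]) simp
 qed
 have le: "ALL n. \<tau> n i <= s n" if "i < N" for i using \<tau>b that by blast
 have neg: "ALL n. ALL t:{s n..<s (Suc n)}. gg F i (\<tau> n i) t < 0" if "i < N" for i using pc(1)[OF that] by blast
 have upd: "ALL n. \<tau> (Suc n) i = (if 0 <= gg F i (\<tau> n i) (s (Suc n)) then s (Suc n) else \<tau> n i)" if "i < N" for i using pc(3)[OF that] by blast
 have self: "ALL t. gg F i t t < 0" for i using gg_self by blast
 have TS: "ALL k. events F i (Suc k) = Inf (ereal ` {t. events F i k < ereal t & 0 <= gg F i (real_of_ereal (events F i k)) t})" for i by simp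
 note ev = event_sequence[OF s0 \<tau>0[rule_format] inc le neg upd self events.simps(1) TS]
 have "closed_loop p d E K h sigma_bar \<beta> \<alpha> \<delta> w v x" unfolding closed_loop_def
 proof (intro conjI ballI allI impI)
  show "states_continuous p x" unfolding states_continuous_iff using dimx cont cpF by simp
  show "event_times p E sigma_bar \<beta> \<alpha> \<delta> w v x" unfolding event_times_def
  proof (intro ballI conjI allI)
   fix i k assume "i : {1..N}"
   then obtain j where j: "i = Suc j" "j < N" by (cases i) auto
   show "tm x i 0 = 0" by (simp add: j tmx)
   have "{t. events F j k < ereal t & sigma_bar*((vnorm (zeta x (Suc j) t))^2 + (ev p E w v x (Suc j) t)^2) + \<beta>*exp (- \<alpha>*t) + \<delta>
     <= (vnorm (sampling_error p E w v x (Suc j) (real_of_ereal (events F j k)) t))^2} =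
    {t. events F j k < ereal t & 0 <= gg F j (real_of_ereal (events F j k)) t}"
   proof (intro Collect_cong conj_cong refl)
    fix t assume "events F j k < ereal t"
    then have "ereal 0 < ereal t" using epos[of j k] by (metis le_less_trans zero_ereal_def)
    then have t: "0 <= t" by simp
    have r0: "0 <= real_of_ereal (events F j k)" using epos by (rule real_of_ereal_pos)
    show "sigma_bar*((vnorm (zeta x (Suc j) t))^2 + (ev p E w v x (Suc j) t)^2) + \<beta>*exp (- \<alpha>*t) + \<delta>
     <= (vnorm (sampling_error p E w v x (Suc j) (real_of_ereal (events F j k)) t))^2 \<longleftrightarrow> 0 <= gg F j (real_of_ereal (events F j k)) t"
     using trigger_gg[OF dimx r0 t j(2)] gF[OF j(2)] by simp
   qed
   then show "tm x i (Suc k) = Inf (ereal ` {t. tm x i k < ereal t &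
    (vnorm (sampling_error p E w v x i (real_of_ereal (tm x i k)) t))^2
     >= sigma_bar*((vnorm (zeta x i t))^2 + (ev p E w v x i t)^2) + \<beta>*exp (- \<alpha>*t) + \<delta>})"
    unfolding j(1) tmx events.simps(2) by simp
  qed
 next
  fix i and t :: real assume "i : {1..N}" and t: "0 <= t"
  then obtain j where j: "i = Suc j" "j < N" by (cases i) auto
  obtain n where n: "t : {s n..<s (Suc n)}" using find[OF t] by blast
  from ev(1)[OF j(2) j(2) j(2) n] obtain k where k: "events F j k = ereal (\<tau> n j)" "ereal t < events F j (Suc k)" by blast
  have "\<tau> n j <= t" using \<tau>b j(2) n by (meson atLeastLessThan_iff order_trans)
  then show "EX k. tm x i k <= ereal t & ereal t < tm x i (Suc k)" unfolding j(1) tmx using k by (intro exI[of _ k]) simp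
 next
  fix i k assume "i : {1..N}"
  then obtain j where j: "i = Suc j" "j < N" by (cases i) auto
  let ?I = "{t. events F j k <= ereal t & ereal t < events F j (Suc k)}"
  have I0: "?I \<subseteq> {0..}"
  proof
   fix t assume "t : ?I"
   then have "ereal 0 <= ereal t" using epos[of j k] by (metis (no_types, lifting) mem_Collect_eq order_trans zero_ereal_def)
   then show "t : {0..}" by simp
  qed
  have "agent_dynamics p d E K h w v x (Suc j) (real_of_ereal (events F j k)) ?I"
   unfolding agent_dynamics_flow[OF dimx j(2) real_of_ereal_pos[OF epos] I0] fF[OF j(2)]
  proof
   fix t assume t: "t : ?I"
   then have t0: "0 <= t" using I0 by auto
   obtain n where n: "t : {s n..<s (Suc n)}" using find[OF t0] by blast
   have e: "events F j k = ereal (\<tau> n j)" using ev(2)[OF j(2) j(2) j(2) n] t by blast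
   have R: "flow F j (\<tau> n j) t {t<..}" using pc(1)[OF j(2)] n by blast
   \<comment> \<open>At a grid time where agent j does not sample, the previous cell has the same
     \<open>\<tau>\<close> and supplies the left derivative; where it samples, t is the left end of
     its interval.\<close>
   have "flow F j (\<tau> n j) t {..<t} | ?I \<subseteq> {t..}"
   proof (cases "s n < t")
    case True then show ?thesis using pc(2)[OF j(2), of n] n by simp
   next
    case False
    then have tn: "t = s n" using n by simp
    show ?thesis
    proof (cases "\<tau> n j = s n")
     case True then show ?thesis unfolding e tn by auto
    next
     case False
     then obtain n' where n': "n = Suc n'" using s0 \<tau>0 by (cases n) auto
     then have "\<tau> n j = \<tau> n' j" using pc(3)[OF j(2), of n'] False by (auto split: if_splits)
     then show ?thesis using pc(2)[OF j(2), of n'] inc tn n' by simp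
    qed
   qed
   then show "flow F j (real_of_ereal (events F j k)) t ?I" using flow_within[OF R] unfolding e real_of_ereal.simps(1) by blast
  qed
  then show "agent_dynamics p d E K h w v x i (real_of_ereal (tm x i k)) {t. tm x i k <= ereal t & ereal t < tm x i (Suc k)}"
   unfolding j(1) tmx .
 qed
 moreover have "starts_at p x z0 xi0 eta0 zeta0" unfolding starts_at_def
 proof (intro ballI)
  fix i assume i: "i : {1..N}"
  then obtain j where j: "i = Suc j" "j < N" by (cases i) auto
  have "z0 i : carrier_vec m" "xi0 i : carrier_vec r" "eta0 i : carrier_vec l" "zeta0 i : carrier_vec r"
   using bspec[OF assms[unfolded initial_dims_def] i] unfolding zdim_m[OF i] by blast+
  then show "zz x i 0 = z0 i & xi x i 0 = xi0 i & eta x i 0 = eta0 i & zeta x i 0 = zeta0 i"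
   unfolding x_def using F0 by (auto intro!: eq_vecI simp: j f0_def)
 qed
 ultimately show ?thesis by blast
qed

end

text \<open>The threshold for h is a function of K, as the observer has to dominate a forcing that
  grows with K. The constants are built from the Lyapunov solution, so stability of
  \<open>Ac\<close> is part of the conclusion. Existence of a trajectory is asserted separately from
  the properties, which hold for every trajectory with the given initial values.\<close>

theorem theorem4p1:
  fixes p :: plant and d :: design and E :: "(nat \<times> nat) set"
    and V W :: "real Matrix.vec set"
  assumes plant: "plant_wf p"
    and graph: "digraph (agents p) E"
    and ctrl: "design_wf p d"
    and V: "compact_vecs (exodim p) V" "0\<^sub>v (exodim p) \<in> V"
    and W: "compact_vecs (wdim p) W" "0\<^sub>v (wdim p) \<in> W"
    and b_pos: "\<forall>w\<in>W. \<forall>i\<in>{1..agents p}. bb p w i > 0"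
    and Assm1: "\<forall>\<mu>. eigenvalue (cmat (exo_S p)) \<mu> \<longrightarrow>
                  semisimple_eigenvalue (cmat (exo_S p)) \<mu> \<and> Re \<mu> = 0"
    and Assm2: "\<forall>w\<in>W. \<forall>i\<in>{1..agents p}. hurwitz (A1 p w i)"
    and Assm3: "connected_digraph (agents p) E"
  shows "\<exists>(Kstar :: real) (hstar :: real \<Rightarrow> real).
    Kstar > 0 \<and> (\<forall>K>Kstar. hstar K > 0) \<and>
    (\<forall>K>Kstar. \<forall>h>hstar K.
       (\<forall>w\<in>W. hurwitz (Ac p d E K h w)) \<and>
       (\<forall>\<epsilon> \<sigma> \<beta> \<alpha> lam sigma_bar \<delta>.
          \<epsilon> > 0 \<and> 0 < \<sigma> \<and> \<sigma> < 1 \<and> \<beta> > 0 \<and>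
          lam = (1 - \<sigma>) / lam_M p d E W K h \<and> 0 < \<alpha> \<and> \<alpha> < lam \<and>
          sigma_bar = \<sigma> / (lam1 p d E W K h * lamM_bar p d W K h * lam2_bar (agents p)) \<and>
          \<delta> = lam * lam_m p d E W K h / lam0 p d E W K h * \<epsilon>\<^sup>2 \<longrightarrow>
          (\<forall>w\<in>W. \<forall>v z0 xi0 eta0 zeta0.
             exo_solution p v \<and> (\<forall>t\<ge>0. v t \<in> V) \<and> initial_dims p z0 xi0 eta0 zeta0 \<longrightarrow>
             (\<exists>x. closed_loop p d E K h sigma_bar \<beta> \<alpha> \<delta> w v x \<and> starts_at p x z0 xi0 eta0 zeta0) \<and>
             (\<forall>x. closed_loop p d E K h sigma_bar \<beta> \<alpha> \<delta> w v x \<and> starts_at p x z0 xi0 eta0 zeta0 \<longrightarrow>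
                bounded_trajectory p v x \<and>
                Limsup at_top (\<lambda>t. ereal (vnorm (err p w v x t))) \<le> ereal \<epsilon>))))"
proof -
 interpret regulation p d E W
  by standard (use plant graph ctrl W b_pos Assm1 Assm2 Assm3 in blast)+
 obtain Ks where Ks: "Ks > 0" "ALL K>Ks. EX hs>=1. ALL h>hs. ALL w:W. hurwitz (Ac p d E K h w)" using Ac_hurwitz by blast
 \<comment> \<open>Two requirements on h for given K: stability of \<open>Ac\<close>, and dominance
   of \<lambda>_3 over the gains of the sampling errors.\<close>
 have "EX hs>0. ALL h>hs. (ALL w:W. hurwitz (Ac p d E K h w)) & (ALL w:W. ALL i<agents p. gain w K i <= lam3 p d h)" if K: "K > Ks" for K
 proof -
  obtain h1 where h1: "h1 >= 1" "ALL h>h1. ALL w:W. hurwitz (Ac p d E K h w)" using Ks(2) K by blast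
  obtain h2 where h2: "h2 >= 1" "ALL h>h2. ALL w:W. ALL i<agents p. gain w K i <= lam3 p d h" using lam3_dominates by blast
  show ?thesis
  proof (rule exI[of _ "max h1 h2"], rule conjI)
   show "max h1 h2 > 0" using h1(1) by simp
   show "ALL h>max h1 h2. (ALL w:W. hurwitz (Ac p d E K h w)) & (ALL w:W. ALL i<agents p. gain w K i <= lam3 p d h)"
    using h1(2) h2(2) by simp
  qed
 qed
 then have "ALL K. EX hs. K > Ks --> hs > 0 & (ALL h>hs. (ALL w:W. hurwitz (Ac p d E K h w)) & (ALL w:W. ALL i<agents p. gain w K i <= lam3 p d h))" by blast
 from choice[OF this] obtain hs where hs: "ALL K. K > Ks --> hs K > 0 & (ALL h>hs K. (ALL w:W. hurwitz (Ac p d E K h w)) & (ALL w:W. ALL i<agents p. gain w K i <= lam3 p d h))"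
  by (elim exE)
 obtain Cv where Cv: "ALL x:V. ALL k<exodim p. \<bar>x $ k\<bar> <= Cv" using compact_vecs_bounded[OF V(1)] by blast
 show ?thesis
 proof (rule exI[of _ Ks], rule exI[of _ hs], intro conjI allI impI ballI)
  show "Ks > 0" by (rule Ks(1))
  show "hs K > 0" if "K > Ks" for K using hs that by blast
  fix K h assume K: "K > Ks" and h: "h > hs K"
  have hw: "ALL w:W. hurwitz (Ac p d E K h w)" and gn: "ALL w:W. ALL i<agents p. gain w K i <= lam3 p d h" and h0: "0 < h"
   using hs K h by (blast, blast, force)
  show "hurwitz (Ac p d E K h w)" if "w : W" for w using hw that by blast
  fix \<epsilon> \<sigma> \<beta> \<alpha> lam sigma_bar \<delta> :: real and w v z0 xi0 eta0 zeta0
  assume par: "\<epsilon> > 0 & 0 < \<sigma> & \<sigma> < 1 & \<beta> > 0 &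
     lam = (1 - \<sigma>) / lam_M p d E W K h & 0 < \<alpha> & \<alpha> < lam &
     sigma_bar = \<sigma> / (lam1 p d E W K h*lamM_bar p d W K h*lam2_bar (agents p)) &
     \<delta> = lam*lam_m p d E W K h / lam0 p d E W K h*\<epsilon>^2"
   and w: "w : W" and ex: "exo_solution p v & (ALL t>=0. v t : V) & initial_dims p z0 xi0 eta0 zeta0"
  interpret sampled p d E W K h \<epsilon> \<sigma> \<beta> \<alpha> lam sigma_bar \<delta> Cv w v
   by standard (use hw gn h0 w par ex Cv in auto)
  show "EX x. closed_loop p d E K h sigma_bar \<beta> \<alpha> \<delta> w v x & starts_at p x z0 xi0 eta0 zeta0"
   by (rule closed_loop_exists) (use ex in blast)
  show "bounded_trajectory p v x" "Limsup at_top (%t. ereal (vnorm (err p w v x t))) <= ereal \<epsilon>"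
   if "closed_loop p d E K h sigma_bar \<beta> \<alpha> \<delta> w v x & starts_at p x z0 xi0 eta0 zeta0" for x
   using closed_loop_bounded closed_loop_limsup that by blast+
 qed
qed

end
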